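(* Let $\Sigma\subset\mathbb{R}^3$ be a generic, pure $3$-dimensional, hereditary, simplicial fan such that $\mathrm{lk}(\Sigma)$ is simply connected, equipped with uniform smoothness $1$ (i.e. $\alpha(\tau)=1$ for interior $\tau\in\Sigma_2$ and $\alpha(\tau)=-1$ for $\tau\in\Sigma_2\cap\partial\Sigma$, so $\Sigma^{-1}=\partial\Sigma$). Then for all $d\ge0$, \[\dim_{\mathbb{R}}C^1(\Sigma)_d=\chi(\mathcal{R}/\mathcal{J}[\Sigma,\partial\Sigma],d):=\sum_{i=0}^3(-1)^i\sum_{\gamma\in\Sigma_{3-i}\setminus(\partial\Sigma)_{3-i}}HF(S/J(\gamma),d);\] equivalently, $H_2(\mathcal{R}/\mathcal{J}[\Sigma,\partial\Sigma])=0$.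
   Context: $S=\mathbb{R}[x,y,z]$, $HF(M,d)=\dim_{\mathbb{R}}M_d$. A cone is the positive hull of finitely many vectors in $\mathbb{R}^3$, of dimension that of its linear span $\mathrm{aff}(\gamma)$; a fan is a finite set of cones closed under faces, any two meeting in a common face; $\Sigma_i$ = $i$-dim cones; pure $3$-dim: all facets (maximal cones) are $3$-dimensional; simplicial: each cone generated by linearly independent vectors; hereditary: for each face $\psi$ the graph on facets containing $\psi$ (edges for pairs sharing a $2$-face) is connected. $\partial\Sigma$ = subfan of faces contained in a $2$-face lying in exactly one facet. $\mathrm{lk}(\Sigma)$ is the polytopal complex of the convex hulls of the unit ray generators of the cones (topologically $\Sigma\cap\mathbb{S}^2$). "Generic" means: for the given combinatorial type, the ray coordinates are chosen in a suitable nonempty Zariski-open (general position) set. $l_\tau$ generates the ideal of $\mathrm{aff}(\tau)$; $J(\tau)=\langle l_\tau^2\rangle$ for interior $\tau\in\Sigma_2$; $J(\gamma)=\sum_{\tau\supseteq\gamma\text{ interior}}J(\tau)$ for non-facets, $J(\sigma)=0$ for facets. $C^1(\Sigma)$ is the graded $S$-module of tuples $(F_\sigma)_{\sigma\in\Sigma_3}$ with $l_\tau^2\mid F_{\sigma_1}-F_{\sigma_2}$ whenever $\sigma_1\cap\sigma_2=\tau\in\Sigma_2$; degree-$d$ part = tuples of forms of degree $d$. With $u_\rho$ unit ray generators, $P(\gamma)=\mathrm{conv}(\{0\}\cup\{u_\rho:\rho\subseteq\gamma\})$; $\mathcal{R}/\mathcal{J}[\Sigma,\partial\Sigma]_i=\bigoplus_{\gamma\in\Sigma_i\setminus(\partial\Sigma)_i}S/J(\gamma)$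 with differential induced by the cellular boundary of the relative cellular chain complex of $(P(\Sigma),\mathrm{lk}(\Sigma)\cup P(\partial\Sigma))$ with $S$ coefficients. *)

theory Defs
  imports "HOL-Analysis.Analysis" "HOL-Library.Function_Algebras"
begin

definition mono3 :: "nat \<times> nat \<times> nat \<Rightarrow> real^3 \<Rightarrow> real" where
  "mono3 m p = (case m of (a, b, c) \<Rightarrow> (p$1)^a * (p$2)^b * (p$3)^c)"

definition mdeg :: "nat \<times> nat \<times> nat \<Rightarrow> nat" where
  "mdeg m = (case m of (a, b, c) \<Rightarrow> a + b + c)"

definition forms :: "nat \<Rightarrow> (real^3 \<Rightarrow> real) set" where
  "forms d = {(\<lambda>p. \<Sum>m\<in>{m. mdeg m = d}. coef m * mono3 m p) | coef. True}"

definition polys :: "(real^3 \<Rightarrow> real) set" where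
  "polys = {(\<lambda>p. \<Sum>m\<in>{m. mdeg m \<le> N}. coef m * mono3 m p) | coef N. True}"

definition fdim :: "('x \<Rightarrow> real) set \<Rightarrow> nat" where
  "fdim S = vector_space.dim (\<lambda>c f. \<lambda>x. c * f x) S"

definition tdim :: "('i \<Rightarrow> 'x \<Rightarrow> real) set \<Rightarrow> nat" where
  "tdim S = vector_space.dim (\<lambda>c F. \<lambda>i x. c * F i x) S"

section \<open>Simplicial fans, given by a combinatorial type K on ray labels 'v and ray vectors u\<close>

definition pos_hull :: "('v \<Rightarrow> real^3) \<Rightarrow> 'v set \<Rightarrow> (real^3) set" where
  "pos_hull u A = {(\<Sum>v\<in>A. c v *\<^sub>R u v) | c. \<forall>v\<in>A. c v \<ge> 0}"

definition simplicial_fan :: "('v::finite) set set \<Rightarrow> ('v \<Rightarrow> real^3) \<Rightarrow> bool" where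
  "simplicial_fan K u \<longleftrightarrow> {} \<in> K \<and> (\<forall>v. {v} \<in> K) \<and> (\<forall>A\<in>K. \<forall>B. B \<subseteq> A \<longrightarrow> B \<in> K) \<and>
     (\<forall>A\<in>K. inj_on u A \<and> independent (u ` A)) \<and>
     (\<forall>A\<in>K. \<forall>B\<in>K. pos_hull u A \<inter> pos_hull u B = pos_hull u (A \<inter> B))"

definition facets :: "'v set set \<Rightarrow> 'v set set" where
  "facets K = {\<sigma>\<in>K. \<forall>A\<in>K. \<sigma> \<subseteq> A \<longrightarrow> A = \<sigma>}"

definition pure3 :: "'v set set \<Rightarrow> bool" where
  "pure3 K \<longleftrightarrow> (\<forall>\<sigma>\<in>facets K. card \<sigma> = 3)"

definition facet_adj :: "'v set set \<Rightarrow> 'v set \<Rightarrow> 'v set \<Rightarrow> 'v set \<Rightarrow> bool" where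
  "facet_adj K \<psi> a b \<longleftrightarrow> a \<in> facets K \<and> b \<in> facets K \<and> \<psi> \<subseteq> a \<and> \<psi> \<subseteq> b \<and> card (a \<inter> b) = 2"

definition hereditary :: "'v set set \<Rightarrow> bool" where
  "hereditary K \<longleftrightarrow> (\<forall>\<psi>\<in>K. \<forall>a b. a \<in> facets K \<and> \<psi> \<subseteq> a \<and> b \<in> facets K \<and> \<psi> \<subseteq> b
      \<longrightarrow> (facet_adj K \<psi>)\<^sup>*\<^sup>* a b)"

definition bdry_2faces :: "'v set set \<Rightarrow> 'v set set" where
  "bdry_2faces K = {\<tau>\<in>K. card \<tau> = 2 \<and> card {\<sigma>\<in>facets K. \<tau> \<subseteq> \<sigma>} = 1}"

definition bdry :: "'v set set \<Rightarrow> 'v set set" where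
  "bdry K = {A\<in>K. \<exists>\<tau>\<in>bdry_2faces K. A \<subseteq> \<tau>}"

definition interior2 :: "'v set set \<Rightarrow> 'v set set" where
  "interior2 K = {\<tau>\<in>K. card \<tau> = 2 \<and> \<tau> \<notin> bdry K}"

definition lk_space :: "'v set set \<Rightarrow> ('v \<Rightarrow> real^3) \<Rightarrow> (real^3) set" where
  "lk_space K u = (\<Union>A\<in>K. convex hull ((\<lambda>v. (1 / norm (u v)) *\<^sub>R u v) ` A))"

text \<open>normal vector of aff(\<tau>); l_\<tau>(p) = normal \<bullet> p\<close>
definition normal :: "('v \<Rightarrow> real^3) \<Rightarrow> 'v set \<Rightarrow> real^3" where
  "normal u \<tau> = (SOME n. n \<noteq> 0 \<and> (\<forall>v\<in>\<tau>. n \<bullet> u v = 0))"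

definition sq_ideal :: "('v \<Rightarrow> real^3) \<Rightarrow> 'v set set \<Rightarrow> (real^3 \<Rightarrow> real) set" where
  "sq_ideal u T = {(\<lambda>p. \<Sum>\<tau>\<in>T. (normal u \<tau> \<bullet> p)^2 * G \<tau> p) | G. \<forall>\<tau>\<in>T. G \<tau> \<in> polys}"

definition Jid :: "'v set set \<Rightarrow> ('v \<Rightarrow> real^3) \<Rightarrow> 'v set \<Rightarrow> (real^3 \<Rightarrow> real) set" where
  "Jid K u \<gamma> = (if \<gamma> \<in> facets K then {(\<lambda>p. 0)} else sq_ideal u {\<tau>\<in>interior2 K. \<gamma> \<subseteq> \<tau>})"

definition HF_quot :: "'v set set \<Rightarrow> ('v \<Rightarrow> real^3) \<Rightarrow> 'v set \<Rightarrow> nat \<Rightarrow> int" where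
  "HF_quot K u \<gamma> d = int (fdim (forms d)) - int (fdim (Jid K u \<gamma> \<inter> forms d))"

definition chi_RJ :: "'v set set \<Rightarrow> ('v \<Rightarrow> real^3) \<Rightarrow> nat \<Rightarrow> int" where
  "chi_RJ K u d = (\<Sum>i\<in>{0..3::nat}. (-1)^i *
      (\<Sum>\<gamma>\<in>{A\<in>K. card A = 3 - i \<and> A \<notin> bdry K}. HF_quot K u \<gamma> d))"

definition C1 :: "'v set set \<Rightarrow> ('v \<Rightarrow> real^3) \<Rightarrow> nat \<Rightarrow> ('v set \<Rightarrow> real^3 \<Rightarrow> real) set" where
  "C1 K u d = {F. (\<forall>\<sigma>\<in>facets K. F \<sigma> \<in> forms d) \<and> (\<forall>A. A \<notin> facets K \<longrightarrow> F A = (\<lambda>p. 0)) \<and>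
     (\<forall>\<sigma>1\<in>facets K. \<forall>\<sigma>2\<in>facets K. card (\<sigma>1 \<inter> \<sigma>2) = 2 \<longrightarrow>
         (\<lambda>p. F \<sigma>1 p - F \<sigma>2 p) \<in> sq_ideal u {\<sigma>1 \<inter> \<sigma>2})}"

section \<open>Polynomial functions of the ray coordinates (for genericity)\<close>

inductive coord_poly :: "(('v \<Rightarrow> real^3) \<Rightarrow> real) \<Rightarrow> bool" where
  cp_const: "coord_poly (\<lambda>u. c)"
| cp_coord: "coord_poly (\<lambda>u. u v $ i)"
| cp_add: "coord_poly P \<Longrightarrow> coord_poly Q \<Longrightarrow> coord_poly (\<lambda>u. P u + Q u)"
| cp_mult: "coord_poly P \<Longrightarrow> coord_poly Q \<Longrightarrow> coord_poly (\<lambda>u. P u * Q u)"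

end

theory Submission
  imports Defs "HOL-Computational_Algebra.Polynomial"
begin

text \<open>
  A spline is determined, up to a global form, by its jumps across the interior 2-faces \<open>\<tau>\<close>, which lie in
  \<open>J(\<tau>)\<close>. As the link is simply connected, a system of jumps is realised by a spline as soon as it sums to zero
  around every interior ray. The formula therefore says that the boundary map from the ideals of the 2-faces to
  the ideals of the interior rays is onto (for a complete fan: onto the kernel of the sum map to the ideal of
  the origin); the Euler characteristic of the fan comes out of the same count with all ideals replaced by \<open>S\<close>.

  All these ideals are generated by squares of linear forms, so surjectivity needs to be checked in degree 2 only.
  There the dual statement is a rigidity property: quadratic forms \<open>A\<^sub>v\<close>, one for each ray, such that \<open>A\<^sub>v\<close> and \<open>A\<^sub>w\<close>
  agree on the normal of the plane of every 2-face \<open>vw\<close>, are induced by one global form. For generic rays this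
  holds for the graph of every minimal 2-cycle modulo 2, by Fogelsanger's argument: contract an edge, decompose
  the result into minimal cycles, undo the contraction on each of them by vertex splitting, and glue. The fan
  with its boundary coned off to a new vertex is such a cycle. For a complete fan one also needs that the
  syzygies of the ideal of all quadrics are linear and, for four rays in general position, generated by those
  of the ideals of the rays.
\<close>

section \<open>Properties holding for generic ray coordinates\<close>

text \<open>Rigidity of a graph is proved for vectors that need not form a fan: it is ensured by the
  nonvanishing of a polynomial in all coordinates, so one position of any kind suffices, such as one
  close to a degenerate position in which two rays coincide. Hence the argument can leave the given
  fan and contract edges. The obstacle is that contracting an edge of a triangulated disc or sphere
  need not give such a surface again: triangles may collide and the result may fall apart. Minimal
  cycles modulo 2 are the class that survives, because a contracted cycle, counted with
  multiplicity, is still a cycle and splits into minimal ones. Fans with boundary fit into this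
  class through the cone: the apex and the boundary rays carry the zero form, which is dual to
  discarding the boundary faces in the relative complex. Simple connectedness enters only where
  jumps are integrated: potentials exist around each ray for combinatorial reasons, and the
  obstruction to matching them is a 1-cocycle on the link.\<close>

definition generically :: "(('v \<Rightarrow> real^3) \<Rightarrow> bool) \<Rightarrow> bool" where
  "generically \<phi> \<longleftrightarrow> (\<exists>P. coord_poly P \<and> (\<exists>u. P u \<noteq> 0) \<and> (\<forall>u. P u \<noteq> 0 \<longrightarrow> \<phi> u))"

lemma coord_poly_on_line:
  assumes "coord_poly P"
  shows "\<exists>q :: real poly. \<forall>t. P (\<lambda>v. u v + t *\<^sub>R w v) = poly q t"
  using assms
proof induction
  case (cp_const c)
  show ?case by (rule exI[of _ "[:c:]"]) simp
next
  case (cp_coord v i)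
  show ?case by (rule exI[of _ "[:u v $ i, w v $ i:]"]) simp
next
  case (cp_add P Q)
  then show ?case by (metis poly_add)
next
  case (cp_mult P Q)
  then show ?case by (metis poly_mult)
qed

text \<open>On the line through \<open>a\<close> and \<open>b\<close> both functions restrict to
  nonzero univariate polynomials, whose product is nonzero.\<close>

lemma coord_poly_mult_nonzero:
  assumes P: "coord_poly P" "P a \<noteq> 0" and Q: "coord_poly Q" "Q b \<noteq> 0"
  shows "\<exists>u. P u * Q u \<noteq> 0"
proof -
  let ?l = "\<lambda>t v. a v + t *\<^sub>R (b v - a v)"
  obtain p where p: "\<And>t. P (?l t) = poly p t"
    using coord_poly_on_line[OF P(1), of a "\<lambda>v. b v - a v"] by blast
  obtain q where q: "\<And>t. Q (?l t) = poly q t"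
    using coord_poly_on_line[OF Q(1), of a "\<lambda>v. b v - a v"] by blast
  have "p \<noteq> 0" using p[of 0] P(2) by auto
  moreover have "q \<noteq> 0" using q[of 1] Q(2) by auto
  ultimately have "p * q \<noteq> 0" by simp
  then obtain t where "poly (p * q) t \<noteq> 0" using poly_all_0_iff_0 by blast
  then have "P (?l t) * Q (?l t) \<noteq> 0" by (simp add: p q)
  then show ?thesis by blast
qed

lemma generically_conj:
  assumes "generically \<phi>" "generically \<psi>"
  shows "generically (\<lambda>u. \<phi> u \<and> \<psi> u)"
proof -
  obtain P a where P: "coord_poly P" "P a \<noteq> 0" "\<And>u. P u \<noteq> 0 \<Longrightarrow> \<phi> u"
    using assms(1) by (auto simp: generically_def)
  obtain Q b where Q: "coord_poly Q" "Q b \<noteq> 0" "\<And>u. Q u \<noteq> 0 \<Longrightarrow> \<psi> u"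
    using assms(2) by (auto simp: generically_def)
  have "coord_poly (\<lambda>u. P u * Q u)" using P Q by (auto intro: cp_mult)
  then show ?thesis unfolding generically_def
    using coord_poly_mult_nonzero[OF P(1,2) Q(1,2)] P(3) Q(3)
    by (intro exI[of _ "\<lambda>u. P u * Q u"]) auto
qed

lemma generically_mono: "generically \<phi> \<Longrightarrow> (\<And>u. \<phi> u \<Longrightarrow> \<psi> u) \<Longrightarrow> generically \<psi>"
  unfolding generically_def by meson

lemma generically_ex: "generically \<phi> \<Longrightarrow> \<exists>u. \<phi> u"
  unfolding generically_def by blast

lemma generically_True: "generically (\<lambda>u. True)"
  unfolding generically_def by (rule exI[of _ "\<lambda>u. 1"]) (auto intro: cp_const)

lemma generically_ball:
  assumes "finite I" "\<And>i. i \<in> I \<Longrightarrow> generically (\<phi> i)"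
  shows "generically (\<lambda>u. \<forall>i\<in>I. \<phi> i u)"
  using assms
proof (induction I rule: finite_induct)
  case empty then show ?case using generically_True by simp
next
  case (insert i I)
  then have "generically (\<lambda>u. \<phi> i u \<and> (\<forall>i\<in>I. \<phi> i u))" by (intro generically_conj) auto
  then show ?case by simp
qed

lemma coord_poly_sum: "(\<And>i. i \<in> I \<Longrightarrow> coord_poly (f i)) \<Longrightarrow> coord_poly (\<lambda>u. \<Sum>i\<in>I. f i u)"
  by (induction I rule: infinite_finite_induct) (auto intro: coord_poly.intros)

lemma coord_poly_prod: "(\<And>i. i \<in> I \<Longrightarrow> coord_poly (f i)) \<Longrightarrow> coord_poly (\<lambda>u. \<Prod>i\<in>I. f i u)"
  by (induction I rule: infinite_finite_induct) (auto intro: coord_poly.intros)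

lemma coord_poly_uminus: "coord_poly f \<Longrightarrow> coord_poly (\<lambda>u. - f u)"
  using cp_mult[OF cp_const[of "-1"], of f] by simp

lemma coord_poly_diff: "coord_poly f \<Longrightarrow> coord_poly g \<Longrightarrow> coord_poly (\<lambda>u. f u - g u)"
  using cp_add[of f "\<lambda>u. - g u"] coord_poly_uminus[of g] by simp

lemma coord_poly_cross: "coord_poly (\<lambda>u. cross3 (u x) (u y) $ i)"
  using exhaust_3[of i]
  by (auto simp: cross_components intro!: coord_poly_diff coord_poly.intros)

lemma coord_poly_triple: "coord_poly (\<lambda>u. u x \<bullet> cross3 (u y) (u z))"
  by (auto simp: inner_vec_def intro!: coord_poly_sum cp_mult cp_coord coord_poly_cross)

lemma coord_poly_det: "(\<And>i j. coord_poly (\<lambda>u. M u $ i $ j)) \<Longrightarrow> coord_poly (\<lambda>u. det (M u))"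
  unfolding det_def by (intro coord_poly_sum cp_mult cp_const coord_poly_prod) auto

definition triples_independent :: "('v \<Rightarrow> real^3) \<Rightarrow> bool" where
  "triples_independent u \<longleftrightarrow>
     (\<forall>x y z. x \<noteq> y \<longrightarrow> y \<noteq> z \<longrightarrow> x \<noteq> z \<longrightarrow> u x \<bullet> cross3 (u y) (u z) \<noteq> 0)"

lemma generically_triples_independent: "generically (triples_independent :: ('v::finite \<Rightarrow> _) \<Rightarrow> bool)"
proof -
  let ?I = "{(x,y,z). x \<noteq> y \<and> y \<noteq> z \<and> x \<noteq> (z::'v)}"
  have "generically (\<lambda>u. case t of (x,y,z) \<Rightarrow> u x \<bullet> cross3 (u y) (u z) \<noteq> 0)" if tI: "t \<in> ?I" for t
  proof -
    obtain x y z where t: "t = (x,y,z)" "x \<noteq> y" "y \<noteq> z" "x \<noteq> z" using tI by auto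
    let ?u = "\<lambda>w::'v. if w = x then axis 1 1 else if w = y then axis 2 1 else (axis 3 1 :: real^3)"
    have "?u x \<bullet> cross3 (?u y) (?u z) \<noteq> 0" using t
      by (simp add: inner_vec_def sum_3 cross_components axis_def)
    then have "\<exists>u. u x \<bullet> cross3 (u y) (u z) \<noteq> 0" by (intro exI[of _ ?u])
    then show ?thesis unfolding generically_def t(1) prod.case
      by (intro exI[of _ "\<lambda>u. u x \<bullet> cross3 (u y) (u z)"]) (auto intro: coord_poly_triple)
  qed
  then have "generically (\<lambda>u. \<forall>t\<in>?I. case t of (x,y,z) \<Rightarrow> u x \<bullet> cross3 (u y) (u z) \<noteq> 0)"
    by (intro generically_ball) auto
  then show ?thesis by (rule generically_mono) (auto simp: triples_independent_def)
qed

text \<open>Over the reals the Gram matrix \<open>M u\<close> of the functionals has the same kernel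
  as their joint map, since \<open>y\<close> paired with \<open>M u *v y\<close> is a sum of
  squares. Injectivity is thus the nonvanishing of one determinant, which is a polynomial in
  \<open>u\<close>.\<close>

lemma generically_injective:
  fixes L :: "(('v \<Rightarrow> real^3) \<Rightarrow> real^'n \<Rightarrow> real) set"
  assumes fin: "finite L" and lin: "\<And>f u. f \<in> L \<Longrightarrow> linear (f u)"
    and cp: "\<And>f y. f \<in> L \<Longrightarrow> coord_poly (\<lambda>u. f u y)"
    and ex: "\<exists>u. \<forall>y. (\<forall>f\<in>L. f u y = 0) \<longrightarrow> y = 0"
  shows "generically (\<lambda>u. \<forall>y. (\<forall>f\<in>L. f u y = 0) \<longrightarrow> y = 0)"
proof -
  define M :: "('v \<Rightarrow> real^3) \<Rightarrow> real^'n^'n" where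
    "M u = (\<chi> i j. \<Sum>f\<in>L. f u (axis i 1) * f u (axis j 1))" for u
  have expand: "f u y = (\<Sum>j\<in>UNIV. f u (axis j 1) * y $ j)" if "f \<in> L" for f u y
  proof -
    have "f u y = f u (\<Sum>j\<in>UNIV. (y $ j) *s axis j 1)" by (simp add: basis_expansion)
    also have "\<dots> = (\<Sum>j\<in>UNIV. f u (axis j 1) * y $ j)"
      using lin[OF that, of u]
      by (simp add: linear_sum scalar_mult_eq_scaleR linear_cmul mult.commute)
    finally show ?thesis .
  qed
  have Mv: "(M u *v y) $ i = (\<Sum>f\<in>L. f u (axis i 1) * f u y)" for u y i
  proof -
    have "(M u *v y) $ i = (\<Sum>j\<in>UNIV. \<Sum>f\<in>L. f u (axis i 1) * f u (axis j 1) * y $ j)"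
      by (simp add: M_def matrix_vector_mult_def sum_distrib_right)
    also have "\<dots> = (\<Sum>f\<in>L. \<Sum>j\<in>UNIV. f u (axis i 1) * f u (axis j 1) * y $ j)"
      by (rule sum.swap)
    also have "\<dots> = (\<Sum>f\<in>L. f u (axis i 1) * f u y)"
    proof (intro sum.cong refl)
      fix f assume "f \<in> L"
      then show "(\<Sum>j\<in>UNIV. f u (axis i 1) * f u (axis j 1) * y $ j) = f u (axis i 1) * f u y"
        by (subst (2) expand) (simp_all add: sum_distrib_left mult.assoc)
    qed
    finally show ?thesis .
  qed
  have ker: "M u *v y = 0 \<longleftrightarrow> (\<forall>f\<in>L. f u y = 0)" for u y
  proof
    assume "M u *v y = 0"
    then have "0 = (\<Sum>i\<in>UNIV. y $ i * (M u *v y) $ i)" by simp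
    also have "\<dots> = (\<Sum>i\<in>UNIV. \<Sum>f\<in>L. (f u (axis i 1) * y $ i) * f u y)"
      by (simp add: Mv sum_distrib_left mult_ac)
    also have "\<dots> = (\<Sum>f\<in>L. \<Sum>i\<in>UNIV. (f u (axis i 1) * y $ i) * f u y)" by (rule sum.swap)
    also have "\<dots> = (\<Sum>f\<in>L. (f u y)\<^sup>2)"
    proof (intro sum.cong refl)
      fix f assume "f \<in> L"
      then show "(\<Sum>i\<in>UNIV. f u (axis i 1) * y $ i * f u y) = (f u y)\<^sup>2"
        using expand[of f u y] by (simp add: sum_distrib_right power2_eq_square)
    qed
    finally have "(\<Sum>f\<in>L. (f u y)\<^sup>2) = 0" by simp
    then show "\<forall>f\<in>L. f u y = 0" using fin by (simp add: sum_nonneg_eq_0_iff)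
  next
    assume "\<forall>f\<in>L. f u y = 0"
    then show "M u *v y = 0" by (auto simp: vec_eq_iff Mv intro!: sum.neutral)
  qed
  have iff: "(\<forall>y. (\<forall>f\<in>L. f u y = 0) \<longrightarrow> y = 0) \<longleftrightarrow> det (M u) \<noteq> 0" for u
    using ker[of u] matrix_left_invertible_ker[of "M u"] invertible_det_nz[of "M u"]
    by (metis invertible_left_inverse)
  have "coord_poly (\<lambda>u. det (M u))"
    by (rule coord_poly_det, simp add: M_def, rule coord_poly_sum, rule cp_mult; rule cp; assumption)
  then show ?thesis unfolding iff generically_def using ex unfolding iff by blast
qed

section \<open>Infinitesimal rigidity of graphs for quadratic forms\<close>

definition qf :: "real^3^3 \<Rightarrow> real^3 \<Rightarrow> real" where
  "qf M n = n \<bullet> (M *v n)"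

lemma qf_comb:
  "qf M (a *\<^sub>R x + b *\<^sub>R y) = a\<^sup>2 * qf M x + b\<^sup>2 * qf M y + a * b * (x \<bullet> (M *v y) + y \<bullet> (M *v x))"
  by (simp add: qf_def matrix_vector_right_distrib matrix_vector_mult_scaleR inner_add_left
      inner_add_right algebra_simps power2_eq_square)

lemma qf_scale: "qf M (c *\<^sub>R x) = c\<^sup>2 * qf M x"
  using qf_comb[of M c x 0 0] by simp

lemma qf_add: "qf M (x + y) = qf M x + qf M y + (x \<bullet> (M *v y) + y \<bullet> (M *v x))"
  using qf_comb[of M 1 x 1 y] by simp

lemma qf_minus [simp]: "qf M (- x) = qf M x"
  using qf_scale[of M "-1" x] by simp

lemma qf_cross_swap: "qf M (cross3 x y) = qf M (cross3 y x)"
  by (subst cross_skew) simp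

lemma qf_diff_matrix: "qf (M - N) n = qf M n - qf N n"
  by (simp add: qf_def matrix_vector_mult_diff_rdistrib inner_diff_right)

lemma qf_add_matrix: "qf (M + N) n = qf M n + qf N n"
  by (simp add: qf_def matrix_vector_mult_add_rdistrib inner_add_right)

lemma qf_scale_matrix: "qf (c *\<^sub>R M) n = c * qf M n"
  by (simp add: qf_def scaleR_matrix_vector_assoc[symmetric])

lemma qf_zero [simp]: "qf 0 n = 0" "qf M 0 = 0"
  by (simp_all add: qf_def)

lemma qf_eq_sum: "qf M n = (\<Sum>i\<in>UNIV. \<Sum>j\<in>UNIV. n $ i * M $ i $ j * n $ j)"
  by (simp add: qf_def inner_vec_def matrix_vector_mult_def sum_distrib_left mult.assoc)

text \<open>Divided by the determinant, the three cross products are the basis dual to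
  \<open>a\<close>, \<open>b\<close>, \<open>c\<close>.\<close>

lemma dual_basis_expansion:
  fixes a b c n :: "real^3"
  assumes "a \<bullet> cross3 b c \<noteq> 0"
  shows "n = (n \<bullet> a / (a \<bullet> cross3 b c)) *\<^sub>R cross3 b c + (n \<bullet> b / (a \<bullet> cross3 b c)) *\<^sub>R cross3 c a
     + (n \<bullet> c / (a \<bullet> cross3 b c)) *\<^sub>R cross3 a b"
proof -
  let ?d = "a \<bullet> cross3 b c"
  have 1: "?d *\<^sub>R n = (n \<bullet> a) *\<^sub>R cross3 b c + (n \<bullet> b) *\<^sub>R cross3 c a + (n \<bullet> c) *\<^sub>R cross3 a b"
    by (simp add: vec_eq_iff forall_3 cross_components inner_vec_def sum_3) (simp add: algebra_simps)
  have "n = (1/?d) *\<^sub>R (?d *\<^sub>R n)" using assms by simp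
  also have "\<dots> = (n \<bullet> a / ?d) *\<^sub>R cross3 b c + (n \<bullet> b / ?d) *\<^sub>R cross3 c a + (n \<bullet> c / ?d) *\<^sub>R cross3 a b"
    unfolding 1 by (simp add: scaleR_add_right)
  finally show ?thesis .
qed

lemma triple_cyclic: "a \<bullet> cross3 b c = b \<bullet> cross3 c a" "a \<bullet> cross3 b c = c \<bullet> cross3 a b"
  "a \<bullet> cross3 b c = - (a \<bullet> cross3 c b)" "a \<bullet> cross3 b c = - (b \<bullet> cross3 a c)"
  by (simp_all add: cross_components inner_vec_def sum_3 algebra_simps)

lemma perp_expansion:
  fixes a b c n :: "real^3"
  assumes "a \<bullet> cross3 b c \<noteq> 0" "n \<bullet> a = 0"
  shows "n = (n \<bullet> b / (a \<bullet> cross3 b c)) *\<^sub>R cross3 c a + (n \<bullet> c / (a \<bullet> cross3 b c)) *\<^sub>R cross3 a b"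
  using dual_basis_expansion[OF assms(1), of n] assms(2) by simp

text \<open>On the plane orthogonal to \<open>p\<close> this is a binary quadratic form with three distinct projective zeros.\<close>
lemma qf_vanishes_on_perp:
  assumes d: "p \<bullet> cross3 w1 w2 \<noteq> 0" "p \<bullet> cross3 w1 w3 \<noteq> 0" "p \<bullet> cross3 w2 w3 \<noteq> 0"
    and z: "qf M (cross3 p w1) = 0" "qf M (cross3 p w2) = 0" "qf M (cross3 p w3) = 0"
    and n: "n \<bullet> p = 0"
  shows "qf M n = 0"
proof -
  let ?d = "p \<bullet> cross3 w1 w2"
  let ?x = "cross3 w2 p" let ?y = "cross3 p w1"
  have zx: "qf M ?x = 0" using z(2) qf_cross_swap by metis
  let ?c = "?x \<bullet> (M *v ?y) + ?y \<bullet> (M *v ?x)"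
  \<comment> \<open>Two of the zeros span the plane, so in these coordinates only the mixed term is
    left.\<close>
  have e: "qf M m = (m \<bullet> w1 / ?d) * (m \<bullet> w2 / ?d) * ?c" if "m \<bullet> p = 0" for m
    by (subst perp_expansion[OF d(1) that], subst qf_comb) (simp add: zx z(1))
  have "cross3 p w3 \<bullet> p = 0" by (simp add: dot_cross_self inner_commute)
  from e[OF this] z(3) have "(cross3 p w3 \<bullet> w1 / ?d) * (cross3 p w3 \<bullet> w2 / ?d) * ?c = 0" by simp
  moreover have "cross3 p w3 \<bullet> w1 \<noteq> 0" using d(2) triple_cyclic by (metis inner_commute neg_equal_0_iff_equal)
  moreover have "cross3 p w3 \<bullet> w2 \<noteq> 0" using d(3) triple_cyclic by (metis inner_commute neg_equal_0_iff_equal)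
  ultimately have "?c = 0" using d(1) by simp
  then show ?thesis using e[OF n] by simp
qed

text \<open>In the basis dual to \<open>a\<close>, \<open>b\<close>, \<open>c\<close> the sum of any
  two components of \<open>n\<close> lies in one of the three planes, and a quadratic form is
  determined by its values on single components and on sums of two.\<close>

lemma qf_vanishes_three_planes:
  assumes d: "a \<bullet> cross3 b c \<noteq> 0"
    and z: "\<And>n. n \<bullet> a = 0 \<Longrightarrow> qf M n = 0" "\<And>n. n \<bullet> b = 0 \<Longrightarrow> qf M n = 0" "\<And>n. n \<bullet> c = 0 \<Longrightarrow> qf M n = 0"
  shows "qf M n = 0"
proof -
  define x y w where xyw: "x = (n \<bullet> a / (a \<bullet> cross3 b c)) *\<^sub>R cross3 b c"
    "y = (n \<bullet> b / (a \<bullet> cross3 b c)) *\<^sub>R cross3 c a" "w = (n \<bullet> c / (a \<bullet> cross3 b c)) *\<^sub>R cross3 a b"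
  have n: "n = x + y + w" unfolding xyw by (rule dual_basis_expansion[OF d])
  have "qf M (x + y + w) = qf M (x + y) + qf M (y + w) + qf M (x + w) - qf M x - qf M y - qf M w"
    by (simp add: qf_add matrix_vector_right_distrib inner_add_left inner_add_right)
  moreover have "qf M (y + w) = 0" "qf M y = 0" "qf M w = 0"
    by (intro z(1), simp add: xyw inner_add_right dot_cross_self inner_commute[of _ a])+
  moreover have "qf M (x + w) = 0" "qf M x = 0" 
    by (intro z(2), simp add: xyw inner_add_right dot_cross_self inner_commute[of _ b])+
  moreover have "qf M (x + y) = 0" 
    by (intro z(3), simp add: xyw inner_add_right dot_cross_self inner_commute[of _ c])
  ultimately show ?thesis using n by simp
qed

definition outer :: "real^3 \<Rightarrow> real^3 \<Rightarrow> real^3^3" where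
  "outer a b = (\<chi> i j. a $ i * b $ j)"

lemma qf_outer: "qf (outer a b) n = (a \<bullet> n) * (b \<bullet> n)"
  by (simp add: qf_eq_sum outer_def inner_vec_def sum_product mult_ac)

lemma inner_outer: "M \<bullet> outer a a = qf M a"
  by (simp add: qf_eq_sum outer_def inner_vec_def mult_ac)

text \<open>The three planes meet pairwise in the lines of the dual basis \<open>?n1\<close>,
  \<open>?n2\<close>, \<open>?n3\<close>. The six coefficients of a form in that basis can therefore
  be read off from \<open>A\<close>, \<open>B\<close>, \<open>C\<close>, consistently by the
  hypotheses.\<close>

lemma triangle_global_form:
  assumes d: "a \<bullet> cross3 b c \<noteq> 0"
    and e: "qf A (cross3 a b) = qf B (cross3 a b)" "qf B (cross3 b c) = qf C (cross3 b c)"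
     "qf A (cross3 c a) = qf C (cross3 c a)"
  shows "\<exists>M. (\<forall>n. n \<bullet> a = 0 \<longrightarrow> qf A n = qf M n) \<and> (\<forall>n. n \<bullet> b = 0 \<longrightarrow> qf B n = qf M n) \<and>
     (\<forall>n. n \<bullet> c = 0 \<longrightarrow> qf C n = qf M n)"
proof -
  let ?d = "a \<bullet> cross3 b c"
  let ?n1 = "cross3 b c" let ?n2 = "cross3 c a" let ?n3 = "cross3 a b"
  let ?m = "\<lambda>A x y. x \<bullet> (A *v y) + y \<bullet> (A *v x)"
  \<comment> \<open>The square coefficients are the common values at the dual vectors; each mixed
    coefficient is taken from the form whose plane contains both dual vectors. Division by the
    squared determinant normalises the dual basis.\<close>
  define M where "M = (1 / ?d\<^sup>2) *\<^sub>R (qf B ?n1 *\<^sub>R outer a a + qf A ?n2 *\<^sub>R outer b b + qf A ?n3 *\<^sub>R outer c c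
     + ?m A ?n2 ?n3 *\<^sub>R outer b c + ?m B ?n3 ?n1 *\<^sub>R outer c a + ?m C ?n1 ?n2 *\<^sub>R outer a b)"
  have qM: "qf M n = (qf B ?n1 * (a \<bullet> n)\<^sup>2 + qf A ?n2 * (b \<bullet> n)\<^sup>2 + qf A ?n3 * (c \<bullet> n)\<^sup>2
     + ?m A ?n2 ?n3 * (b \<bullet> n) * (c \<bullet> n) + ?m B ?n3 ?n1 * (c \<bullet> n) * (a \<bullet> n) + ?m C ?n1 ?n2 * (a \<bullet> n) * (b \<bullet> n)) / ?d\<^sup>2" for n
    unfolding M_def qf_scale_matrix qf_add_matrix qf_outer by (simp add: power2_eq_square mult.assoc)
  have db: "b \<bullet> cross3 c a = ?d" and dc: "c \<bullet> cross3 a b = ?d" using triple_cyclic by metis+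
  have 1: "qf A n = qf M n" if "n \<bullet> a = 0" for n
    using perp_expansion[OF d that] qf_comb[of A "n \<bullet> b / ?d" ?n2 "n \<bullet> c / ?d" ?n3] qM[of n] that
    by (simp add: inner_commute[of _ n] add_divide_distrib power_divide) (simp add: power2_eq_square mult_ac)
  have 2: "qf B n = qf M n" if "n \<bullet> b = 0" for n
    using perp_expansion[of b c a n] d that qf_comb[of B "n \<bullet> c / ?d" ?n3 "n \<bullet> a / ?d" ?n1] qM[of n] e(1)
    by (simp add: db inner_commute[of _ n] add_divide_distrib power_divide) (simp add: power2_eq_square mult_ac)
  have 3: "qf C n = qf M n" if "n \<bullet> c = 0" for n
    using perp_expansion[of c a b n] d that qf_comb[of C "n \<bullet> a / ?d" ?n1 "n \<bullet> b / ?d" ?n2] qM[of n] e(2,3)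
    by (simp add: dc inner_commute[of _ n] add_divide_distrib power_divide) (simp add: power2_eq_square mult_ac)
  show ?thesis using 1 2 3 by blast
qed

lemma symmetric_inner_swap: "transpose M = M \<Longrightarrow> x \<bullet> (M *v y) = y \<bullet> (M *v x)" for M :: "real^'n^'n"
  by (metis dot_lmul_matrix inner_commute transpose_matrix_vector)

text \<open>As \<open>M\<close> kills \<open>u\<close>, removing from a vector its component along
  \<open>u\<close> does not change the value of the form; a form that vanishes identically has zero
  symmetric matrix by polarisation.\<close>

lemma symmetric_qf_zero_on_perp:
  assumes s: "transpose M = M" and k: "M *v u = 0" and z: "\<And>n. n \<bullet> u = 0 \<Longrightarrow> qf M n = 0"
  shows "M = 0"
proof -
  have q0: "qf M n = 0" for n
  proof -
    let ?t = "(n \<bullet> u) / (u \<bullet> u)"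
    let ?m = "n - ?t *\<^sub>R u"
    have "?m \<bullet> u = 0" by (cases "u = 0") (simp_all add: inner_diff_left)
    then have "qf M ?m = 0" by (rule z)
    moreover have "qf M u = 0" by (simp add: qf_def k)
    moreover have "u \<bullet> (M *v ?m) = 0" using symmetric_inner_swap[OF s, of u ?m] k by simp
    ultimately have "qf M (1 *\<^sub>R ?m + ?t *\<^sub>R u) = 0" by (subst qf_comb) (simp add: k)
    then show ?thesis by simp
  qed
  have b: "x \<bullet> (M *v y) = 0" for x y
    using qf_add[of M x y] symmetric_inner_swap[OF s, of x y] by (simp add: q0)
  have "M $ i $ j = 0" for i j
    using b[of "axis i 1" "axis j 1"]
    by (simp add: inner_axis' matrix_vector_mult_basis column_def)
  then show ?thesis by (simp add: vec_eq_iff)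
qed

text \<open>Compressing the symmetrised matrix by the orthogonal projection gives a normal form of
  the restriction to the plane orthogonal to \<open>u\<close>. For \<open>u = 0\<close> the quotient
  is 0 and the projection is the identity.\<close>

definition perp_part :: "real^3 \<Rightarrow> real^3^3 \<Rightarrow> real^3^3" where
  "perp_part u M = (let P = mat 1 - (1 / (u \<bullet> u)) *\<^sub>R outer u u
     in P ** ((1/2) *\<^sub>R (M + transpose M)) ** P)"

lemma perp_part:
  shows "transpose (perp_part u M) = perp_part u M" "perp_part u M *v u = 0"
    "n \<bullet> u = 0 \<Longrightarrow> qf (perp_part u M) n = qf M n"
proof -
  define P where "P = mat 1 - (1 / (u \<bullet> u)) *\<^sub>R outer u u"
  define S where "S = (1/2) *\<^sub>R (M + transpose M)"
  have pp: "perp_part u M = P ** S ** P" by (simp add: perp_part_def P_def S_def Let_def)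
  have tP: "transpose P = P" by (simp add: P_def transpose_def outer_def vec_eq_iff mat_def mult.commute)
  have tS: "transpose S = S" by (simp add: S_def transpose_def vec_eq_iff)
  have Pv: "P *v n = n - ((u \<bullet> n) / (u \<bullet> u)) *\<^sub>R u" for n
  proof -
    have "outer u u *v n = (u \<bullet> n) *\<^sub>R u"
      by (simp add: vec_eq_iff outer_def matrix_vector_mult_def inner_vec_def sum_distrib_left mult_ac)
    then show ?thesis by (simp add: P_def matrix_vector_mult_diff_rdistrib scaleR_matrix_vector_assoc[symmetric])
  qed
  show "transpose (perp_part u M) = perp_part u M"
    by (simp add: pp matrix_transpose_mul tP tS matrix_mul_assoc)
  have "P *v u = 0" by (simp add: Pv)
  then show "perp_part u M *v u = 0" by (simp add: pp matrix_vector_mul_assoc[symmetric])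
  show "qf (perp_part u M) n = qf M n" if "n \<bullet> u = 0"
  proof -
    have Pn: "P *v n = n" using that by (simp add: Pv inner_commute)
    have "qf (perp_part u M) n = n \<bullet> (P *v (S *v n))" by (simp add: qf_def pp matrix_vector_mul_assoc[symmetric] Pn)
    also have "\<dots> = (S *v n) \<bullet> n" using symmetric_inner_swap[OF tP, of n "S *v n"] Pn by simp
    also have "\<dots> = (qf M n + n \<bullet> (transpose M *v n)) / 2"
      by (simp add: S_def qf_def scaleR_matrix_vector_assoc[symmetric] matrix_vector_mult_add_rdistrib inner_add_right inner_commute[of _ n] add_divide_distrib)
    also have "n \<bullet> (transpose M *v n) = qf M n"
      by (metis dot_lmul_matrix inner_commute transpose_matrix_vector qf_def)
    finally show ?thesis by simp
  qed
qed

section \<open>Frameworks of quadratic forms on a graph\<close>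

definition compatible :: "('v \<Rightarrow> real^3) \<Rightarrow> 'v set set \<Rightarrow> ('v \<Rightarrow> real^3^3) \<Rightarrow> bool" where
  "compatible u E A \<longleftrightarrow> (\<forall>x y. {x,y} \<in> E \<longrightarrow> qf (A x) (cross3 (u x) (u y)) = qf (A y) (cross3 (u x) (u y)))"

text \<open>Every edge at \<open>x\<close> tests \<open>A x\<close> at a vector orthogonal to
  \<open>u x\<close>, so only the restriction to that plane can be compared with a global form. The
  count is that of bar frameworks in space: three coefficients per vertex, one equation per edge,
  and a six-dimensional space of trivial solutions.\<close>

definition rigid :: "('v \<Rightarrow> real^3) \<Rightarrow> 'v set set \<Rightarrow> bool" where
  "rigid u E \<longleftrightarrow> (\<forall>A. compatible u E A \<longrightarrow>
      (\<exists>B. \<forall>x\<in>\<Union>E. \<forall>n. n \<bullet> u x = 0 \<longrightarrow> qf (A x) n = qf B n))"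

text \<open>Rigidity with the global forms factored out, by pinning the three vertices of a triangle;
  each form is normalised to have \<open>u x\<close> in its kernel, so that the solution space depends
  polynomially on \<open>u\<close>.\<close>
definition pinned_solution :: "('v \<Rightarrow> real^3) \<Rightarrow> 'v set set \<Rightarrow> 'v set \<Rightarrow> ('v \<Rightarrow> real^3^3) \<Rightarrow> bool" where
  "pinned_solution u E T A \<longleftrightarrow> compatible u E A \<and> (\<forall>x. transpose (A x) = A x) \<and> (\<forall>x. A x *v u x = 0) \<and>
     (\<forall>x. x \<in> T \<or> x \<notin> \<Union>E \<longrightarrow> A x = 0)"

definition pinned_rigid :: "('v \<Rightarrow> real^3) \<Rightarrow> 'v set set \<Rightarrow> 'v set \<Rightarrow> bool" where
  "pinned_rigid u E T \<longleftrightarrow> (\<forall>A. pinned_solution u E T A \<longrightarrow> (\<forall>x. A x = 0))"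

lemma rigid_pinned_zero:
  assumes r: "rigid u E" and abc: "a \<in> \<Union>E" "b \<in> \<Union>E" "c \<in> \<Union>E" "u a \<bullet> cross3 (u b) (u c) \<noteq> 0"
    and A: "compatible u E A" "A a = 0" "A b = 0" "A c = 0"
    and x: "x \<in> \<Union>E" "n \<bullet> u x = 0"
  shows "qf (A x) n = 0"
proof -
  obtain B where B: "\<And>x n. x \<in> \<Union>E \<Longrightarrow> n \<bullet> u x = 0 \<Longrightarrow> qf (A x) n = qf B n"
    using r A(1) unfolding rigid_def by blast
  have "qf B n = 0"
  proof (rule qf_vanishes_three_planes[OF abc(4)])
    show "qf B m = 0" if "m \<bullet> u a = 0" for m using B[OF abc(1) that] A(2) by simp
    show "qf B m = 0" if "m \<bullet> u b = 0" for m using B[OF abc(2) that] A(3) by simp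
    show "qf B m = 0" if "m \<bullet> u c = 0" for m using B[OF abc(3) that] A(4) by simp
  qed
  then show ?thesis using B[OF x] by simp
qed

text \<open>The triangle determines a global form by \<open>triangle_global_form\<close>;
  subtracting it and normalising with \<open>perp_part\<close> turns an arbitrary solution into a
  pinned one.\<close>

lemma rigid_if_pinned_rigid:
  assumes p: "pinned_rigid u E {a,b,c}" and e: "{a,b} \<in> E" "{b,c} \<in> E" "{c,a} \<in> E"
    and d: "u a \<bullet> cross3 (u b) (u c) \<noteq> 0"
  shows "rigid u E"
  unfolding rigid_def
proof (intro allI impI)
  fix A assume A: "compatible u E A"
  have c: "{x,y} \<in> E \<Longrightarrow> qf (A x) (cross3 (u x) (u y)) = qf (A y) (cross3 (u x) (u y))" for x y
    using A unfolding compatible_def by blast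
  have "qf (A a) (cross3 (u c) (u a)) = qf (A c) (cross3 (u c) (u a))" using c[OF e(3)] by simp
  then obtain M where M: "\<And>n. n \<bullet> u a = 0 \<Longrightarrow> qf (A a) n = qf M n" "\<And>n. n \<bullet> u b = 0 \<Longrightarrow> qf (A b) n = qf M n"
     "\<And>n. n \<bullet> u c = 0 \<Longrightarrow> qf (A c) n = qf M n"
    using triangle_global_form[OF d c[OF e(1)] c[OF e(2)]] by blast
  define A' where "A' x = (if x \<in> \<Union>E then perp_part (u x) (A x - M) else 0)" for x
  have q: "qf (A' x) n = qf (A x) n - qf M n" if "x \<in> \<Union>E" "n \<bullet> u x = 0" for x n
    using that by (simp add: A'_def perp_part(3) qf_diff_matrix)
  have s: "transpose (A' x) = A' x" "A' x *v u x = 0" for x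
    using perp_part(1,2)[of "u x" "A x - M"] by (simp_all add: A'_def transpose_def vec_eq_iff)
  have z: "A' x = 0" if x: "x \<in> {a,b,c}" for x
  proof (rule symmetric_qf_zero_on_perp[OF s])
    fix n assume "n \<bullet> u x = 0"
    moreover have "x \<in> \<Union>E" using x e by auto
    ultimately show "qf (A' x) n = 0" using q M x by auto
  qed
  have comp: "compatible u E A'"
    unfolding compatible_def
  proof (intro allI impI)
    fix x y assume xy: "{x,y} \<in> E"
    have "cross3 (u x) (u y) \<bullet> u x = 0" "cross3 (u x) (u y) \<bullet> u y = 0" "x \<in> \<Union>E" "y \<in> \<Union>E"
      using xy by (auto simp: dot_cross_self inner_commute)
    then show "qf (A' x) (cross3 (u x) (u y)) = qf (A' y) (cross3 (u x) (u y))"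
      using q c[OF xy] by simp
  qed
  have z': "A' x = 0" if "x \<notin> \<Union>E" for x using that by (simp add: A'_def)
  have "pinned_solution u E {a,b,c} A'"
    unfolding pinned_solution_def
    by (intro conjI allI impI comp s) (elim disjE, erule z, erule z')
  then have "A' x = 0" for x using p unfolding pinned_rigid_def by blast
  then show "\<exists>B. \<forall>x\<in>\<Union>E. \<forall>n. n \<bullet> u x = 0 \<longrightarrow> qf (A x) n = qf B n"
    using q by (intro exI[of _ M]) simp
qed

lemma compatible_mono: "compatible u F A \<Longrightarrow> E \<subseteq> F \<Longrightarrow> compatible u E A"
  unfolding compatible_def by blast

text \<open>The global forms of the two parts agree on the planes of three independent shared
  vertices, hence everywhere.\<close>

lemma rigid_glue:
  assumes r: "rigid u E" "rigid u F"
    and m: "a \<in> \<Union>E \<inter> \<Union>F" "b \<in> \<Union>E \<inter> \<Union>F" "c \<in> \<Union>E \<inter> \<Union>F"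
    and d: "u a \<bullet> cross3 (u b) (u c) \<noteq> 0"
  shows "rigid u (E \<union> F)"
  unfolding rigid_def
proof (intro allI impI)
  fix A assume A: "compatible u (E \<union> F) A"
  obtain B where B: "\<And>x n. x \<in> \<Union>E \<Longrightarrow> n \<bullet> u x = 0 \<Longrightarrow> qf (A x) n = qf B n"
    using r(1) compatible_mono[OF A, of E] unfolding rigid_def by blast
  obtain C where C: "\<And>x n. x \<in> \<Union>F \<Longrightarrow> n \<bullet> u x = 0 \<Longrightarrow> qf (A x) n = qf C n"
    using r(2) compatible_mono[OF A, of F] unfolding rigid_def by blast
  have eq: "qf (B - C) n = 0" if "n \<bullet> u x = 0" "x \<in> \<Union>E \<inter> \<Union>F" for n x
    using B[of x n] C[of x n] that by (simp add: qf_diff_matrix)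
  have "qf (B - C) n = 0" for n
    by (rule qf_vanishes_three_planes[OF d]) (use eq m in blast)+
  then have "qf B n = qf C n" for n by (simp add: qf_diff_matrix)
  then show "\<exists>B. \<forall>x\<in>\<Union>(E \<union> F). \<forall>n. n \<bullet> u x = 0 \<longrightarrow> qf (A x) n = qf B n"
    using B C by (intro exI[of _ B]) (metis UnE Union_Un_distrib)
qed

lemma rigid_superset:
  assumes "rigid u E" "E \<subseteq> F" "\<Union>F \<subseteq> \<Union>E"
  shows "rigid u F"
  using assms compatible_mono unfolding rigid_def by (metis (no_types, lifting) subset_iff)

text \<open>The triangle \<open>a b c\<close> gives a global form; at \<open>d\<close> the
  difference from it vanishes on the three lines coming from the edges to \<open>a\<close>,
  \<open>b\<close>, \<open>c\<close>, hence on the whole plane.\<close>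

lemma rigid_K4:
  assumes dist: "distinct [a,b,c,d]" and u: "triples_independent u"
  shows "rigid u {{a,b},{b,c},{c,a},{d,a},{d,b},{d,c}}" (is "rigid u ?E")
  unfolding rigid_def
proof (intro allI impI)
  fix A assume C: "compatible u ?E A"
  have c: "{x,y} \<in> ?E \<Longrightarrow> qf (A x) (cross3 (u x) (u y)) = qf (A y) (cross3 (u x) (u y))" for x y
    by (rule C[unfolded compatible_def, rule_format])
  have t: "u x \<bullet> cross3 (u y) (u z) \<noteq> 0" if "distinct [x,y,z]" for x y z
    using u that by (simp add: triples_independent_def)
  have ca: "qf (A a) (cross3 (u c) (u a)) = qf (A c) (cross3 (u c) (u a))" using c[of c a] by simp
  obtain M where M: "\<And>n. n \<bullet> u a = 0 \<Longrightarrow> qf (A a) n = qf M n" "\<And>n. n \<bullet> u b = 0 \<Longrightarrow> qf (A b) n = qf M n"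
     "\<And>n. n \<bullet> u c = 0 \<Longrightarrow> qf (A c) n = qf M n"
    using triangle_global_form[OF t[of a b c] c[of a b] c[of b c] ca] dist
    by (metis (no_types, lifting) distinct_length_2_or_more distinct_singleton insertI1 insertI2)
  have o: "cross3 (u d) (u x) \<bullet> u x = 0" for x by (simp add: dot_cross_self)
  have "qf (A d - M) n = 0" if "n \<bullet> u d = 0" for n
  proof (rule qf_vanishes_on_perp[OF t[of d a b] t[of d a c] t[of d b c] _ _ _ that])
    show "qf (A d - M) (cross3 (u d) (u a)) = 0" using c[of d a] M(1)[OF o] by (simp add: qf_diff_matrix)
    show "qf (A d - M) (cross3 (u d) (u b)) = 0" using c[of d b] M(2)[OF o] by (simp add: qf_diff_matrix)
    show "qf (A d - M) (cross3 (u d) (u c)) = 0" using c[of d c] M(3)[OF o] by (simp add: qf_diff_matrix)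
  qed (use dist in auto)
  then have "\<And>n. n \<bullet> u d = 0 \<Longrightarrow> qf (A d) n = qf M n" by (simp add: qf_diff_matrix)
  then show "\<exists>B. \<forall>x\<in>\<Union>?E. \<forall>n. n \<bullet> u x = 0 \<longrightarrow> qf (A x) n = qf B n"
    using M by (intro exI[of _ M]) auto
qed

text \<open>Once all matrices are stored in one vector, pinned solutions are the common kernel of
  finitely many functionals, linear in the solution and polynomial in \<open>u\<close>. This is the
  passage from one position to generic ones, and the reason for working with pinned solutions
  instead of the quotient by global forms.\<close>

lemma generically_pinned_rigid:
  fixes E :: "'v::finite set set"
  assumes ex: "\<exists>u. pinned_rigid u E T"
  shows "generically (\<lambda>u. pinned_rigid u E T)"
proof -
  define h :: "real^('v \<times> 3 \<times> 3) \<Rightarrow> 'v \<Rightarrow> real^3^3" where "h y x = (\<chi> i j. y $ (x,i,j))" for y x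
  have h_add: "h (y + z) x = h y x + h z x" and h_scale: "h (c *\<^sub>R y) x = c *\<^sub>R h y x" for y z x c
    by (simp_all add: h_def vec_eq_iff)
  define L1 :: "(('v \<Rightarrow> real^3) \<Rightarrow> real^('v \<times> 3 \<times> 3) \<Rightarrow> real) set" where
    "L1 = (\<lambda>(x,i,j) u y. h y x $ i $ j - h y x $ j $ i) ` UNIV"
  define L2 :: "(('v \<Rightarrow> real^3) \<Rightarrow> real^('v \<times> 3 \<times> 3) \<Rightarrow> real) set" where
    "L2 = (\<lambda>(x,i) u y. (h y x *v u x) $ i) ` UNIV"
  define L3 :: "(('v \<Rightarrow> real^3) \<Rightarrow> real^('v \<times> 3 \<times> 3) \<Rightarrow> real) set" where
    "L3 = (\<lambda>(x,z) u y. qf (h y x) (cross3 (u x) (u z)) - qf (h y z) (cross3 (u x) (u z))) ` {(x,z). {x,z} \<in> E}"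
  define L4 :: "(('v \<Rightarrow> real^3) \<Rightarrow> real^('v \<times> 3 \<times> 3) \<Rightarrow> real) set" where
    "L4 = (\<lambda>(x,i,j) u y. h y x $ i $ j) ` {(x,i,j). x \<in> T \<or> x \<notin> \<Union>E}"
  let ?L = "L1 \<union> L2 \<union> L3 \<union> L4"
  have sol: "pinned_solution u E T (h y) \<longleftrightarrow> (\<forall>f\<in>?L. f u y = 0)" for u y
    unfolding pinned_solution_def compatible_def ball_Un L1_def L2_def L3_def L4_def
    by (auto simp: vec_eq_iff transpose_def)
  have zero: "y = 0 \<longleftrightarrow> (\<forall>x. h y x = 0)" for y
    by (auto simp: h_def vec_eq_iff)
  have surj: "\<exists>y. A = h y" for A
    by (rule exI[of _ "\<chi> k. case k of (x,i,j) \<Rightarrow> A x $ i $ j"]) (simp add: h_def fun_eq_iff vec_eq_iff)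
  have iff: "pinned_rigid u E T \<longleftrightarrow> (\<forall>y. (\<forall>f\<in>?L. f u y = 0) \<longrightarrow> y = 0)" for u
    unfolding pinned_rigid_def sol[symmetric] zero using surj by metis
  have cq: "coord_poly (\<lambda>u. qf M (cross3 (u x) (u z)))" for M and x z :: 'v
    unfolding qf_eq_sum by (intro coord_poly_sum cp_mult cp_const coord_poly_cross)
  have "generically (\<lambda>u. \<forall>y. (\<forall>f\<in>?L. f u y = 0) \<longrightarrow> y = 0)"
  proof (rule generically_injective)
    show "finite ?L" unfolding L1_def L2_def L3_def L4_def by simp
    show "linear (f u)" if "f \<in> ?L" for f u
      using that unfolding L1_def L2_def L3_def L4_def
      by (auto intro!: linearI simp: h_add h_scale qf_add_matrix qf_scale_matrix
          matrix_vector_mult_add_rdistrib scaleR_matrix_vector_assoc[symmetric] algebra_simps)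
    show "coord_poly (\<lambda>u. f u y)" if "f \<in> ?L" for f y
      using that unfolding L1_def L2_def L3_def L4_def
      by (auto simp: matrix_vector_mult_def intro!: cp_const coord_poly_diff cq coord_poly_sum cp_mult cp_coord)
    show "\<exists>u. \<forall>y. (\<forall>f\<in>?L. f u y = 0) \<longrightarrow> y = 0" using ex unfolding iff .
  qed
  then show ?thesis unfolding iff .
qed

section \<open>Limits of frameworks and vertex splitting\<close>

lemma tendsto_cross3:
  assumes "(f \<longlongrightarrow> a) F" "(g \<longlongrightarrow> b) F"
  shows "((\<lambda>x. cross3 (f x) (g x)) \<longlongrightarrow> cross3 a b) F"
proof (rule vec_tendstoI)
  fix i :: 3
  show "((\<lambda>x. cross3 (f x) (g x) $ i) \<longlongrightarrow> cross3 a b $ i) F"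
    using exhaust_3[of i] by (elim disjE) (simp add: cross_components, intro tendsto_intros assms)+
qed

lemma tendsto_qf:
  assumes "(M \<longlongrightarrow> N) F" "(f \<longlongrightarrow> a) F"
  shows "((\<lambda>x. qf (M x) (f x)) \<longlongrightarrow> qf N a) F"
  unfolding qf_eq_sum by (intro tendsto_intros assms)

lemma tendsto_mat_vec:
  fixes f :: "_ \<Rightarrow> real^'n"
  assumes "(M \<longlongrightarrow> N) F" "(f \<longlongrightarrow> a) F"
  shows "((\<lambda>x. M x *v f x) \<longlongrightarrow> N *v a) F"
  by (rule vec_tendstoI) (simp add: matrix_vector_mult_def, intro tendsto_intros assms)

lemma pinned_solution_scale:
  assumes "pinned_solution u E T A" shows "pinned_solution u E T (\<lambda>x. c *\<^sub>R A x)"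
  using assms unfolding pinned_solution_def compatible_def
  by (auto simp: qf_scale_matrix scaleR_matrix_vector_assoc[symmetric] transpose_def vec_eq_iff)

text \<open>Nonzero solutions are scaled to the unit sphere, whose compactness yields a convergent
  subsequence with nonzero limit. Nothing is assumed about convergence of the positions
  \<open>U n\<close>.\<close>

lemma pinned_limit:
  fixes E :: "'v::finite set set"
  assumes "\<And>n::nat. \<not> pinned_rigid (U n) E T"
  obtains X l r where "strict_mono (r :: nat \<Rightarrow> nat)" "\<And>n. pinned_solution (U (r n)) E T (X n)"
    "\<And>x. (\<lambda>n. X n x) \<longlonglongrightarrow> l x" "\<exists>x. l x \<noteq> (0 :: real^3^3)"
proof -
  have "\<exists>Y. norm (Y :: real^3^3^'v) = 1 \<and> pinned_solution (U n) E T (\<lambda>x. Y $ x)" for n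
  proof -
    obtain A x where A: "pinned_solution (U n) E T A" "A x \<noteq> 0"
      using assms[of n] unfolding pinned_rigid_def by blast
    let ?Z = "(\<chi> x. A x) :: real^3^3^'v"
    have nz: "?Z \<noteq> 0" using A(2) by (auto simp: vec_eq_iff[of _ "0::real^3^3^'v"])
    let ?Y = "(1 / norm ?Z) *\<^sub>R ?Z"
    have "norm ?Y = 1" using nz by simp
    moreover have "pinned_solution (U n) E T (\<lambda>x. ?Y $ x)"
      using pinned_solution_scale[OF A(1), of "1 / norm ?Z"] by simp
    ultimately show ?thesis by blast
  qed
  then obtain Y where Y: "\<And>n. norm (Y n :: real^3^3^'v) = 1" "\<And>n. pinned_solution (U n) E T (\<lambda>x. Y n $ x)"
    by metis
  have "compact (sphere (0::real^3^3^'v) 1)" by simp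
  then obtain l r where lr: "l \<in> sphere 0 1" "strict_mono r" "(Y \<circ> r) \<longlonglongrightarrow> l"
    unfolding compact_def using Y(1) by (metis dist_0_norm mem_sphere)
  show ?thesis
  proof (rule that[of r "\<lambda>n x. Y (r n) $ x" "\<lambda>x. l $ x"])
    show "strict_mono r" by fact
    show "pinned_solution (U (r n)) E T (\<lambda>x. Y (r n) $ x)" for n by (rule Y(2))
    show "(\<lambda>n. Y (r n) $ x) \<longlonglongrightarrow> l $ x" for x using tendsto_vec_nth[OF lr(3), of x] by (simp add: o_def)
    have "l \<noteq> 0" using lr(1) by auto
    then show "\<exists>x. l $ x \<noteq> 0" by (auto simp: vec_eq_iff[of l 0])
  qed
qed

text \<open>Splitting \<open>s\<close> into \<open>s\<close> and \<open>t\<close> with two common neighbours keeps rigidity: let \<open>t\<close> tend to \<open>s\<close>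
  in direction \<open>z\<close>. In the limit the equation of the edge \<open>st\<close>, divided by the square of the distance,
  and those of the common neighbours force the forms at \<open>s\<close> and \<open>t\<close> to agree.\<close>
lemma vertex_split:
  fixes u0 :: "'v::finite \<Rightarrow> real^3"
  assumes ne: "s \<noteq> t" and u: "triples_independent u0" and r: "rigid u0 E'"
    and E': "\<And>x y. {x,y} \<in> E' \<Longrightarrow> x \<noteq> t \<and> y \<noteq> t \<and> ({x,y} \<in> E \<or> (x = s \<and> {t,y} \<in> E) \<or> (y = s \<and> {x,t} \<in> E))"
    and s: "s \<in> \<Union>E'" and t: "t \<notin> \<Union>E'" and V: "\<Union>E \<subseteq> insert t (\<Union>E')"
    and st: "{s,t} \<in> E" and c1: "{s,c1} \<in> E" "{t,c1} \<in> E" and c2: "{s,c2} \<in> E" "{t,c2} \<in> E"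
    and c: "distinct [c1,c2,s,t]"
    and T: "\<And>x. \<phi> x = (if x = t then s else x)" "distinct [\<phi> a, \<phi> b, \<phi> c]" "{\<phi> a, \<phi> b, \<phi> c} \<subseteq> \<Union>E'"
  shows "\<exists>u. pinned_rigid u E {a,b,c}"
proof (rule ccontr)
  let ?p = "u0 s"
  \<comment> \<open>The sum is a direction for which \<open>u0 c1\<close>, \<open>u0 c2\<close> and
    \<open>?z\<close> are pairwise independent modulo \<open>?p\<close>, as
    \<open>qf_vanishes_on_perp\<close> demands.\<close>
  let ?z = "u0 c1 + u0 c2"
  let ?U = "\<lambda>n::nat. u0(t := ?p + (1 / real (Suc n)) *\<^sub>R ?z)"
  let ?u = "u0(t := ?p)"
  assume "\<nexists>u. pinned_rigid u E {a,b,c}"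
  then have "\<And>n. \<not> pinned_rigid (?U n) E {a,b,c}" by blast
  then obtain X l and r' :: "nat \<Rightarrow> nat" where X: "strict_mono r'" "\<And>n. pinned_solution (?U (r' n)) E {a,b,c} (X n)"
    "\<And>x. (\<lambda>n. X n x) \<longlonglongrightarrow> l x" and nz: "\<exists>x. l x \<noteq> 0"
    by (rule pinned_limit[where U = ?U]) (rule that; assumption)
  have Xs: "compatible (?U (r' n)) E (X n)" "transpose (X n x) = X n x" "X n x *v ?U (r' n) x = 0"
    "x \<in> {a,b,c} \<or> x \<notin> \<Union>E \<Longrightarrow> X n x = 0" for n x
    using X(2)[of n] unfolding pinned_solution_def by blast+
  have Ul: "(\<lambda>n. ?U (r' n) x) \<longlonglongrightarrow> ?u x" for x
  proof (cases "x = t")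
    case True
    have "(\<lambda>n. ?p + (1 / real (Suc n)) *\<^sub>R ?z) \<longlonglongrightarrow> ?p + 0 *\<^sub>R ?z"
      by (intro tendsto_intros LIMSEQ_Suc lim_1_over_n)
    then have "(\<lambda>n. ?p + (1 / real (Suc (r' n))) *\<^sub>R ?z) \<longlonglongrightarrow> ?p"
      using LIMSEQ_subseq_LIMSEQ[OF _ X(1)] by (fastforce simp: o_def)
    then show ?thesis using True by simp
  qed simp
  have sym: "transpose (l x) = l x" for x
  proof -
    have "l x $ i $ j = l x $ j $ i" for i j
    proof (rule LIMSEQ_unique)
      show "(\<lambda>n. X n x $ i $ j) \<longlonglongrightarrow> l x $ i $ j" by (intro tendsto_vec_nth X(3))
      have "X n x $ i $ j = X n x $ j $ i" for n
        using Xs(2)[of n x] by (metis (no_types, lifting) transpose_def vec_lambda_beta)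
      then show "(\<lambda>n. X n x $ i $ j) \<longlonglongrightarrow> l x $ j $ i" using tendsto_vec_nth[OF tendsto_vec_nth[OF X(3)]] by simp
    qed
    then show ?thesis by (simp add: transpose_def vec_eq_iff)
  qed
  have ker: "l x *v ?u x = 0" for x
  proof (rule LIMSEQ_unique)
    show "(\<lambda>n. X n x *v ?U (r' n) x) \<longlonglongrightarrow> l x *v ?u x" by (intro tendsto_mat_vec X(3) Ul)
    show "(\<lambda>n. X n x *v ?U (r' n) x) \<longlonglongrightarrow> 0" unfolding Xs(3) by simp
  qed
  have pin: "l x = 0" if "x \<in> {a,b,c} \<or> x \<notin> \<Union>E" for x
  proof (rule LIMSEQ_unique[OF X(3)])
    show "(\<lambda>n. X n x) \<longlonglongrightarrow> 0" using Xs(4)[OF that] by simp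
  qed
  have comp: "qf (l x) (cross3 (?u x) (?u y)) = qf (l y) (cross3 (?u x) (?u y))" if "{x,y} \<in> E" for x y
  proof (rule LIMSEQ_unique)
    show "(\<lambda>n. qf (X n x) (cross3 (?U (r' n) x) (?U (r' n) y))) \<longlonglongrightarrow> qf (l x) (cross3 (?u x) (?u y))"
      by (intro tendsto_qf tendsto_cross3 X(3) Ul)
    have "(\<lambda>n. qf (X n y) (cross3 (?U (r' n) x) (?U (r' n) y))) \<longlonglongrightarrow> qf (l y) (cross3 (?u x) (?u y))"
      by (intro tendsto_qf tendsto_cross3 X(3) Ul)
    moreover have "qf (X n x) (cross3 (?U (r' n) x) (?U (r' n) y)) = qf (X n y) (cross3 (?U (r' n) x) (?U (r' n) y))" for n
      using Xs(1)[of n] that unfolding compatible_def by blast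
    ultimately show "(\<lambda>n. qf (X n x) (cross3 (?U (r' n) x) (?U (r' n) y))) \<longlonglongrightarrow> qf (l y) (cross3 (?u x) (?u y))"
      by simp
  qed
  have zz: "qf (l s) (cross3 ?p ?z) = qf (l t) (cross3 ?p ?z)"
  proof (rule LIMSEQ_unique)
    show "(\<lambda>n. qf (X n s) (cross3 ?p ?z)) \<longlonglongrightarrow> qf (l s) (cross3 ?p ?z)"
      by (intro tendsto_qf X(3) tendsto_const)
    have "qf (X n s) (cross3 ?p ?z) = qf (X n t) (cross3 ?p ?z)" for n
    proof -
      let ?e = "1 / real (Suc (r' n))"
      have "cross3 (?U (r' n) s) (?U (r' n) t) = ?e *\<^sub>R cross3 ?p ?z"
        using ne by (simp add: cross_add_right cross_mult_right)
      moreover have "qf (X n s) (cross3 (?U (r' n) s) (?U (r' n) t)) = qf (X n t) (cross3 (?U (r' n) s) (?U (r' n) t))"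
        using Xs(1)[of n] st unfolding compatible_def by blast
      ultimately have "?e\<^sup>2 * qf (X n s) (cross3 ?p ?z) = ?e\<^sup>2 * qf (X n t) (cross3 ?p ?z)" by (simp only: qf_scale)
      then show ?thesis by simp
    qed
    then show "(\<lambda>n. qf (X n s) (cross3 ?p ?z)) \<longlonglongrightarrow> qf (l t) (cross3 ?p ?z)"
      using tendsto_qf[OF X(3)[of t] tendsto_const, of "cross3 ?p ?z"] by simp
  qed
  have ti: "u0 x \<bullet> cross3 (u0 y) (u0 z) \<noteq> 0" if "distinct [x,y,z]" for x y z
    using u that by (simp add: triples_independent_def)
  have "l s - l t = 0"
  proof (rule symmetric_qf_zero_on_perp[of _ ?p])
    show "transpose (l s - l t) = l s - l t" using sym[of s] sym[of t] by (simp add: transpose_def vec_eq_iff)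
    show "(l s - l t) *v ?p = 0" using ker[of s] ker[of t] ne by (simp add: matrix_vector_mult_diff_rdistrib)
    show "qf (l s - l t) n = 0" if "n \<bullet> ?p = 0" for n
    proof (rule qf_vanishes_on_perp[of ?p "u0 c1" "u0 c2" ?z, OF _ _ _ _ _ _ that])
      show 1: "?p \<bullet> cross3 (u0 c1) (u0 c2) \<noteq> 0" using ti[of s c1 c2] c by auto
      show "?p \<bullet> cross3 (u0 c1) ?z \<noteq> 0" using 1 by (simp add: cross_add_right)
      show "?p \<bullet> cross3 (u0 c2) ?z \<noteq> 0" using 1 by (simp add: cross_add_right triple_cyclic(3)[of ?p "u0 c2"])
      show "qf (l s - l t) (cross3 ?p (u0 c1)) = 0" using comp[OF c1(1)] comp[OF c1(2)] c ne by (simp add: qf_diff_matrix)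
      show "qf (l s - l t) (cross3 ?p (u0 c2)) = 0" using comp[OF c2(1)] comp[OF c2(2)] c ne by (simp add: qf_diff_matrix)
      show "qf (l s - l t) (cross3 ?p ?z) = 0" using zz by (simp add: qf_diff_matrix)
    qed
  qed
  then have lst: "l t = l s" by simp
  \<comment> \<open>Every equation of the contracted graph is the limit of an equation from
    \<open>E\<close>, with \<open>t\<close> renamed to \<open>s\<close>.\<close>
  have comp': "compatible u0 E' l" unfolding compatible_def
  proof (intro allI impI)
    fix x y assume xy: "{x,y} \<in> E'"
    have n: "x \<noteq> t" "y \<noteq> t" using E'[OF xy] by auto
    consider "{x,y} \<in> E" | "x = s" "{t,y} \<in> E" | "y = s" "{x,t} \<in> E" using E'[OF xy] by blast
    then show "qf (l x) (cross3 (u0 x) (u0 y)) = qf (l y) (cross3 (u0 x) (u0 y))"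
    proof cases
      case 1 show ?thesis using comp[OF 1] n by simp
    next
      case 2 show ?thesis using comp[OF 2(2)] n 2(1) lst by simp
    next
      case 3 show ?thesis using comp[OF 3(2)] n 3(1) lst by simp
    qed
  qed
  \<comment> \<open>Zeros at the pinned vertices thus become zeros at three independent vertices of
    the contracted graph, also if \<open>t\<close> was pinned.\<close>
  have l\<phi>: "l (\<phi> x) = l x" for x using lst by (simp add: T(1))
  have za: "l (\<phi> a) = 0" "l (\<phi> b) = 0" "l (\<phi> c) = 0" unfolding l\<phi> using pin by auto
  have E'0: "l x = 0" if x: "x \<in> \<Union>E'" for x
  proof -
    have xt: "x \<noteq> t" using x t by blast
    show ?thesis
    proof (rule symmetric_qf_zero_on_perp[OF sym ker])
      fix n assume "n \<bullet> ?u x = 0"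
      then have "n \<bullet> u0 x = 0" using xt by simp
      then show "qf (l x) n = 0"
        using rigid_pinned_zero[OF r _ _ _ ti[OF T(2)] comp' za x] T(3) by simp
    qed
  qed
  have "l x = 0" for x
  proof (cases "x \<in> \<Union>E")
    case True
    then consider "x = t" | "x \<in> \<Union>E'" using V by blast
    then show ?thesis
    proof cases
      case 1 then show ?thesis using E'0[OF s] lst by simp
    next
      case 2 then show ?thesis by (rule E'0)
    qed
  next
    case False then show ?thesis using pin by blast
  qed
  then show False using nz by blast
qed

section \<open>Minimal cycles are generically rigid\<close>

definition degree2 :: "'v set set \<Rightarrow> 'v set \<Rightarrow> nat" where
  "degree2 S e = card {T\<in>S. e \<subseteq> T}"

text \<open>A simplicial 2-cycle with coefficients modulo 2, identified with the set of its
  triangles.\<close>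

definition cycle2 :: "'v set set \<Rightarrow> bool" where
  "cycle2 S \<longleftrightarrow> (\<forall>T\<in>S. card T = 3) \<and> (\<forall>e. card e = 2 \<longrightarrow> even (degree2 S e))"

definition min_cycle :: "'v set set \<Rightarrow> bool" where
  "min_cycle S \<longleftrightarrow> cycle2 S \<and> S \<noteq> {} \<and> (\<forall>D\<subseteq>S. cycle2 D \<longrightarrow> D = {} \<or> D = S)"

definition edges2 :: "'v set set \<Rightarrow> 'v set set" where
  "edges2 S = {e. card e = 2 \<and> (\<exists>T\<in>S. e \<subseteq> T)}"

lemma Union_edges2:
  assumes "\<forall>T\<in>S. card T = 3"
  shows "\<Union>(edges2 S) = \<Union>S"
proof
  show "\<Union>S \<subseteq> \<Union>(edges2 S)"
  proof
    fix x assume "x \<in> \<Union>S"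
    then obtain T where T: "T \<in> S" "x \<in> T" by blast
    have "card T = 3" using assms T by blast
    then obtain y where "y \<in> T" "y \<noteq> x" using T(2) by (auto simp: card_3_iff)
    then have "{x,y} \<in> edges2 S" using T by (auto simp: edges2_def)
    then show "x \<in> \<Union>(edges2 S)" by blast
  qed
qed (auto simp: edges2_def)

lemma pair_in_edges2: "x \<noteq> y \<Longrightarrow> {x,y} \<subseteq> T \<Longrightarrow> T \<in> S \<Longrightarrow> {x,y} \<in> edges2 S"
  by (auto simp: edges2_def)

lemma degree2_pos: "degree2 S e \<noteq> 0 \<Longrightarrow> \<exists>T\<in>S. e \<subseteq> T"
  unfolding degree2_def by (metis (no_types, lifting) Collect_empty_eq card.empty)

lemma degree2_Diff:
  fixes S :: "'v::finite set set"
  assumes "D \<subseteq> S"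
  shows "degree2 S e = degree2 D e + degree2 (S - D) e"
proof -
  have "{T\<in>S. e \<subseteq> T} = {T\<in>D. e \<subseteq> T} \<union> {T\<in>S - D. e \<subseteq> T}" using assms by blast
  then show ?thesis unfolding degree2_def by (simp add: card_Un_disjoint disjoint_iff)
qed

text \<open>Each triangle at \<open>s\<close> is counted once for each of its two other vertices.
  The parity of this sum serves as a handshake argument around \<open>s\<close>.\<close>

lemma sum_degree2_star:
  fixes S :: "'v::finite set set"
  assumes "\<forall>T\<in>S. card T = 3"
  shows "(\<Sum>c\<in>-{s}. degree2 S {s,c}) = 2 * card {T\<in>S. s \<in> T}"
proof -
  have "(\<Sum>c\<in>-{s}. degree2 S {s,c}) = (\<Sum>c\<in>-{s}. \<Sum>T\<in>S. if s \<in> T \<and> c \<in> T then 1 else 0)"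
    by (intro sum.cong refl) (simp add: degree2_def sum.If_cases Int_def)
  also have "\<dots> = (\<Sum>T\<in>S. \<Sum>c\<in>-{s}. if s \<in> T \<and> c \<in> T then 1 else 0)" by (rule sum.swap)
  also have "\<dots> = (\<Sum>T\<in>S. if s \<in> T then 2 else 0)"
  proof (intro sum.cong refl)
    fix T assume "T \<in> S"
    then have "card T = 3" using assms by blast
    then have "s \<in> T \<Longrightarrow> card (- {s} \<inter> T) = 2" by (simp add: Diff_eq[symmetric] Int_commute[of "- {s}"])
    then show "(\<Sum>c\<in>-{s}. if s \<in> T \<and> c \<in> T then 1 else 0) = (if s \<in> T then 2 else (0::nat))"
      by (simp add: sum.If_cases)
  qed
  also have "\<dots> = 2 * card {T\<in>S. s \<in> T}" by (simp add: sum.If_cases Int_def mult.commute)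
  finally show ?thesis .
qed

section \<open>Contraction of an edge of a minimal cycle\<close>

locale contraction =
  fixes S :: "'v::finite set set" and s t :: 'v
  assumes min: "min_cycle S" and ne: "s \<noteq> t" and edge: "\<exists>T\<in>S. {s,t} \<subseteq> T"
begin

text \<open>The triangles that do not collapse to an edge when \<open>t\<close> is moved to
  \<open>s\<close>.\<close>

definition S0 where "S0 = {T\<in>S. \<not> {s,t} \<subseteq> T}"

text \<open>Balanced sets are those whose image under the contraction of \<open>t\<close> to \<open>s\<close> is a cycle modulo 2, counted
  with multiplicity.\<close>
definition balanced where
  "balanced D \<longleftrightarrow> D \<subseteq> S0 \<and> (\<forall>e. card e = 2 \<longrightarrow> s \<notin> e \<longrightarrow> t \<notin> e \<longrightarrow> even (degree2 D e)) \<and>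
     (\<forall>c. c \<noteq> s \<longrightarrow> c \<noteq> t \<longrightarrow> even (degree2 D {s,c} + degree2 D {t,c}))"

definition \<phi> where "\<phi> T = (if t \<in> T then insert s (T - {t}) else T)"

text \<open>For \<open>D\<close> inside \<open>S0\<close> the edge \<open>{s,t}\<close> lies in no
  triangle of \<open>D\<close>. It is added to every piece because vertex splitting needs it and
  because its ends are then shared by all pieces when they are glued.\<close>

definition piece where "piece D = insert {s,t} (edges2 D)"

lemma card3: "T \<in> S \<Longrightarrow> card T = 3" and even_deg: "card e = 2 \<Longrightarrow> even (degree2 S e)"
  using min by (auto simp: min_cycle_def cycle2_def)

lemma S0_sub: "S0 \<subseteq> S" by (auto simp: S0_def)

lemma subcycle: "D \<subseteq> S \<Longrightarrow> cycle2 D \<Longrightarrow> D = {} \<or> D = S"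
  using min by (auto simp: min_cycle_def)

lemma balanced_card3: "balanced D \<Longrightarrow> \<forall>T\<in>D. card T = 3"
  using S0_sub card3 by (auto simp: balanced_def)

lemma balanced_Diff:
  assumes "balanced D" "balanced D'" "D' \<subseteq> D"
  shows "balanced (D - D')"
proof -
  have "degree2 D e = degree2 D' e + degree2 (D - D') e" for e by (rule degree2_Diff[OF assms(3)])
  then show ?thesis using assms(1,2) unfolding balanced_def by (auto simp: algebra_simps)
qed

lemma degree_st: "D \<subseteq> S0 \<Longrightarrow> degree2 D {s,t} = 0"
  using degree2_pos[of D "{s,t}"] by (auto simp: S0_def)

lemma degree_S0: "card e = 2 \<Longrightarrow> e \<inter> {s,t} = {} \<Longrightarrow> degree2 S0 e = degree2 S e"
proof -
  assume e: "card e = 2" "e \<inter> {s,t} = {}"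
  have "T \<in> S0" if T: "T \<in> S" "e \<subseteq> T" for T
  proof (rule ccontr)
    assume "T \<notin> S0"
    then have "e \<union> {s,t} \<subseteq> T" using T by (auto simp: S0_def)
    then have "card (e \<union> {s,t}) \<le> 3" using card3[OF T(1)] by (metis card_mono finite)
    then show False using e ne by (simp add: card_Un_disjoint)
  qed
  then have "{T\<in>S0. e \<subseteq> T} = {T\<in>S. e \<subseteq> T}" using S0_sub by blast
  then show ?thesis by (simp add: degree2_def)
qed

lemma third_unique: "T \<in> S \<Longrightarrow> {s,t,c} \<subseteq> T \<Longrightarrow> c \<noteq> s \<Longrightarrow> c \<noteq> t \<Longrightarrow> T = {s,t,c}"
  using card3[of T] ne card_seteq[of T "{s,t,c}"] by simp

text \<open>A discarded triangle \<open>{s,t,c}\<close> lowers the degrees of \<open>{s,c}\<close>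
  and \<open>{t,c}\<close> alike, so the parity of their sum is unchanged; edges avoiding
  \<open>s\<close> and \<open>t\<close> keep their degree.\<close>

lemma balanced_S0: "balanced S0"
  unfolding balanced_def
proof (intro conjI allI impI)
  fix e :: "'v set" assume "card e = 2" "s \<notin> e" "t \<notin> e"
  then show "even (degree2 S0 e)" using degree_S0[of e] even_deg by auto
next
  fix c assume c: "c \<noteq> s" "c \<noteq> t"
  let ?k = "card ({{s,t,c}} \<inter> S)"
  have k: "degree2 S {x,c} = degree2 S0 {x,c} + ?k" if x: "x \<in> {s,t}" for x
  proof -
    have "{T\<in>S - S0. {x,c} \<subseteq> T} = {{s,t,c}} \<inter> S"
      using third_unique c x by (auto simp: S0_def)
    then show ?thesis using degree2_Diff[OF S0_sub, of "{x,c}"] by (simp add: degree2_def)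
  qed
  have "even (degree2 S {s,c})" "even (degree2 S {t,c})" using c by (auto intro!: even_deg)
  then show "even (degree2 S0 {s,c} + degree2 S0 {t,c})" using k[of s] k[of t] by simp
qed simp

text \<open>The triangles over an edge \<open>{s,c}\<close> of the image come from those through
  \<open>{s,c}\<close> and those through \<open>{t,c}\<close>, two disjoint families since no
  triangle of \<open>S0\<close> contains both \<open>s\<close> and \<open>t\<close>. The
  \<open>THE\<close> recovers \<open>c\<close> from the edge.\<close>

lemma degree_image:
  assumes D: "D \<subseteq> S0" and inj: "inj_on \<phi> D" and e: "card e = 2"
  shows "degree2 (\<phi> ` D) e = (if t \<in> e then 0 else if s \<in> e then
     (let c = (THE c. e = {s,c}) in degree2 D {s,c} + degree2 D {t,c}) else degree2 D e)"
proof -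
  have d: "degree2 (\<phi> ` D) e = card {T\<in>D. e \<subseteq> \<phi> T}"
  proof -
    have "{T\<in>\<phi> ` D. e \<subseteq> T} = \<phi> ` {T\<in>D. e \<subseteq> \<phi> T}" by blast
    moreover have "inj_on \<phi> {T\<in>D. e \<subseteq> \<phi> T}" using inj by (rule inj_on_subset) blast
    ultimately show ?thesis by (simp add: degree2_def card_image)
  qed
  consider "t \<in> e" | "t \<notin> e" "s \<in> e" | "t \<notin> e" "s \<notin> e" by blast
  then show ?thesis
  proof cases
    case 1
    then have "{T\<in>D. e \<subseteq> \<phi> T} = {}" using ne by (auto simp: \<phi>_def)
    then show ?thesis using 1 d by (metis card.empty)
  next
    case 2
    obtain c where c: "e = {s,c}" "c \<noteq> s" using e 2 by (auto simp: card_2_iff doubleton_eq_iff)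
    have the: "(THE c. e = {s,c}) = c" using c by (auto simp: doubleton_eq_iff)
    have "{T\<in>D. e \<subseteq> \<phi> T} = {T\<in>D. {s,c} \<subseteq> T} \<union> {T\<in>D. {t,c} \<subseteq> T}"
      using 2 c D by (auto simp: \<phi>_def S0_def)
    moreover have "{T\<in>D. {s,c} \<subseteq> T} \<inter> {T\<in>D. {t,c} \<subseteq> T} = {}" using D by (auto simp: S0_def)
    ultimately show ?thesis using 2 d the by (simp add: degree2_def card_Un_disjoint Let_def)
  next
    case 3
    have "{T\<in>D. e \<subseteq> \<phi> T} = {T\<in>D. e \<subseteq> T}" using 3 by (auto simp: \<phi>_def)
    then show ?thesis using 3 d by (simp add: degree2_def)
  qed
qed

lemma card_\<phi>: "T \<in> S0 \<Longrightarrow> card (\<phi> T) = 3"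
  using card3[of T] by (auto simp: \<phi>_def S0_def)

lemma balanced_iff_cycle:
  assumes D: "D \<subseteq> S0" and inj: "inj_on \<phi> D"
  shows "balanced D \<longleftrightarrow> cycle2 (\<phi> ` D)"
proof -
  have c3: "\<forall>T\<in>\<phi> ` D. card T = 3" using D card_\<phi> by blast
  have sc: "degree2 (\<phi> ` D) {s,c} = degree2 D {s,c} + degree2 D {t,c}" if "c \<noteq> s" "c \<noteq> t" for c
  proof -
    have "(THE c'. {s,c} = {s,c'}) = c" using that by (auto simp: doubleton_eq_iff)
    then show ?thesis using degree_image[OF D inj, of "{s,c}"] that ne by simp
  qed
  have o: "degree2 (\<phi> ` D) e = degree2 D e" if "card e = 2" "s \<notin> e" "t \<notin> e" for e
    using degree_image[OF D inj that(1)] that by simp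
  have z: "degree2 (\<phi> ` D) e = 0" if "card e = 2" "t \<in> e" for e
    using degree_image[OF D inj that(1)] that by simp
  show ?thesis
  proof
    assume b: "balanced D"
    have "even (degree2 (\<phi> ` D) e)" if e: "card e = 2" for e
    proof -
      consider "t \<in> e" | "t \<notin> e" "s \<in> e" | "t \<notin> e" "s \<notin> e" by blast
      then show ?thesis
      proof cases
        case 1 then show ?thesis using z[OF e] by simp
      next
        case 2
        then obtain c where c: "e = {s,c}" "c \<noteq> s" using e by (auto simp: card_2_iff doubleton_eq_iff)
        then show ?thesis using sc[of c] b 2 by (auto simp: balanced_def)
      next
        case 3 then show ?thesis using o[OF e] b e by (simp add: balanced_def)
      qed
    qed
    then show "cycle2 (\<phi> ` D)" using c3 by (simp add: cycle2_def)
  next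
    assume c: "cycle2 (\<phi> ` D)"
    show "balanced D" unfolding balanced_def
    proof (intro conjI allI impI D)
      fix e :: "'v set" assume "card e = 2" "s \<notin> e" "t \<notin> e"
      then show "even (degree2 D e)" using o[of e] c unfolding cycle2_def by metis
    next
      fix x assume "x \<noteq> s" "x \<noteq> t"
      then show "even (degree2 D {s,x} + degree2 D {t,x})"
        using sc[of x] c card_2_iff[of "{s,x}"] unfolding cycle2_def by metis
    qed
  qed
qed

text \<open>These are the two common neighbours needed for vertex splitting. If all edges at
  \<open>s\<close> had even degree, \<open>D\<close> would be a cycle properly inside
  \<open>S\<close>; so some degree is odd, and by the handshake count there are at least two such
  edges. Balance transfers oddness from \<open>{s,c}\<close> to \<open>{t,c}\<close>.\<close>

lemma odd_neighbours:
  assumes b: "balanced D" and D: "D \<noteq> {}"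
  obtains c1 c2 where "distinct [c1,c2,s,t]" "odd (degree2 D {s,c1})" "odd (degree2 D {s,c2})"
    "odd (degree2 D {t,c1})" "odd (degree2 D {t,c2})"
proof -
  let ?X = "{c\<in>-{s}. odd (degree2 D {s,c})}"
  have st: "D \<subseteq> S0" using b by (simp add: balanced_def)
  have "even (\<Sum>c\<in>-{s}. degree2 D {s,c})"
    using sum_degree2_star[of D s] balanced_card3[OF b] by simp
  then have ev: "even (card ?X)" by (simp add: even_sum_iff)
  have "?X \<noteq> {}"
  proof
    assume X: "?X = {}"
    have "even (degree2 D e)" if e: "card e = 2" for e
    proof -
      consider "s \<notin> e" "t \<notin> e" | c where "c \<noteq> s" "e = {s,c}" | c where "c \<noteq> s" "c \<noteq> t" "e = {t,c}"
        using e by (auto simp: card_2_iff) (metis doubleton_eq_iff)+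
      then show ?thesis
      proof cases
        case 1 then show ?thesis using b e by (simp add: balanced_def)
      next
        case 2 then show ?thesis using X by blast
      next
        case 3
        have "even (degree2 D {s,c} + degree2 D {t,c})" using b 3 by (simp add: balanced_def)
        moreover have "even (degree2 D {s,c})" using X 3 by blast
        ultimately show ?thesis using 3 by simp
      qed
    qed
    then have "cycle2 D" using balanced_card3[OF b] by (simp add: cycle2_def)
    then have "D = S" using subcycle[of D] D st S0_sub by blast
    then show False using edge st by (auto simp: S0_def)
  qed
  then obtain c1 where c1: "c1 \<in> ?X" by blast
  have "?X \<noteq> {c1}" using ev by (metis card_1_singleton_iff odd_one One_nat_def)
  then obtain c2 where c2: "c2 \<in> ?X" "c2 \<noteq> c1" using c1 by blast
  have t: "c \<noteq> t" if "c \<in> ?X" for c using that degree_st[OF st] by auto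
  have "odd (degree2 D {t,c})" if "c \<in> ?X" for c
  proof -
    have "even (degree2 D {s,c} + degree2 D {t,c})" using b that t[OF that] by (auto simp: balanced_def)
    then show ?thesis using that by simp
  qed
  then show ?thesis using that[of c1 c2] c1 c2 t ne by auto
qed

definition min_balanced where
  "min_balanced D \<longleftrightarrow> balanced D \<and> D \<noteq> {} \<and> (\<forall>D'\<subseteq>D. balanced D' \<longrightarrow> D' = {} \<or> D' = D)"

text \<open>Take such a set of least size. A balanced part avoiding \<open>T\<close> could be
  removed from it, as differences of nested balanced sets are balanced.\<close>

lemma min_balanced_containing:
  assumes "balanced R" "T \<in> R"
  obtains D where "min_balanced D" "D \<subseteq> R" "T \<in> D"
proof -
  let ?P = "\<lambda>D. balanced D \<and> D \<subseteq> R \<and> T \<in> D"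
  obtain D where D: "?P D" "\<And>D'. ?P D' \<Longrightarrow> card D \<le> card D'"
    using assms ex_has_least_nat[of ?P R card] by blast
  have "min_balanced D" unfolding min_balanced_def
  proof (intro conjI allI impI)
    fix D' assume D': "D' \<subseteq> D" "balanced D'"
    show "D' = {} \<or> D' = D"
    proof (cases "T \<in> D'")
      case True
      then have "card D \<le> card D'" using D D' by blast
      then show ?thesis using D'(1) by (metis card_seteq finite)
    next
      case False
      have "balanced (D - D')" using balanced_Diff D' D(1) by blast
      then have "card D \<le> card (D - D')" using D False by blast
      then have "D - D' = D" by (metis card_seteq finite Diff_subset)
      then show ?thesis using D'(1) by blast
    qed
  qed (use D in auto)
  then show ?thesis using that D by blast
qed

lemma pair_balanced:
  assumes "insert s A \<in> S" "insert t A \<in> S" "s \<notin> A" "t \<notin> A"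
  shows "balanced {insert s A, insert t A}"
proof -
  have ne': "insert s A \<noteq> insert t A" using assms ne by blast
  have d: "degree2 {insert s A, insert t A} e = (if e \<subseteq> insert s A then 1 else 0) + (if e \<subseteq> insert t A then 1 else 0)" for e
  proof -
    have "{T\<in>{insert s A, insert t A}. e \<subseteq> T} = (if e \<subseteq> insert s A then {insert s A} else {}) \<union> (if e \<subseteq> insert t A then {insert t A} else {})"
      by auto
    then show ?thesis unfolding degree2_def using ne' by (auto simp: card_insert_if)
  qed
  show ?thesis unfolding balanced_def d
    using assms ne by (auto simp: S0_def subset_insert)
qed

text \<open>If two triangles collide under the contraction they already form a balanced set, so
  \<open>D\<close> is that pair and the piece is a complete graph on four vertices. Otherwise the
  image is a minimal cycle without \<open>t\<close>, rigid by induction, and vertex splitting undoes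
  the contraction.\<close>

lemma piece_rigid:
  assumes IH: "\<And>S'. card (\<Union>S') < card (\<Union>S) \<Longrightarrow> min_cycle S' \<Longrightarrow> generically (\<lambda>u::'v \<Rightarrow> real^3. rigid u (edges2 S'))"
    and D: "min_balanced D"
  shows "generically (\<lambda>u. rigid u (piece D))"
proof (cases "inj_on \<phi> D")
  case False
  have bD: "balanced D" "D \<subseteq> S0" using D by (auto simp: min_balanced_def balanced_def)
  obtain T T' where T: "T \<in> D" "T' \<in> D" "T \<noteq> T'" "\<phi> T = \<phi> T'" using False by (auto simp: inj_on_def)
  have "\<exists>A. s \<notin> A \<and> t \<notin> A \<and> insert s A \<in> D \<and> insert t A \<in> D"
  proof -
    have *: "\<exists>A. s \<notin> A \<and> t \<notin> A \<and> insert s A \<in> D \<and> insert t A \<in> D"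
      if "T \<in> D" "T' \<in> D" "\<phi> T = \<phi> T'" "t \<in> T" "t \<notin> T'" for T T'
    proof (rule exI[of _ "T - {t}"], intro conjI)
      have "s \<notin> T" using that bD by (auto simp: S0_def)
      then show "s \<notin> T - {t}" by simp
      have "T' = insert s (T - {t})" using that by (simp add: \<phi>_def)
      then show "insert s (T - {t}) \<in> D" using that by simp
      show "insert t (T - {t}) \<in> D" using that by (simp add: insert_absorb)
    qed simp
    show ?thesis
    proof (cases "t \<in> T")
      case True
      have "t \<notin> T'"
      proof
        assume "t \<in> T'"
        then have e: "insert s (T - {t}) = insert s (T' - {t})" using True T by (simp add: \<phi>_def)
        have "s \<notin> T" "s \<notin> T'" using True \<open>t \<in> T'\<close> T bD by (auto simp: S0_def)
        then have "T - {t} = T' - {t}" using e by (metis Diff_iff insert_ident)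
        then show False using True \<open>t \<in> T'\<close> T(3) by blast
      qed
      then show ?thesis using *[OF T(1,2,4) True] by blast
    next
      case False
      then have "t \<in> T'" using T by (auto simp: \<phi>_def)
      then show ?thesis using *[OF T(2,1) T(4)[symmetric]] False by blast
    qed
  qed
  then obtain A where A: "s \<notin> A" "t \<notin> A" "insert s A \<in> D" "insert t A \<in> D" by blast
  have "balanced {insert s A, insert t A}" using pair_balanced A bD S0_sub by blast
  then have Deq: "D = {insert s A, insert t A}" using D A unfolding min_balanced_def by (metis empty_not_insert insert_subset empty_subsetI)
  have "card (insert s A) = 3" using card3 A bD S0_sub by blast
  then have "card A = 2" using A(1) by simp
  then obtain a b where ab: "A = {a,b}" "a \<noteq> b" by (auto simp: card_2_iff)
  have dist: "distinct [a,b,s,t]" using ab A ne by auto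
  let ?K = "{{a,b},{b,s},{s,a},{t,a},{t,b},{t,s}}"
  have "rigid u (piece D)" if "triples_independent u" for u
  proof (rule rigid_superset[OF rigid_K4[OF dist that]])
    show "?K \<subseteq> piece D"
      unfolding piece_def edges2_def Deq ab(1) using dist by (auto simp: insert_commute)
    show "\<Union>(piece D) \<subseteq> \<Union>?K" unfolding piece_def edges2_def Deq ab(1) by auto
  qed
  then show ?thesis by (rule generically_mono[OF generically_triples_independent])
next
  case inj: True
  have bD: "balanced D" "D \<subseteq> S0" "D \<noteq> {}" using D by (auto simp: min_balanced_def balanced_def)
  let ?S' = "\<phi> ` D"
  have c3: "\<forall>T\<in>?S'. card T = 3" using bD card_\<phi> by blast
  have "min_cycle ?S'" unfolding min_cycle_def
  proof (intro conjI allI impI)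
    show "cycle2 ?S'" using balanced_iff_cycle[OF bD(2) inj] bD by blast
    show "?S' \<noteq> {}" using bD by simp
    fix D' assume D': "D' \<subseteq> ?S'" "cycle2 D'"
    let ?D = "{T\<in>D. \<phi> T \<in> D'}"
    have im: "\<phi> ` ?D = D'" using D' by blast
    have in': "inj_on \<phi> ?D" using inj by (rule inj_on_subset) (rule Collect_restrict)
    have sub': "?D \<subseteq> D" by (rule Collect_restrict)
    have "balanced ?D = cycle2 D'"
      using balanced_iff_cycle[OF order_trans[OF sub' bD(2)] in'] unfolding im .
    then have "balanced ?D" using D'(2) by (simp only:)
    moreover have "\<And>D'. D' \<subseteq> D \<Longrightarrow> balanced D' \<Longrightarrow> D' = {} \<or> D' = D"
      using D unfolding min_balanced_def by blast
    ultimately have "?D = {} \<or> ?D = D" using sub' by (simp only:)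
    then have "\<phi> ` ?D = \<phi> ` {} \<or> \<phi> ` ?D = \<phi> ` D" by (rule disj_forward) (simp_all only:)
    then show "D' = {} \<or> D' = ?S'" unfolding im by simp
  qed
  moreover have "card (\<Union>?S') < card (\<Union>S)"
  proof (rule psubset_card_mono)
    have "t \<in> \<Union>S" "s \<in> \<Union>S" using edge by auto
    moreover have "t \<notin> \<Union>?S'" using ne by (auto simp: \<phi>_def)
    moreover have "\<Union>?S' \<subseteq> insert s (\<Union>S)" using bD(2) S0_sub by (auto simp: \<phi>_def split: if_splits)
    ultimately show "\<Union>?S' \<subset> \<Union>S" by blast
  qed simp
  ultimately have "generically (\<lambda>u. rigid u (edges2 ?S'))" using IH by blast
  then have "generically (\<lambda>u. rigid u (edges2 ?S') \<and> triples_independent u)"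
    using generically_triples_independent by (rule generically_conj)
  then obtain u0 :: "'v \<Rightarrow> real^3" where u0: "rigid u0 (edges2 ?S')" "triples_independent u0"
    using generically_ex by blast
  obtain c1 c2 where c: "distinct [c1,c2,s,t]" "odd (degree2 D {s,c1})" "odd (degree2 D {s,c2})"
    "odd (degree2 D {t,c1})" "odd (degree2 D {t,c2})" using odd_neighbours[OF bD(1,3)] .
  have pE: "{x,y} \<in> piece D" if "odd (degree2 D {x,y})" "x \<noteq> y" for x y
    using degree2_pos[of D "{x,y}"] that pair_in_edges2 by (fastforce simp: piece_def)
  obtain T where T: "T \<in> D" using bD by blast
  then have T3: "card T = 3" using bD(2) S0_sub card3 by blast
  then obtain a b d where abd: "T = {a,b,d}" "distinct [a,b,d]" by (auto simp: card_3_iff)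
  \<comment> \<open>\<open>T\<close> misses \<open>s\<close> or \<open>t\<close>, so its three
    vertices stay distinct after the contraction and it can serve as the pinned triangle.\<close>
  have nT: "\<not> {s,t} \<subseteq> T" using T bD(2) by (auto simp: S0_def)
  have UE: "\<Union>(edges2 ?S') = \<Union>?S'" by (rule Union_edges2[OF c3])
  let ?f = "\<lambda>x. if x = t then s else x"
  have sE: "s \<in> \<Union>?S'"
  proof -
    obtain T where "T \<in> D" "{s,c1} \<subseteq> T" using degree2_pos[of D "{s,c1}"] c by (metis even_zero)
    then have "s \<in> \<phi> T" "\<phi> T \<in> ?S'" using ne by (auto simp: \<phi>_def)
    then show ?thesis by blast
  qed
  have "\<exists>u. pinned_rigid u (piece D) {a,b,d}"
  proof (rule vertex_split[OF ne u0(2,1), where \<phi> = ?f])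
    show "x \<noteq> t \<and> y \<noteq> t \<and> ({x,y} \<in> piece D \<or> x = s \<and> {t,y} \<in> piece D \<or> y = s \<and> {x,t} \<in> piece D)"
      if xy: "{x,y} \<in> edges2 ?S'" for x y
    proof -
      obtain T where T: "T \<in> D" "{x,y} \<subseteq> \<phi> T" "card {x,y} = 2" using xy by (auto simp: edges2_def)
      have n: "x \<noteq> y" using T(3) by auto
      have nt: "x \<noteq> t" "y \<noteq> t" using T(2) ne by (auto simp: \<phi>_def split: if_splits)
      have *: "{p,q} \<in> piece D" if "p \<in> T" "q \<in> T" "p \<noteq> q" for p q
        using that T(1) pair_in_edges2[of p q T D] by (simp add: piece_def)
      show ?thesis
      proof (cases "t \<in> T")
        case True
        then have xT: "x = s \<or> x \<in> T" "y = s \<or> y \<in> T" using T(2) by (auto simp: \<phi>_def)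
        then show ?thesis using nt n * True by metis
      next
        case False
        then have "x \<in> T" "y \<in> T" using T(2) by (auto simp: \<phi>_def)
        then show ?thesis using * n nt by blast
      qed
    qed
    show "s \<in> \<Union>(edges2 ?S')" using sE UE by simp
    show "t \<notin> \<Union>(edges2 ?S')" unfolding UE using ne by (auto simp: \<phi>_def)
    show "\<Union>(piece D) \<subseteq> insert t (\<Union>(edges2 ?S'))"
    proof -
      have "\<Union>(piece D) = {s,t} \<union> \<Union>D"
        unfolding piece_def using Union_edges2[OF balanced_card3[OF bD(1)]] by simp
      moreover have "\<Union>D \<subseteq> insert t (\<Union>?S')" by (auto simp: \<phi>_def)
      ultimately show ?thesis using sE UE by auto
    qed
    show "{s,t} \<in> piece D" by (simp add: piece_def)
    show "{s,c1} \<in> piece D" "{t,c1} \<in> piece D" "{s,c2} \<in> piece D" "{t,c2} \<in> piece D"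
      using pE c by auto
    show "distinct [c1,c2,s,t]" by fact
    show "distinct [?f a, ?f b, ?f d]" using abd nT by auto
    have "?f ` T = \<phi> T" using ne by (auto simp: \<phi>_def)
    then show "{?f a, ?f b, ?f d} \<subseteq> \<Union>(edges2 ?S')" unfolding UE using T abd(1) by auto
  qed simp
  then have "generically (\<lambda>u. pinned_rigid u (piece D) {a,b,d})" by (rule generically_pinned_rigid)
  then have "generically (\<lambda>u. pinned_rigid u (piece D) {a,b,d} \<and> triples_independent u)"
    using generically_triples_independent by (rule generically_conj)
  then show ?thesis
  proof (rule generically_mono)
    fix u :: "'v \<Rightarrow> real^3" assume u: "pinned_rigid u (piece D) {a,b,d} \<and> triples_independent u"
    have e: "{x,y} \<in> piece D" if "x \<in> T" "y \<in> T" "x \<noteq> y" for x y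
      using that T pair_in_edges2[of x y T D] by (simp add: piece_def)
    show "rigid u (piece D)"
    proof (rule rigid_if_pinned_rigid)
      show "pinned_rigid u (piece D) {a,b,d}" using u by blast
      show "{a,b} \<in> piece D" "{b,d} \<in> piece D" "{d,a} \<in> piece D" using e abd by auto
      show "u a \<bullet> cross3 (u b) (u d) \<noteq> 0" using u abd(2) by (auto simp: triples_independent_def)
    qed
  qed
qed

lemma Union_piece: "balanced D \<Longrightarrow> \<Union>(piece D) = {s,t} \<union> \<Union>D"
  unfolding piece_def using Union_edges2[OF balanced_card3] by simp

text \<open>The degree of \<open>{s,x}\<close> is even, so a second triangle contains it; that one
  omits \<open>t\<close>, because only one triangle has the vertices \<open>s\<close>,
  \<open>t\<close>, \<open>x\<close>.\<close>

lemma other_triangle: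
  assumes "T \<in> S" "{s,t} \<subseteq> T" "x \<in> T" "x \<noteq> s" "x \<noteq> t"
  shows "\<exists>T'\<in>S0. {s,x} \<subseteq> T'"
proof -
  have "T \<in> {T\<in>S. {s,x} \<subseteq> T}" using assms by auto
  moreover have "even (card {T\<in>S. {s,x} \<subseteq> T})" using even_deg[of "{s,x}"] assms by (simp add: degree2_def)
  ultimately have "{T\<in>S. {s,x} \<subseteq> T} \<noteq> {T}" by (metis card_1_singleton_iff odd_one One_nat_def)
  then obtain T' where T': "T' \<in> S" "{s,x} \<subseteq> T'" "T' \<noteq> T" using \<open>T \<in> {T\<in>S. {s,x} \<subseteq> T}\<close> by blast
  have "t \<notin> T'"
  proof
    assume "t \<in> T'"
    then have "T' = {s,t,x}" using third_unique T' assms by auto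
    moreover have "T = {s,t,x}" using third_unique assms by auto
    ultimately show False using T' by simp
  qed
  then show ?thesis using T' by (auto simp: S0_def)
qed

text \<open>A maximal rigid union of pieces is everything: if it met the remaining triangles only in \<open>s\<close> and \<open>t\<close>,
  completing it by triangles through \<open>st\<close> would give a proper subcycle.\<close>
lemma rigid_of_induction:
  assumes IH: "\<And>S'. card (\<Union>S') < card (\<Union>S) \<Longrightarrow> min_cycle S' \<Longrightarrow> generically (\<lambda>u::'v \<Rightarrow> real^3. rigid u (edges2 S'))"
  shows "generically (\<lambda>u. rigid u (edges2 S))"
proof -
  let ?good = "\<lambda>D. balanced D \<and> D \<noteq> {} \<and> generically (\<lambda>u. rigid u (piece D))"
  obtain T0 where T0: "T0 \<in> S0"
  proof -
    obtain T where T: "T \<in> S" "{s,t} \<subseteq> T" using edge by blast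
    have "card T = 3" using T card3 by blast
    then have "\<not> T \<subseteq> {s,t}" using ne by (metis T(2) card_2_iff equalityI numeral_eq_iff semiring_norm(89))
    then obtain x where "x \<in> T" "x \<noteq> s" "x \<noteq> t" by blast
    then show ?thesis using other_triangle[OF T] that by blast
  qed
  obtain D0 where "min_balanced D0" using min_balanced_containing[OF balanced_S0 T0] by blast
  then have "?good D0" using piece_rigid[OF IH] by (auto simp: min_balanced_def)
  then have "\<exists>D. ?good D \<and> (\<forall>D'. ?good D' \<longrightarrow> card D' \<le> card D)"
    by (rule ex_has_greatest_nat[where b = "Suc (card (UNIV :: 'v set set))"])
      (metis card_mono finite subset_UNIV le_imp_less_Suc)
  then obtain D where D: "?good D" "\<And>D'. ?good D' \<Longrightarrow> card D' \<le> card D" by blast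
  have DS: "D \<subseteq> S0" using D by (simp add: balanced_def)
  have "D = S0"
  proof (rule ccontr)
    assume "D \<noteq> S0"
    let ?R = "S0 - D"
    have R: "balanced ?R" using balanced_Diff balanced_S0 D DS by blast
    show False
    \<comment> \<open>A shared vertex besides \<open>s\<close> and \<open>t\<close> allows gluing,
      against the maximal choice of \<open>D\<close>; the other case contradicts the minimality of
      \<open>S\<close>.\<close>
    proof (cases "\<exists>c T. c \<noteq> s \<and> c \<noteq> t \<and> c \<in> \<Union>D \<and> T \<in> ?R \<and> c \<in> T")
      case True
      then obtain c T where c: "c \<noteq> s" "c \<noteq> t" "c \<in> \<Union>D" "T \<in> ?R" "c \<in> T" by blast
      obtain D' where D': "min_balanced D'" "D' \<subseteq> ?R" "T \<in> D'" using min_balanced_containing[OF R c(4)] .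
      have bD': "balanced D'" using D' by (simp add: min_balanced_def)
      have un: "(D \<union> D') - D' = D" "D' \<subseteq> D \<union> D'" using D' by auto
      have deg: "degree2 (D \<union> D') e = degree2 D' e + degree2 D e" for e
        using degree2_Diff[OF un(2), of e] un(1) by simp
      have b: "balanced (D \<union> D')"
        using D(1) bD' unfolding balanced_def deg by (auto simp: algebra_simps)
      have pe: "piece (D \<union> D') = piece D \<union> piece D'" by (auto simp: piece_def edges2_def)
      have "generically (\<lambda>u. (rigid u (piece D) \<and> rigid u (piece D')) \<and> triples_independent u)"
        using D(1) piece_rigid[OF IH D'(1)] generically_triples_independent by (intro generically_conj) auto
      then have "generically (\<lambda>u. rigid u (piece (D \<union> D')))"
      proof (rule generically_mono)
        fix u :: "'v \<Rightarrow> real^3" assume u: "(rigid u (piece D) \<and> rigid u (piece D')) \<and> triples_independent u"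
        show "rigid u (piece (D \<union> D'))" unfolding pe
        proof (rule rigid_glue[of u _ _ s t c])
          show "rigid u (piece D)" "rigid u (piece D')" using u by auto
          show "s \<in> \<Union>(piece D) \<inter> \<Union>(piece D')" "t \<in> \<Union>(piece D) \<inter> \<Union>(piece D')" by (auto simp: piece_def)
          show "c \<in> \<Union>(piece D) \<inter> \<Union>(piece D')" using Union_piece D(1) bD' c D' by blast
          show "u s \<bullet> cross3 (u t) (u c) \<noteq> 0" using u c ne by (auto simp: triples_independent_def)
        qed
      qed
      then have "?good (D \<union> D')" using b D(1) by blast
      then have "card (D \<union> D') \<le> card D" using D(2) by blast
      moreover have "D \<subset> D \<union> D'" using D'(2,3) by blast
      ultimately show False by (metis finite psubset_card_mono not_le)
    next
      case False
      then have sep: "T \<in> D" if "T \<in> S0" "c \<in> T" "c \<in> \<Union>D" "c \<noteq> s" "c \<noteq> t" for T c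
        using that by blast
      let ?P = "D \<union> {T\<in>S. {s,t} \<subseteq> T \<and> (\<exists>c\<in>T. c \<noteq> s \<and> c \<noteq> t \<and> c \<in> \<Union>D)}"
      have PS: "?P \<subseteq> S" using DS S0_sub by blast
      have c3: "\<forall>T\<in>?P. card T = 3" using PS card3 by blast
      have in_P: "degree2 ?P e = degree2 S e" if e: "c \<in> e" "c \<noteq> s" "c \<noteq> t" "c \<in> \<Union>D" for e c
      proof -
        have "{T\<in>?P. e \<subseteq> T} = {T\<in>S. e \<subseteq> T}"
        proof
          show "{T\<in>S. e \<subseteq> T} \<subseteq> {T\<in>?P. e \<subseteq> T}"
          proof
            fix T assume T: "T \<in> {T\<in>S. e \<subseteq> T}"
            show "T \<in> {T\<in>?P. e \<subseteq> T}"
            proof (cases "{s,t} \<subseteq> T")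
              case True then show ?thesis using T e by auto
            next
              case False
              then have "T \<in> S0" using T by (auto simp: S0_def)
              then have "T \<in> D" using sep[of T c] T e by blast
              then show ?thesis using T by blast
            qed
          qed
        qed (use PS in blast)
        then show ?thesis by (simp add: degree2_def)
      qed
      have third: "x \<in> \<Union>D" if T: "T \<in> ?P" "x \<in> T" "x \<noteq> s" "x \<noteq> t" for T x
      proof (cases "T \<in> D")
        case True then show ?thesis using T by blast
      next
        case False
        then obtain c where c: "T \<in> S" "{s,t} \<subseteq> T" "c \<in> T" "c \<noteq> s" "c \<noteq> t" "c \<in> \<Union>D" using T(1) by blast
        then have "T = {s,t,c}" using third_unique by auto
        then show ?thesis using c T by blast
      qed
      have ev: "even (degree2 ?P e)" if e: "card e = 2" "e \<noteq> {s,t}" for e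
      proof -
        have "\<exists>c\<in>e. c \<noteq> s \<and> c \<noteq> t" using e by (auto simp: card_2_iff)
        then obtain c where c: "c \<in> e" "c \<noteq> s" "c \<noteq> t" by blast
        show ?thesis
        proof (cases "c \<in> \<Union>D")
          case True then show ?thesis using in_P[OF c] even_deg[OF e(1)] by simp
        next
          case False
          then have "{T\<in>?P. e \<subseteq> T} = {}" using third c by blast
          then show ?thesis unfolding degree2_def by (metis card.empty even_zero)
        qed
      qed
      \<comment> \<open>Only the edge \<open>{s,t}\<close> escapes the local argument; its parity
        follows from the handshake count at \<open>s\<close>.\<close>
      have ev': "even (degree2 ?P {s,t})"
      proof -
        have "even (\<Sum>c\<in>-{s}. degree2 ?P {s,c})" using sum_degree2_star[OF c3, of s] by simp
        also have "(\<Sum>c\<in>-{s}. degree2 ?P {s,c}) = degree2 ?P {s,t} + (\<Sum>c\<in>-{s}-{t}. degree2 ?P {s,c})"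
          using ne by (intro sum.remove) auto
        finally have "even (degree2 ?P {s,t} + (\<Sum>c\<in>-{s}-{t}. degree2 ?P {s,c}))" .
        moreover have "even (\<Sum>c\<in>-{s}-{t}. degree2 ?P {s,c})"
          by (rule dvd_sum, rule ev) (auto simp: doubleton_eq_iff)
        ultimately show ?thesis by simp
      qed
      have "even (degree2 ?P e)" if "card e = 2" for e
        by (cases "e = {s,t}") (simp_all only: ev' ev[OF that] simp_thms)
      then have "cycle2 ?P" unfolding cycle2_def using c3 by blast
      then have P: "?P = S" using subcycle[OF PS] D(1) by blast
      have "S0 \<subseteq> D"
      proof
        fix T assume "T \<in> S0"
        then have "T \<in> ?P" "\<not> {s,t} \<subseteq> T" using P by (auto simp: S0_def)
        then show "T \<in> D" by blast
      qed
      then show False using \<open>D \<noteq> S0\<close> DS by blast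
    qed
  qed
  then have g: "generically (\<lambda>u. rigid u (piece S0))" using D by simp
  have sub: "piece S0 \<subseteq> edges2 S"
    using edge ne by (auto simp: piece_def edges2_def S0_def)
  \<comment> \<open>Restoring the collapsed triangles adds edges but no vertices, since each of
    their vertices besides \<open>s\<close> and \<open>t\<close> also lies in a triangle of
    \<open>S0\<close>.\<close>
  have un: "\<Union>(edges2 S) \<subseteq> \<Union>(piece S0)"
  proof
    fix x assume "x \<in> \<Union>(edges2 S)"
    then obtain T where T: "T \<in> S" "x \<in> T" by (auto simp: edges2_def)
    have "x \<in> {s,t} \<union> \<Union>S0"
    proof (cases "T \<in> S0 \<or> x = s \<or> x = t")
      case False
      then have "{s,t} \<subseteq> T" using T by (auto simp: S0_def)
      then show ?thesis using other_triangle[OF T(1) _ T(2)] False by blast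
    qed (use T in auto)
    then show "x \<in> \<Union>(piece S0)" using Union_piece[OF balanced_S0] by simp
  qed
  show ?thesis by (rule generically_mono[OF g]) (rule rigid_superset[OF _ sub un])
qed

end

text \<open>Induction on the number of vertices. The boundary of a tetrahedron needs no separate
  treatment: its two surviving triangles collide, which is the complete graph case of
  \<open>piece_rigid\<close>.\<close>

theorem min_cycle_generically_rigid:
  fixes S :: "'v::finite set set"
  assumes "min_cycle S"
  shows "generically (\<lambda>u. rigid u (edges2 S))"
  using assms
proof (induction "card (\<Union>S)" arbitrary: S rule: less_induct)
  case less
  obtain T where T: "T \<in> S" "card T = 3" using less(2) by (auto simp: min_cycle_def cycle2_def)
  then obtain s t where "s \<in> T" "t \<in> T" "s \<noteq> t" by (auto simp: card_3_iff)
  then interpret contraction S s t using less(2) T by unfold_locales auto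
  show ?case using rigid_of_induction less(1) by blast
qed

section \<open>Dimension counts in spaces of functions\<close>

lemma (in vector_space_pair) dim_kernel_image:
  assumes lin: "Vector_Spaces.linear s1 s2 f" and V: "vs1.subspace V"
    and fin: "V \<subseteq> vs1.span G" "finite G"
  shows "vs1.dim V = vs1.dim {x\<in>V. f x = 0} + vs2.dim (f ` V)"
proof -
  let ?N = "{x\<in>V. f x = 0}"
  obtain B where B: "B \<subseteq> ?N" "vs1.independent B" "?N \<subseteq> vs1.span B" "card B = vs1.dim ?N"
    using vs1.basis_exists by blast
  have "B \<subseteq> V" using B by auto
  then obtain C where C: "B \<subseteq> C" "C \<subseteq> V" "vs1.independent C" "V \<subseteq> vs1.span C"
    using vs1.maximal_independent_subset_extend[OF _ B(2)] by metis
  have finC: "finite C" using vs1.independent_span_bound[OF fin(2) C(3)] C(2) fin(1) by blast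
  have dV: "vs1.dim V = card C" using vs1.basis_card_eq_dim[OF C(2,4,3)] by simp
  have spV: "vs1.span C = V" using C V vs1.span_subspace by blast
  \<comment> \<open>The vectors that extend a basis of the kernel to one of \<open>V\<close> map to
    a basis of the image.\<close>
  let ?D = "C - B"
  have disj: "x = 0" if x: "x \<in> vs1.span B" "x \<in> vs1.span ?D" for x
  proof -
    have 1: "vs1.representation C x = vs1.representation B x"
      by (rule vs1.representation_extend[OF C(3) x(1) C(1)])
    have 2: "vs1.representation C x = vs1.representation ?D x"
      by (rule vs1.representation_extend[OF C(3) x(2)]) auto
    have 3: "vs1.representation C x b = 0" for b
      using 1 2 vs1.representation_ne_zero by (metis Diff_iff)
    have "x \<in> vs1.span C" using x(1) C(1) vs1.span_mono by blast
    then have "(\<Sum>b\<in>C. s1 (vs1.representation C x b) b) = x"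
      using vs1.sum_representation_eq[OF C(3) _ finC] by auto
    then show ?thesis using 3 by simp
  qed
  have inj: "inj_on f (vs1.span ?D)"
  proof (rule inj_onI)
    fix x y assume x: "x \<in> vs1.span ?D" and y: "y \<in> vs1.span ?D" and e: "f x = f y"
    have xy: "x - y \<in> vs1.span ?D" using x y vs1.span_diff by blast
    have "x - y \<in> vs1.span C" using xy vs1.span_mono[of ?D C] by blast
    then have "x - y \<in> V" using spV by simp
    moreover have "f (x - y) = 0" using e linear_diff[OF lin] by simp
    ultimately have "x - y \<in> vs1.span B" using B(3) by blast
    then have "x - y = 0" using disj xy by blast
    then show "x = y" by simp
  qed
  have ind: "vs2.independent (f ` ?D)"
    using linear_independent_injective_image[OF lin _ inj] vs1.independent_mono[OF C(3)] by auto
  have sub: "f ` V \<subseteq> vs2.span (f ` ?D)"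
  proof -
    have "f ` V = vs2.span (f ` C)" using linear_span_image[OF lin] spV by metis
    also have "\<dots> \<subseteq> vs2.span (f ` ?D)"
    proof (rule vs2.span_minimal[OF _ vs2.subspace_span])
      show "f ` C \<subseteq> vs2.span (f ` ?D)"
      proof (rule image_subsetI)
        fix x assume "x \<in> C"
        show "f x \<in> vs2.span (f ` ?D)"
        proof (cases "x \<in> B")
          case True then have "f x = 0" using B(1) by auto
          then show ?thesis using vs2.span_zero by simp
        next
          case False then show ?thesis using \<open>x \<in> C\<close> vs2.span_base by auto
        qed
      qed
    qed
    finally show ?thesis .
  qed
  have "vs2.dim (f ` V) = card (f ` ?D)"
    by (rule vs2.basis_card_eq_dim[symmetric, OF _ sub ind]) (use C(2) in auto)
  also have "\<dots> = card ?D"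
    by (rule card_image) (rule inj_on_subset[OF inj vs1.span_superset])
  finally have "vs2.dim (f ` V) = card ?D" .
  moreover have "card ?D = card C - card B" "card B \<le> card C"
    using finC C(1) by (auto intro: card_Diff_subset finite_subset card_mono)
  ultimately show ?thesis using dV B(4) by simp
qed

lemma (in vector_space) subspace_eq_of_dim_le:
  assumes U: "subspace U" and UW: "U \<subseteq> W" and fin: "W \<subseteq> span G" "finite G"
    and le: "dim W \<le> dim U"
  shows "U = W"
proof -
  obtain B where B: "B \<subseteq> U" "independent B" "U \<subseteq> span B" "card B = dim U"
    using basis_exists by blast
  obtain C where C: "B \<subseteq> C" "C \<subseteq> W" "independent C" "W \<subseteq> span C"
    using maximal_independent_subset_extend[OF _ B(2), of W] B(1) UW by (metis order_trans)
  have finC: "finite C" using independent_span_bound[OF fin(2) C(3)] C(2) fin(1) by blast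
  have "card C = dim W" using basis_card_eq_dim[OF C(2,4,3)] by simp
  then have "B = C" using le B(4) C(1) finC by (metis card_seteq)
  then have "W \<subseteq> span U" using C(4) span_mono[OF B(1)] by blast
  moreover have "span U = U" using U span_eq_iff by blast
  ultimately show ?thesis using UW by blast
qed

text \<open>The scalings here and in \<open>ts\<close> have the form used in \<open>fdim\<close> and
  \<open>tdim\<close>, so that these are \<open>fs.dim\<close> and \<open>ts.dim\<close>.\<close>

interpretation fs: vector_space "\<lambda>c (f::'x \<Rightarrow> real). \<lambda>x. c * f x"
  by unfold_locales (simp_all add: fun_eq_iff distrib_left distrib_right)

interpretation ts: vector_space "\<lambda>c (F::'i \<Rightarrow> 'x \<Rightarrow> real). \<lambda>i x. c * F i x"
  by unfold_locales (simp_all add: fun_eq_iff distrib_left distrib_right)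

interpretation tt: vector_space_pair "\<lambda>c (F::'i \<Rightarrow> 'x \<Rightarrow> real). \<lambda>i x. c * F i x"
   "\<lambda>c (F::'j \<Rightarrow> 'y \<Rightarrow> real). \<lambda>i x. c * F i x" ..

interpretation tf: vector_space_pair "\<lambda>c (F::'i \<Rightarrow> 'x \<Rightarrow> real). \<lambda>i x. c * F i x"
   "\<lambda>c (f::'y \<Rightarrow> real). \<lambda>x. c * f x" ..

interpretation ft: vector_space_pair "\<lambda>c (f::'y \<Rightarrow> real). \<lambda>x. c * f x" 
   "\<lambda>c (F::'i \<Rightarrow> 'x \<Rightarrow> real). \<lambda>i x. c * F i x" ..

interpretation ff: vector_space_pair "\<lambda>c (f::'x \<Rightarrow> real). \<lambda>x. c * f x" 
   "\<lambda>c (f::'y \<Rightarrow> real). \<lambda>x. c * f x" ..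

lemma fdim_eq: "fdim = fs.dim" by (simp add: fdim_def fun_eq_iff)
lemma tdim_eq: "tdim = ts.dim" by (simp add: tdim_def fun_eq_iff)

text \<open>Components outside \<open>I\<close> are fixed to zero, the convention of
  \<open>C1\<close>, so that dimensions are those of the sum over \<open>I\<close>.\<close>

definition direct_sum :: "'i set \<Rightarrow> ('i \<Rightarrow> ('x \<Rightarrow> real) set) \<Rightarrow> ('i \<Rightarrow> 'x \<Rightarrow> real) set" where
  "direct_sum I W = {F. (\<forall>i\<in>I. F i \<in> W i) \<and> (\<forall>i. i \<notin> I \<longrightarrow> F i = (\<lambda>x. 0))}"

lemma direct_sum_subspace: "(\<And>i. i \<in> I \<Longrightarrow> fs.subspace (W i)) \<Longrightarrow> ts.subspace (direct_sum I W)"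
proof (rule ts.subspaceI)
  assume W: "\<And>i. i \<in> I \<Longrightarrow> fs.subspace (W i)"
  show "0 \<in> direct_sum I W" using fs.subspace_0[OF W] by (simp add: direct_sum_def zero_fun_def)
  show "F + G \<in> direct_sum I W" if "F \<in> direct_sum I W" "G \<in> direct_sum I W" for F G
    using that fs.subspace_add[OF W] by (simp add: direct_sum_def plus_fun_def)
  show "(\<lambda>i x. c * F i x) \<in> direct_sum I W" if "F \<in> direct_sum I W" for c F
    using that fs.subspace_scale[OF W] by (simp add: direct_sum_def)
qed

lemma direct_sum_finite_span:
  assumes "finite I" "finite G" "\<And>i. i \<in> I \<Longrightarrow> W i \<subseteq> fs.span G"
  shows "\<exists>H. finite H \<and> direct_sum I W \<subseteq> ts.span H"
proof -
  let ?e = "\<lambda>i g j. if j = i then g else (\<lambda>x. 0::real)"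
  let ?H = "(\<lambda>(i,g). ?e i g) ` (I \<times> G)"
  have lin: "Vector_Spaces.linear (\<lambda>c f x. c * f x) (\<lambda>c F i x. c * F i x) (?e i)" for i
    by unfold_locales (auto simp: fun_eq_iff)
  have "F \<in> ts.span ?H" if F: "F \<in> direct_sum I W" for F
  proof -
    have "?e i (F i) \<in> ts.span ?H" if i: "i \<in> I" for i
    proof -
      have "F i \<in> fs.span G" using F i assms(3) by (auto simp: direct_sum_def)
      then have "?e i (F i) \<in> ?e i ` fs.span G" by blast
      also have "\<dots> = ts.span (?e i ` G)" using ft.linear_span_image[OF lin] by metis
      also have "\<dots> \<subseteq> ts.span ?H" by (rule ts.span_mono) (use i in auto)
      finally show ?thesis .
    qed
    then have "(\<Sum>i\<in>I. ?e i (F i)) \<in> ts.span ?H" by (rule ts.span_sum)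
    moreover have "(\<Sum>i\<in>I. ?e i (F i)) = F"
    proof
      fix j
      have s: "(\<Sum>i\<in>I. ?e i (F i)) j = (\<Sum>i\<in>I. ?e i (F i) j)"
        by (induction I rule: infinite_finite_induct) auto
      show "(\<Sum>i\<in>I. ?e i (F i)) j = F j"
        unfolding s using F assms(1) by (auto simp: direct_sum_def zero_fun_def[symmetric] sum.delta cong: if_cong)
    qed
    ultimately show ?thesis by simp
  qed
  then show ?thesis using assms(1,2) by (intro exI[of _ ?H]) auto
qed

lemma direct_sum_dim:
  assumes "finite I" "finite G" "\<And>i. i \<in> I \<Longrightarrow> W i \<subseteq> fs.span G" "\<And>i. i \<in> I \<Longrightarrow> fs.subspace (W i)"
  shows "ts.dim (direct_sum I W) = (\<Sum>i\<in>I. fs.dim (W i))"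
  using assms(1,3,4)
proof (induction I rule: finite_induct)
  case empty
  have "direct_sum {} W = {0}" by (auto simp: direct_sum_def zero_fun_def fun_eq_iff)
  then have "ts.dim (direct_sum {} W) = 0" using ts.dim_le_card[of "{0}" "{}"] by simp
  then show ?case by simp
next
  case (insert k I)
  let ?f = "\<lambda>F::'a \<Rightarrow> 'b \<Rightarrow> real. F k"
  have lin: "Vector_Spaces.linear (\<lambda>c F i x. c * F i x) (\<lambda>c f x. c * f x) ?f"
    by unfold_locales auto
  obtain H where H: "finite H" "direct_sum (insert k I) W \<subseteq> ts.span H"
    using direct_sum_finite_span[of "insert k I" G W] insert assms(2) by auto
  have sub: "ts.subspace (direct_sum (insert k I) W)" by (rule direct_sum_subspace) (use insert in auto)
  have 1: "{F\<in>direct_sum (insert k I) W. ?f F = 0} = direct_sum I W"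
    using insert(2) insert(5)[of k] by (fastforce simp: direct_sum_def zero_fun_def fs.subspace_def)
  have 2: "?f ` direct_sum (insert k I) W = W k"
  proof
    show "W k \<subseteq> ?f ` direct_sum (insert k I) W"
    proof
      fix w assume w: "w \<in> W k"
      let ?F = "\<lambda>j. if j = k then w else (\<lambda>x. 0)"
      have "?F \<in> direct_sum (insert k I) W"
        using w insert(5) by (auto simp: direct_sum_def fs.subspace_def zero_fun_def)
      then show "w \<in> ?f ` direct_sum (insert k I) W" by (auto intro!: image_eqI[of _ _ ?F])
    qed
  qed (auto simp: direct_sum_def)
  have "ts.dim (direct_sum (insert k I) W) = ts.dim (direct_sum I W) + fs.dim (W k)"
    using tf.dim_kernel_image[OF lin sub H(2,1)] 1 2 by simp
  then show ?case using insert by simp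
qed

section \<open>Forms in three variables\<close>

lemma finite_mdeg: "finite {m. mdeg m = d}" "finite {m. mdeg m \<le> d}"
proof -
  have "{m. mdeg m \<le> d} \<subseteq> {..d} \<times> {..d} \<times> {..d}" by (auto simp: mdeg_def)
  then show "finite {m. mdeg m \<le> d}" by (rule finite_subset) simp
  then show "finite {m. mdeg m = d}" by (rule finite_subset[rotated]) auto
qed

lemma formsI: "(\<lambda>p. \<Sum>m\<in>{m. mdeg m = d}. a m * mono3 m p) \<in> forms d"
  unfolding forms_def mem_Collect_eq by (rule exI[of _ a]) simp

lemma polysI: "(\<lambda>p. \<Sum>m\<in>{m. mdeg m \<le> N}. a m * mono3 m p) \<in> polys"
  unfolding polys_def mem_Collect_eq by (rule exI[of _ a], rule exI[of _ N]) simp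

lemma forms_subspace: "fs.subspace (forms d)"
proof (rule fs.subspaceI)
  show "0 \<in> forms d" unfolding forms_def by (auto intro!: exI[of _ "\<lambda>m. 0"])
  show "f + g \<in> forms d" if fg: "f \<in> forms d" "g \<in> forms d" for f g
  proof -
    obtain a b where "f = (\<lambda>p. \<Sum>m\<in>{m. mdeg m = d}. a m * mono3 m p)" "g = (\<lambda>p. \<Sum>m\<in>{m. mdeg m = d}. b m * mono3 m p)"
      using fg unfolding forms_def by blast
    then have "f + g = (\<lambda>p. \<Sum>m\<in>{m. mdeg m = d}. (a m + b m) * mono3 m p)"
      by (simp add: fun_eq_iff distrib_right sum.distrib)
    then show ?thesis using formsI[of "\<lambda>m. a m + b m" d] by (simp only:)
  qed
  show "(\<lambda>x. c * f x) \<in> forms d" if fd: "f \<in> forms d" for c f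
  proof -
    obtain a where "f = (\<lambda>p. \<Sum>m\<in>{m. mdeg m = d}. a m * mono3 m p)" using fd unfolding forms_def by blast
    then have "(\<lambda>x. c * f x) = (\<lambda>p. \<Sum>m\<in>{m. mdeg m = d}. (c * a m) * mono3 m p)"
      by (simp add: sum_distrib_left mult.assoc)
    then show ?thesis unfolding forms_def mem_Collect_eq by (intro exI[of _ "\<lambda>m. c * a m"]) simp
  qed
qed

lemma mono3_in_forms: "mono3 m \<in> forms (mdeg m)"
proof -
  have "mono3 m p = (\<Sum>m'\<in>{m'. mdeg m' = mdeg m}. (if m' = m then 1 else 0) * mono3 m' p)" for p
    by (subst sum.remove[OF finite_mdeg(1), of m]) (auto intro!: sum.neutral)
  then show ?thesis unfolding forms_def mem_Collect_eq
    by (intro exI[of _ "\<lambda>m'. if m' = m then 1 else 0"]) (auto simp: fun_eq_iff)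
qed

lemma forms_0: "(\<lambda>p. 0) \<in> forms d"
  using fs.subspace_0[OF forms_subspace, of d] by (simp add: zero_fun_def)

lemma forms_add: "f \<in> forms d \<Longrightarrow> g \<in> forms d \<Longrightarrow> (\<lambda>p. f p + g p) \<in> forms d"
  using fs.subspace_add[OF forms_subspace, of f d g] by (simp add: plus_fun_def)

lemma forms_scale: "f \<in> forms d \<Longrightarrow> (\<lambda>p. c * f p) \<in> forms d"
  using fs.subspace_scale[OF forms_subspace] .

lemma forms_uminus: "f \<in> forms d \<Longrightarrow> (\<lambda>p. - f p) \<in> forms d"
  using forms_scale[of f d "-1"] by simp

lemma forms_diff: "f \<in> forms d \<Longrightarrow> g \<in> forms d \<Longrightarrow> (\<lambda>p. f p - g p) \<in> forms d"
  using forms_add[of f d "\<lambda>p. - g p"] forms_uminus[of g] by simp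

lemma forms_sum: "(\<And>i. i \<in> I \<Longrightarrow> f i \<in> forms d) \<Longrightarrow> (\<lambda>p. \<Sum>i\<in>I. f i p) \<in> forms d"
  by (induction I rule: infinite_finite_induct) (auto intro: forms_0 forms_add)

lemma forms_finite_span: "forms d \<subseteq> fs.span (mono3 ` {m. mdeg m = d})"
proof
  fix f assume "f \<in> forms d"
  then obtain a where f: "f = (\<lambda>p. \<Sum>m\<in>{m. mdeg m = d}. a m * mono3 m p)" unfolding forms_def by blast
  have "f = (\<Sum>m\<in>{m. mdeg m = d}. (\<lambda>p. a m * mono3 m p))"
  proof -
    have "(\<Sum>m\<in>M. (\<lambda>p. a m * mono3 m p)) p = (\<Sum>m\<in>M. a m * mono3 m p)" for M p
      by (induction M rule: infinite_finite_induct) auto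
    then show ?thesis by (simp add: f fun_eq_iff)
  qed
  also have "\<dots> \<in> fs.span (mono3 ` {m. mdeg m = d})"
    by (intro fs.span_sum fs.span_scale fs.span_base) auto
  finally show "f \<in> fs.span (mono3 ` {m. mdeg m = d})" .
qed

lemma mono3_mult: "mono3 (a,b,c) p * mono3 (a',b',c') p = mono3 (a+a',b+b',c+c') p"
  by (simp add: mono3_def power_add)

lemma forms_mult:
  assumes "f \<in> forms d" "g \<in> forms e"
  shows "(\<lambda>p. f p * g p) \<in> forms (d + e)"
proof -
  obtain a where f: "f = (\<lambda>p. \<Sum>m\<in>{m. mdeg m = d}. a m * mono3 m p)" using assms unfolding forms_def by blast
  obtain b where g: "g = (\<lambda>p. \<Sum>m\<in>{m. mdeg m = e}. b m * mono3 m p)" using assms unfolding forms_def by blast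
  have "(\<lambda>p. mono3 m p * mono3 m' p) \<in> forms (d + e)" if "mdeg m = d" "mdeg m' = e" for m m'
  proof -
    obtain x y z x' y' z' where m: "m = (x,y,z)" "m' = (x',y',z')" by (metis prod.exhaust)
    then have "mdeg (x+x',y+y',z+z') = d + e" using that by (simp add: mdeg_def)
    then show ?thesis using mono3_in_forms[of "(x+x',y+y',z+z')"] by (simp add: m mono3_mult)
  qed
  then have "(\<lambda>p. (a m * b m') * (mono3 m p * mono3 m' p)) \<in> forms (d + e)" if "mdeg m = d" "mdeg m' = e" for m m'
    using that by (intro forms_scale) auto
  then have "(\<lambda>p. \<Sum>m\<in>{m. mdeg m = d}. \<Sum>m'\<in>{m. mdeg m = e}. (a m * b m') * (mono3 m p * mono3 m' p)) \<in> forms (d + e)"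
    by (intro forms_sum) auto
  moreover have "(\<lambda>p. f p * g p) = (\<lambda>p. \<Sum>m\<in>{m. mdeg m = d}. \<Sum>m'\<in>{m. mdeg m = e}. (a m * b m') * (mono3 m p * mono3 m' p))"
    by (simp add: f g sum_product mult_ac)
  ultimately show ?thesis by simp
qed

lemma coord_in_forms: "(\<lambda>p. p $ i) \<in> forms 1"
proof -
  have "mono3 (1,0,0) = (\<lambda>p. p $ 1)" "mono3 (0,1,0) = (\<lambda>p. p $ 2)" "mono3 (0,0,1) = (\<lambda>p. p $ 3)"
    by (simp_all add: mono3_def fun_eq_iff)
  then show ?thesis
    using exhaust_3[of i] mono3_in_forms[of "(1,0,0)"] mono3_in_forms[of "(0,1,0)"] mono3_in_forms[of "(0,0,1)"]
    by (auto simp: mdeg_def)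
qed

lemma const_in_forms: "(\<lambda>p. c) \<in> forms 0"
  using forms_scale[OF mono3_in_forms[of "(0,0,0)"], of c] by (simp add: mdeg_def mono3_def)

lemma inner_in_forms: "(\<lambda>p. n \<bullet> p) \<in> forms 1"
  unfolding inner_vec_def inner_real_def by (intro forms_sum forms_scale coord_in_forms)

lemma inner_sq_in_forms: "(\<lambda>p. (n \<bullet> p)\<^sup>2) \<in> forms 2"
  using forms_mult[OF inner_in_forms inner_in_forms, of n n] by (simp add: power2_eq_square numeral_2_eq_2)

lemma mono3_scaled: "mono3 m (t *\<^sub>R p) = t ^ mdeg m * mono3 m p"
  by (cases m) (simp add: mono3_def mdeg_def power_mult_distrib power_add)

lemma forms_homogeneous: "f \<in> forms d \<Longrightarrow> f (t *\<^sub>R p) = t ^ d * f p"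
  unfolding forms_def by (auto simp: mono3_scaled sum_distrib_left mult_ac intro!: sum.cong)

lemma forms_continuous:
  assumes "f \<in> forms d" shows "continuous_on UNIV f"
proof -
  have "continuous_on UNIV (mono3 m)" for m
    by (cases m) (simp add: mono3_def, intro continuous_intros)
  then show ?thesis using assms unfolding forms_def by (auto intro!: continuous_intros)
qed

text \<open>The homogeneous components of \<open>G\<close>. Any bound \<open>M\<close> beyond
  \<open>N\<close> is allowed, so that finitely many polynomials can share one.\<close>

lemma polys_components:
  assumes "G \<in> polys"
  shows "\<exists>g N. (\<forall>k. g k \<in> forms k) \<and> (\<forall>M\<ge>N. \<forall>p. G p = (\<Sum>k\<le>M. g k p))"
proof -
  obtain a N where G: "G = (\<lambda>p. \<Sum>m\<in>{m. mdeg m \<le> N}. a m * mono3 m p)" using assms unfolding polys_def by blast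
  define g where "g k = (\<lambda>p. \<Sum>m\<in>{m. mdeg m = k}. (if mdeg m \<le> N then a m else 0) * mono3 m p)" for k
  have "g k \<in> forms k" for k unfolding g_def by (rule formsI)
  moreover have "G p = (\<Sum>k\<le>M. g k p)" if "M \<ge> N" for M p
  proof -
    have "(\<Sum>k\<le>M. g k p) = (\<Sum>m\<in>{m. mdeg m \<le> M}. (if mdeg m \<le> N then a m else 0) * mono3 m p)"
    proof -
      have "(\<Sum>k\<in>{..M}. \<Sum>m\<in>{m\<in>{m. mdeg m \<le> M}. mdeg m = k}. (if mdeg m \<le> N then a m else 0) * mono3 m p)
         = (\<Sum>m\<in>{m. mdeg m \<le> M}. (if mdeg m \<le> N then a m else 0) * mono3 m p)"
        by (rule sum.group) (auto simp: finite_mdeg)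
      moreover have "{m\<in>{m. mdeg m \<le> M}. mdeg m = k} = {m. mdeg m = k}" if "k \<le> M" for k using that by auto
      ultimately show ?thesis unfolding g_def by simp
    qed
    also have "\<dots> = (\<Sum>m\<in>{m. mdeg m \<le> N}. a m * mono3 m p)"
      by (rule sum.mono_neutral_cong_right) (use that in \<open>auto simp: finite_mdeg\<close>)
    finally show ?thesis by (simp add: G)
  qed
  ultimately show ?thesis by blast
qed

lemma forms_in_polys: "f \<in> forms d \<Longrightarrow> f \<in> polys"
proof -
  assume "f \<in> forms d"
  then obtain a where f: "f = (\<lambda>p. \<Sum>m\<in>{m. mdeg m = d}. a m * mono3 m p)" unfolding forms_def by blast
  have "f = (\<lambda>p. \<Sum>m\<in>{m. mdeg m \<le> d}. (if mdeg m = d then a m else 0) * mono3 m p)"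
    unfolding f by (intro ext sum.mono_neutral_cong_left) (auto simp: finite_mdeg)
  then show ?thesis using polysI[of "\<lambda>m. if mdeg m = d then a m else 0" d] by (simp only:)
qed

text \<open>Evaluation at \<open>t *\<^sub>R p\<close> gives an identity of polynomials in
  \<open>t\<close>. Comparing the coefficients of degree \<open>d\<close> replaces each polynomial
  factor by its component of degree \<open>d - 2\<close>; as this subtraction is truncated,
  \<open>d < 2\<close> is kept apart, where the coefficient is 0.\<close>

lemma sq_ideal_form_homogeneous:
  assumes fin: "finite T" and f: "f \<in> sq_ideal u T" "f \<in> forms d"
  shows "\<exists>H. (\<forall>\<tau>\<in>T. H \<tau> \<in> forms (d - 2)) \<and> (\<forall>p. f p = (if d < 2 then 0 else \<Sum>\<tau>\<in>T. (normal u \<tau> \<bullet> p)\<^sup>2 * H \<tau> p))"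
proof -
  obtain G where G: "f = (\<lambda>p. \<Sum>\<tau>\<in>T. (normal u \<tau> \<bullet> p)\<^sup>2 * G \<tau> p)" "\<And>\<tau>. \<tau> \<in> T \<Longrightarrow> G \<tau> \<in> polys"
    using f(1) unfolding sq_ideal_def by blast
  have "\<forall>\<tau>\<in>T. \<exists>g N. (\<forall>k. g k \<in> forms k) \<and> (\<forall>M\<ge>N. \<forall>p. G \<tau> p = (\<Sum>k\<le>M. g k p))"
    using polys_components G(2) by blast
  then obtain g N where g: "\<And>\<tau> k. \<tau> \<in> T \<Longrightarrow> g \<tau> k \<in> forms k"
    "\<And>\<tau> M p. \<tau> \<in> T \<Longrightarrow> M \<ge> N \<tau> \<Longrightarrow> G \<tau> p = (\<Sum>k\<le>M. g \<tau> k p)" by metis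
  define M where "M = d + (\<Sum>\<tau>\<in>T. N \<tau>)"
  have M: "N \<tau> \<le> M" if "\<tau> \<in> T" for \<tau> using that fin member_le_sum[of \<tau> T N] by (simp add: M_def)
  have key: "f p = (if d < 2 then 0 else \<Sum>\<tau>\<in>T. (normal u \<tau> \<bullet> p)\<^sup>2 * g \<tau> (d - 2) p)" for p
  proof -
    define c where "c k = (\<Sum>\<tau>\<in>T. (normal u \<tau> \<bullet> p)\<^sup>2 * g \<tau> k p)" for k
    have eq: "poly (monom (f p) d) t = poly (\<Sum>k\<le>M. monom (c k) (k + 2)) t" for t
    proof -
      have "t ^ d * f p = f (t *\<^sub>R p)" using forms_homogeneous[OF f(2)] by simp
      also have "\<dots> = (\<Sum>\<tau>\<in>T. (normal u \<tau> \<bullet> (t *\<^sub>R p))\<^sup>2 * (\<Sum>k\<le>M. g \<tau> k (t *\<^sub>R p)))"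
        unfolding G(1) using g(2) M by (intro sum.cong) auto
      also have "\<dots> = (\<Sum>\<tau>\<in>T. \<Sum>k\<le>M. t ^ (k + 2) * ((normal u \<tau> \<bullet> p)\<^sup>2 * g \<tau> k p))"
        using forms_homogeneous[OF g(1)]
        by (intro sum.cong refl) (simp add: sum_distrib_left power_mult_distrib power_add mult_ac power2_eq_square)
      also have "\<dots> = (\<Sum>k\<le>M. t ^ (k + 2) * c k)"
        unfolding c_def by (subst sum.swap) (simp add: sum_distrib_left)
      finally show ?thesis by (simp add: poly_monom poly_sum mult.commute)
    qed
    then have "monom (f p) d = (\<Sum>k\<le>M. monom (c k) (k + 2))" by (simp add: poly_eq_poly_eq_iff[symmetric] fun_eq_iff)
    then have "f p = coeff (\<Sum>k\<le>M. monom (c k) (k + 2)) d" by (metis coeff_monom)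
    also have "\<dots> = (\<Sum>k\<le>M. if k + 2 = d then c k else 0)" by (simp add: coeff_sum coeff_monom)
    also have "\<dots> = (if d < 2 then 0 else c (d - 2))"
    proof (cases "d < 2")
      case False
      have "(\<Sum>k\<le>M. if k + 2 = d then c k else 0) = (\<Sum>k\<le>M. if k = d - 2 then c k else 0)"
        using False by (intro sum.cong) auto
      also have "\<dots> = c (d - 2)" by (simp add: M_def)
      finally show ?thesis using False by simp
    qed (auto intro!: sum.neutral)
    finally show ?thesis by (simp add: c_def)
  qed
  show ?thesis using key g(1) by (intro exI[of _ "\<lambda>\<tau>. g \<tau> (d - 2)"]) auto
qed

lemma sq_ideal_forms_eq:
  assumes "finite T"
  shows "sq_ideal u T \<inter> forms d = (if d < 2 then {\<lambda>p. 0}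
     else {\<lambda>p. \<Sum>\<tau>\<in>T. (normal u \<tau> \<bullet> p)\<^sup>2 * H \<tau> p | H. \<forall>\<tau>\<in>T. H \<tau> \<in> forms (d - 2)})" (is "?L = ?R")
proof
  show "?L \<subseteq> ?R"
  proof
    fix f assume "f \<in> ?L"
    then obtain H where H: "\<forall>\<tau>\<in>T. H \<tau> \<in> forms (d - 2)"
      "\<forall>p. f p = (if d < 2 then 0 else \<Sum>\<tau>\<in>T. (normal u \<tau> \<bullet> p)\<^sup>2 * H \<tau> p)"
      using sq_ideal_form_homogeneous[OF assms] by blast
    have "f = (if d < 2 then (\<lambda>p. 0) else (\<lambda>p. \<Sum>\<tau>\<in>T. (normal u \<tau> \<bullet> p)\<^sup>2 * H \<tau> p))"
      using H(2) by (auto simp: fun_eq_iff)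
    then show "f \<in> ?R" using H(1) by auto
  qed
  show "?R \<subseteq> ?L"
  proof
    fix f assume f: "f \<in> ?R"
    show "f \<in> ?L"
    proof (cases "d < 2")
      case True
      have "(\<lambda>p. 0) \<in> sq_ideal u T" unfolding sq_ideal_def mem_Collect_eq
        by (rule exI[of _ "\<lambda>\<tau> p. 0"]) (auto intro: forms_in_polys forms_0[of 0])
      then show ?thesis using f True forms_0 by auto
    next
      case False
      then obtain H where H: "f = (\<lambda>p. \<Sum>\<tau>\<in>T. (normal u \<tau> \<bullet> p)\<^sup>2 * H \<tau> p)" "\<forall>\<tau>\<in>T. H \<tau> \<in> forms (d - 2)"
        using f by auto
      have "f \<in> sq_ideal u T" unfolding sq_ideal_def using H forms_in_polys by blast
      moreover have "f \<in> forms d" unfolding H(1)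
      proof (rule forms_sum)
        fix \<tau> assume "\<tau> \<in> T"
        then have "(\<lambda>p. (normal u \<tau> \<bullet> p)\<^sup>2 * H \<tau> p) \<in> forms (2 + (d - 2))"
          using forms_mult[OF inner_sq_in_forms] H(2) by blast
        moreover have "2 + (d - 2) = d" using False by simp
        ultimately show "(\<lambda>p. (normal u \<tau> \<bullet> p)\<^sup>2 * H \<tau> p) \<in> forms d" by (simp only:)
      qed
      ultimately show ?thesis by simp
    qed
  qed
qed

lemma sq_ideal_forms_subspace:
  assumes "finite T"
  shows "fs.subspace (sq_ideal u T \<inter> forms d)"
proof (cases "d < 2")
  case True
  then show ?thesis unfolding sq_ideal_forms_eq[OF assms]
    by (auto simp: fs.subspace_def zero_fun_def fun_eq_iff)
next
  case False
  show ?thesis unfolding sq_ideal_forms_eq[OF assms] if_not_P[OF False]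
  proof (rule fs.subspaceI)
    show "0 \<in> {\<lambda>p. \<Sum>\<tau>\<in>T. (normal u \<tau> \<bullet> p)\<^sup>2 * H \<tau> p |H. \<forall>\<tau>\<in>T. H \<tau> \<in> forms (d - 2)}"
      by (auto intro!: exI[of _ "\<lambda>\<tau> p. 0"] forms_0 simp: zero_fun_def)
  next
    fix f g assume "f \<in> {\<lambda>p. \<Sum>\<tau>\<in>T. (normal u \<tau> \<bullet> p)\<^sup>2 * H \<tau> p |H. \<forall>\<tau>\<in>T. H \<tau> \<in> forms (d - 2)}"
      "g \<in> {\<lambda>p. \<Sum>\<tau>\<in>T. (normal u \<tau> \<bullet> p)\<^sup>2 * H \<tau> p |H. \<forall>\<tau>\<in>T. H \<tau> \<in> forms (d - 2)}"
    then obtain H H' where "f = (\<lambda>p. \<Sum>\<tau>\<in>T. (normal u \<tau> \<bullet> p)\<^sup>2 * H \<tau> p)" "\<forall>\<tau>\<in>T. H \<tau> \<in> forms (d - 2)"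
      "g = (\<lambda>p. \<Sum>\<tau>\<in>T. (normal u \<tau> \<bullet> p)\<^sup>2 * H' \<tau> p)" "\<forall>\<tau>\<in>T. H' \<tau> \<in> forms (d - 2)" by blast
    then show "f + g \<in> {\<lambda>p. \<Sum>\<tau>\<in>T. (normal u \<tau> \<bullet> p)\<^sup>2 * H \<tau> p |H. \<forall>\<tau>\<in>T. H \<tau> \<in> forms (d - 2)}"
      by (auto intro!: exI[of _ "\<lambda>\<tau> p. H \<tau> p + H' \<tau> p"] forms_add simp: fun_eq_iff distrib_left sum.distrib)
  next
    fix c f assume "f \<in> {\<lambda>p. \<Sum>\<tau>\<in>T. (normal u \<tau> \<bullet> p)\<^sup>2 * H \<tau> p |H. \<forall>\<tau>\<in>T. H \<tau> \<in> forms (d - 2)}"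
    then obtain H where "f = (\<lambda>p. \<Sum>\<tau>\<in>T. (normal u \<tau> \<bullet> p)\<^sup>2 * H \<tau> p)" "\<forall>\<tau>\<in>T. H \<tau> \<in> forms (d - 2)" by blast
    then show "(\<lambda>x. c * f x) \<in> {\<lambda>p. \<Sum>\<tau>\<in>T. (normal u \<tau> \<bullet> p)\<^sup>2 * H \<tau> p |H. \<forall>\<tau>\<in>T. H \<tau> \<in> forms (d - 2)}"
      by (auto intro!: exI[of _ "\<lambda>\<tau> p. c * H \<tau> p"] forms_scale simp: fun_eq_iff sum_distrib_left mult_ac)
  qed
qed

text \<open>Forms of degree \<open>e - 1\<close>, where a form of degree \<open>-1\<close> is zero.\<close>
definition forms_pred :: "nat \<Rightarrow> (real^3 \<Rightarrow> real) set" where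
  "forms_pred e = (if e = 0 then {\<lambda>p. 0} else forms (e - 1))"

lemma forms_pred_0: "(\<lambda>p. 0) \<in> forms_pred e"
  by (simp add: forms_pred_def forms_0)

lemma forms_pred_add: "f \<in> forms_pred e \<Longrightarrow> g \<in> forms_pred e \<Longrightarrow> (\<lambda>p. f p + g p) \<in> forms_pred e"
  by (auto simp: forms_pred_def intro: forms_add split: if_splits)

lemma forms_pred_scale: "f \<in> forms_pred e \<Longrightarrow> (\<lambda>p. c * f p) \<in> forms_pred e"
  by (auto simp: forms_pred_def intro: forms_scale split: if_splits)

lemma forms_pred_uminus: "f \<in> forms_pred e \<Longrightarrow> (\<lambda>p. - f p) \<in> forms_pred e"
  using forms_pred_scale[of f e "-1"] by simp

lemma forms_pred_sum: "(\<And>i. i \<in> I \<Longrightarrow> f i \<in> forms_pred d) \<Longrightarrow> (\<lambda>p. \<Sum>i\<in>I. f i p) \<in> forms_pred d"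
  by (induction I rule: infinite_finite_induct) (auto intro: forms_pred_0 forms_pred_add)

lemma forms_pred_coord: "f \<in> forms_pred e \<Longrightarrow> (\<lambda>p. p $ i * f p) \<in> forms e"
  using forms_mult[OF coord_in_forms, of f "e - 1" i] by (auto simp: forms_pred_def forms_0 split: if_splits)

text \<open>Monomials are grouped into those containing the third variable, the remaining ones
  containing the second, and the pure power of the first. The last clause says that \<open>B\<close>
  does not involve the third variable, so that \<open>koszul_exact\<close> can compute it on a
  plane.\<close>

lemma forms_division:
  assumes "f \<in> forms e"
  shows "\<exists>B C k. B \<in> forms_pred e \<and> C \<in> forms_pred e \<and> (\<forall>p. f p = p $ 2 * B p + p $ 3 * C p + k * (p $ 1) ^ e) \<and>
     (\<forall>p q. p $ 1 = q $ 1 \<longrightarrow> p $ 2 = q $ 2 \<longrightarrow> B p = B q)"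
proof -
  obtain a where f: "f = (\<lambda>p. \<Sum>m\<in>{m. mdeg m = e}. a m * mono3 m p)" using assms unfolding forms_def by blast
  let ?M = "{m. mdeg m = e}"
  let ?M3 = "{m\<in>?M. snd (snd m) > 0}"
  let ?M2 = "{m\<in>?M. snd (snd m) = 0 \<and> fst (snd m) > 0}"
  let ?M1 = "{m\<in>?M. snd (snd m) = 0 \<and> fst (snd m) = 0}"
  define C where "C p = (\<Sum>m\<in>?M3. a m * mono3 (fst m, fst (snd m), snd (snd m) - 1) p)" for p
  define B where "B p = (\<Sum>m\<in>?M2. a m * mono3 (fst m, fst (snd m) - 1, 0) p)" for p
  have M1: "?M1 = {(e,0,0)}" by (auto simp: mdeg_def)
  have pred: "mono3 m \<in> forms_pred e" if "mdeg m + 1 = e" for m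
    using mono3_in_forms[of m] that by (auto simp: forms_pred_def)
  have "B \<in> forms_pred e" unfolding B_def
    by (intro forms_pred_sum forms_pred_scale pred) (auto simp: mdeg_def)
  moreover have "C \<in> forms_pred e" unfolding C_def
    by (intro forms_pred_sum forms_pred_scale pred) (auto simp: mdeg_def)
  moreover have "f p = p $ 2 * B p + p $ 3 * C p + a (e,0,0) * (p $ 1) ^ e" for p
  proof -
    have "?M = (?M2 \<union> ?M3) \<union> ?M1" by auto
    then have "f p = (\<Sum>m\<in>(?M2 \<union> ?M3) \<union> ?M1. a m * mono3 m p)" unfolding f by metis
    also have "\<dots> = (\<Sum>m\<in>?M2. a m * mono3 m p) + (\<Sum>m\<in>?M3. a m * mono3 m p) + (\<Sum>m\<in>?M1. a m * mono3 m p)"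
    proof -
      have "finite ?M1" "finite ?M2" "finite ?M3" by (simp_all add: finite_mdeg)
      moreover have "(?M2 \<union> ?M3) \<inter> ?M1 = {}" "?M2 \<inter> ?M3 = {}" by auto
      ultimately show ?thesis by (simp only: sum.union_disjoint finite_Un simp_thms)
    qed
    also have "(\<Sum>m\<in>?M2. a m * mono3 m p) = p $ 2 * B p"
      unfolding B_def sum_distrib_left
      by (intro sum.cong refl) (auto simp: mono3_def gr0_conv_Suc)
    also have "(\<Sum>m\<in>?M3. a m * mono3 m p) = p $ 3 * C p"
      unfolding C_def sum_distrib_left
      by (intro sum.cong refl) (auto simp: mono3_def gr0_conv_Suc)
    also have "(\<Sum>m\<in>?M1. a m * mono3 m p) = a (e,0,0) * (p $ 1) ^ e"
      unfolding M1 by (simp add: mono3_def)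
    finally show ?thesis .
  qed
  moreover have "B p = B q" if "p $ 1 = q $ 1" "p $ 2 = q $ 2" for p q
    unfolding B_def using that by (intro sum.cong) (auto simp: mono3_def)
  ultimately show ?thesis by blast
qed

text \<open>By continuity. It serves to cancel a coordinate factor from an identity between
  forms.\<close>

lemma forms_zero_off_hyperplane:
  assumes f: "f \<in> forms e" and z: "\<And>p. p $ i \<noteq> 0 \<Longrightarrow> f p = 0"
  shows "f p = 0"
proof (cases "p $ i = 0")
  case True
  let ?q = "\<lambda>n::nat. p + (1 / real (Suc n)) *\<^sub>R axis i 1"
  have "?q \<longlonglongrightarrow> p + 0 *\<^sub>R axis i 1" by (intro tendsto_intros LIMSEQ_Suc lim_1_over_n)
  then have "?q \<longlonglongrightarrow> p" by simp
  moreover have "isCont f p" using forms_continuous[OF f] by (simp add: continuous_on_eq_continuous_at)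
  ultimately have "(\<lambda>n. f (?q n)) \<longlonglongrightarrow> f p" by (rule isCont_tendsto_compose[rotated])
  moreover have "f (?q n) = 0" for n by (rule z) (use True in \<open>simp add: axis_def\<close>)
  ultimately show ?thesis by (simp add: LIMSEQ_const_iff)
qed (rule z)

text \<open>The only relations among the three coordinates are the Koszul ones. The coefficients are
  found one after the other: division of \<open>g 1\<close> gives \<open>A\<close> and
  \<open>B\<close>, division of the corrected \<open>g 2\<close> gives \<open>C\<close>, and then
  the corrected \<open>g 3\<close> has to vanish.\<close>

lemma koszul_exact:
  fixes g :: "3 \<Rightarrow> real^3 \<Rightarrow> real"
  assumes g: "\<And>j. g j \<in> forms e" and rel: "\<And>p. (\<Sum>j\<in>UNIV. g j p * p $ j) = 0"
  shows "\<exists>a. (\<forall>j k. a j k \<in> forms_pred e) \<and> (\<forall>j k p. a j k p = - a k j p) \<and>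
     (\<forall>j p. g j p = (\<Sum>k\<in>UNIV. a j k p * p $ k))"
proof -
  have rel': "g 1 p * p $ 1 + g 2 p * p $ 2 + g 3 p * p $ 3 = 0" for p using rel[of p] by (simp add: sum_3)
  obtain A B k where AB: "A \<in> forms_pred e" "B \<in> forms_pred e" "\<And>p. g 1 p = p $ 2 * A p + p $ 3 * B p + k * (p $ 1) ^ e"
    using forms_division[OF g[of 1]] by blast
  \<comment> \<open>At the first basis vector the relation reduces to \<open>g 1 = 0\<close>, and
    only the pure power survives there.\<close>
  have "k = 0" using rel'[of "axis 1 1"] AB(3)[of "axis 1 1"] by (simp add: axis_def)
  then have g1: "g 1 p = p $ 2 * A p + p $ 3 * B p" for p using AB(3) by simp
  let ?g2 = "\<lambda>p. g 2 p + p $ 1 * A p"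
  have g2f: "?g2 \<in> forms e" by (intro forms_add g forms_pred_coord AB)
  obtain B2 C k2 where C: "B2 \<in> forms_pred e" "C \<in> forms_pred e" "\<And>p. ?g2 p = p $ 2 * B2 p + p $ 3 * C p + k2 * (p $ 1) ^ e"
     "\<And>p q. p $ 1 = q $ 1 \<Longrightarrow> p $ 2 = q $ 2 \<Longrightarrow> B2 p = B2 q"
    using forms_division[OF g2f] by blast
  \<comment> \<open>The part of \<open>?g2\<close> free of the third variable. Where that variable
    is 0, the relation says that the second variable times \<open>?r\<close> is 0.\<close>
  let ?r = "\<lambda>p. p $ 2 * B2 p + k2 * (p $ 1) ^ e"
  have rf: "?r \<in> forms e"
  proof -
    have "?r = (\<lambda>p. ?g2 p - p $ 3 * C p)" using C(3) by (simp add: fun_eq_iff)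
    then show ?thesis using forms_diff[OF g2f forms_pred_coord[OF C(2), of 3]] by simp
  qed
  have r0: "?r p = 0" for p
  proof (rule forms_zero_off_hyperplane[OF rf, of 2])
    fix p :: "real^3" assume p: "p $ 2 \<noteq> 0"
    let ?q = "\<chi> i. if i = 3 then 0 else p $ i"
    have "?q $ 2 * ?g2 ?q = 0" using rel'[of ?q] g1[of ?q] by (simp add: algebra_simps)
    then have "?g2 ?q = 0" using p by simp
    then have "?r ?q = 0" using C(3)[of ?q] by simp
    moreover have "B2 ?q = B2 p" by (rule C(4)) simp_all
    ultimately show "?r p = 0" by simp
  qed
  have g2: "g 2 p = - (p $ 1 * A p) + p $ 3 * C p" for p using C(3)[of p] r0[of p] by simp
  let ?g3 = "\<lambda>p. g 3 p + p $ 1 * B p + p $ 2 * C p"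
  have g3f: "?g3 \<in> forms e" by (intro forms_add g forms_pred_coord AB C)
  have g3': "?g3 p = 0" for p
  proof (rule forms_zero_off_hyperplane[OF g3f, of 3])
    fix p :: "real^3" assume p: "p $ 3 \<noteq> 0"
    have "p $ 3 * ?g3 p = 0" using rel'[of p] by (simp add: g1 g2 algebra_simps)
    then show "?g3 p = 0" using p by simp
  qed
  have g3: "g 3 p = - (p $ 1 * B p) - p $ 2 * C p" for p using g3'[of p] by simp
  define a where "a j k = (if j = 1 \<and> k = 2 then A else if j = 2 \<and> k = 1 then (\<lambda>p. - A p)
      else if j = 1 \<and> k = 3 then B else if j = 3 \<and> k = 1 then (\<lambda>p. - B p)
      else if j = 2 \<and> k = 3 then C else if j = 3 \<and> k = 2 then (\<lambda>p. - C p) else (\<lambda>p. 0))" for j k :: 3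
  show ?thesis
  proof (intro exI[of _ a] conjI allI)
    show "a j k \<in> forms_pred e" for j k
      unfolding a_def by (auto intro: AB C forms_pred_uminus forms_pred_0)
    show "a j k p = - a k j p" for j k p
      using exhaust_3[of j] exhaust_3[of k] by (elim disjE) (simp_all add: a_def)
    show "g j p = (\<Sum>k\<in>UNIV. a j k p * p $ k)" for j p
      using exhaust_3[of j]
    proof (elim disjE)
      show ?thesis if "j = 1" using that by (simp add: a_def sum_3 g1 mult.commute)
      show ?thesis if "j = 2" using that by (simp add: a_def sum_3 g2 mult.commute)
      show ?thesis if "j = 3" using that by (simp add: a_def sum_3 g3 mult.commute)
    qed
  qed
qed

section \<open>Simplicial cocycles on a simply connected link\<close>

lemma finite_rat_common_denominator:
  assumes "finite (R :: rat set)"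
  shows "\<exists>N::int. N > 0 \<and> (\<forall>r\<in>R. of_int N * r \<in> \<int>)"
  using assms
proof (induction R rule: finite_induct)
  case empty show ?case by (rule exI[of _ 1]) simp
next
  case (insert r R)
  then obtain N where N: "N > 0" "\<forall>r\<in>R. of_int N * r \<in> \<int>" by blast
  obtain a b where r: "r = of_int a / of_int b" "b > 0" by (metis Fract_of_int_quotient Rat_cases)
  have "of_int (N * b) * r = of_int (N * a)" using r by simp
  then have "of_int (N * b) * r \<in> \<int>" by (metis Ints_of_int)
  moreover have "of_int (N * b) * x \<in> \<int>" if "x \<in> R" for x
  proof -
    have "of_int (N * b) * x = of_int b * (of_int N * x)" by simp
    then show ?thesis using N(2) that by (metis Ints_mult Ints_of_int)
  qed
  ultimately show ?case using N r by (intro exI[of _ "N * b"]) auto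
qed

interpretation rv: vector_space "\<lambda>(q::rat) (x::real). of_rat q * x"
  by unfold_locales (simp_all add: distrib_left distrib_right of_rat_add of_rat_mult mult.assoc)

locale fan_link =
  fixes K :: "'v::finite set set" and u :: "'v \<Rightarrow> real^3"
  assumes fan: "simplicial_fan K u"
begin

definition ray where "ray v = (1 / norm (u v)) *\<^sub>R u v"

lemma ray_nonzero: "u v \<noteq> 0"
proof -
  have "{v} \<in> K" using fan by (simp add: simplicial_fan_def)
  then have "independent (u ` {v})" using fan unfolding simplicial_fan_def by blast
  then show ?thesis using dependent_zero by auto
qed

lemma ex_coordinate:
  assumes A: "A \<in> K"
  shows "\<exists>g::real^3 \<Rightarrow> real. linear g \<and> (\<forall>w\<in>A. g (ray w) = (if w = v then 1 else 0))"
proof -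
  have "inj_on u A" "independent (u ` A)" using fan A unfolding simplicial_fan_def by blast+
  then obtain g :: "real^3 \<Rightarrow> real" where g: "linear g"
     "\<forall>x\<in>u ` A. g x = (if the_inv_into A u x = v then norm (u v) else 0)"
    using linear_independent_extend[of "u ` A" "\<lambda>x. if the_inv_into A u x = v then norm (u v) else 0"] by blast
  have "g (ray w) = (if w = v then 1 else 0)" if "w \<in> A" for w
  proof -
    have "g (u w) = (if w = v then norm (u v) else 0)"
      using g(2) that the_inv_into_f_f[OF \<open>inj_on u A\<close> that] by simp
    then show ?thesis using ray_nonzero by (simp add: ray_def linear_cmul[OF g(1)])
  qed
  then show ?thesis using g(1) by blast
qed

text \<open>Barycentric coordinates on the cell of \<open>A\<close>, extended to linear functionals
  on the whole space. The extension is a choice when \<open>A\<close> has fewer than three rays; its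
  values on the cell are not.\<close>

definition coord where
  "coord A v = (SOME g::real^3 \<Rightarrow> real. linear g \<and> (\<forall>w\<in>A. g (ray w) = (if w = v then 1 else 0)))"

lemma coord: assumes "A \<in> K" shows "linear (coord A v)" "w \<in> A \<Longrightarrow> coord A v (ray w) = (if w = v then 1 else 0)"
  using someI_ex[OF ex_coordinate[OF assms, of v]] unfolding coord_def by blast+

definition cell where "cell A = convex hull (ray ` A)"

lemma cell_coord:
  assumes A: "A \<in> K" and x: "x \<in> cell A"
  shows "\<forall>v\<in>A. coord A v x \<ge> 0" "(\<Sum>v\<in>A. coord A v x) = 1" "x = (\<Sum>v\<in>A. coord A v x *\<^sub>R ray v)"
proof -
  let ?Q = "{x. (\<forall>v\<in>A. coord A v x \<ge> 0) \<and> (\<Sum>v\<in>A. coord A v x) = 1 \<and> x = (\<Sum>v\<in>A. coord A v x *\<^sub>R ray v)}"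
  note lin = coord(1)[OF A]
  have "convex ?Q"
  proof (rule convexI)
    fix x y :: "real^3" and a b :: real
    assume x: "x \<in> ?Q" and y: "y \<in> ?Q" and ab: "0 \<le> a" "0 \<le> b" "a + b = 1"
    have c: "coord A v (a *\<^sub>R x + b *\<^sub>R y) = a * coord A v x + b * coord A v y" for v
      by (simp add: linear_add[OF lin] linear_cmul[OF lin])
    have "(\<Sum>v\<in>A. coord A v (a *\<^sub>R x + b *\<^sub>R y) *\<^sub>R ray v) =
       a *\<^sub>R (\<Sum>v\<in>A. coord A v x *\<^sub>R ray v) + b *\<^sub>R (\<Sum>v\<in>A. coord A v y *\<^sub>R ray v)"
      by (simp add: c scaleR_add_left sum.distrib scaleR_sum_right)
    moreover have "(\<Sum>v\<in>A. coord A v (a *\<^sub>R x + b *\<^sub>R y)) = a * (\<Sum>v\<in>A. coord A v x) + b * (\<Sum>v\<in>A. coord A v y)"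
      by (simp add: c sum.distrib sum_distrib_left)
    moreover have "x = (\<Sum>v\<in>A. coord A v x *\<^sub>R ray v)" "y = (\<Sum>v\<in>A. coord A v y *\<^sub>R ray v)"
      "(\<Sum>v\<in>A. coord A v x) = 1" "(\<Sum>v\<in>A. coord A v y) = 1" using x y by auto
    moreover have "\<forall>v\<in>A. coord A v (a *\<^sub>R x + b *\<^sub>R y) \<ge> 0" using x y ab by (auto simp: c)
    ultimately show "a *\<^sub>R x + b *\<^sub>R y \<in> ?Q" using ab by simp
  qed
  moreover have "ray ` A \<subseteq> ?Q"
  proof
    fix y assume "y \<in> ray ` A"
    then obtain w where w: "w \<in> A" "y = ray w" by blast
    have c: "coord A v y = (if v = w then 1 else 0)" for v using coord(2)[OF A w(1), of v] w(2) by auto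
    have "(\<Sum>v\<in>A. coord A v y *\<^sub>R ray v) = (\<Sum>v\<in>A. if v = w then ray w else 0)"
      by (intro sum.cong) (auto simp: c)
    also have "\<dots> = y" using w by simp
    finally have "(\<Sum>v\<in>A. coord A v y *\<^sub>R ray v) = y" .
    moreover have "(\<Sum>v\<in>A. coord A v y) = 1" unfolding c using w(1) by simp
    moreover have "\<forall>v\<in>A. coord A v y \<ge> 0" unfolding c by simp
    ultimately show "y \<in> ?Q" by (simp only: mem_Collect_eq simp_thms)
  qed
  ultimately have "cell A \<subseteq> ?Q" unfolding cell_def by (rule hull_minimal[rotated])
  then have "x \<in> ?Q" using x by blast
  then show "\<forall>v\<in>A. coord A v x \<ge> 0" "(\<Sum>v\<in>A. coord A v x) = 1" "x = (\<Sum>v\<in>A. coord A v x *\<^sub>R ray v)"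
    by auto
qed

text \<open>By the fan axiom the point is a combination of the rays of \<open>A \<inter> B\<close>,
  and the functionals of both cells read off the same coefficients.\<close>

lemma coord_Int:
  assumes A: "A \<in> K" and B: "B \<in> K" and x: "x \<in> cell A" "x \<in> cell B"
  shows "\<exists>c. (\<forall>v\<in>A. coord A v x = (if v \<in> B then c v else 0)) \<and> (\<forall>v\<in>B. coord B v x = (if v \<in> A then c v else 0))"
proof -
  have ph: "x \<in> pos_hull u C" if C: "C \<in> K" "x \<in> cell C" for C
  proof -
    have "x = (\<Sum>v\<in>C. (coord C v x / norm (u v)) *\<^sub>R u v)"
      using cell_coord(3)[OF C] by (simp add: ray_def)
    moreover have "\<forall>v\<in>C. coord C v x / norm (u v) \<ge> 0" using cell_coord(1)[OF C] by simp
    ultimately show ?thesis unfolding pos_hull_def mem_Collect_eq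
      by (intro exI[of _ "\<lambda>v. coord C v x / norm (u v)"]) (rule conjI)
  qed
  have "pos_hull u A \<inter> pos_hull u B = pos_hull u (A \<inter> B)" using fan A B unfolding simplicial_fan_def by blast
  then have "x \<in> pos_hull u (A \<inter> B)" using ph A B x by blast
  then obtain c where c: "x = (\<Sum>v\<in>A \<inter> B. c v *\<^sub>R u v)" unfolding pos_hull_def by blast
  have xr: "x = (\<Sum>v\<in>A \<inter> B. (c v * norm (u v)) *\<^sub>R ray v)" unfolding c
    by (intro sum.cong) (simp_all add: ray_def ray_nonzero)
  have *: "coord C w x = (if w \<in> A \<inter> B then c w * norm (u w) else 0)" if C: "C \<in> K" "A \<inter> B \<subseteq> C" "w \<in> C" for C w
  proof -
    have "coord C w x = (\<Sum>v\<in>A \<inter> B. (c v * norm (u v)) * coord C w (ray v))"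
      unfolding xr by (simp add: linear_sum[OF coord(1)[OF C(1)]] linear_cmul[OF coord(1)[OF C(1)]])
    also have "\<dots> = (\<Sum>v\<in>A \<inter> B. if v = w then c v * norm (u v) else 0)"
      using C coord(2)[OF C(1)] by (intro sum.cong) auto
    finally show ?thesis by simp
  qed
  show ?thesis
    by (rule exI[of _ "\<lambda>v. c v * norm (u v)"]) (use *[OF A] *[OF B] in auto)
qed

lemma lk_cells: "lk_space K u = (\<Union>A\<in>K. cell A)"
  by (simp add: lk_space_def cell_def ray_def[abs_def])

lemma closed_cell: "closed (cell A)"
  unfolding cell_def by (rule compact_imp_closed, rule compact_convex_hull, rule finite_imp_compact) simp

lemma convex_cell: "convex (cell A)"
  by (simp add: cell_def)

text \<open>A finite union of closed convex sets is an absolute neighbourhood retract. Local path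
  connectedness is what allows a continuous logarithm on the link.\<close>

lemma locally_path_connected_lk: "locally path_connected (lk_space K u)"
proof -
  have "ANR (\<Union>(cell ` K))"
    by (rule ANR_finite_Union_convex_closed)
      (auto simp: closed_cell convex_cell)
  then show ?thesis unfolding lk_cells by (rule ANR_imp_locally_path_connected)
qed

text \<open>Affine interpolation turns an integral cocycle into a map from the link to the circle; a continuous
  logarithm of this map restricts to a potential on the vertices.\<close>
lemma int_cocycle_is_coboundary:
  fixes c :: "'v \<Rightarrow> 'v \<Rightarrow> real"
  assumes sc: "simply_connected (lk_space K u)"
    and cc: "\<And>A v w x. A \<in> K \<Longrightarrow> v \<in> A \<Longrightarrow> w \<in> A \<Longrightarrow> x \<in> A \<Longrightarrow> c v w + c w x = c v x"
    and int: "\<And>v w. c v w \<in> \<int>"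
  shows "\<exists>b. \<forall>A\<in>K. \<forall>v\<in>A. \<forall>w\<in>A. c v w = b w - b v"
proof -
  define base where "base A = (SOME v. v \<in> A)" for A :: "'v set"
  have base: "base A \<in> A" if "A \<noteq> {}" for A using that by (auto simp: base_def some_in_eq)
  \<comment> \<open>Interpolates the cocycle from a base vertex of the cell; only the value modulo
    integers is independent of the cell.\<close>
  define h where "h A x = (\<Sum>w\<in>A. coord A w x * c (base A) w)" for A x
  define f where "f A x = exp (2 * pi * h A x * \<i>)" for A x
  have hcont: "continuous_on S (h A)" if "A \<in> K" for A S
  proof -
    have "linear (h A)" unfolding h_def
      by (intro linear_compose_sum ballI linearI) (simp_all add: linear_add[OF coord(1)[OF that]] linear_cmul[OF coord(1)[OF that]] distrib_right)
    then show ?thesis by (simp add: linear_continuous_on linear_conv_bounded_linear)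
  qed
  \<comment> \<open>On a common face, changing the base vertex shifts \<open>h\<close> by an
    integer, which the exponential does not see.\<close>
  have agree: "f A x = f B x" if A: "A \<in> K" "x \<in> cell A" and B: "B \<in> K" "x \<in> cell B" for A B x
  proof -
    obtain l where l: "\<And>v. v \<in> A \<Longrightarrow> coord A v x = (if v \<in> B then l v else 0)"
      "\<And>v. v \<in> B \<Longrightarrow> coord B v x = (if v \<in> A then l v else 0)"
      using coord_Int[OF A(1) B(1) A(2) B(2)] by blast
    have sA: "(\<Sum>w\<in>A. coord A w x * g w) = (\<Sum>w\<in>A \<inter> B. l w * g w)" for g
      by (rule sum.mono_neutral_cong_right) (auto simp: l)
    have sB: "(\<Sum>w\<in>B. coord B w x * g w) = (\<Sum>w\<in>A \<inter> B. l w * g w)" for g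
      by (rule sum.mono_neutral_cong_right) (auto simp: l)
    have one: "(\<Sum>w\<in>A \<inter> B. l w) = 1" using sA[of "\<lambda>w. 1"] cell_coord(2)[OF A] by simp
    then have "A \<inter> B \<noteq> {}" by auto
    then obtain y where y: "y \<in> A" "y \<in> B" by blast
    have hA: "h A x = c (base A) y + (\<Sum>w\<in>A \<inter> B. l w * c y w)"
    proof -
      have "h A x = (\<Sum>w\<in>A \<inter> B. l w * (c (base A) y + c y w))"
        unfolding h_def sA using cc[OF A(1) base[of A] y(1)] y(1) by (intro sum.cong refl) fastforce
      then show ?thesis using one by (simp add: distrib_left sum.distrib sum_distrib_right[symmetric])
    qed
    have hB: "h B x = c (base B) y + (\<Sum>w\<in>A \<inter> B. l w * c y w)"
    proof -
      have "h B x = (\<Sum>w\<in>A \<inter> B. l w * (c (base B) y + c y w))"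
        unfolding h_def sB using cc[OF B(1) base[of B] y(2)] y(2) by (intro sum.cong refl) fastforce
      then show ?thesis using one by (simp add: distrib_left sum.distrib sum_distrib_right[symmetric])
    qed
    have "h A x = h B x + (c (base A) y - c (base B) y)" using hA hB by simp
    moreover obtain n where "c (base A) y - c (base B) y = of_int n" using int Ints_diff Ints_cases by metis
    ultimately have "2 * pi * h A x * \<i> = 2 * pi * h B x * \<i> + of_int n * (2 * of_real pi * \<i>)" by (simp add: algebra_simps)
    then show ?thesis unfolding f_def by (simp add: exp_add exp_integer_2pi mult_ac)
  qed
  define F where "F x = f (SOME A. A \<in> K \<and> x \<in> cell A) x" for x
  have F: "F x = f A x" if "A \<in> K" "x \<in> cell A" for A x
  proof -
    have "(SOME A. A \<in> K \<and> x \<in> cell A) \<in> K \<and> x \<in> cell (SOME A. A \<in> K \<and> x \<in> cell A)"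
      by (rule someI[of "\<lambda>A. A \<in> K \<and> x \<in> cell A"]) (use that in blast)
    then show ?thesis unfolding F_def using agree that by blast
  qed
  have "continuous_on (\<Union>A\<in>K. cell A) F"
  proof (rule continuous_on_closed_Union)
    show "closed (cell A)" for A by (rule closed_cell)
    show "continuous_on (cell A) F" if A: "A \<in> K" for A
    proof (rule continuous_on_eq)
      show "continuous_on (cell A) (f A)" unfolding f_def by (intro continuous_intros hcont[OF A])
      show "f A x = F x" if "x \<in> cell A" for x using F[OF A that] by simp
    qed
  qed simp
  then have Fc: "continuous_on (lk_space K u) F" unfolding lk_cells .
  have "F x \<noteq> 0" for x by (simp add: F_def f_def)
  then obtain g where g: "continuous_on (lk_space K u) g" "\<And>x. x \<in> lk_space K u \<Longrightarrow> F x = exp (g x)"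
    using continuous_logarithm_on_simply_connected[OF Fc sc locally_path_connected_lk] by metis
  define b where "b v = Im (g (ray v)) / (2 * pi)" for v
  have "c v w = b w - b v" if A: "A \<in> K" and vw: "v \<in> A" "w \<in> A" for A v w
  proof -
    \<comment> \<open>On one cell both terms are logarithms of the same map, so they differ by an
      integer multiple of 2 pi i, constant by connectedness.\<close>
    let ?d = "\<lambda>x. g x - 2 * pi * h A x * \<i>"
    have sub: "cell A \<subseteq> lk_space K u" using A unfolding lk_cells by blast
    have dc: "continuous_on (cell A) ?d"
      by (intro continuous_intros hcont[OF A] continuous_on_subset[OF g(1) sub])
    have e1: "exp (?d x) = 1" if "x \<in> cell A" for x
      using g(2)[of x] F[OF A that] sub that unfolding f_def by (auto simp: exp_diff)
    have "?d constant_on cell A"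
    proof (rule continuous_discrete_range_constant[OF _ dc])
      show "connected (cell A)" unfolding cell_def by (intro convex_connected convex_convex_hull)
      fix x assume x: "x \<in> cell A"
      show "\<exists>e>0. \<forall>y. y \<in> cell A \<and> ?d y \<noteq> ?d x \<longrightarrow> e \<le> norm (?d y - ?d x)"
      proof (intro exI[of _ 1] conjI allI impI)
        fix y assume y: "y \<in> cell A \<and> ?d y \<noteq> ?d x"
        obtain n where n: "Re (?d x) = 0" "Im (?d x) = of_int (2 * n) * pi" using e1[OF x] unfolding exp_eq_1 by blast
        obtain m where m: "Re (?d y) = 0" "Im (?d y) = of_int (2 * m) * pi" using e1 y unfolding exp_eq_1 by blast
        have "m \<noteq> n" using y n m complex_eq_iff by metis
        then have "\<bar>real_of_int (m - n)\<bar> \<ge> 1" by linarith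
        have "1 \<le> 2 * pi * \<bar>real_of_int (m - n)\<bar>"
          using pi_gt3 mult_mono[of 1 "2 * pi" 1 "\<bar>real_of_int (m - n)\<bar>"] \<open>\<bar>real_of_int (m - n)\<bar> \<ge> 1\<close> by simp
        also have "\<dots> = \<bar>Im (?d y - ?d x)\<bar>"
        proof -
          have "Im (?d y - ?d x) = Im (?d y) - Im (?d x)" by (rule minus_complex.simps)
          also have "\<dots> = 2 * pi * real_of_int (m - n)" unfolding n(2) m(2) by (simp add: algebra_simps)
          finally show ?thesis by (simp add: abs_mult)
        qed
        also have "\<dots> \<le> norm (?d y - ?d x)" by (rule abs_Im_le_cmod)
        finally show "1 \<le> norm (?d y - ?d x)" .
      qed simp
    qed
    then obtain k where k: "\<And>x. x \<in> cell A \<Longrightarrow> ?d x = k" unfolding constant_on_def by blast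
    have hr: "h A (ray z) = c (base A) z" if "z \<in> A" for z
    proof -
      have "h A (ray z) = (\<Sum>w\<in>A. if w = z then c (base A) z else 0)"
        unfolding h_def using coord(2)[OF A that] by (intro sum.cong) auto
      then show ?thesis using that by simp
    qed
    have bz: "2 * pi * b z = Im k + 2 * pi * c (base A) z" if z: "z \<in> A" for z
    proof -
      have "ray z \<in> cell A" unfolding cell_def using z by (simp add: hull_inc)
      then have "g (ray z) = k + 2 * pi * c (base A) z * \<i>" using k[of "ray z"] hr[OF z] by (simp add: algebra_simps)
      then have "Im (g (ray z)) = Im k + 2 * pi * c (base A) z" by simp
      then show ?thesis by (simp add: b_def)
    qed
    have bA: "base A \<in> A" using base vw by blast
    have "2 * pi * (b w - b v) = 2 * pi * (c (base A) w - c (base A) v)"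
      using bz[OF vw(1)] bz[OF vw(2)] by (simp add: algebra_simps)
    then have "b w - b v = c (base A) w - c (base A) v" by simp
    then show ?thesis using cc[OF A bA vw] by simp
  qed
  then show ?thesis by blast
qed

text \<open>Real cocycles reduce to integral ones through a rational basis of the span of their values.\<close>
lemma cocycle_is_coboundary:
  fixes c :: "'v \<Rightarrow> 'v \<Rightarrow> real"
  assumes sc: "simply_connected (lk_space K u)"
    and cc: "\<And>A v w x. A \<in> K \<Longrightarrow> v \<in> A \<Longrightarrow> w \<in> A \<Longrightarrow> x \<in> A \<Longrightarrow> c v w + c w x = c v x"
  shows "\<exists>b. \<forall>A\<in>K. \<forall>v\<in>A. \<forall>w\<in>A. c v w = b w - b v"
proof -
  let ?X = "(\<lambda>(v,w). c v w) ` UNIV"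
  obtain B where B: "B \<subseteq> ?X" "rv.independent B" "?X \<subseteq> rv.span B" using rv.basis_exists by metis
  have finB: "finite B" using B(1) by (rule finite_subset) simp
  have sp: "c v w \<in> rv.span B" for v w using B(3) by auto
  define rep where "rep x v w = rv.representation B (c v w) x" for x v w
  obtain N :: int where N: "N > 0" "\<And>r. r \<in> (\<lambda>(x,v,w). rep x v w) ` (B \<times> UNIV \<times> UNIV) \<Longrightarrow> of_int N * r \<in> \<int>"
    using finite_rat_common_denominator[of "(\<lambda>(x,v,w). rep x v w) ` (B \<times> UNIV \<times> UNIV)"] finB
    by (metis finite_SigmaI finite_imageI finite)
  have "\<exists>b. \<forall>A\<in>K. \<forall>v\<in>A. \<forall>w\<in>A. of_rat (of_int N * rep x v w) = (b w - b v :: real)" if x: "x \<in> B" for x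
  proof (rule int_cocycle_is_coboundary[OF sc])
    fix A v w z assume A: "A \<in> K" "v \<in> A" "w \<in> A" "z \<in> A"
    \<comment> \<open>Coordinates with respect to a rational basis are additive, so each of them
      inherits the cocycle identity.\<close>
    have "rep x v w + rep x w z = rep x v z"
      unfolding rep_def using rv.representation_add[OF B(2) sp sp, of v w w z] cc[OF A] by (metis (no_types))
    then show "of_rat (of_int N * rep x v w) + of_rat (of_int N * rep x w z) = (of_rat (of_int N * rep x v z) :: real)"
      by (metis of_rat_add distrib_left)
  next
    fix v w
    have "of_int N * rep x v w \<in> \<int>" using x by (intro N(2) image_eqI[of _ _ "(x,v,w)"]) auto
    then show "(of_rat (of_int N * rep x v w) :: real) \<in> \<int>" by (metis Ints_cases Ints_of_int of_rat_of_int_eq)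
  qed
  then obtain b where b: "\<And>x A v w. x \<in> B \<Longrightarrow> A \<in> K \<Longrightarrow> v \<in> A \<Longrightarrow> w \<in> A \<Longrightarrow>
      of_rat (of_int N * rep x v w) = (b x w - b x v :: real)" by metis
  show ?thesis
  proof (intro exI[of _ "\<lambda>v. \<Sum>x\<in>B. b x v / of_int N * x"] ballI)
    fix A v w assume A: "A \<in> K" "v \<in> A" "w \<in> A"
    have "c v w = (\<Sum>x\<in>B. of_rat (rep x v w) * x)"
      using rv.sum_representation_eq[OF B(2) sp finB order_refl, of v w] by (simp add: rep_def)
    also have "\<dots> = (\<Sum>x\<in>B. (b x w - b x v) / of_int N * x)"
    proof (rule sum.cong[OF refl])
      fix x assume "x \<in> B"
      then have "real_of_int N * of_rat (rep x v w) = b x w - b x v" using b[OF _ A] by (simp add: of_rat_mult)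
      then have "of_rat (rep x v w) = (b x w - b x v) / of_int N" using N(1) by (simp add: field_simps)
      then show "of_rat (rep x v w) * x = (b x w - b x v) / of_int N * x" by simp
    qed
    finally show "c v w = (\<Sum>x\<in>B. b x w / of_int N * x) - (\<Sum>x\<in>B. b x v / of_int N * x)"
      by (simp add: sum_subtractf[symmetric] diff_divide_distrib left_diff_distrib)
  qed
qed

end

section \<open>Combinatorics of fans\<close>

lemma fs_dim_functional:
  fixes V :: "('x \<Rightarrow> real) set" and \<phi> :: "('x \<Rightarrow> real) \<Rightarrow> real"
  assumes V: "fs.subspace V" and fin: "V \<subseteq> fs.span G" "finite G"
    and add: "\<And>f g. \<phi> (\<lambda>x. f x + g x) = \<phi> f + \<phi> g" and scale: "\<And>c f. \<phi> (\<lambda>x. c * f x) = c * \<phi> f"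
    and nz: "f \<in> V" "\<phi> f \<noteq> 0"
  shows "fs.dim V = fs.dim {x\<in>V. \<phi> x = 0} + 1"
proof -
  \<comment> \<open>The functional is read as a map to constant functions, so that rank-nullity
    between function spaces applies.\<close>
  let ?h = "\<lambda>f (n::nat). \<phi> f"
  let ?o = "\<lambda>n::nat. 1::real"
  have lin: "Vector_Spaces.linear (\<lambda>c f x. c * f x) (\<lambda>c f x. c * f x) ?h"
  proof unfold_locales
    show "?h (f + g) = ?h f + ?h g" for f g using add[of f g] by (simp add: plus_fun_def)
    show "?h (\<lambda>x. c * f x) = (\<lambda>x. c * ?h f x)" for c f using scale[of c f] by simp
  qed
  have im: "?h ` V = {\<lambda>n. k |k. True}"
  proof
    show "{\<lambda>n. k |k. True} \<subseteq> ?h ` V"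
    proof
      fix y :: "nat \<Rightarrow> real" assume "y \<in> {\<lambda>n. k |k. True}"
      then obtain k where k: "y = (\<lambda>n. k)" by blast
      have "(\<lambda>x. (k / \<phi> f) * f x) \<in> V" using fs.subspace_scale[OF V nz(1)] .
      moreover have "?h (\<lambda>x. (k / \<phi> f) * f x) = y" unfolding scale using nz k by simp
      ultimately show "y \<in> ?h ` V" by blast
    qed
  qed auto
  have "fs.dim {\<lambda>n::nat. k::real |k. True} = card {?o}"
  proof (rule fs.basis_card_eq_dim[symmetric])
    show "{?o} \<subseteq> {\<lambda>n. k |k. True}" by auto
    show "{\<lambda>n. k |k. True} \<subseteq> fs.span {?o}"
    proof
      fix y :: "nat \<Rightarrow> real" assume "y \<in> {\<lambda>n. k |k. True}"
      then obtain k where "y = (\<lambda>n. k * ?o n)" by auto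
      then show "y \<in> fs.span {?o}" using fs.span_scale[OF fs.span_base, of ?o "{?o}" k] by simp
    qed
    show "fs.independent {?o}" by (simp add: fs.dependent_single fun_eq_iff)
  qed
  then have "fs.dim (?h ` V) = 1" unfolding im by simp
  moreover have "{x\<in>V. ?h x = 0} = {x\<in>V. \<phi> x = 0}" by (auto simp: fun_eq_iff)
  ultimately show ?thesis using ff.dim_kernel_image[OF lin V fin] by simp
qed

lemma fs_dim_zero: "fs.dim {0} = 0"
  using fs.dim_le_card[of "{0}" "{}"] by simp

definition supported :: "'x set \<Rightarrow> ('x \<Rightarrow> real) set" where
  "supported I = {f. \<forall>x. x \<notin> I \<longrightarrow> f x = 0}"

lemma supported_subspace: "fs.subspace (supported I)"
  by (rule fs.subspaceI) (auto simp: supported_def)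

lemma supported_span:
  assumes "finite I" shows "\<exists>G. finite G \<and> supported I \<subseteq> fs.span G"
proof -
  let ?e = "\<lambda>i x. if x = i then 1 else (0::real)"
  have "f \<in> fs.span (?e ` I)" if f: "f \<in> supported I" for f
  proof -
    have "f = (\<Sum>i\<in>I. (\<lambda>x. f i * ?e i x))"
    proof
      fix x
      have "(\<Sum>i\<in>J. (\<lambda>x. f i * ?e i x)) x = (\<Sum>i\<in>J. f i * ?e i x)" for J
        by (induction J rule: infinite_finite_induct) auto
      then show "f x = (\<Sum>i\<in>I. (\<lambda>x. f i * ?e i x)) x"
        using f assms by (simp add: supported_def if_distrib cong: if_cong)
    qed
    also have "\<dots> \<in> fs.span (?e ` I)" by (intro fs.span_sum fs.span_scale fs.span_base) auto
    finally show ?thesis .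
  qed
  then show ?thesis using assms by (intro exI[of _ "?e ` I"]) auto
qed

lemma supported_dim: "finite I \<Longrightarrow> fs.dim (supported I) = card I"
proof (induction I rule: finite_induct)
  case empty
  have "supported {} = {0 :: 'a \<Rightarrow> real}" by (auto simp: supported_def fun_eq_iff)
  then show ?case using fs_dim_zero by simp
next
  case (insert k I)
  obtain G where G: "finite G" "supported (insert k I) \<subseteq> fs.span G" using supported_span[of "insert k I"] insert by auto
  have "fs.dim (supported (insert k I)) = fs.dim {x\<in>supported (insert k I). x k = 0} + 1"
    by (rule fs_dim_functional[OF supported_subspace G(2,1), of "\<lambda>x. x k" "\<lambda>x. if x = k then 1 else 0"])
      (auto simp: supported_def)
  moreover have "{x\<in>supported (insert k I). x k = 0} = supported I" using insert(2) by (auto simp: supported_def)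
  ultimately show ?case using insert by simp
qed

locale pure_fan = fan_link K u for K :: "'v::finite set set" and u :: "'v \<Rightarrow> real^3" +
  assumes pure: "pure3 K" and her: "hereditary K"
begin

lemma K_down: "A \<in> K \<Longrightarrow> B \<subseteq> A \<Longrightarrow> B \<in> K" and K_vertex: "{v} \<in> K" and K_empty: "{} \<in> K"
  using fan unfolding simplicial_fan_def by blast+

lemma in_facet: assumes "A \<in> K" shows "\<exists>\<sigma>\<in>facets K. A \<subseteq> \<sigma>"
proof -
  let ?P = "\<lambda>B. B \<in> K \<and> A \<subseteq> B"
  have "\<exists>B. ?P B \<and> (\<forall>C. ?P C \<longrightarrow> card C \<le> card B)"
    by (rule ex_has_greatest_nat[where k = A and b = "Suc (card (UNIV :: 'v set))"])
      (use assms in \<open>auto simp: less_Suc_eq_le card_mono\<close>)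
  then obtain B where B: "B \<in> K" "A \<subseteq> B" "\<And>C. C \<in> K \<Longrightarrow> A \<subseteq> C \<Longrightarrow> card C \<le> card B" by blast
  have "C = B" if "C \<in> K" "B \<subseteq> C" for C
    using card_seteq[of C B] B(2) B(3)[OF that(1)] that by auto
  then have "B \<in> facets K" using B by (auto simp: facets_def)
  then show ?thesis using B by blast
qed

lemma facet_card: "\<sigma> \<in> facets K \<Longrightarrow> card \<sigma> = 3" and facet_K: "\<sigma> \<in> facets K \<Longrightarrow> \<sigma> \<in> K"
  using pure by (auto simp: pure3_def facets_def)

lemma facets_iff: "\<sigma> \<in> facets K \<longleftrightarrow> \<sigma> \<in> K \<and> card \<sigma> = 3"
proof
  assume s: "\<sigma> \<in> K \<and> card \<sigma> = 3"
  then obtain \<sigma>' where "\<sigma>' \<in> facets K" "\<sigma> \<subseteq> \<sigma>'" using in_facet by blast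
  then show "\<sigma> \<in> facets K" using s facet_card card_seteq[of \<sigma>' \<sigma>] by auto
qed (auto simp: facet_card facet_K)

lemma dual_vector:
  assumes "A \<in> K" "v \<in> A"
  shows "\<exists>n. n \<bullet> u v \<noteq> 0 \<and> (\<forall>w\<in>A. w \<noteq> v \<longrightarrow> n \<bullet> u w = 0)"
proof -
  let ?n = "\<chi> i. coord A v (axis i 1)"
  note lin = coord(1)[OF assms(1), of v]
  have c: "coord A v x = ?n \<bullet> x" for x
  proof -
    have "coord A v x = coord A v (\<Sum>i\<in>UNIV. (x $ i) *s axis i 1)" by (simp add: basis_expansion)
    also have "\<dots> = ?n \<bullet> x"
      by (simp add: linear_sum[OF lin] scalar_mult_eq_scaleR linear_cmul[OF lin] inner_vec_def mult.commute)
    finally show ?thesis .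
  qed
  have "?n \<bullet> ray v = 1" using coord(2)[OF assms, of v] c[of "ray v"] by simp
  then have "?n \<bullet> u v \<noteq> 0" by (auto simp: ray_def)
  moreover have "?n \<bullet> u w = 0" if "w \<in> A" "w \<noteq> v" for w
    using coord(2)[OF assms(1) that(1), of v] c[of "ray w"] that ray_nonzero[of w] by (simp add: ray_def)
  ultimately show ?thesis by blast
qed

lemma edge_cross_nonzero:
  assumes "{v,w} \<in> K" "v \<noteq> w" shows "cross3 (u v) (u w) \<noteq> 0"
proof
  assume z: "cross3 (u v) (u w) = 0"
  obtain n where n: "n \<bullet> u v \<noteq> 0" "n \<bullet> u w = 0" using dual_vector[OF assms(1), of v] assms(2) by auto
  have "cross3 n (cross3 (u v) (u w)) = (n \<bullet> u w) *\<^sub>R u v - (n \<bullet> u v) *\<^sub>R u w"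
    by (simp add: vec_eq_iff forall_3 cross_components inner_vec_def sum_3 algebra_simps)
  then show False using z n ray_nonzero[of w] by simp
qed

definition det3 where "det3 v w x = u v \<bullet> cross3 (u w) (u x)"

lemma det3_nonzero:
  assumes K: "{v,w,x} \<in> K" and d: "distinct [v,w,x]"
  shows "det3 v w x \<noteq> 0"
proof
  assume z: "det3 v w x = 0"
  obtain n where n: "n \<bullet> u v \<noteq> 0" "n \<bullet> u w = 0" "n \<bullet> u x = 0" using dual_vector[OF K, of v] d by auto
  have "det3 v w x *\<^sub>R n = (n \<bullet> u v) *\<^sub>R cross3 (u w) (u x) + (n \<bullet> u w) *\<^sub>R cross3 (u x) (u v) + (n \<bullet> u x) *\<^sub>R cross3 (u v) (u w)"
    unfolding det3_def by (simp add: vec_eq_iff forall_3 cross_components inner_vec_def sum_3) (simp add: algebra_simps)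
  then have "cross3 (u w) (u x) = 0" using z n by simp
  moreover have "{w,x} \<in> K" by (rule K_down[OF K]) auto
  ultimately show False using edge_cross_nonzero d by auto
qed

lemma det3_swap: "det3 v x w = - det3 v w x" "det3 w v x = - det3 v w x"
  by (simp_all add: det3_def cross_components inner_vec_def sum_3 algebra_simps)

text \<open>If \<open>x\<close> and \<open>y\<close> lay on one side of the plane, a point in the
  middle of the common face, moved a little towards \<open>x\<close>, would lie in both cones but
  not in the face.\<close>

lemma opposite_sides:
  assumes K: "{v,w,x} \<in> K" "{v,w,y} \<in> K" and d: "distinct [v,w,x,y]"
  shows "det3 v w x * det3 v w y < 0"
proof (rule ccontr)
  assume neg: "\<not> det3 v w x * det3 v w y < 0"
  have nz: "det3 v w x \<noteq> 0" "det3 v w y \<noteq> 0" using det3_nonzero K d by auto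
  then have pos: "det3 v w x * det3 v w y > 0" using neg by (metis mult_eq_0_iff not_less_iff_gr_or_eq)
  let ?D = "det3 v w y"
  \<comment> \<open>By Cramer's rule these are the coefficients of \<open>u x\<close> in the basis
    \<open>u v\<close>, \<open>u w\<close>, \<open>u y\<close>; that of \<open>u y\<close> is
    positive when both rays lie on one side.\<close>
  define a b c where abc: "a = det3 x w y / ?D" "b = det3 v x y / ?D" "c = det3 v w x / ?D"
  have c: "c > 0" using pos nz unfolding abc by (simp add: zero_less_divide_iff zero_less_mult_iff)
  have "?D *\<^sub>R u x = det3 x w y *\<^sub>R u v + det3 v x y *\<^sub>R u w + det3 v w x *\<^sub>R u y"
    unfolding det3_def by (simp add: vec_eq_iff forall_3 cross_components inner_vec_def sum_3) (simp add: algebra_simps)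
  then have "(1 / ?D) *\<^sub>R (?D *\<^sub>R u x) = (1 / ?D) *\<^sub>R (det3 x w y *\<^sub>R u v + det3 v x y *\<^sub>R u w + det3 v w x *\<^sub>R u y)" by simp
  then have ux: "u x = a *\<^sub>R u v + b *\<^sub>R u w + c *\<^sub>R u y" using nz unfolding abc by (simp add: scaleR_add_right)
  \<comment> \<open>Small enough that \<open>e * a\<close> and \<open>e * b\<close> have absolute
    value at most 1.\<close>
  define e where "e = 1 / (1 + \<bar>a\<bar> + \<bar>b\<bar>)"
  have e: "e > 0" "e * (1 + \<bar>a\<bar> + \<bar>b\<bar>) = 1" unfolding e_def by auto
  have ea: "1 + e * a \<ge> 0" "1 + e * b \<ge> 0"
  proof -
    have *: "\<bar>e * t\<bar> \<le> 1" if "\<bar>t\<bar> \<le> 1 + \<bar>a\<bar> + \<bar>b\<bar>" for t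
      using mult_left_mono[OF that, of e] e by (simp add: abs_mult)
    show "1 + e * a \<ge> 0" "1 + e * b \<ge> 0" using *[of a] *[of b] by auto
  qed
  let ?q = "u v + u w + e *\<^sub>R u x"
  have 1: "?q \<in> pos_hull u {v,w,x}"
    unfolding pos_hull_def mem_Collect_eq
    by (rule exI[of _ "\<lambda>z. if z = x then e else 1"]) (use d e in auto)
  have "?q = (1 + e * a) *\<^sub>R u v + (1 + e * b) *\<^sub>R u w + (e * c) *\<^sub>R u y"
    unfolding ux by (simp add: scaleR_add_left scaleR_add_right)
  then have 2: "?q \<in> pos_hull u {v,w,y}"
    unfolding pos_hull_def mem_Collect_eq
    by (intro exI[of _ "\<lambda>z. if z = v then 1 + e * a else if z = w then 1 + e * b else e * c"]) (use d e ea c in auto)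
  have "pos_hull u {v,w,x} \<inter> pos_hull u {v,w,y} = pos_hull u ({v,w,x} \<inter> {v,w,y})"
    using fan K unfolding simplicial_fan_def by blast
  also have "{v,w,x} \<inter> {v,w,y} = {v,w}" using d by auto
  finally have "?q \<in> pos_hull u {v,w}" using 1 2 by blast
  then obtain l where l: "?q = (\<Sum>z\<in>{v,w}. l z *\<^sub>R u z)" unfolding pos_hull_def by blast
  obtain n where n: "n \<bullet> u x \<noteq> 0" "n \<bullet> u v = 0" "n \<bullet> u w = 0" using dual_vector[OF K(1), of x] d by auto
  have "n \<bullet> ?q = e * (n \<bullet> u x)" using n by (simp add: inner_add_right)
  moreover have "n \<bullet> ?q = 0" unfolding l using n d by (simp add: inner_add_right)
  ultimately show False using n e by simp
qed

definition star where "star \<tau> = {\<sigma>\<in>facets K. \<tau> \<subseteq> \<sigma>}"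

lemma bdry_2faces_iff: "\<tau> \<in> bdry_2faces K \<longleftrightarrow> \<tau> \<in> K \<and> card \<tau> = 2 \<and> card (star \<tau>) = 1"
  by (simp add: bdry_2faces_def star_def)

text \<open>A 2-face inside a boundary 2-face equals it, so for 2-faces lying in \<open>bdry\<close>
  is a condition on the number of facets.\<close>

lemma interior2_iff: "\<tau> \<in> interior2 K \<longleftrightarrow> \<tau> \<in> K \<and> card \<tau> = 2 \<and> card (star \<tau>) \<noteq> 1"
proof -
  have "\<tau> \<in> bdry K \<longleftrightarrow> \<tau> \<in> bdry_2faces K" if "\<tau> \<in> K" "card \<tau> = 2"
    using that unfolding bdry_def bdry_2faces_def by (auto dest: card_seteq[rotated])
  then show ?thesis unfolding interior2_def using bdry_2faces_iff by blast
qed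

text \<open>\<open>side \<sigma> v w\<close> is the side of the oriented plane through \<open>v\<close>, \<open>w\<close> on which the facet lies.\<close>
definition side :: "'v set \<Rightarrow> 'v \<Rightarrow> 'v \<Rightarrow> real" where
  "side \<sigma> v w = sgn (det3 v w (THE x. \<sigma> = {v,w,x} \<and> x \<noteq> v \<and> x \<noteq> w))"

lemma side_eq: "distinct [v,w,x] \<Longrightarrow> side {v,w,x} v w = sgn (det3 v w x)"
proof -
  assume d: "distinct [v,w,x]"
  have "(THE y. {v,w,x} = {v,w,y} \<and> y \<noteq> v \<and> y \<noteq> w) = x" using d by (intro the_equality) auto
  then show ?thesis by (simp add: side_def)
qed

lemma facet_third:
  assumes "\<sigma> \<in> facets K" "v \<in> \<sigma>" "w \<in> \<sigma>" "v \<noteq> w"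
  obtains x where "\<sigma> = {v,w,x}" "distinct [v,w,x]"
proof -
  have "card (\<sigma> - {v,w}) = 1" using facet_card[OF assms(1)] assms by (simp add: card_Diff_subset)
  then obtain x where "\<sigma> - {v,w} = {x}" by (auto simp: card_1_singleton_iff)
  then have "\<sigma> = {v,w,x}" "distinct [v,w,x]" using assms by auto
  then show ?thesis by (rule that)
qed

lemma side_pm1:
  assumes "\<sigma> \<in> facets K" "v \<in> \<sigma>" "w \<in> \<sigma>" "v \<noteq> w"
  shows "side \<sigma> v w = 1 \<or> side \<sigma> v w = -1"
proof -
  obtain x where x: "\<sigma> = {v,w,x}" "distinct [v,w,x]" using facet_third[OF assms] .
  have "det3 v w x \<noteq> 0" using det3_nonzero facet_K[OF assms(1)] x by blast
  then show ?thesis using side_eq[OF x(2)] x(1) by (auto simp: sgn_real_def)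
qed

lemma side_swap:
  assumes "\<sigma> \<in> facets K" "v \<in> \<sigma>" "w \<in> \<sigma>" "v \<noteq> w"
  shows "side \<sigma> w v = - side \<sigma> v w"
proof -
  obtain x where x: "\<sigma> = {v,w,x}" "distinct [v,w,x]" using facet_third[OF assms] .
  have "\<sigma> = {w,v,x}" "distinct [w,v,x]" using x by auto
  then show ?thesis using side_eq[OF x(2)] side_eq[of w v x] x(1) det3_swap(2)[of w v x] by (simp add: sgn_minus)
qed

lemma side_third:
  assumes "{v,w,x} \<in> facets K" "distinct [v,w,x]"
  shows "side {v,w,x} v x = - side {v,w,x} v w"
proof -
  have "{v,w,x} = {v,x,w}" by auto
  then have "side {v,w,x} v x = sgn (det3 v x w)" using side_eq[of v x w] assms(2) by auto
  then show ?thesis using side_eq[OF assms(2)] det3_swap(1)[of v x w] by (simp add: sgn_minus)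
qed

lemma side_opposite:
  assumes s: "\<sigma> \<in> facets K" "\<sigma>' \<in> facets K" "\<sigma> \<noteq> \<sigma>'" and v: "{v,w} \<subseteq> \<sigma>" "{v,w} \<subseteq> \<sigma>'" "v \<noteq> w"
  shows "side \<sigma>' v w = - side \<sigma> v w"
proof -
  obtain x where x: "\<sigma> = {v,w,x}" "distinct [v,w,x]" using facet_third[OF s(1)] v by auto
  obtain y where y: "\<sigma>' = {v,w,y}" "distinct [v,w,y]" using facet_third[OF s(2)] v by auto
  have "det3 v w x * det3 v w y < 0"
    by (rule opposite_sides) (use x y s facet_K in auto)
  then have "sgn (det3 v w y) = - sgn (det3 v w x)" by (auto simp: mult_less_0_iff sgn_real_def)
  then show ?thesis using side_eq x y by simp
qed

text \<open>Facets through one edge lie on pairwise opposite sides of its plane, and there are only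
  two sides.\<close>

lemma star_le2:
  assumes "card \<tau> = 2" shows "card (star \<tau>) \<le> 2"
proof (rule ccontr)
  assume "\<not> card (star \<tau>) \<le> 2"
  then have "3 \<le> card (star \<tau>)" by simp
  then obtain Q where "Q \<subseteq> star \<tau>" "card Q = 3" using obtain_subset_with_card_n by metis
  then obtain a b c where abc: "a \<in> star \<tau>" "b \<in> star \<tau>" "c \<in> star \<tau>" "a \<noteq> b" "b \<noteq> c" "a \<noteq> c"
    by (auto simp: card_3_iff)
  obtain v w where vw: "\<tau> = {v,w}" "v \<noteq> w" using assms by (auto simp: card_2_iff)
  have "side b v w = - side a v w" "side c v w = - side a v w" "side c v w = - side b v w"
    using abc vw by (auto intro!: side_opposite simp: star_def)
  moreover have "side a v w \<noteq> 0" using side_pm1[of a v w] abc vw by (auto simp: star_def)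
  ultimately show False by simp
qed

lemma star_interior: "\<tau> \<in> interior2 K \<Longrightarrow> card (star \<tau>) = 2"
proof -
  assume t: "\<tau> \<in> interior2 K"
  then have "\<tau> \<in> K" "card \<tau> = 2" "card (star \<tau>) \<noteq> 1" by (auto simp: interior2_iff)
  moreover have "star \<tau> \<noteq> {}" using in_facet[OF \<open>\<tau> \<in> K\<close>] by (auto simp: star_def)
  ultimately show ?thesis using star_le2[of \<tau>] by (metis One_nat_def Suc_1 antisym card_eq_0_iff finite le_SucE less_one linorder_not_le)
qed

lemma adjacent_interior:
  assumes "a \<in> facets K" "b \<in> facets K" "card (a \<inter> b) = 2"
  shows "a \<inter> b \<in> interior2 K" "star (a \<inter> b) = {a,b}" "a \<noteq> b"
proof -
  show ab: "a \<noteq> b" using assms facet_card by auto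
  have "{a,b} \<subseteq> star (a \<inter> b)" using assms by (auto simp: star_def)
  then show s: "star (a \<inter> b) = {a,b}" using star_le2[OF assms(3)] ab card_seteq[of "star (a \<inter> b)" "{a,b}"] by simp
  have "a \<inter> b \<in> K" using K_down[OF facet_K[OF assms(1)]] by auto
  then show "a \<inter> b \<in> interior2 K" using s ab assms(3) by (simp add: interior2_iff)
qed

section \<open>Jumps across 2-faces and incidence signs\<close>

definition orient :: "'v set \<Rightarrow> 'v \<times> 'v" where
  "orient \<tau> = (SOME p. \<tau> = {fst p, snd p} \<and> fst p \<noteq> snd p)"

lemma orient: assumes "card \<tau> = 2" shows "\<tau> = {fst (orient \<tau>), snd (orient \<tau>)}" "fst (orient \<tau>) \<noteq> snd (orient \<tau>)"
proof -
  obtain v w where "\<tau> = {v,w}" "v \<noteq> w" using assms by (auto simp: card_2_iff)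
  then have "\<exists>p. \<tau> = {fst p, snd p} \<and> fst p \<noteq> snd p" by (intro exI[of _ "(v,w)"]) auto
  from someI_ex[OF this] show "\<tau> = {fst (orient \<tau>), snd (orient \<tau>)}" "fst (orient \<tau>) \<noteq> snd (orient \<tau>)"
    unfolding orient_def by auto
qed

text \<open>The incidence numbers of the cellular boundary map from 2-faces to rays, for the
  orientation chosen by \<open>orient\<close>.\<close>

definition inc :: "'v \<Rightarrow> 'v set \<Rightarrow> real" where
  "inc v \<tau> = (if v = fst (orient \<tau>) then 1 else if v = snd (orient \<tau>) then -1 else 0)"

definition oside where "oside \<sigma> \<tau> = side \<sigma> (fst (orient \<tau>)) (snd (orient \<tau>))"

text \<open>On an interior 2-face this is the signed difference of the values on its two facets,
  that is, the boundary map from facets to 2-faces.\<close>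

definition jump :: "('v set \<Rightarrow> real) \<Rightarrow> 'v set \<Rightarrow> real" where
  "jump F \<tau> = (\<Sum>\<sigma>\<in>star \<tau>. oside \<sigma> \<tau> * F \<sigma>)"

lemma inc_pm1: "card \<tau> = 2 \<Longrightarrow> v \<in> \<tau> \<Longrightarrow> inc v \<tau> = 1 \<or> inc v \<tau> = -1"
  using orient[of \<tau>] by (auto simp: inc_def)

lemma inc_0: "card \<tau> = 2 \<Longrightarrow> v \<notin> \<tau> \<Longrightarrow> inc v \<tau> = 0"
  using orient[of \<tau>] by (auto simp: inc_def)

lemma inc_opposite: "card \<tau> = 2 \<Longrightarrow> \<tau> = {v,w} \<Longrightarrow> inc w \<tau> = - inc v \<tau>"
  using orient[of \<tau>] by (auto simp: inc_def doubleton_eq_iff)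

text \<open>Both factors change sign with the orientation chosen for the edge, so the product does
  not depend on it.\<close>

lemma inc_oside:
  assumes "\<sigma> \<in> facets K" "{v,w} \<subseteq> \<sigma>" "v \<noteq> w"
  shows "inc v {v,w} * oside \<sigma> {v,w} = side \<sigma> v w"
proof -
  have "card {v,w} = 2" using assms by simp
  note o = orient[OF this]
  then consider "orient {v,w} = (v,w)" | "orient {v,w} = (w,v)" by (metis doubleton_eq_iff prod.collapse)
  then show ?thesis
  proof cases
    case 1 then show ?thesis by (simp add: inc_def oside_def)
  next
    case 2 then show ?thesis using assms side_swap[of \<sigma> v w] by (simp add: inc_def oside_def)
  qed
qed

lemma interior_star:
  assumes "\<tau> \<in> interior2 K" "a \<in> star \<tau>"
  obtains b where "star \<tau> = {a,b}" "a \<noteq> b" "a \<inter> b = \<tau>" "oside b \<tau> = - oside a \<tau>" "b \<in> facets K"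
proof -
  have "card (star \<tau>) = 2" by (rule star_interior[OF assms(1)])
  then obtain p q where pq: "star \<tau> = {p,q}" "p \<noteq> q" by (auto simp: card_2_iff)
  define b where "b = (if a = p then q else p)"
  have b: "star \<tau> = {a,b}" "a \<noteq> b" using pq assms(2) by (auto simp: b_def)
  have f: "a \<in> facets K" "b \<in> facets K" "\<tau> \<subseteq> a" "\<tau> \<subseteq> b" using b assms(2) by (auto simp: star_def)
  have t2: "card \<tau> = 2" using assms by (simp add: interior2_iff)
  have "a \<inter> b = \<tau>"
  proof -
    have "\<tau> \<subseteq> a \<inter> b" using f by blast
    moreover have "card (a \<inter> b) \<le> 2"
    proof (rule ccontr)
      assume "\<not> card (a \<inter> b) \<le> 2"
      then have "card (a \<inter> b) \<ge> 3" by simp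
      then have "a \<inter> b = a" "a \<inter> b = b"
        using card_seteq[of a "a \<inter> b"] card_seteq[of b "a \<inter> b"] facet_card f by auto
      then show False using b by blast
    qed
    ultimately show ?thesis using t2 card_seteq[of "a \<inter> b" \<tau>] by auto
  qed
  moreover have "oside b \<tau> = - oside a \<tau>" unfolding oside_def
    by (rule side_opposite) (use f b orient[OF t2] in auto)
  ultimately show ?thesis using that[of b] b f by blast
qed

lemma oside_pm1:
  assumes "\<tau> \<in> interior2 K" "a \<in> star \<tau>" shows "oside a \<tau> = 1 \<or> oside a \<tau> = -1"
proof -
  have t2: "card \<tau> = 2" using assms by (simp add: interior2_iff)
  have "fst (orient \<tau>) \<in> \<tau>" "snd (orient \<tau>) \<in> \<tau>" using orient(1)[OF t2] by auto
  then show ?thesis unfolding oside_def by (intro side_pm1) (use assms orient(2)[OF t2] in \<open>auto simp: star_def\<close>)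
qed

lemma jump_eq:
  assumes "star \<tau> = {a,b}" "a \<noteq> b" "oside b \<tau> = - oside a \<tau>"
  shows "jump F \<tau> = oside a \<tau> * (F a - F b)"
  using assms by (simp add: jump_def algebra_simps)

lemma jump_const: "\<tau> \<in> interior2 K \<Longrightarrow> jump (\<lambda>\<sigma>. k) \<tau> = 0"
proof -
  assume t: "\<tau> \<in> interior2 K"
  obtain a where a: "a \<in> star \<tau>" using star_interior[OF t] by fastforce
  show ?thesis using interior_star[OF t a] jump_eq by (metis diff_self mult_zero_right)
qed

lemma jump_add: "jump (\<lambda>\<sigma>. F \<sigma> + G \<sigma>) \<tau> = jump F \<tau> + jump G \<tau>"
  by (simp add: jump_def distrib_left sum.distrib)

lemma jump_scale: "jump (\<lambda>\<sigma>. c * F \<sigma>) \<tau> = c * jump F \<tau>"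
  by (simp add: jump_def sum_distrib_left mult_ac)

lemma jump_cong: "(\<And>\<sigma>. \<sigma> \<in> star \<tau> \<Longrightarrow> F \<sigma> = G \<sigma>) \<Longrightarrow> jump F \<tau> = jump G \<tau>"
  by (simp add: jump_def)

definition interior_vertices where "interior_vertices = {v. {v} \<notin> bdry K}"

lemma interior_vertex_iff: "v \<in> interior_vertices \<longleftrightarrow> (\<forall>\<tau>\<in>bdry_2faces K. v \<notin> \<tau>)"
  using K_vertex by (auto simp: interior_vertices_def bdry_def)

lemma edges_at_interior_vertex:
  assumes "v \<in> interior_vertices" "\<tau> \<in> K" "card \<tau> = 2" "v \<in> \<tau>"
  shows "\<tau> \<in> interior2 K"
  using assms interior_vertex_iff bdry_2faces_iff interior2_iff by blast

definition bound :: "('v set \<Rightarrow> real) \<Rightarrow> 'v \<Rightarrow> real" where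
  "bound g v = (\<Sum>\<tau>\<in>interior2 K. inc v \<tau> * g \<tau>)"

lemma bound_eq: "bound g v = (\<Sum>\<tau>\<in>{\<tau>\<in>interior2 K. v \<in> \<tau>}. inc v \<tau> * g \<tau>)"
  unfolding bound_def
proof (rule sum.mono_neutral_right)
  show "\<forall>\<tau>\<in>interior2 K - {\<tau>\<in>interior2 K. v \<in> \<tau>}. inc v \<tau> * g \<tau> = 0"
    using inc_0 interior2_iff by fastforce
qed auto

lemma edges_of_facet:
  assumes "v \<in> \<sigma>" "\<sigma> = {v,w,x}" "distinct [v,w,x]"
  shows "{\<tau>. card \<tau> = 2 \<and> v \<in> \<tau> \<and> \<tau> \<subseteq> \<sigma>} = {{v,w},{v,x}}"
proof
  show "{\<tau>. card \<tau> = 2 \<and> v \<in> \<tau> \<and> \<tau> \<subseteq> \<sigma>} \<subseteq> {{v,w},{v,x}}"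
  proof
    fix \<tau> assume t: "\<tau> \<in> {\<tau>. card \<tau> = 2 \<and> v \<in> \<tau> \<and> \<tau> \<subseteq> \<sigma>}"
    then obtain y where "\<tau> = {v,y}" "y \<noteq> v" by (auto simp: card_2_iff)
    then show "\<tau> \<in> {{v,w},{v,x}}" using t assms by auto
  qed
qed (use assms in auto)

text \<open>Boundary of a boundary: a facet at \<open>v\<close> contributes through its two edges at
  \<open>v\<close>, with opposite signs by \<open>side_third\<close>. At an interior ray both of
  these edges are interior.\<close>

lemma bound_jump:
  assumes v: "v \<in> interior_vertices"
  shows "bound (jump F) v = 0"
proof -
  let ?E = "{\<tau>\<in>interior2 K. v \<in> \<tau>}"
  have "bound (jump F) v = (\<Sum>\<tau>\<in>?E. \<Sum>\<sigma>\<in>facets K. if \<tau> \<subseteq> \<sigma> then inc v \<tau> * oside \<sigma> \<tau> * F \<sigma> else 0)"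
    unfolding bound_eq jump_def star_def
    by (intro sum.cong refl) (auto simp: sum_distrib_left sum.inter_filter mult.assoc intro!: sum.cong)
  also have "\<dots> = (\<Sum>\<sigma>\<in>facets K. \<Sum>\<tau>\<in>?E. if \<tau> \<subseteq> \<sigma> then inc v \<tau> * oside \<sigma> \<tau> * F \<sigma> else 0)"
    by (rule sum.swap)
  also have "\<dots> = 0"
  proof (rule sum.neutral, rule ballI)
    fix \<sigma> assume s: "\<sigma> \<in> facets K"
    have eq: "(\<Sum>\<tau>\<in>?E. if \<tau> \<subseteq> \<sigma> then inc v \<tau> * oside \<sigma> \<tau> * F \<sigma> else 0) = (\<Sum>\<tau>\<in>{\<tau>\<in>?E. \<tau> \<subseteq> \<sigma>}. inc v \<tau> * oside \<sigma> \<tau> * F \<sigma>)"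
      by (rule sum.inter_filter[symmetric]) simp
    show "(\<Sum>\<tau>\<in>?E. if \<tau> \<subseteq> \<sigma> then inc v \<tau> * oside \<sigma> \<tau> * F \<sigma> else 0) = 0"
    proof (cases "v \<in> \<sigma>")
      case False
      then have "{\<tau>\<in>?E. \<tau> \<subseteq> \<sigma>} = {}" by auto
      then show ?thesis unfolding eq by (metis sum.empty)
    next
      case True
      have "\<sigma> \<noteq> {v}" using facet_card[OF s] by auto
      then obtain w where w: "w \<in> \<sigma>" "v \<noteq> w" using True by blast
      obtain x where x: "\<sigma> = {v,w,x}" "distinct [v,w,x]" using facet_third[OF s True w] .
      have "{\<tau>\<in>?E. \<tau> \<subseteq> \<sigma>} = {\<tau>. card \<tau> = 2 \<and> v \<in> \<tau> \<and> \<tau> \<subseteq> \<sigma>}"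
        using edges_at_interior_vertex[OF v] K_down[OF facet_K[OF s]] by (auto simp: interior2_iff)
      also have "\<dots> = {{v,w},{v,x}}" by (rule edges_of_facet[OF True x])
      finally have e: "{\<tau>\<in>?E. \<tau> \<subseteq> \<sigma>} = {{v,w},{v,x}}" .
      have ne: "{v,w} \<noteq> {v,x}" using x(2) by (auto simp: doubleton_eq_iff)
      have "inc v {v,w} * oside \<sigma> {v,w} = side \<sigma> v w" by (rule inc_oside[OF s]) (use x in auto)
      moreover have "inc v {v,x} * oside \<sigma> {v,x} = side \<sigma> v x" by (rule inc_oside[OF s]) (use x in auto)
      moreover have "side \<sigma> v x = - side \<sigma> v w" using side_third x s by blast
      ultimately show ?thesis unfolding eq e using ne by simp
    qed
  qed
  finally show ?thesis .
qed

lemma equal_if_jump_zero: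
  assumes "a \<in> facets K" "b \<in> facets K" "card (a \<inter> b) = 2" "jump F (a \<inter> b) = 0"
  shows "F a = F b"
proof -
  note i = adjacent_interior[OF assms(1-3)]
  have "a \<in> star (a \<inter> b)" using i(2) by simp
  then obtain b' where b': "star (a \<inter> b) = {a,b'}" "a \<noteq> b'" "oside b' (a \<inter> b) = - oside a (a \<inter> b)"
    using interior_star[OF i(1)] by metis
  have "b' = b" using b' i by auto
  then have "oside a (a \<inter> b) * (F a - F b) = 0" using jump_eq[OF b', of F] assms(4) by simp
  moreover have "oside a (a \<inter> b) \<noteq> 0" using oside_pm1[OF i(1) \<open>a \<in> star _\<close>] by auto
  ultimately show ?thesis by simp
qed

text \<open>Hereditariness lets values propagate through the 2-faces containing
  \<open>\<psi>\<close>. The empty face gives the global statement, a single ray the local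
  one.\<close>

lemma local_constant:
  assumes "\<psi> \<in> K" and z: "\<And>\<tau>. \<tau> \<in> interior2 K \<Longrightarrow> \<psi> \<subseteq> \<tau> \<Longrightarrow> jump F \<tau> = 0"
    and ab: "a \<in> facets K" "b \<in> facets K" "\<psi> \<subseteq> a" "\<psi> \<subseteq> b"
  shows "F a = F b"
proof -
  have "(facet_adj K \<psi>)\<^sup>*\<^sup>* a b" using her assms unfolding hereditary_def by blast
  then show ?thesis
  proof (induction rule: rtranclp_induct)
    case (step y x)
    then have yx: "y \<in> facets K" "x \<in> facets K" "card (y \<inter> x) = 2" "\<psi> \<subseteq> y \<inter> x" by (auto simp: facet_adj_def)
    then have "F y = F x" using equal_if_jump_zero z adjacent_interior(1) by blast
    then show ?case using step by simp
  qed simp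
qed

text \<open>Incidences of edges and facets at \<open>v\<close> are counted in two ways: a facet has
  two edges at \<open>v\<close>, an interior edge lies in two facets, a boundary edge in
  one.\<close>

lemma local_counts:
  defines "E v \<equiv> {\<tau>\<in>interior2 K. v \<in> \<tau>}" and "B v \<equiv> {\<tau>\<in>bdry_2faces K. v \<in> \<tau>}"
  shows "2 * card (star {v}) = 2 * card (E v) + card (B v)"
proof -
  let ?A = "{\<tau>\<in>K. card \<tau> = 2 \<and> v \<in> \<tau>}"
  have "(\<Sum>\<tau>\<in>?A. card (star \<tau>)) = (\<Sum>\<tau>\<in>?A. \<Sum>\<sigma>\<in>facets K. if \<tau> \<subseteq> \<sigma> then 1 else 0)"
    by (intro sum.cong refl) (simp add: star_def sum.If_cases Int_def)
  also have "\<dots> = (\<Sum>\<sigma>\<in>facets K. \<Sum>\<tau>\<in>?A. if \<tau> \<subseteq> \<sigma> then 1 else 0)" by (rule sum.swap)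
  also have "\<dots> = (\<Sum>\<sigma>\<in>facets K. if v \<in> \<sigma> then 2 else 0)"
  proof (intro sum.cong refl)
    fix \<sigma> assume s: "\<sigma> \<in> facets K"
    have eq: "(\<Sum>\<tau>\<in>?A. if \<tau> \<subseteq> \<sigma> then 1 else 0) = card {\<tau>\<in>?A. \<tau> \<subseteq> \<sigma>}" by (simp add: sum.If_cases Int_def conj_ac)
    show "(\<Sum>\<tau>\<in>?A. if \<tau> \<subseteq> \<sigma> then 1 else 0) = (if v \<in> \<sigma> then 2 else (0::nat))"
    proof (cases "v \<in> \<sigma>")
      case False
      then have "{\<tau>\<in>?A. \<tau> \<subseteq> \<sigma>} = {}" by auto
      then show ?thesis unfolding eq using False by (simp only: card.empty if_False)
    next
      case True
      have "\<sigma> \<noteq> {v}" using facet_card[OF s] by auto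
      then obtain w where w: "w \<in> \<sigma>" "v \<noteq> w" using True by blast
      obtain x where x: "\<sigma> = {v,w,x}" "distinct [v,w,x]" using facet_third[OF s True w] .
      have "{\<tau>\<in>?A. \<tau> \<subseteq> \<sigma>} = {\<tau>. card \<tau> = 2 \<and> v \<in> \<tau> \<and> \<tau> \<subseteq> \<sigma>}" using K_down[OF facet_K[OF s]] by auto
      also have "\<dots> = {{v,w},{v,x}}" by (rule edges_of_facet[OF True x])
      finally have e: "{\<tau>\<in>?A. \<tau> \<subseteq> \<sigma>} = {{v,w},{v,x}}" .
      have "{v,w} \<noteq> {v,x}" using x(2) by (auto simp: doubleton_eq_iff)
      then show ?thesis unfolding eq e using True by simp
    qed
  qed
  also have "\<dots> = 2 * card (star {v})" by (simp add: star_def sum.If_cases Int_def mult.commute)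
  finally have 1: "(\<Sum>\<tau>\<in>?A. card (star \<tau>)) = 2 * card (star {v})" .
  have "?A = E v \<union> B v" "E v \<inter> B v = {}" by (auto simp: E_def B_def interior2_iff bdry_2faces_iff)
  then have "(\<Sum>\<tau>\<in>?A. card (star \<tau>)) = (\<Sum>\<tau>\<in>E v. card (star \<tau>)) + (\<Sum>\<tau>\<in>B v. card (star \<tau>))"
    by (simp add: sum.union_disjoint)
  also have "(\<Sum>\<tau>\<in>E v. card (star \<tau>)) = 2 * card (E v)" using star_interior by (simp add: E_def)
  also have "(\<Sum>\<tau>\<in>B v. card (star \<tau>)) = card (B v)" by (simp add: B_def bdry_2faces_iff)
  finally show ?thesis using 1 by simp
qed

lemma jump_outside: "jump F \<tau> = jump G \<tau>" if "\<And>\<sigma>. \<sigma> \<in> facets K \<Longrightarrow> \<tau> \<subseteq> \<sigma> \<Longrightarrow> F \<sigma> = G \<sigma>"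
  using that by (intro jump_cong) (auto simp: star_def)

text \<open>At a vertex the jump map has corank one on an interior vertex, where its image is cut out by
  \<open>bound\<close>, and is surjective at a boundary vertex; both follow by counting dimensions.\<close>
lemma local_potential:
  assumes g: "v \<in> interior_vertices \<Longrightarrow> bound g v = 0"
  shows "\<exists>p. \<forall>\<tau>\<in>interior2 K. v \<in> \<tau> \<longrightarrow> jump p \<tau> = g \<tau>"
proof -
  let ?F = "star {v}" let ?E = "{\<tau>\<in>interior2 K. v \<in> \<tau>}"
  let ?L = "\<lambda>p \<tau>. if \<tau> \<in> ?E then jump p \<tau> else 0"
  obtain \<sigma>0 where s0: "\<sigma>0 \<in> ?F" using in_facet[OF K_vertex[of v]] by (auto simp: star_def)
  obtain G where G: "finite G" "supported ?F \<subseteq> fs.span G" using supported_span[of ?F] by auto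
  obtain G' where G': "finite G'" "supported ?E \<subseteq> fs.span G'" using supported_span[of ?E] by auto
  have lin: "Vector_Spaces.linear (\<lambda>c f x. c * f x) (\<lambda>c f x. c * f x) ?L"
    by unfold_locales (simp_all add: fun_eq_iff plus_fun_def jump_add jump_scale)
  let ?N = "{p\<in>supported ?F. ?L p = 0}"
  have sN: "fs.subspace ?N"
    using supported_subspace[of ?F] unfolding fs.subspace_def
    by (auto simp: fun_eq_iff plus_fun_def jump_add jump_scale jump_def)
  have const: "p a = p b" if p: "p \<in> ?N" and ab: "a \<in> ?F" "b \<in> ?F" for p a b
  proof (rule local_constant[OF K_vertex[of v]])
    show "jump p \<tau> = 0" if "\<tau> \<in> interior2 K" "{v} \<subseteq> \<tau>" for \<tau>
      using p that fun_cong[of "?L p" 0 \<tau>] by auto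
  qed (use ab in \<open>auto simp: star_def\<close>)
  let ?o = "\<lambda>\<sigma>. if \<sigma> \<in> ?F then 1 else (0::real)"
  have oN: "?o \<in> ?N"
  proof -
    have "jump ?o \<tau> = 0" if "\<tau> \<in> ?E" for \<tau>
    proof -
      have "jump ?o \<tau> = jump (\<lambda>\<sigma>. 1) \<tau>" by (rule jump_outside) (use that in \<open>auto simp: star_def\<close>)
      then show ?thesis using jump_const[of \<tau> 1] that by simp
    qed
    then show ?thesis by (auto simp: supported_def fun_eq_iff)
  qed
  \<comment> \<open>The kernel consists of the constants on the star, so the rank is one less than
    the number of facets at \<open>v\<close>.\<close>
  have "fs.dim ?N = fs.dim {p\<in>?N. p \<sigma>0 = 0} + 1"
    by (rule fs_dim_functional[OF sN _ G(1) _ _ oN]) (use G(2) s0 in auto)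
  moreover have "{p\<in>?N. p \<sigma>0 = 0} = {0}"
  proof
    show "{p\<in>?N. p \<sigma>0 = 0} \<subseteq> {0}"
    proof
      fix p assume p: "p \<in> {p\<in>?N. p \<sigma>0 = 0}"
      have "p \<sigma> = 0" for \<sigma> using const[of p \<sigma>0 \<sigma>] p s0 by (cases "\<sigma> \<in> ?F") (auto simp: supported_def)
      then show "p \<in> {0}" by (auto simp: fun_eq_iff)
    qed
    show "{0} \<subseteq> {p\<in>?N. p \<sigma>0 = 0}" using fs.subspace_0[OF sN] by auto
  qed
  ultimately have "fs.dim ?N = 1" using fs_dim_zero by simp
  then have rank: "card ?F = 1 + fs.dim (?L ` supported ?F)"
    using ff.dim_kernel_image[OF lin supported_subspace G(2,1)] supported_dim[of ?F] by simp
  have subL: "fs.subspace (?L ` supported ?F)" by (rule ff.linear_subspace_image[OF lin supported_subspace])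
  let ?g = "\<lambda>\<tau>. if \<tau> \<in> ?E then g \<tau> else 0"
  have gE: "?g \<in> supported ?E" by (auto simp: supported_def)
  have "?g \<in> ?L ` supported ?F"
  proof (cases "v \<in> interior_vertices")
    case True
    have B0: "{\<tau>\<in>bdry_2faces K. v \<in> \<tau>} = {}" using True by (auto simp: interior_vertex_iff)
    have cE: "card ?E = card ?F" using local_counts[of v] unfolding B0 by simp
    let ?W = "{h\<in>supported ?E. bound h v = 0}"
    have add: "bound (\<lambda>x. f x + h x) v = bound f v + bound h v" and scale: "bound (\<lambda>x. c * f x) v = c * bound f v" for f h c
      by (simp_all add: bound_def distrib_left sum.distrib sum_distrib_left mult_ac)
    have "?E \<noteq> {}" using cE s0 by (metis card.empty card_eq_0_iff empty_iff finite)
    then obtain \<tau>0 where t0: "\<tau>0 \<in> ?E" by blast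
    let ?h = "\<lambda>\<tau>. if \<tau> = \<tau>0 then 1 else (0::real)"
    have "bound ?h v = inc v \<tau>0" using t0 by (simp add: bound_def if_distrib cong: if_cong)
    then have "bound ?h v \<noteq> 0" using inc_pm1[of \<tau>0 v] t0 by (auto simp: interior2_iff)
    moreover have "?h \<in> supported ?E" using t0 by (auto simp: supported_def)
    ultimately have "fs.dim (supported ?E) = fs.dim ?W + 1"
      by (intro fs_dim_functional[OF supported_subspace G'(2,1) add scale])
    then have "card ?E = fs.dim ?W + 1" using supported_dim[of ?E] by simp
    then have "fs.dim ?W \<le> fs.dim (?L ` supported ?F)" using rank cE by simp
    moreover have "?L ` supported ?F \<subseteq> ?W"
    proof (rule image_subsetI)
      fix p
      have "bound (?L p) v = bound (jump p) v" unfolding bound_eq by (intro sum.cong) auto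
      then show "?L p \<in> ?W" using bound_jump[OF True] by (auto simp: supported_def)
    qed
    ultimately have eq: "?L ` supported ?F = ?W"
      by (intro fs.subspace_eq_of_dim_le[OF subL _ _ G'(1)]) (use G'(2) in auto)
    have "bound ?g v = bound g v" unfolding bound_eq by (intro sum.cong) auto
    then have "?g \<in> ?W" using gE g[OF True] by simp
    then show ?thesis unfolding eq .
  next
    case False
    then have "{\<tau>\<in>bdry_2faces K. v \<in> \<tau>} \<noteq> {}" by (auto simp: interior_vertex_iff)
    then have "card {\<tau>\<in>bdry_2faces K. v \<in> \<tau>} > 0" by (simp add: card_gt_0_iff)
    then have "card ?E < card ?F" using local_counts[of v] by linarith
    then have "fs.dim (supported ?E) \<le> fs.dim (?L ` supported ?F)" using rank supported_dim[of ?E] by simp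
    moreover have "?L ` supported ?F \<subseteq> supported ?E" by (auto simp: supported_def)
    ultimately have "?L ` supported ?F = supported ?E"
      by (intro fs.subspace_eq_of_dim_le[OF subL _ G'(2,1)])
    then show ?thesis using gE by simp
  qed
  then obtain p where p: "?g = ?L p" by blast
  show ?thesis
  proof (intro exI[of _ p] ballI impI)
    fix \<tau> assume "\<tau> \<in> interior2 K" "v \<in> \<tau>"
    then show "jump p \<tau> = g \<tau>" using fun_cong[OF p, of \<tau>] by simp
  qed
qed

text \<open>Local potentials at two rays differ by a constant on the facets containing both. These
  constants form a cocycle on the link; as it is a coboundary, the local potentials can be shifted
  until they agree.\<close>

theorem global_potential:
  assumes sc: "simply_connected (lk_space K u)" and g: "\<And>v. v \<in> interior_vertices \<Longrightarrow> bound g v = 0"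
  shows "\<exists>p. \<forall>\<tau>\<in>interior2 K. jump p \<tau> = g \<tau>"
proof -
  obtain p where p: "\<And>v \<tau>. \<tau> \<in> interior2 K \<Longrightarrow> v \<in> \<tau> \<Longrightarrow> jump (p v) \<tau> = g \<tau>"
    using local_potential[OF g] by metis
  \<comment> \<open>Evaluated on an arbitrary facet through both rays. Two such facets give the same
    value, as both potentials have the same jump across the 2-face \<open>{v,w}\<close>.\<close>
  define c where "c v w = p v (SOME \<sigma>. \<sigma> \<in> star {v,w}) - p w (SOME \<sigma>. \<sigma> \<in> star {v,w})" for v w
  have c: "c v w = p v \<sigma> - p w \<sigma>" if s: "\<sigma> \<in> facets K" "v \<in> \<sigma>" "w \<in> \<sigma>" for v w \<sigma>
  proof -
    define \<sigma>' where "\<sigma>' = (SOME \<sigma>. \<sigma> \<in> star {v,w})"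
    have "\<sigma>' \<in> star {v,w}" unfolding \<sigma>'_def by (rule someI[of _ \<sigma>]) (use s in \<open>auto simp: star_def\<close>)
    then have s': "\<sigma>' \<in> facets K" "v \<in> \<sigma>'" "w \<in> \<sigma>'" by (auto simp: star_def)
    have "p v \<sigma> - p w \<sigma> = p v \<sigma>' - p w \<sigma>'"
    proof (cases "v = w \<or> \<sigma> = \<sigma>'")
      case False
      have c2: "card (\<sigma> \<inter> \<sigma>') = 2"
      proof -
        have "{v,w} \<subseteq> \<sigma> \<inter> \<sigma>'" using s s' by auto
        then have "card {v,w} \<le> card (\<sigma> \<inter> \<sigma>')" by (intro card_mono) auto
        then have "2 \<le> card (\<sigma> \<inter> \<sigma>')" using False by simp
        moreover have "card (\<sigma> \<inter> \<sigma>') < 3"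
        proof (rule ccontr)
          assume "\<not> card (\<sigma> \<inter> \<sigma>') < 3"
          then have "\<sigma> \<inter> \<sigma>' = \<sigma>" "\<sigma> \<inter> \<sigma>' = \<sigma>'"
            using card_seteq[of \<sigma> "\<sigma> \<inter> \<sigma>'"] card_seteq[of \<sigma>' "\<sigma> \<inter> \<sigma>'"] facet_card s s' by auto
          then show False using False by blast
        qed
        ultimately show ?thesis by simp
      qed
      have i: "\<sigma> \<inter> \<sigma>' \<in> interior2 K" using adjacent_interior[OF s(1) s'(1) c2] by blast
      have "jump (\<lambda>\<sigma>. p v \<sigma> + (-1) * p w \<sigma>) (\<sigma> \<inter> \<sigma>') = 0"
        unfolding jump_add jump_scale using p[OF i] s s' by simp
      from equal_if_jump_zero[OF s(1) s'(1) c2 this] show ?thesis by simp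
    qed auto
    then show ?thesis by (simp add: c_def \<sigma>'_def)
  qed
  have "\<exists>b. \<forall>A\<in>K. \<forall>v\<in>A. \<forall>w\<in>A. c v w = b w - b v"
  proof (rule cocycle_is_coboundary[OF sc])
    fix A v w x assume A: "A \<in> K" "v \<in> A" "w \<in> A" "x \<in> A"
    obtain \<sigma> where s: "\<sigma> \<in> facets K" "A \<subseteq> \<sigma>" using in_facet[OF A(1)] by blast
    have "v \<in> \<sigma>" "w \<in> \<sigma>" "x \<in> \<sigma>" using s(2) A by auto
    then show "c v w + c w x = c v x" using c[OF s(1)] by simp
  qed
  then obtain b where b: "\<And>A v w. A \<in> K \<Longrightarrow> v \<in> A \<Longrightarrow> w \<in> A \<Longrightarrow> c v w = b w - b v" by blast
  define q where "q \<sigma> = p (SOME v. v \<in> \<sigma>) \<sigma> + b (SOME v. v \<in> \<sigma>)" for \<sigma>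
  have q: "q \<sigma> = p v \<sigma> + b v" if s: "\<sigma> \<in> facets K" "v \<in> \<sigma>" for \<sigma> v
  proof -
    have w: "(SOME v. v \<in> \<sigma>) \<in> \<sigma>" using s(2) by (rule someI)
    show ?thesis unfolding q_def using c[OF s(1) s(2) w] b[OF facet_K[OF s(1)] s(2) w] by simp
  qed
  show ?thesis
  proof (intro exI[of _ q] ballI)
    fix \<tau> assume t: "\<tau> \<in> interior2 K"
    then obtain v where v: "v \<in> \<tau>" by (auto simp: interior2_iff card_2_iff)
    have "jump q \<tau> = jump (\<lambda>\<sigma>. p v \<sigma> + b v) \<tau>" by (rule jump_outside) (use q v in blast)
    also have "\<dots> = g \<tau>" unfolding jump_add using jump_const[OF t] p[OF t v] by simp
    finally show "jump q \<tau> = g \<tau>" .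
  qed
qed

end

section \<open>Counting splines\<close>

context pure_fan
begin

definition jmp :: "('v set \<Rightarrow> real^3 \<Rightarrow> real) \<Rightarrow> 'v set \<Rightarrow> real^3 \<Rightarrow> real" where
  "jmp F = (\<lambda>\<tau> p. if \<tau> \<in> interior2 K then jump (\<lambda>\<sigma>. F \<sigma> p) \<tau> else 0)"

definition bdm :: "('v set \<Rightarrow> real^3 \<Rightarrow> real) \<Rightarrow> 'v \<Rightarrow> real^3 \<Rightarrow> real" where
  "bdm g = (\<lambda>v p. if v \<in> interior_vertices then bound (\<lambda>\<tau>. g \<tau> p) v else 0)"

text \<open>The coefficients are abstract because the count is run twice: with \<open>J\<close> the
  ideals of the 2-faces, and with \<open>J\<close> constantly \<open>X\<close>.\<close>

definition splines :: "(real^3 \<Rightarrow> real) set \<Rightarrow> ('v set \<Rightarrow> (real^3 \<Rightarrow> real) set) \<Rightarrow> ('v set \<Rightarrow> real^3 \<Rightarrow> real) set" where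
  "splines X J = {F \<in> direct_sum (facets K) (\<lambda>_. X). \<forall>\<tau>\<in>interior2 K. jmp F \<tau> \<in> J \<tau>}"

lemma bound_add: "bound (\<lambda>x. f x + h x) v = bound f v + bound h v"
  and bound_scale: "bound (\<lambda>x. c * f x) v = c * bound f v"
  by (simp_all add: bound_def distrib_left sum.distrib sum_distrib_left mult_ac)

lemma jmp_linear: "Vector_Spaces.linear (\<lambda>c F i x. c * F i x) (\<lambda>c F i x. c * F i x) jmp"
  by unfold_locales (simp_all add: jmp_def fun_eq_iff jump_add jump_scale)

lemma bdm_linear: "Vector_Spaces.linear (\<lambda>c F i x. c * F i x) (\<lambda>c F i x. c * F i x) bdm"
  by unfold_locales (simp_all add: bdm_def fun_eq_iff bound_add bound_scale)

lemma facets_nonempty: "facets K \<noteq> {}"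
  using in_facet[OF K_empty] by blast

text \<open>Rank-nullity for \<open>jmp\<close> and for \<open>bdm\<close>. The kernel of
  \<open>jmp\<close> is one copy of \<open>X\<close>, since equal values propagate over all facets;
  its image is the kernel of \<open>bdm\<close>, by \<open>bound_jump\<close> and
  \<open>global_potential\<close>.\<close>

lemma spline_count:
  assumes sc: "simply_connected (lk_space K u)"
    and X: "fs.subspace X" "X \<subseteq> fs.span G" "finite G"
    and J: "\<And>\<tau>. \<tau> \<in> interior2 K \<Longrightarrow> fs.subspace (J \<tau>)" "\<And>\<tau>. \<tau> \<in> interior2 K \<Longrightarrow> J \<tau> \<subseteq> X"
  shows "ts.dim (splines X J) + ts.dim (bdm ` direct_sum (interior2 K) J) = fs.dim X + (\<Sum>\<tau>\<in>interior2 K. fs.dim (J \<tau>))"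
proof -
  let ?C = "direct_sum (interior2 K) J"
  let ?Z = "{g\<in>?C. bdm g = 0}"
  obtain G1 where G1: "finite G1" "direct_sum (facets K) (\<lambda>_. X) \<subseteq> ts.span G1"
    using direct_sum_finite_span[of "facets K" G "\<lambda>_. X"] X by auto
  have JG: "J \<tau> \<subseteq> fs.span G" if "\<tau> \<in> interior2 K" for \<tau> using J(2)[OF that] X(2) by blast
  obtain G2 where G2: "finite G2" "?C \<subseteq> ts.span G2"
    using direct_sum_finite_span[of "interior2 K" G J] X(3) JG by auto
  have dsub: "ts.subspace (direct_sum (facets K) (\<lambda>_. X))" by (rule direct_sum_subspace[OF X(1)])
  have Ssub: "ts.subspace (splines X J)"
  proof (rule ts.subspaceI)
    show "0 \<in> splines X J"
      using ts.subspace_0[OF dsub] tt.linear_0[OF jmp_linear] fs.subspace_0[OF J(1)] by (simp add: splines_def)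
    show "F + F' \<in> splines X J" if "F \<in> splines X J" "F' \<in> splines X J" for F F'
      using that ts.subspace_add[OF dsub] tt.linear_add[OF jmp_linear, of F F'] fs.subspace_add[OF J(1)]
      by (simp add: splines_def)
    show "(\<lambda>i x. c * F i x) \<in> splines X J" if "F \<in> splines X J" for c F
      using that ts.subspace_scale[OF dsub] tt.linear_scale[OF jmp_linear, of c F] fs.subspace_scale[OF J(1)]
      by (simp add: splines_def)
  qed
  have Sspan: "splines X J \<subseteq> ts.span G1" using G1(2) by (auto simp: splines_def)
  let ?e = "\<lambda>h \<sigma>. if \<sigma> \<in> facets K then h else (\<lambda>p. 0::real)"
  have elin: "Vector_Spaces.linear (\<lambda>c f x. c * f x) (\<lambda>c F i x. c * F i x) ?e"
    by unfold_locales (auto simp: fun_eq_iff)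
  have ker: "{F\<in>splines X J. jmp F = 0} = ?e ` X"
  proof
    show "{F\<in>splines X J. jmp F = 0} \<subseteq> ?e ` X"
    proof
      fix F assume F: "F \<in> {F\<in>splines X J. jmp F = 0}"
      obtain \<sigma>0 where s0: "\<sigma>0 \<in> facets K" using facets_nonempty by blast
      have "F \<sigma> p = F \<sigma>0 p" if s: "\<sigma> \<in> facets K" for \<sigma> p
      proof (rule local_constant[OF K_empty, of "\<lambda>\<sigma>. F \<sigma> p"])
        fix \<tau> assume t: "\<tau> \<in> interior2 K"
        have "jmp F \<tau> p = 0" using F by simp
        then show "jump (\<lambda>\<sigma>. F \<sigma> p) \<tau> = 0" using t by (simp add: jmp_def)
      qed (use s s0 in auto)
      then have "F \<sigma> = F \<sigma>0" if "\<sigma> \<in> facets K" for \<sigma> using that by blast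
      moreover have "F \<sigma> = (\<lambda>p. 0)" if "\<sigma> \<notin> facets K" for \<sigma> using F that by (auto simp: splines_def direct_sum_def)
      ultimately have "F = ?e (F \<sigma>0)" by auto
      moreover have "F \<sigma>0 \<in> X" using F s0 by (auto simp: splines_def direct_sum_def)
      ultimately show "F \<in> ?e ` X" by blast
    qed
    show "?e ` X \<subseteq> {F\<in>splines X J. jmp F = 0}"
    proof (rule image_subsetI)
      fix h assume h: "h \<in> X"
      have "jmp (?e h) \<tau> p = 0" for \<tau> p
      proof (cases "\<tau> \<in> interior2 K")
        case True
        have "jump (\<lambda>\<sigma>. ?e h \<sigma> p) \<tau> = jump (\<lambda>\<sigma>. h p) \<tau>" by (rule jump_outside) simp
        then show ?thesis using jump_const[OF True] by (simp add: jmp_def)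
      qed (simp add: jmp_def)
      then have "jmp (?e h) = 0" by (simp add: fun_eq_iff)
      then show "?e h \<in> {F\<in>splines X J. jmp F = 0}"
        using h fs.subspace_0[OF J(1)] by (auto simp: splines_def direct_sum_def)
    qed
  qed
  have dker: "ts.dim (?e ` X) = fs.dim X"
  proof -
    have "{h\<in>X. ?e h = 0} = {0}"
    proof
      show "{h\<in>X. ?e h = 0} \<subseteq> {0}"
      proof
        fix h assume h: "h \<in> {h\<in>X. ?e h = 0}"
        obtain \<sigma>0 where s0: "\<sigma>0 \<in> facets K" using facets_nonempty by blast
        have "?e h = 0" using h by blast
        then have "?e h \<sigma>0 = 0 \<sigma>0" by (rule fun_cong)
        then show "h \<in> {0}" using s0 by simp
      qed
      show "{0} \<subseteq> {h\<in>X. ?e h = 0}" using fs.subspace_0[OF X(1)] by (auto simp: fun_eq_iff)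
    qed
    then have "fs.dim X = fs.dim {0 :: real^3 \<Rightarrow> real} + ts.dim (?e ` X)"
      using ft.dim_kernel_image[OF elin X] by (simp only:)
    then show ?thesis using fs_dim_zero by simp
  qed
  have im: "jmp ` splines X J = ?Z"
  proof
    show "jmp ` splines X J \<subseteq> ?Z"
    proof (rule image_subsetI)
      fix F assume F: "F \<in> splines X J"
      have "jmp F \<in> ?C" using F by (auto simp: splines_def direct_sum_def) (simp add: jmp_def)
      moreover have "bdm (jmp F) v p = 0" for v p
      proof (cases "v \<in> interior_vertices")
        case True
        have "bound (\<lambda>\<tau>. jmp F \<tau> p) v = bound (jump (\<lambda>\<sigma>. F \<sigma> p)) v"
          unfolding bound_def by (intro sum.cong) (auto simp: jmp_def)
        then show ?thesis using bound_jump[OF True] True by (simp add: bdm_def)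
      qed (simp add: bdm_def)
      ultimately show "jmp F \<in> ?Z" by (simp add: fun_eq_iff)
    qed
    show "?Z \<subseteq> jmp ` splines X J"
    proof
      fix g assume g: "g \<in> ?Z"
      have "\<exists>P. \<forall>\<tau>\<in>interior2 K. jump P \<tau> = g \<tau> p" for p
      proof (rule global_potential[OF sc])
        fix v assume "v \<in> interior_vertices"
        moreover have "bdm g v p = 0" using g by simp
        ultimately show "bound (\<lambda>\<tau>. g \<tau> p) v = 0" by (simp add: bdm_def)
      qed
      then obtain P where P: "\<And>p \<tau>. \<tau> \<in> interior2 K \<Longrightarrow> jump (P p) \<tau> = g \<tau> p" by metis
      obtain \<sigma>0 where s0: "\<sigma>0 \<in> facets K" using facets_nonempty by blast
      \<comment> \<open>The pointwise potentials depend on \<open>p\<close> in no controlled way.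
        Normalised to 0 on one facet, they are sums of signed jumps along paths of facets and hence
        lie in \<open>X\<close>.\<close>
      define F where "F \<sigma> p = (if \<sigma> \<in> facets K then P p \<sigma> + - P p \<sigma>0 else 0)" for \<sigma> p
      have jF: "jump (\<lambda>\<sigma>. F \<sigma> p) \<tau> = g \<tau> p" if t: "\<tau> \<in> interior2 K" for \<tau> p
      proof -
        have "jump (\<lambda>\<sigma>. F \<sigma> p) \<tau> = jump (\<lambda>\<sigma>. P p \<sigma> + - P p \<sigma>0) \<tau>"
          by (rule jump_outside) (simp add: F_def)
        also have "\<dots> = g \<tau> p" unfolding jump_add jump_const[OF t] using P[OF t] by simp
        finally show ?thesis .
      qed
      have "F \<sigma> \<in> X" if s: "\<sigma> \<in> facets K" for \<sigma>
      proof -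
        have "(facet_adj K {})\<^sup>*\<^sup>* \<sigma>0 \<sigma>" using her s s0 K_empty unfolding hereditary_def by blast
        then show ?thesis
        proof (induction rule: rtranclp_induct)
          case base
          have "F \<sigma>0 = 0" by (auto simp: F_def fun_eq_iff)
          then show ?case using fs.subspace_0[OF X(1)] by (simp only:)
        next
          case (step a b)
          then have ab: "a \<in> facets K" "b \<in> facets K" "card (a \<inter> b) = 2" by (auto simp: facet_adj_def)
          note i = adjacent_interior[OF ab]
          have "a \<in> star (a \<inter> b)" using i(2) by simp
          then obtain b' where b': "star (a \<inter> b) = {a,b'}" "a \<noteq> b'" "oside b' (a \<inter> b) = - oside a (a \<inter> b)"
            using interior_star[OF i(1)] by metis
          have bb: "b' = b" using b' i by auto
          have pm: "oside a (a \<inter> b) = 1 \<or> oside a (a \<inter> b) = -1" using oside_pm1[OF i(1) \<open>a \<in> star _\<close>] .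
          have "F b p = F a p + (- oside a (a \<inter> b)) * g (a \<inter> b) p" for p
            using jump_eq[OF b', of "\<lambda>\<sigma>. F \<sigma> p"] jF[OF i(1), of p] pm bb by auto
          then have "F b = F a + (\<lambda>p. (- oside a (a \<inter> b)) * g (a \<inter> b) p)" by (simp add: fun_eq_iff)
          moreover have "g (a \<inter> b) \<in> X" using g J(2)[OF i(1)] i(1) by (auto simp: direct_sum_def)
          ultimately show ?case using step(3) fs.subspace_add[OF X(1)] fs.subspace_scale[OF X(1)] by metis
        qed
      qed
      then have "F \<in> direct_sum (facets K) (\<lambda>_. X)" by (auto simp: direct_sum_def F_def)
      moreover have jm: "jmp F = g"
      proof (intro ext)
        fix \<tau> p show "jmp F \<tau> p = g \<tau> p"
          using jF[of \<tau> p] g by (cases "\<tau> \<in> interior2 K") (auto simp: jmp_def direct_sum_def)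
      qed
      ultimately have "F \<in> splines X J" using g by (auto simp: splines_def direct_sum_def)
      then show "g \<in> jmp ` splines X J" using jm by blast
    qed
  qed
  have "ts.dim (splines X J) = fs.dim X + ts.dim ?Z"
    using tt.dim_kernel_image[OF jmp_linear Ssub Sspan G1(1)] unfolding ker dker im .
  moreover have "ts.dim ?C = ts.dim ?Z + ts.dim (bdm ` ?C)"
    using tt.dim_kernel_image[OF bdm_linear direct_sum_subspace[OF J(1)] G2(2,1)] .
  moreover have "ts.dim ?C = (\<Sum>\<tau>\<in>interior2 K. fs.dim (J \<tau>))"
    using direct_sum_dim[of "interior2 K" G J] X(3) JG J(1) by auto
  ultimately show ?thesis by simp
qed

lemma interior_vertices_closed: "bdry_2faces K = {} \<Longrightarrow> interior_vertices = UNIV"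
  by (auto simp: interior_vertex_iff)

lemma ex_boundary_vertex: "bdry_2faces K \<noteq> {} \<Longrightarrow> \<exists>v. v \<notin> interior_vertices"
proof -
  assume "bdry_2faces K \<noteq> {}"
  then obtain \<tau> where t: "\<tau> \<in> bdry_2faces K" by blast
  then obtain v where "v \<in> \<tau>" by (auto simp: bdry_2faces_def card_2_iff)
  then show ?thesis using t interior_vertex_iff by blast
qed

lemma closed_image_dim:
  fixes Jv :: "'v \<Rightarrow> (real^3 \<Rightarrow> real) set"
  assumes X: "X \<subseteq> fs.span G" "finite G"
    and Jv: "\<And>v. fs.subspace (Jv v)" "\<And>v. Jv v \<subseteq> X"
    and sur: "(\<lambda>f. \<Sum>v\<in>UNIV. f v) ` direct_sum (UNIV :: 'v set) Jv = J0"
  shows "ts.dim {f\<in>direct_sum UNIV Jv. (\<Sum>v\<in>UNIV. f v) = 0} + fs.dim J0 = (\<Sum>v\<in>UNIV. fs.dim (Jv v))"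
proof -
  have lin: "Vector_Spaces.linear (\<lambda>c F i x. c * F i x) (\<lambda>c f x. c * f x) (\<lambda>f::'v \<Rightarrow> real^3 \<Rightarrow> real. \<Sum>v\<in>UNIV. f v)"
  proof unfold_locales
    fix c :: real and f :: "'v \<Rightarrow> real^3 \<Rightarrow> real"
    have "(\<Sum>v\<in>A. (\<lambda>x. c * f v x)) = (\<lambda>x. c * (\<Sum>v\<in>A. f v) x)" for A
      by (induction A rule: infinite_finite_induct) (auto simp: fun_eq_iff distrib_left)
    then show "(\<Sum>v\<in>UNIV. (\<lambda>x. c * f v x)) = (\<lambda>x. c * (\<Sum>v\<in>UNIV. f v) x)" .
  qed (simp add: sum.distrib)
  have JG: "Jv v \<subseteq> fs.span G" for v using Jv(2) X(1) by blast
  obtain G2 where G2: "finite G2" "direct_sum (UNIV :: 'v set) Jv \<subseteq> ts.span G2"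
    using direct_sum_finite_span[of "UNIV :: 'v set" G Jv] X(2) JG by auto
  have "ts.dim (direct_sum UNIV Jv) = (\<Sum>v\<in>UNIV. fs.dim (Jv v))"
    using direct_sum_dim[of "UNIV :: 'v set" G Jv] X(2) JG Jv(1) by auto
  moreover have "ts.subspace (direct_sum UNIV Jv)" by (rule direct_sum_subspace) (rule Jv(1))
  ultimately show ?thesis
    using tf.dim_kernel_image[OF lin _ G2(2,1)] sur by simp
qed

definition single :: "'v \<Rightarrow> (real^3 \<Rightarrow> real) \<Rightarrow> 'v \<Rightarrow> real^3 \<Rightarrow> real" where
  "single v h = (\<lambda>w. if w = v \<and> v \<in> interior_vertices then h else (\<lambda>p. 0))"

lemma single_decomposition:
  assumes "f \<in> direct_sum interior_vertices W"
  shows "f = (\<Sum>v\<in>UNIV. single v (f v))"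
proof (intro ext)
  fix w p
  have s: "(\<Sum>v\<in>A. single v (f v)) w p = (\<Sum>v\<in>A. single v (f v) w p)" for A
    by (induction A rule: infinite_finite_induct) auto
  have "(\<Sum>v\<in>UNIV. single v (f v) w p) = (\<Sum>v\<in>UNIV. if v = w then single w (f w) w p else 0)"
    by (intro sum.cong) (auto simp: single_def)
  also have "\<dots> = f w p" using assms by (auto simp: single_def direct_sum_def)
  finally show "f w p = (\<Sum>v\<in>UNIV. single v (f v)) w p" unfolding s ..
qed

lemma vertices_connected:
  assumes adj: "\<And>v w. {v,w} \<in> K \<Longrightarrow> v \<noteq> w \<Longrightarrow> R v w" and refl: "\<And>v. R v v"
    and trans: "\<And>v w x. R v w \<Longrightarrow> R w x \<Longrightarrow> R v x"
  shows "R v w"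
proof -
  have same: "R x y" if "\<sigma> \<in> facets K" "x \<in> \<sigma>" "y \<in> \<sigma>" for \<sigma> x y
    using adj[of x y] refl K_down[OF facet_K[OF that(1)], of "{x,y}"] that by (cases "x = y") auto
  obtain a where a: "a \<in> facets K" "v \<in> a" using in_facet[OF K_vertex[of v]] by auto
  obtain b where b: "b \<in> facets K" "w \<in> b" using in_facet[OF K_vertex[of w]] by auto
  have "(facet_adj K {})\<^sup>*\<^sup>* a b" using her a b K_empty unfolding hereditary_def by blast
  then have "b \<in> facets K \<longrightarrow> (\<forall>x\<in>b. R v x)"
  proof (induction rule: rtranclp_induct)
    case base show ?case using same[OF a(1,2)] by blast
  next
    case (step y z)
    then have yz: "y \<in> facets K" "z \<in> facets K" "card (y \<inter> z) = 2" by (auto simp: facet_adj_def)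
    then obtain x where "x \<in> y" "x \<in> z" by (metis Int_iff card.empty ex_in_conv zero_neq_numeral)
    then show ?case using step(3) yz same[OF yz(2)] trans by blast
  qed
  then show ?thesis using b by blast
qed

lemma sum_bdm_zero:
  assumes "bdry_2faces K = {}" shows "(\<Sum>v\<in>UNIV. bdm g v) = 0"
proof
  fix p
  have s: "(\<Sum>v\<in>A. bdm g v) p = (\<Sum>v\<in>A. bdm g v p)" for A
    by (induction A rule: infinite_finite_induct) auto
  have "(\<Sum>v\<in>UNIV. bdm g v p) = (\<Sum>v\<in>UNIV. \<Sum>\<tau>\<in>interior2 K. inc v \<tau> * g \<tau> p)"
    using interior_vertices_closed[OF assms] by (simp add: bdm_def bound_def)
  also have "\<dots> = (\<Sum>\<tau>\<in>interior2 K. (\<Sum>v\<in>UNIV. inc v \<tau>) * g \<tau> p)"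
    by (subst sum.swap) (simp add: sum_distrib_right)
  also have "\<dots> = 0"
  proof (rule sum.neutral, rule ballI)
    fix \<tau> assume "\<tau> \<in> interior2 K"
    then have t: "card \<tau> = 2" by (simp add: interior2_iff)
    have "(\<Sum>v\<in>UNIV. inc v \<tau>) = (\<Sum>v\<in>{fst (orient \<tau>), snd (orient \<tau>)}. inc v \<tau>)"
      by (rule sum.mono_neutral_right) (auto simp: inc_def)
    also have "\<dots> = 0" using orient(2)[OF t] by (simp add: inc_def)
    finally show "(\<Sum>v\<in>UNIV. inc v \<tau>) * g \<tau> p = 0" by simp
  qed
  finally show "(\<Sum>v\<in>UNIV. bdm g v) p = 0 p" using s by simp
qed

text \<open>A value can be moved along edges from ray to ray, so the differences of
  \<open>single\<close> lie in the image. With a boundary the value disappears at a boundary ray;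
  without one only the total is preserved.\<close>

lemma const_image:
  assumes X: "fs.subspace X"
  shows "bdry_2faces K \<noteq> {} \<Longrightarrow> bdm ` direct_sum (interior2 K) (\<lambda>_. X) = direct_sum interior_vertices (\<lambda>_. X)"
    and "bdry_2faces K = {} \<Longrightarrow> bdm ` direct_sum (interior2 K) (\<lambda>_. X) = {f\<in>direct_sum (UNIV :: 'v set) (\<lambda>_. X). (\<Sum>v\<in>UNIV. f v) = 0}"
proof -
  let ?I = "bdm ` direct_sum (interior2 K) (\<lambda>_. X)"
  have Isub: "ts.subspace ?I" by (rule tt.linear_subspace_image[OF bdm_linear direct_sum_subspace[OF X]])
  have "\<forall>h\<in>X. single v h - single w h \<in> ?I" for v w
  proof (rule vertices_connected[of "\<lambda>v w. \<forall>h\<in>X. single v h - single w h \<in> ?I"])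
    show "\<forall>h\<in>X. single v h - single v h \<in> ?I" for v using ts.subspace_0[OF Isub] by simp
    show "\<forall>h\<in>X. single v h - single x h \<in> ?I"
      if vw: "\<forall>h\<in>X. single v h - single w h \<in> ?I" and wx: "\<forall>h\<in>X. single w h - single x h \<in> ?I" for v w x
    proof
      fix h assume "h \<in> X"
      then have "(single v h - single w h) + (single w h - single x h) \<in> ?I"
        using vw wx by (intro ts.subspace_add[OF Isub]) auto
      then show "single v h - single x h \<in> ?I" by simp
    qed
    fix v w assume vw: "{v,w} \<in> K" "v \<noteq> w"
    show "\<forall>h\<in>X. single v h - single w h \<in> ?I"
    proof
      fix h assume h: "h \<in> X"
      show "single v h - single w h \<in> ?I"
      proof (cases "{v,w} \<in> interior2 K")
        case False
        then have "v \<notin> interior_vertices" "w \<notin> interior_vertices"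
          using edges_at_interior_vertex vw by auto
        then have "single v h - single w h = 0" by (simp add: single_def fun_eq_iff)
        then show ?thesis using ts.subspace_0[OF Isub] by simp
      next
        case True
        let ?t = "{v,w}"
        let ?g = "\<lambda>\<tau>. if \<tau> = ?t then (\<lambda>p. inc v ?t * h p) else (\<lambda>p. 0)"
        have gC: "?g \<in> direct_sum (interior2 K) (\<lambda>_. X)"
          using True h fs.subspace_scale[OF X h] fs.subspace_0[OF X] by (auto simp: direct_sum_def zero_fun_def)
        have gb: "bdm ?g = single v h - single w h"
        proof (intro ext)
          fix x p
          have b: "bound (\<lambda>\<tau>. ?g \<tau> p) x = inc x ?t * (inc v ?t * h p)"
          proof -
            have "bound (\<lambda>\<tau>. ?g \<tau> p) x = (\<Sum>\<tau>\<in>interior2 K. if \<tau> = ?t then inc x ?t * (inc v ?t * h p) else 0)"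
              unfolding bound_def by (intro sum.cong) auto
            then show ?thesis using True by simp
          qed
          have c2: "card ?t = 2" using vw by simp
          have "inc v ?t * inc v ?t = 1" using inc_pm1[OF c2, of v] by auto
          then have 1: "inc v ?t * (inc v ?t * h p) = h p" by (metis mult.assoc mult_1)
          moreover have "inc w ?t = - inc v ?t" using inc_opposite[OF c2 refl] .
          moreover have "inc x ?t = 0" if "x \<noteq> v" "x \<noteq> w" using inc_0[OF c2] that by simp
          ultimately show "bdm ?g x p = (single v h - single w h) x p"
            unfolding bdm_def b using vw by (auto simp: single_def)
        qed
        show ?thesis unfolding gb[symmetric] by (rule imageI[OF gC])
      qed
    qed
  qed
  then have conn: "single v h - single w h \<in> ?I" if "h \<in> X" for v w h using that by blast
  have sub: "?I \<subseteq> direct_sum interior_vertices (\<lambda>_. X)"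
  proof (rule image_subsetI)
    fix g assume g: "g \<in> direct_sum (interior2 K) (\<lambda>_. X)"
    have "(\<lambda>p. bound (\<lambda>\<tau>. g \<tau> p) v) \<in> X" for v
    proof -
      have "(\<lambda>p. bound (\<lambda>\<tau>. g \<tau> p) v) = (\<Sum>\<tau>\<in>interior2 K. (\<lambda>p. inc v \<tau> * g \<tau> p))"
      proof
        fix p
        have "(\<Sum>\<tau>\<in>A. (\<lambda>p. inc v \<tau> * g \<tau> p)) p = (\<Sum>\<tau>\<in>A. inc v \<tau> * g \<tau> p)" for A
          by (induction A rule: infinite_finite_induct) auto
        then show "bound (\<lambda>\<tau>. g \<tau> p) v = (\<Sum>\<tau>\<in>interior2 K. (\<lambda>p. inc v \<tau> * g \<tau> p)) p" by (simp add: bound_def)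
      qed
      also have "\<dots> \<in> X" using g by (intro fs.subspace_sum[OF X] fs.subspace_scale[OF X]) (auto simp: direct_sum_def)
      finally show ?thesis .
    qed
    then show "bdm g \<in> direct_sum interior_vertices (\<lambda>_. X)" by (auto simp: direct_sum_def bdm_def)
  qed
  show "?I = direct_sum interior_vertices (\<lambda>_. X)" if bd: "bdry_2faces K \<noteq> {}"
  proof
    show "direct_sum interior_vertices (\<lambda>_. X) \<subseteq> ?I"
    proof
      fix f assume f: "f \<in> direct_sum interior_vertices (\<lambda>_. X)"
      obtain b where b: "b \<notin> interior_vertices" using ex_boundary_vertex[OF bd] by blast
      have fX: "f v \<in> X" for v using f fs.subspace_0[OF X] by (cases "v \<in> interior_vertices") (auto simp: direct_sum_def zero_fun_def)
      have "single b h = 0" for h using b by (simp add: single_def fun_eq_iff)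
      then have "single v (f v) \<in> ?I" for v using conn[OF fX[of v], of v b] by simp
      then have "(\<Sum>v\<in>UNIV. single v (f v)) \<in> ?I" by (intro ts.subspace_sum[OF Isub])
      then show "f \<in> ?I" using single_decomposition[OF f] by simp
    qed
  qed (rule sub)
  show "?I = {f\<in>direct_sum (UNIV :: 'v set) (\<lambda>_. X). (\<Sum>v\<in>UNIV. f v) = 0}" if cl: "bdry_2faces K = {}"
  proof
    note iv = interior_vertices_closed[OF cl]
    have "(\<Sum>v\<in>UNIV. bdm g v) = 0" for g by (rule sum_bdm_zero[OF cl])
    then show "?I \<subseteq> {f\<in>direct_sum (UNIV :: 'v set) (\<lambda>_. X). (\<Sum>v\<in>UNIV. f v) = 0}" using sub unfolding iv by blast
    show "{f\<in>direct_sum (UNIV :: 'v set) (\<lambda>_. X). (\<Sum>v\<in>UNIV. f v) = 0} \<subseteq> ?I"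
    proof
      fix f assume "f \<in> {f\<in>direct_sum (UNIV :: 'v set) (\<lambda>_. X). (\<Sum>v\<in>UNIV. f v) = 0}"
      then have f: "f \<in> direct_sum interior_vertices (\<lambda>_. X)" "(\<Sum>v\<in>UNIV. f v) = 0" by (auto simp: iv)
      have fX: "f v \<in> X" for v using f by (auto simp: direct_sum_def iv)
      obtain b :: 'v where True by blast
      have sing: "(\<Sum>v\<in>UNIV. single b (f v)) = 0"
      proof (intro ext)
        fix w p
        have "(\<Sum>v\<in>A. single b (f v)) w p = (if w = b then (\<Sum>v\<in>A. f v) p else 0)" for A
          by (induction A rule: infinite_finite_induct) (auto simp: single_def iv)
        then show "(\<Sum>v\<in>UNIV. single b (f v)) w p = 0 w p" using f(2) by simp
      qed
      have "(\<Sum>v\<in>UNIV. single v (f v) - single b (f v)) \<in> ?I" by (intro ts.subspace_sum[OF Isub] conn fX)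
      then show "f \<in> ?I" using single_decomposition[OF f(1)] sing by (simp add: sum_subtractf)
    qed
  qed
qed

end

section \<open>Exactness at the vertices\<close>

text \<open>Finite-dimensional duality, through which spanning statements in degree 2 become
  rigidity statements about annihilating forms.\<close>

lemma in_span_if_annihilated:
  fixes S :: "'a::euclidean_space set"
  assumes "\<And>a. (\<And>s. s \<in> S \<Longrightarrow> a \<bullet> s = 0) \<Longrightarrow> a \<bullet> y = 0"
  shows "y \<in> span S"
proof -
  obtain x z where xz: "x \<in> span S" "\<And>w. w \<in> span S \<Longrightarrow> orthogonal z w" "y = x + z"
    using orthogonal_subspace_decomp_exists[of S y] by metis
  have "z \<bullet> y = 0" by (rule assms) (use xz(2) span_base in \<open>auto simp: orthogonal_def\<close>)
  moreover have "z \<bullet> x = 0" using xz(1,2) by (simp add: orthogonal_def)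
  ultimately have "z \<bullet> z = 0" using xz(3) by (simp add: inner_add_right)
  then show ?thesis using xz by simp
qed

context pure_fan
begin

definition edges where "edges = {e\<in>K. card e = 2}"

text \<open>Both vectors are orthogonal to the plane of the edge. Edge equations may therefore be
  tested on the chosen normal or on the cross product.\<close>

lemma normal_edge:
  assumes "{v,w} \<in> K" "v \<noteq> w"
  shows "\<exists>k. k \<noteq> 0 \<and> normal u {v,w} = k *\<^sub>R cross3 (u v) (u w)"
proof -
  let ?c = "cross3 (u v) (u w)" let ?n = "normal u {v,w}"
  have c: "?c \<noteq> 0" by (rule edge_cross_nonzero[OF assms])
  have "\<exists>n. n \<noteq> 0 \<and> (\<forall>x\<in>{v,w}. n \<bullet> u x = 0)"
    using c by (intro exI[of _ ?c]) (auto simp: dot_cross_self inner_commute)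
  from someI_ex[OF this] have n: "?n \<noteq> 0" "?n \<bullet> u v = 0" "?n \<bullet> u w = 0" unfolding normal_def by auto
  have cc: "?c \<bullet> ?c \<noteq> 0" using c by simp
  have "?n = (?n \<bullet> ?c / (?c \<bullet> ?c)) *\<^sub>R ?c" using dual_basis_expansion[OF cc, of ?n] n by simp
  moreover from this have "?n \<bullet> ?c / (?c \<bullet> ?c) \<noteq> 0" using n(1) by (metis scaleR_zero_left)
  ultimately show ?thesis by blast
qed

lemma qf_normal_iff:
  assumes "{v,w} \<in> K" "v \<noteq> w"
  shows "qf A (normal u {v,w}) = qf B (normal u {v,w}) \<longleftrightarrow> qf A (cross3 (u v) (u w)) = qf B (cross3 (u v) (u w))"
  using normal_edge[OF assms] by (auto simp: qf_scale)

lemma normal_perp: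
  assumes "\<tau> \<in> interior2 K" "v \<in> \<tau>" shows "normal u \<tau> \<bullet> u v = 0"
proof -
  obtain w where w: "\<tau> = {v,w}" "v \<noteq> w" using assms by (auto simp: interior2_iff card_2_iff)
  then obtain k where "normal u \<tau> = k *\<^sub>R cross3 (u v) (u w)"
    using normal_edge[of v w] assms(1) by (auto simp: interior2_iff)
  then show ?thesis by (simp add: dot_cross_self inner_commute)
qed

definition bsum :: "('v set \<Rightarrow> real^3 \<Rightarrow> real) \<Rightarrow> 'v \<Rightarrow> real^3 \<Rightarrow> real" where
  "bsum H v p = (if v \<in> interior_vertices then \<Sum>\<tau>\<in>interior2 K. inc v \<tau> * ((normal u \<tau> \<bullet> p)\<^sup>2 * H \<tau> p) else 0)"

text \<open>The image of the boundary map in degree \<open>e + 2\<close>.\<close>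
definition bimage :: "nat \<Rightarrow> ('v \<Rightarrow> real^3 \<Rightarrow> real) set" where
  "bimage e = bsum ` {H. \<forall>\<tau>. H \<tau> \<in> forms e}"

lemma bimageI: "(\<And>\<tau>. H \<tau> \<in> forms e) \<Longrightarrow> (\<And>v p. y v p = bsum H v p) \<Longrightarrow> y \<in> bimage e"
  unfolding bimage_def by (rule image_eqI[of _ _ H]) (auto simp: fun_eq_iff)

lemma bimageE:
  assumes "y \<in> bimage e"
  obtains H where "\<And>\<tau>. H \<tau> \<in> forms e" "y = bsum H"
  using assms unfolding bimage_def by auto

lemma bimage_add: assumes "y \<in> bimage e" "z \<in> bimage e" shows "(\<lambda>v p. y v p + z v p) \<in> bimage e"
proof -
  obtain H where H: "\<And>\<tau>. H \<tau> \<in> forms e" "y = bsum H" using assms(1) by (blast elim: bimageE)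
  obtain H' where H': "\<And>\<tau>. H' \<tau> \<in> forms e" "z = bsum H'" using assms(2) by (blast elim: bimageE)
  show ?thesis
    by (rule bimageI[of "\<lambda>\<tau> p. H \<tau> p + H' \<tau> p"]) (auto simp: H H' bsum_def forms_add distrib_left sum.distrib)
qed

lemma bimage_mult: assumes "y \<in> bimage e" "q \<in> forms k" shows "(\<lambda>v p. q p * y v p) \<in> bimage (e + k)"
proof -
  obtain H where H: "\<And>\<tau>. H \<tau> \<in> forms e" "y = bsum H" using assms(1) by (blast elim: bimageE)
  show ?thesis
  proof (rule bimageI[of "\<lambda>\<tau> p. H \<tau> p * q p"])
    show "(\<lambda>p. H \<tau> p * q p) \<in> forms (e + k)" for \<tau> by (rule forms_mult[OF H(1) assms(2)])
  qed (auto simp: H(2) bsum_def sum_distrib_left mult_ac intro!: sum.cong)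
qed

lemma bimage_scale: "y \<in> bimage e \<Longrightarrow> (\<lambda>v p. c * y v p) \<in> bimage e"
  using bimage_mult[OF _ const_in_forms, of y e c] by simp

lemma bimage_zero: "(\<lambda>v p. 0) \<in> bimage e"
  by (rule bimageI[of "\<lambda>\<tau> p. 0"]) (auto simp: forms_0 bsum_def)

lemma bimage_diff: "y \<in> bimage e \<Longrightarrow> z \<in> bimage e \<Longrightarrow> (\<lambda>v p. y v p - z v p) \<in> bimage e"
  using bimage_add[OF _ bimage_scale, of y e z "-1"] by simp

lemma bimage_sum: "(\<And>i. i \<in> A \<Longrightarrow> y i \<in> bimage e) \<Longrightarrow> (\<lambda>v p. \<Sum>i\<in>A. y i v p) \<in> bimage e"
  by (induction A rule: infinite_finite_induct) (auto intro: bimage_zero bimage_add)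

lemma bimage_subspace: "ts.subspace (bimage e)"
  by (rule ts.subspaceI) (use bimage_zero bimage_add bimage_scale in \<open>auto simp: zero_fun_def plus_fun_def\<close>)

abbreviation edge_ideal where "edge_ideal d \<tau> \<equiv> sq_ideal u {\<tau>} \<inter> forms d"
abbreviation vertex_ideal where "vertex_ideal d v \<equiv> sq_ideal u {\<tau>\<in>interior2 K. v \<in> \<tau>} \<inter> forms d"

lemma image_eq_bimage: "bdm ` direct_sum (interior2 K) (edge_ideal (e + 2)) = bimage e"
proof
  have e2: "\<not> e + 2 < 2" by simp
  show "bdm ` direct_sum (interior2 K) (edge_ideal (e + 2)) \<subseteq> bimage e"
  proof (rule image_subsetI)
    fix g assume g: "g \<in> direct_sum (interior2 K) (edge_ideal (e + 2))"
    have "\<exists>h. h \<in> forms e \<and> (\<tau> \<in> interior2 K \<longrightarrow> g \<tau> = (\<lambda>p. (normal u \<tau> \<bullet> p)\<^sup>2 * h p))" for \<tau>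
    proof (cases "\<tau> \<in> interior2 K")
      case True
      then have "g \<tau> \<in> edge_ideal (e + 2) \<tau>" using g by (auto simp: direct_sum_def)
      then obtain H where "g \<tau> = (\<lambda>p. \<Sum>\<tau>'\<in>{\<tau>}. (normal u \<tau>' \<bullet> p)\<^sup>2 * H \<tau>' p)" "H \<tau> \<in> forms e"
        unfolding sq_ideal_forms_eq[OF finite, of u "{\<tau>}"] if_not_P[OF e2] by auto
      then show ?thesis by auto
    qed (use forms_0 in blast)
    then obtain H where H: "\<And>\<tau>. H \<tau> \<in> forms e" "\<And>\<tau>. \<tau> \<in> interior2 K \<Longrightarrow> g \<tau> = (\<lambda>p. (normal u \<tau> \<bullet> p)\<^sup>2 * H \<tau> p)" by metis
    show "bdm g \<in> bimage e" by (rule bimageI[of H]) (auto simp: bdm_def bound_def bsum_def H)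
  qed
  show "bimage e \<subseteq> bdm ` direct_sum (interior2 K) (edge_ideal (e + 2))"
  proof
    fix y assume "y \<in> bimage e"
    then obtain H where H: "\<And>\<tau>. H \<tau> \<in> forms e" "y = bsum H" by (blast elim: bimageE)
    define g where "g \<tau> = (if \<tau> \<in> interior2 K then (\<lambda>p. (normal u \<tau> \<bullet> p)\<^sup>2 * H \<tau> p) else (\<lambda>p. 0))" for \<tau>
    have "g \<tau> \<in> edge_ideal (e + 2) \<tau>" if "\<tau> \<in> interior2 K" for \<tau>
      unfolding sq_ideal_forms_eq[OF finite, of u "{\<tau>}"] if_not_P[OF e2] using that H(1) by (auto simp: g_def)
    then have "g \<in> direct_sum (interior2 K) (edge_ideal (e + 2))" by (auto simp: direct_sum_def g_def)
    moreover have "y = bdm g" by (auto simp: fun_eq_iff H(2) bdm_def bound_def bsum_def g_def)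
    ultimately show "y \<in> bdm ` direct_sum (interior2 K) (edge_ideal (e + 2))" by blast
  qed
qed

lemma bimage_subset: "bimage e \<subseteq> direct_sum interior_vertices (vertex_ideal (e + 2))"
proof
  have e2: "\<not> e + 2 < 2" by simp
  fix y assume "y \<in> bimage e"
  then obtain H where H: "\<And>\<tau>. H \<tau> \<in> forms e" "y = bsum H" by (blast elim: bimageE)
  have "y v \<in> vertex_ideal (e + 2) v" if v: "v \<in> interior_vertices" for v
  proof -
    have "y v = (\<lambda>p. \<Sum>\<tau>\<in>{\<tau>\<in>interior2 K. v \<in> \<tau>}. (normal u \<tau> \<bullet> p)\<^sup>2 * (inc v \<tau> * H \<tau> p))"
    proof
      fix p
      have "y v p = (\<Sum>\<tau>\<in>{\<tau>\<in>interior2 K. v \<in> \<tau>}. inc v \<tau> * ((normal u \<tau> \<bullet> p)\<^sup>2 * H \<tau> p))"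
        using bound_eq[of "\<lambda>\<tau>. (normal u \<tau> \<bullet> p)\<^sup>2 * H \<tau> p" v] v unfolding bound_def by (simp add: H(2) bsum_def)
      then show "y v p = (\<Sum>\<tau>\<in>{\<tau>\<in>interior2 K. v \<in> \<tau>}. (normal u \<tau> \<bullet> p)\<^sup>2 * (inc v \<tau> * H \<tau> p))"
        by (simp add: mult_ac)
    qed
    moreover have "\<forall>\<tau>\<in>{\<tau>\<in>interior2 K. v \<in> \<tau>}. (\<lambda>p. inc v \<tau> * H \<tau> p) \<in> forms (e + 2 - 2)"
      using forms_scale[OF H(1)] by simp
    ultimately show ?thesis unfolding sq_ideal_forms_eq[OF finite] if_not_P[OF e2] mem_Collect_eq
      by (intro exI[of _ "\<lambda>\<tau> p. inc v \<tau> * H \<tau> p"] conjI)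
  qed
  then show "y \<in> direct_sum interior_vertices (vertex_ideal (e + 2))" by (auto simp: direct_sum_def H(2) bsum_def)
qed

lemma vertex_ideal_decomposition:
  assumes f: "f \<in> direct_sum interior_vertices (vertex_ideal (e + 2))"
  shows "\<exists>H. (\<forall>v \<tau>. H v \<tau> \<in> forms e) \<and>
    (\<forall>v p. f v p = (if v \<in> interior_vertices then \<Sum>\<tau>\<in>{\<tau>\<in>interior2 K. v \<in> \<tau>}. (normal u \<tau> \<bullet> p)\<^sup>2 * H v \<tau> p else 0))"
proof -
  have e2: "\<not> e + 2 < 2" by simp
  let ?P = "\<lambda>v h. (\<forall>\<tau>. h \<tau> \<in> forms e) \<and> (v \<in> interior_vertices \<longrightarrow>
     f v = (\<lambda>p. \<Sum>\<tau>\<in>{\<tau>\<in>interior2 K. v \<in> \<tau>}. (normal u \<tau> \<bullet> p)\<^sup>2 * h \<tau> p))"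
  have "\<exists>h. ?P v h" for v
  proof (cases "v \<in> interior_vertices")
    case True
    then have "f v \<in> vertex_ideal (e + 2) v" using f by (auto simp: direct_sum_def)
    then obtain h where h: "f v = (\<lambda>p. \<Sum>\<tau>\<in>{\<tau>\<in>interior2 K. v \<in> \<tau>}. (normal u \<tau> \<bullet> p)\<^sup>2 * h \<tau> p)"
       "\<And>\<tau>. \<tau> \<in> interior2 K \<Longrightarrow> v \<in> \<tau> \<Longrightarrow> h \<tau> \<in> forms e"
      unfolding sq_ideal_forms_eq[OF finite] if_not_P[OF e2] by auto
    let ?h = "\<lambda>\<tau>. if \<tau> \<in> interior2 K \<and> v \<in> \<tau> then h \<tau> else (\<lambda>p. 0)"
    have "f v = (\<lambda>p. \<Sum>\<tau>\<in>{\<tau>\<in>interior2 K. v \<in> \<tau>}. (normal u \<tau> \<bullet> p)\<^sup>2 * ?h \<tau> p)"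
      unfolding h(1) by (intro ext sum.cong) auto
    moreover have "\<forall>\<tau>. ?h \<tau> \<in> forms e" using h(2) forms_0 by simp
    ultimately show ?thesis by (intro exI[of _ ?h] conjI impI)
  qed (auto intro!: exI[of _ "\<lambda>\<tau> p. 0"] forms_0)
  then have "\<exists>H. \<forall>v. ?P v (H v)" by (intro choice allI)
  then obtain H where HP: "\<forall>v. ?P v (H v)" by (rule exE)
  have H: "H v \<tau> \<in> forms e" "v \<in> interior_vertices \<Longrightarrow>
     f v = (\<lambda>p. \<Sum>\<tau>\<in>{\<tau>\<in>interior2 K. v \<in> \<tau>}. (normal u \<tau> \<bullet> p)\<^sup>2 * H v \<tau> p)" for v \<tau>
    using spec[OF HP, of v] by auto
  show ?thesis
  proof (intro exI[of _ H] conjI allI)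
    show "H v \<tau> \<in> forms e" for v \<tau> by (rule H(1))
    show "f v p = (if v \<in> interior_vertices then \<Sum>\<tau>\<in>{\<tau>\<in>interior2 K. v \<in> \<tau>}. (normal u \<tau> \<bullet> p)\<^sup>2 * H v \<tau> p else 0)" for v p
      using H(2)[of v] f by (cases "v \<in> interior_vertices") (auto simp: direct_sum_def)
  qed
qed

text \<open>The boundary of the generator of \<open>J(\<tau>)\<close>, with squares of linear forms
  encoded as symmetric matrices. The inner product with \<open>outer n n\<close> evaluates a form at
  \<open>n\<close>, which makes the duality with rigidity explicit.\<close>

definition Dmat :: "'v set \<Rightarrow> real^3^3^'v" where
  "Dmat \<tau> = (\<chi> w. if w \<in> interior_vertices then inc w \<tau> *\<^sub>R outer (normal u \<tau>) (normal u \<tau>) else 0)"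

lemma bimage_of_span:
  assumes "Y \<in> span (Dmat ` interior2 K)"
  shows "(\<lambda>v p. qf (Y $ v) p) \<in> bimage 0"
proof -
  let ?Q = "{Y. (\<lambda>v p. qf (Y $ v) p) \<in> bimage 0}"
  have "subspace ?Q"
  proof (rule subspaceI)
    show "0 \<in> ?Q" using bimage_zero[of 0] by (simp add: qf_zero(1)[abs_def])
    show "Y + Z \<in> ?Q" if "Y \<in> ?Q" "Z \<in> ?Q" for Y Z
    proof -
      have "(\<lambda>v p. qf ((Y + Z) $ v) p) = (\<lambda>v p. qf (Y $ v) p + qf (Z $ v) p)" by (simp add: fun_eq_iff qf_add_matrix)
      then show ?thesis using bimage_add[of "\<lambda>v p. qf (Y $ v) p" 0 "\<lambda>v p. qf (Z $ v) p"] that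
        by (simp only: mem_Collect_eq)
    qed
    show "c *\<^sub>R Y \<in> ?Q" if "Y \<in> ?Q" for c Y
    proof -
      have "(\<lambda>v p. qf ((c *\<^sub>R Y) $ v) p) = (\<lambda>v p. c * qf (Y $ v) p)" by (simp add: fun_eq_iff qf_scale_matrix)
      then show ?thesis using bimage_scale[of "\<lambda>v p. qf (Y $ v) p" 0 c] that
        by (simp only: mem_Collect_eq)
    qed
  qed
  moreover have "Dmat ` interior2 K \<subseteq> ?Q"
  proof (rule image_subsetI, rule CollectI)
    fix \<tau> assume t: "\<tau> \<in> interior2 K"
    show "(\<lambda>v p. qf (Dmat \<tau> $ v) p) \<in> bimage 0"
    proof (rule bimageI[of "\<lambda>\<tau>' p. if \<tau>' = \<tau> then 1 else 0"])
      show "(\<lambda>p. if \<tau>' = \<tau> then 1 else 0) \<in> forms 0" for \<tau>' by (rule const_in_forms)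
      fix v p
      have "(\<Sum>\<tau>'\<in>interior2 K. inc v \<tau>' * ((normal u \<tau>' \<bullet> p)\<^sup>2 * (if \<tau>' = \<tau> then 1 else 0))) =
        (\<Sum>\<tau>'\<in>interior2 K. if \<tau>' = \<tau> then inc v \<tau> * (normal u \<tau> \<bullet> p)\<^sup>2 else 0)" by (intro sum.cong) auto
      also have "\<dots> = inc v \<tau> * (normal u \<tau> \<bullet> p)\<^sup>2" using t by simp
      finally show "qf (Dmat \<tau> $ v) p = bsum (\<lambda>\<tau>' p. if \<tau>' = \<tau> then 1 else 0) v p"
        unfolding bsum_def by (simp add: Dmat_def qf_scale_matrix qf_outer power2_eq_square)
    qed
  qed
  ultimately have "span (Dmat ` interior2 K) \<subseteq> ?Q" by (rule span_minimal[rotated])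
  then show ?thesis using assms by blast
qed

text \<open>Pairing with \<open>Dmat \<tau>\<close> gives, up to sign, the difference of the two
  forms at the normal of \<open>\<tau>\<close>, with zero taken at boundary rays. An edge that is
  not interior joins two boundary rays, where its equation is trivial.\<close>

lemma annihilator_compatible:
  assumes A: "\<And>\<tau>. \<tau> \<in> interior2 K \<Longrightarrow> A \<bullet> Dmat \<tau> = 0"
  shows "compatible u edges (\<lambda>x. if x \<in> interior_vertices then A $ x else 0)" (is "compatible u edges ?A")
  unfolding compatible_def
proof (intro allI impI)
  fix x y assume "{x,y} \<in> edges"
  then have xy: "{x,y} \<in> K" "x \<noteq> y" "card {x,y} = 2" by (auto simp: edges_def)
  show "qf (?A x) (cross3 (u x) (u y)) = qf (?A y) (cross3 (u x) (u y))"
  proof (cases "{x,y} \<in> interior2 K")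
    case False
    then have "x \<notin> interior_vertices" "y \<notin> interior_vertices"
      using edges_at_interior_vertex xy by auto
    then show ?thesis by simp
  next
    case True
    let ?t = "{x,y}" let ?n = "normal u ?t"
    have "0 = A \<bullet> Dmat ?t" using A[OF True] by simp
    also have "\<dots> = (\<Sum>w\<in>UNIV. A $ w \<bullet> (Dmat ?t $ w))" by (rule inner_vec_def)
    also have "\<dots> = (\<Sum>w\<in>UNIV. inc w ?t * qf (?A w) ?n)"
      by (intro sum.cong refl) (simp add: Dmat_def inner_outer)
    also have "\<dots> = (\<Sum>w\<in>{x,y}. inc w ?t * qf (?A w) ?n)"
      by (rule sum.mono_neutral_right) (auto simp: inc_0[OF xy(3)])
    also have "\<dots> = inc x ?t * (qf (?A x) ?n - qf (?A y) ?n)"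
      using xy(2) inc_opposite[OF xy(3) refl] by (simp add: algebra_simps)
    finally have "qf (?A x) ?n = qf (?A y) ?n" using inc_pm1[OF xy(3), of x] by auto
    then show ?thesis using qf_normal_iff[OF xy(1,2)] by blast
  qed
qed

lemma low_degree_image:
  assumes "d < 2"
  shows "bdm ` direct_sum (interior2 K) (edge_ideal d) = {0}" "direct_sum I (vertex_ideal d) = {0}"
proof -
  have 1: "sq_ideal u T \<inter> forms d = {0}" for T :: "'v set set"
    unfolding sq_ideal_forms_eq[OF finite] using assms by (simp add: zero_fun_def)
  have 2: "direct_sum I (\<lambda>_::'i. {0 :: real^3 \<Rightarrow> real}) = {0}" for I :: "'i set"
    unfolding direct_sum_def by (auto simp: zero_fun_def fun_eq_iff) blast
  show "direct_sum I (vertex_ideal d) = {0}" unfolding 1 by (rule 2)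
  show "bdm ` direct_sum (interior2 K) (edge_ideal d) = {0}"
    unfolding 1 2 using tt.linear_0[OF bdm_linear] by simp
qed

text \<open>Hypothesis \<open>R\<close> is rigidity with zero forms on the boundary rays. By duality
  every generator of a vertex ideal, placed at its ray alone, is in the image in degree 2;
  multiplication by forms gives the higher degrees.\<close>

lemma open_image:
  assumes R: "\<And>A x n. compatible u edges A \<Longrightarrow> (\<And>x. x \<notin> interior_vertices \<Longrightarrow> A x = 0) \<Longrightarrow> n \<bullet> u x = 0 \<Longrightarrow> qf (A x) n = 0"
  shows "bdm ` direct_sum (interior2 K) (edge_ideal d) = direct_sum interior_vertices (vertex_ideal d)"
proof (cases "d < 2")
  case True then show ?thesis using low_degree_image by simp
next
  case False
  then obtain e where d: "d = e + 2" by (metis le_add_diff_inverse2 not_less)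
  have gen: "(\<lambda>w p. if w = v then (normal u \<tau> \<bullet> p)\<^sup>2 else 0) \<in> bimage 0"
    if v: "v \<in> interior_vertices" and t: "\<tau> \<in> interior2 K" "v \<in> \<tau>" for v \<tau>
  proof -
    let ?n = "normal u \<tau>"
    let ?Y = "(\<chi> w. if w = v then outer ?n ?n else 0) :: real^3^3^'v"
    have "?Y \<in> span (Dmat ` interior2 K)"
    proof (rule in_span_if_annihilated)
      fix A assume "\<And>s. s \<in> Dmat ` interior2 K \<Longrightarrow> A \<bullet> s = 0"
      then have "compatible u edges (\<lambda>x. if x \<in> interior_vertices then A $ x else 0)"
        by (intro annihilator_compatible) auto
      from R[OF this _ normal_perp[OF t]] have "qf (A $ v) ?n = 0" using v by auto
      moreover have "A \<bullet> ?Y = (\<Sum>w\<in>UNIV. if w = v then qf (A $ v) ?n else 0)"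
        unfolding inner_vec_def[of A] by (intro sum.cong) (auto simp: inner_outer)
      ultimately show "A \<bullet> ?Y = 0" by simp
    qed
    from bimage_of_span[OF this] have "(\<lambda>w p. qf (?Y $ w) p) \<in> bimage 0" .
    moreover have "(\<lambda>w p. qf (?Y $ w) p) = (\<lambda>w p. if w = v then (?n \<bullet> p)\<^sup>2 else 0)"
      by (auto simp: fun_eq_iff qf_outer power2_eq_square)
    ultimately show ?thesis by simp
  qed
  have "direct_sum interior_vertices (vertex_ideal d) \<subseteq> bimage e"
  proof
    fix f assume "f \<in> direct_sum interior_vertices (vertex_ideal d)"
    then obtain H where H: "\<And>v \<tau>. H v \<tau> \<in> forms e"
      "\<And>v p. f v p = (if v \<in> interior_vertices then \<Sum>\<tau>\<in>{\<tau>\<in>interior2 K. v \<in> \<tau>}. (normal u \<tau> \<bullet> p)\<^sup>2 * H v \<tau> p else 0)"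
      using vertex_ideal_decomposition unfolding d by blast
    have "(\<lambda>w p. \<Sum>v\<in>interior_vertices. \<Sum>\<tau>\<in>{\<tau>\<in>interior2 K. v \<in> \<tau>}. H v \<tau> p * (if w = v then (normal u \<tau> \<bullet> p)\<^sup>2 else 0)) \<in> bimage e"
      using bimage_mult[OF gen H(1)] by (intro bimage_sum) auto
    moreover have "(\<Sum>v\<in>interior_vertices. \<Sum>\<tau>\<in>{\<tau>\<in>interior2 K. v \<in> \<tau>}. H v \<tau> p * (if w = v then (normal u \<tau> \<bullet> p)\<^sup>2 else 0)) = f w p" for w p
    proof -
      have "(\<Sum>v\<in>interior_vertices. \<Sum>\<tau>\<in>{\<tau>\<in>interior2 K. v \<in> \<tau>}. H v \<tau> p * (if w = v then (normal u \<tau> \<bullet> p)\<^sup>2 else 0))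
        = (\<Sum>v\<in>interior_vertices. if v = w then \<Sum>\<tau>\<in>{\<tau>\<in>interior2 K. w \<in> \<tau>}. (normal u \<tau> \<bullet> p)\<^sup>2 * H w \<tau> p else 0)"
        by (intro sum.cong) (auto simp: mult.commute)
      then show ?thesis by (simp add: H(2))
    qed
    ultimately show "f \<in> bimage e" by simp
  qed
  then show ?thesis using image_eq_bimage[of e] bimage_subset[of e] unfolding d by blast
qed

end

text \<open>Replaces membership in a subspace by the vanishing of real functionals, so that
  identities modulo the image of the boundary map become identities of multilinear forms.\<close>

lemma ts_separating_functional:
  fixes I :: "('i \<Rightarrow> 'x \<Rightarrow> real) set"
  assumes I: "ts.subspace I" and x: "x \<notin> I"
  shows "\<exists>\<phi>. (\<forall>F G. \<phi> (\<lambda>i y. F i y + G i y) = \<phi> F + (\<phi> G :: real)) \<and> (\<forall>c F. \<phi> (\<lambda>i y. c * F i y) = c * \<phi> F) \<and>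
     (\<forall>F\<in>I. \<phi> F = 0) \<and> \<phi> x \<noteq> 0"
proof -
  obtain B where B: "B \<subseteq> I" "ts.independent B" "I \<subseteq> ts.span B" using ts.basis_exists by metis
  have sp: "ts.span B = I" using B I ts.span_subspace by blast
  have ind: "ts.independent (insert x B)" using B(2) x sp by (simp add: ts.independent_insertI)
  obtain f where f: "Vector_Spaces.linear (\<lambda>c F i y. c * F i y) (\<lambda>c g y. c * g y) f"
    "\<forall>b\<in>insert x B. f b = (if b = x then (\<lambda>n::nat. 1) else (\<lambda>n. 0))"
    using tf.linear_independent_extend[OF ind, of "\<lambda>b. if b = x then (\<lambda>n::nat. 1) else (\<lambda>n. 0)"] by blast
  have fB: "f b = 0" if "b \<in> B" for b
  proof -
    have "b \<noteq> x" using that x B(1) by blast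
    then show ?thesis using f(2) that by (auto simp: zero_fun_def)
  qed
  have fI: "f F = 0" if "F \<in> I" for F
  proof -
    have "F \<in> ts.span B" using that sp by simp
    from tf.linear_eq_0_on_span[OF f(1) fB this] show ?thesis .
  qed
  show ?thesis
  proof (intro exI[of _ "\<lambda>F. f F 0"] conjI allI ballI)
    show "f (\<lambda>i y. F i y + G i y) 0 = f F 0 + f G 0" for F G
      using tf.linear_add[OF f(1), of F G] by (simp add: plus_fun_def)
    show "f (\<lambda>i y. c * F i y) 0 = c * f F 0" for c F using tf.linear_scale[OF f(1), of c F] by simp
    show "f F 0 = 0" if "F \<in> I" for F using fI[OF that] by simp
    show "f x 0 \<noteq> 0" using f(2) by simp
  qed
qed

text \<open>The linear syzygies of the ideal of the squares of all linear forms are spanned by those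
  involving only forms that vanish at one of four points in general position.\<close>
lemma trilinear_vanishes:
  fixes t :: "real^3 \<Rightarrow> real^3 \<Rightarrow> real^3 \<Rightarrow> real"
  assumes l1: "\<And>x y. linear (\<lambda>z. t z x y)" and l2: "\<And>x y. linear (\<lambda>z. t x z y)" and l3: "\<And>x y. linear (\<lambda>z. t x y z)"
    and anti: "\<And>x y z. t x y z = - t y x z" and cyc: "\<And>x y z. t x y z + t y z x + t z x y = 0"
    and van: "\<And>w x y z. w \<in> {a,b,c,e} \<Longrightarrow> x \<bullet> w = 0 \<Longrightarrow> y \<bullet> w = 0 \<Longrightarrow> z \<bullet> w = 0 \<Longrightarrow> t x y z = 0"
    and d: "a \<bullet> cross3 b c \<noteq> 0" "e \<bullet> cross3 b c \<noteq> 0" "e \<bullet> cross3 c a \<noteq> 0" "e \<bullet> cross3 a b \<noteq> 0"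
  shows "t x y z = 0"
proof -
  \<comment> \<open>Four points match a dimension count: such trilinear forms make up a space of
    dimension 8, and the plane orthogonal to each point imposes two conditions.\<close>
  let ?n1 = "cross3 b c" let ?n2 = "cross3 c a" let ?n3 = "cross3 a b"
  define \<alpha> \<beta> \<gamma> where abg: "\<alpha> = e \<bullet> ?n1" "\<beta> = e \<bullet> ?n2" "\<gamma> = e \<bullet> ?n3"
  have nz: "\<alpha> \<noteq> 0" "\<beta> \<noteq> 0" "\<gamma> \<noteq> 0" using d by (auto simp: abg)
  note lin = linear_add[OF l1] linear_add[OF l2] linear_add[OF l3] linear_diff[OF l1] linear_diff[OF l2] linear_diff[OF l3]
    linear_cmul[OF l1] linear_cmul[OF l2] linear_cmul[OF l3]
  have o: "?n1 \<bullet> b = 0" "?n1 \<bullet> c = 0" "?n2 \<bullet> c = 0" "?n2 \<bullet> a = 0" "?n3 \<bullet> a = 0" "?n3 \<bullet> b = 0"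
    by (simp_all add: dot_cross_self inner_commute)
  have sq: "t x x z = 0" for x z using anti[of x x z] by simp
  have z: "t ?n1 ?n2 ?n1 = 0" "t ?n1 ?n2 ?n2 = 0" "t ?n2 ?n3 ?n2 = 0" "t ?n2 ?n3 ?n3 = 0" "t ?n3 ?n1 ?n3 = 0" "t ?n3 ?n1 ?n1 = 0"
    using van[of c] van[of a] van[of b] o by auto
  \<comment> \<open>Two vectors spanning the plane orthogonal to \<open>e\<close>.\<close>
  define p q where pq_def: "p = \<beta> *\<^sub>R ?n1 - \<alpha> *\<^sub>R ?n2" "q = \<gamma> *\<^sub>R ?n2 - \<beta> *\<^sub>R ?n3"
  have pe: "p \<bullet> e = 0" "q \<bullet> e = 0" by (simp_all add: pq_def inner_diff_left abg inner_commute[of _ e] inner_diff_right)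
  have pq: "t p q x = \<beta> * \<gamma> * t ?n1 ?n2 x + \<beta> * \<beta> * t ?n3 ?n1 x + \<alpha> * \<beta> * t ?n2 ?n3 x" for x
    unfolding pq_def using anti[of ?n1 ?n3 x] by (simp add: lin sq algebra_simps)
  have "t p q (\<beta> *\<^sub>R ?n1 - \<alpha> *\<^sub>R ?n2) = \<beta> * t p q ?n1 - \<alpha> * t p q ?n2"
    "t p q (\<gamma> *\<^sub>R ?n2 - \<beta> *\<^sub>R ?n3) = \<gamma> * t p q ?n2 - \<beta> * t p q ?n3"
    by (simp_all add: linear_diff[OF l3] linear_cmul[OF l3])
  then have "t p q p = \<beta> * t p q ?n1 - \<alpha> * t p q ?n2" "t p q q = \<gamma> * t p q ?n2 - \<beta> * t p q ?n3"
    unfolding pq_def(1)[symmetric] pq_def(2)[symmetric] .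
  moreover have "t p q p = 0" "t p q q = 0" using van[of e] pe by auto
  ultimately have "\<beta> * t p q ?n1 - \<alpha> * t p q ?n2 = 0" "\<gamma> * t p q ?n2 - \<beta> * t p q ?n3 = 0" by simp_all
  then have "\<alpha> * \<beta> * \<beta> * (t ?n2 ?n3 ?n1 - t ?n3 ?n1 ?n2) = 0" "\<beta> * \<beta> * \<gamma> * (t ?n3 ?n1 ?n2 - t ?n1 ?n2 ?n3) = 0"
    unfolding pq z by (simp_all add: algebra_simps)
  \<comment> \<open>The conditions at \<open>e\<close> make the three cyclic values equal, and the
    cyclic identity makes their sum zero.\<close>
  then have "t ?n2 ?n3 ?n1 = t ?n3 ?n1 ?n2" "t ?n3 ?n1 ?n2 = t ?n1 ?n2 ?n3" using nz by auto
  then have m: "t ?n1 ?n2 ?n3 = 0" "t ?n2 ?n3 ?n1 = 0" "t ?n3 ?n1 ?n2 = 0" using cyc[of ?n1 ?n2 ?n3] by auto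
  have basis: "t u v w = 0" if "u \<in> {?n1,?n2,?n3}" "v \<in> {?n1,?n2,?n3}" "w \<in> {?n1,?n2,?n3}" for u v w
    using that anti[of ?n2 ?n1 w] anti[of ?n3 ?n2 w] anti[of ?n1 ?n3 w] sq z m by auto
  have ex: "\<exists>r s q. x = r *\<^sub>R ?n1 + s *\<^sub>R ?n2 + q *\<^sub>R ?n3" for x using dual_basis_expansion[OF d(1), of x] by blast
  have 1: "t u v x = 0" if "u \<in> {?n1,?n2,?n3}" "v \<in> {?n1,?n2,?n3}" for u v x
  proof -
    obtain r s q where "x = r *\<^sub>R ?n1 + s *\<^sub>R ?n2 + q *\<^sub>R ?n3" using ex by blast
    then show ?thesis using basis[OF that] by (simp add: linear_add[OF l3] linear_cmul[OF l3])
  qed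
  have 2: "t u y x = 0" if "u \<in> {?n1,?n2,?n3}" for u y x
  proof -
    obtain r s q where "y = r *\<^sub>R ?n1 + s *\<^sub>R ?n2 + q *\<^sub>R ?n3" using ex by blast
    then show ?thesis using 1[OF that] by (simp add: linear_add[OF l2] linear_cmul[OF l2])
  qed
  obtain r s q where "x = r *\<^sub>R ?n1 + s *\<^sub>R ?n2 + q *\<^sub>R ?n3" using ex by blast
  then show ?thesis using 2 by (simp add: linear_add[OF l1] linear_cmul[OF l1])
qed

section \<open>Fans without boundary: lifting the syzygies of the quadrics\<close>

definition symm :: "real^3 \<Rightarrow> real^3 \<Rightarrow> real^3^3" where
  "symm l m = outer l m + outer m l"

lemma inner_symm: "A \<bullet> symm l m = qf A (l + m) - qf A l - qf A m"
proof -
  have "A \<bullet> outer x y = x \<bullet> (A *v y)" for x y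
    by (simp add: outer_def inner_vec_def matrix_vector_mult_def sum_distrib_left mult_ac)
  then show ?thesis by (simp add: symm_def inner_add_right qf_add)
qed

text \<open>The factor 2 is due to the undivided symmetrisation; in \<open>closed_image\<close> it
  is offset by a factor 1/2.\<close>

lemma qf_symm: "qf (symm l m) p = 2 * (l \<bullet> p) * (m \<bullet> p)"
  by (simp add: symm_def qf_add_matrix qf_outer)

lemma symm_expansion: "symm l m = (\<Sum>i\<in>UNIV. \<Sum>j\<in>UNIV. (l $ i * m $ j) *\<^sub>R symm (axis i 1) (axis j 1))"
  by (simp add: vec_eq_iff forall_3 symm_def outer_def axis_def sum_3)

locale closed_rigid_fan = pure_fan K u for K :: "'v::finite set set" and u :: "'v \<Rightarrow> real^3" +
  assumes cl: "bdry_2faces K = {}" and rig: "rigid u edges" and ti: "triples_independent u"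
    and c4: "CARD('v) \<ge> 4"
begin

lemma Union_edges: "\<Union>edges = UNIV"
proof -
  have "v \<in> \<Union>edges" for v
  proof -
    obtain \<sigma> where s: "\<sigma> \<in> facets K" "v \<in> \<sigma>" using in_facet[OF K_vertex[of v]] by auto
    have "\<sigma> \<noteq> {v}" using facet_card[OF s(1)] by auto
    then obtain w where "w \<in> \<sigma>" "w \<noteq> v" using s by blast
    then have "{v,w} \<in> edges" using K_down[OF facet_K[OF s(1)], of "{v,w}"] s by (auto simp: edges_def)
    then show ?thesis by blast
  qed
  then show ?thesis by blast
qed

lemma iv: "interior_vertices = UNIV" by (rule interior_vertices_closed[OF cl])

lemma i2: "interior2 K = edges"
proof (rule set_eqI)
  show "\<tau> \<in> interior2 K \<longleftrightarrow> \<tau> \<in> edges" for \<tau>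
    using bdry_2faces_iff[of \<tau>] interior2_iff[of \<tau>] cl by (auto simp: edges_def)
qed

lemma ex_three_others: "\<exists>a b c. distinct [v,a,b,c]" for v :: 'v
proof -
  have "card (UNIV - {v}) \<ge> 3" using c4 by (simp add: card_Diff_subset)
  then obtain Q where "Q \<subseteq> UNIV - {v}" "card Q = 3" using obtain_subset_with_card_n by metis
  then obtain a b c where "Q = {a,b,c}" "distinct [a,b,c]" by (auto simp: card_3_iff)
  moreover have "v \<notin> Q" using \<open>Q \<subseteq> UNIV - {v}\<close> by blast
  ultimately have "distinct [v,a,b,c]" by simp
  then show ?thesis by blast
qed

lemma det_ne: "distinct [a,b,c] \<Longrightarrow> u a \<bullet> cross3 (u b) (u c) \<noteq> 0"
  using ti by (simp add: triples_independent_def)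

text \<open>The tuple equal to \<open>A\<close> at \<open>v\<close> and 0 elsewhere solves the edge
  equations, and three further rays pin it to zero.\<close>

lemma zero_on_star:
  assumes A: "\<And>\<tau>. \<tau> \<in> edges \<Longrightarrow> v \<in> \<tau> \<Longrightarrow> qf A (normal u \<tau>) = 0" and n: "n \<bullet> u v = 0"
  shows "qf A n = 0"
proof -
  let ?A = "\<lambda>x. if x = v then A else 0"
  obtain a b c where abc: "distinct [v,a,b,c]" using ex_three_others by blast
  have "compatible u edges ?A" unfolding compatible_def
  proof (intro allI impI)
    fix x y assume "{x,y} \<in> edges"
    then have xy: "{x,y} \<in> edges" "{x,y} \<in> K" "x \<noteq> y" by (auto simp: edges_def)
    have "qf A (cross3 (u x) (u y)) = 0" if "v \<in> {x,y}"
      using A[OF xy(1) that] qf_normal_iff[OF xy(2,3), of A 0] by simp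
    then show "qf (?A x) (cross3 (u x) (u y)) = qf (?A y) (cross3 (u x) (u y))" by auto
  qed
  from rigid_pinned_zero[OF rig _ _ _ det_ne[of a b c] this, of v n] show ?thesis
    using abc n Union_edges by auto
qed

text \<open>The degree 2 part of the ideal of the ray \<open>v\<close> in matrix form; by
  \<open>symm_starspan\<close> it contains all products of two linear forms vanishing at
  \<open>u v\<close>.\<close>

definition starspan where "starspan v = span ((\<lambda>\<tau>. outer (normal u \<tau>) (normal u \<tau>)) ` {\<tau>\<in>edges. v \<in> \<tau>})"

lemma symm_starspan:
  assumes "l \<bullet> u v = 0" "m \<bullet> u v = 0" shows "symm l m \<in> starspan v"
  unfolding starspan_def
proof (rule in_span_if_annihilated)
  fix A assume "\<And>s. s \<in> (\<lambda>\<tau>. outer (normal u \<tau>) (normal u \<tau>)) ` {\<tau>\<in>edges. v \<in> \<tau>} \<Longrightarrow> A \<bullet> s = 0"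
  then have "qf A (normal u \<tau>) = 0" if "\<tau> \<in> edges" "v \<in> \<tau>" for \<tau> using that by (auto simp: inner_outer[symmetric])
  then have "qf A n = 0" if "n \<bullet> u v = 0" for n using zero_on_star that by blast
  then show "A \<bullet> symm l m = 0" using assms by (simp add: inner_symm inner_add_left)
qed

definition good :: "real^3^3^'v \<Rightarrow> bool" where "good Y \<longleftrightarrow> (\<forall>v. Y $ v \<in> starspan v)"

lemma good_add: "good Y \<Longrightarrow> good Z \<Longrightarrow> good (Y + Z)" and good_scale: "good Y \<Longrightarrow> good (c *\<^sub>R Y)" and good_zero: "good 0"
  by (auto simp: good_def starspan_def span_add span_scale span_zero)

lemma good_diff: "good Y \<Longrightarrow> good Z \<Longrightarrow> good (Y - Z)"
  using good_add[of Y "(-1) *\<^sub>R Z"] good_scale[of Z "-1"] by simp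

lemma good_sum: "(\<And>i. i \<in> A \<Longrightarrow> good (Y i)) \<Longrightarrow> good (\<Sum>i\<in>A. Y i)"
  by (induction A rule: infinite_finite_induct) (auto intro: good_add good_zero)

text \<open>Exactness in degree 2. A functional annihilating the image agrees on every star with one
  global form \<open>B\<close>, so its value on \<open>Y\<close> is that of \<open>B\<close> on the
  total of \<open>Y\<close>, which is 0.\<close>

lemma bimage_of_good:
  assumes Y: "good Y" "(\<Sum>v\<in>UNIV. Y $ v) = 0"
  shows "(\<lambda>v p. qf (Y $ v) p) \<in> bimage 0"
proof (rule bimage_of_span, rule in_span_if_annihilated)
  fix A assume "\<And>s. s \<in> Dmat ` interior2 K \<Longrightarrow> A \<bullet> s = 0"
  then have "compatible u edges (\<lambda>x. if x \<in> interior_vertices then A $ x else 0)"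
    by (intro annihilator_compatible) auto
  then have "compatible u edges (\<lambda>x. A $ x)" by (simp add: iv)
  from rig[unfolded rigid_def, rule_format, OF this]
  obtain B where B0: "\<forall>x\<in>\<Union>edges. \<forall>n. n \<bullet> u x = 0 \<longrightarrow> qf (A $ x) n = qf B n" by (rule exE)
  have B: "qf (A $ x) n = qf B n" if "n \<bullet> u x = 0" for x n
    using B0 that unfolding Union_edges by simp
  have "A $ v \<bullet> M = B \<bullet> M" if "M \<in> starspan v" for v M
  proof -
    have "(A $ v - B) \<bullet> M = 0"
      using that unfolding starspan_def
    proof (induction rule: span_induct)
      case base
      show ?case by (auto intro!: subspaceI simp: inner_add_right)
    next
      case (step x)
      then obtain \<tau> where t: "\<tau> \<in> edges" "v \<in> \<tau>" "x = outer (normal u \<tau>) (normal u \<tau>)" by blast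
      have "qf (A $ v) (normal u \<tau>) = qf B (normal u \<tau>)" using B normal_perp t i2 by blast
      then show ?case by (simp add: t(3) inner_outer qf_diff_matrix)
    qed
    then show ?thesis by (simp add: inner_diff_left)
  qed
  then have "A \<bullet> Y = (\<Sum>v\<in>UNIV. B \<bullet> Y $ v)" using Y(1) unfolding inner_vec_def[of A] good_def by simp
  also have "\<dots> = 0" using Y(2) by (simp add: inner_sum_right[symmetric])
  finally show "A \<bullet> Y = 0" .
qed

text \<open>The squares of all normals span the quadrics, because a form vanishing on them vanishes
  on the planes of three independent rays; each square can be placed at one end of its edge.\<close>

lemma ex_good_symm: "\<exists>Y. good Y \<and> (\<Sum>v\<in>UNIV. Y $ v) = symm l m"
proof -
  let ?S = "(\<lambda>\<tau>. outer (normal u \<tau>) (normal u \<tau>)) ` edges"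
  let ?Q = "{M. \<exists>Y. good Y \<and> (\<Sum>v\<in>UNIV. Y $ v) = M}"
  have "symm l m \<in> span ?S"
  proof (rule in_span_if_annihilated)
    fix A assume "\<And>s. s \<in> ?S \<Longrightarrow> A \<bullet> s = 0"
    then have "qf A (normal u \<tau>) = 0" if "\<tau> \<in> edges" for \<tau> using that by (auto simp: inner_outer[symmetric])
    then have z: "qf A n = 0" if "n \<bullet> u v = 0" for n v using zero_on_star that by blast
    obtain a b c where "distinct [undefined :: 'v,a,b,c]" using ex_three_others by blast
    then have "u a \<bullet> cross3 (u b) (u c) \<noteq> 0" using det_ne[of a b c] by auto
    then have "qf A n = 0" for n by (rule qf_vanishes_three_planes) (use z in blast)+
    then show "A \<bullet> symm l m = 0" by (simp add: inner_symm)
  qed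
  also have "span ?S \<subseteq> ?Q"
  proof (rule span_minimal)
    show "subspace ?Q"
    proof (rule subspaceI)
      show "0 \<in> ?Q" using good_zero by (auto intro!: exI[of _ 0])
      show "x + y \<in> ?Q" if xy: "x \<in> ?Q" "y \<in> ?Q" for x y
      proof -
        obtain Y Z where "good Y" "(\<Sum>v\<in>UNIV. Y $ v) = x" "good Z" "(\<Sum>v\<in>UNIV. Z $ v) = y" using xy by blast
        then show ?thesis using good_add by (auto intro!: exI[of _ "Y + Z"] simp: sum.distrib)
      qed
      show "c *\<^sub>R x \<in> ?Q" if x: "x \<in> ?Q" for c x
      proof -
        obtain Y where "good Y" "(\<Sum>v\<in>UNIV. Y $ v) = x" using x by blast
        then show ?thesis using good_scale by (auto intro!: exI[of _ "c *\<^sub>R Y"] simp: scaleR_sum_right)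
      qed
    qed
    show "?S \<subseteq> ?Q"
    proof (rule image_subsetI, rule CollectI)
      fix \<tau> assume t: "\<tau> \<in> edges"
      then obtain v where v: "v \<in> \<tau>" by (auto simp: edges_def card_2_iff)
      let ?M = "outer (normal u \<tau>) (normal u \<tau>)"
      let ?Y = "(\<chi> w. if w = v then ?M else 0) :: real^3^3^'v"
      have "?M \<in> starspan v" unfolding starspan_def using t v by (intro span_base) auto
      then have "good ?Y" unfolding good_def starspan_def by (auto intro: span_zero)
      moreover have "(\<Sum>w\<in>UNIV. ?Y $ w) = ?M" by simp
      ultimately show "\<exists>Y. good Y \<and> (\<Sum>v\<in>UNIV. Y $ v) = ?M" by blast
    qed
  qed
  finally show ?thesis by blast
qed

definition Yb :: "3 \<Rightarrow> 3 \<Rightarrow> real^3^3^'v" where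
  "Yb i j = (SOME Y. good Y \<and> (\<Sum>v\<in>UNIV. Y $ v) = symm (axis i 1) (axis j 1))"

lemma Yb: "good (Yb i j)" "(\<Sum>v\<in>UNIV. Yb i j $ v) = symm (axis i 1) (axis j 1)"
  using someI_ex[OF ex_good_symm[of "axis i 1" "axis j 1"]] unfolding Yb_def by auto

text \<open>A bilinear choice of preimages of the symmetrised products under the sum over all rays.
  Fixed on pairs of basis vectors, it need not be symmetric; symmetry holds modulo the image by
  \<open>theta_swap\<close>.\<close>

definition Theta :: "real^3 \<Rightarrow> real^3 \<Rightarrow> real^3^3^'v" where
  "Theta l m = (\<Sum>i\<in>UNIV. \<Sum>j\<in>UNIV. (l $ i * m $ j) *\<^sub>R Yb i j)"

definition theta :: "real^3 \<Rightarrow> real^3 \<Rightarrow> 'v \<Rightarrow> real^3 \<Rightarrow> real" where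
  "theta l m v p = qf (Theta l m $ v) p"

lemma Theta_good: "good (Theta l m)"
  unfolding Theta_def by (intro good_sum good_scale Yb)

lemma Theta_sum: "(\<Sum>v\<in>UNIV. Theta l m $ v) = symm l m"
proof -
  have "(\<Sum>v\<in>UNIV. Theta l m $ v) = (\<Sum>v\<in>UNIV. \<Sum>i\<in>UNIV. \<Sum>j\<in>UNIV. (l $ i * m $ j) *\<^sub>R (Yb i j $ v))"
    by (simp add: Theta_def)
  also have "\<dots> = (\<Sum>i\<in>UNIV. \<Sum>v\<in>UNIV. \<Sum>j\<in>UNIV. (l $ i * m $ j) *\<^sub>R (Yb i j $ v))" by (rule sum.swap)
  also have "\<dots> = (\<Sum>i\<in>UNIV. \<Sum>j\<in>UNIV. \<Sum>v\<in>UNIV. (l $ i * m $ j) *\<^sub>R (Yb i j $ v))" by (intro sum.cong refl sum.swap)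
  also have "\<dots> = (\<Sum>i\<in>UNIV. \<Sum>j\<in>UNIV. (l $ i * m $ j) *\<^sub>R symm (axis i 1) (axis j 1))"
    by (simp add: scaleR_sum_right[symmetric] Yb(2))
  finally show ?thesis using symm_expansion by metis
qed

lemma theta_expansion: "theta l m v p = (\<Sum>i\<in>UNIV. \<Sum>j\<in>UNIV. l $ i * m $ j * theta (axis i 1) (axis j 1) v p)"
proof -
  have b: "Theta (axis i 1) (axis j 1) = Yb i j" for i j
    using exhaust_3[of i] exhaust_3[of j] by (elim disjE) (simp_all add: Theta_def sum_3 axis_def)
  have s: "qf (\<Sum>i\<in>A. M i) p = (\<Sum>i\<in>A. qf (M i) p)" for M :: "3 \<Rightarrow> real^3^3" and A
    by (induction A rule: infinite_finite_induct) (auto simp: qf_add_matrix)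
  show ?thesis unfolding theta_def b by (simp add: Theta_def s qf_scale_matrix)
qed

lemma theta_add1: "theta (l + l') m v p = theta l m v p + theta l' m v p"
  and theta_add2: "theta l (m + m') v p = theta l m v p + theta l m' v p"
  and theta_scale1: "theta (c *\<^sub>R l) m v p = c * theta l m v p"
  and theta_scale2: "theta l (c *\<^sub>R m) v p = c * theta l m v p"
  by (subst (1 2 3) theta_expansion, simp add: distrib_right distrib_left sum.distrib)+
     (subst (1 2) theta_expansion, simp add: sum_distrib_left mult_ac)+

text \<open>If both linear forms vanish at \<open>u v\<close>, their product may be placed at
  \<open>v\<close> alone; this preimage and the chosen one have the same sum, so
  \<open>bimage_of_good\<close> applies to their difference.\<close>

lemma theta_local:
  assumes "l \<bullet> u v = 0" "m \<bullet> u v = 0"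
  shows "(\<lambda>w p. theta l m w p - (if w = v then 2 * (l \<bullet> p) * (m \<bullet> p) else 0)) \<in> bimage 0"
proof -
  let ?Y = "(\<chi> w. if w = v then symm l m else 0) :: real^3^3^'v"
  have "good ?Y" using symm_starspan[OF assms] unfolding good_def starspan_def by (auto intro: span_zero)
  then have "good (Theta l m - ?Y)" by (intro good_diff Theta_good)
  moreover have "(\<Sum>w\<in>UNIV. (Theta l m - ?Y) $ w) = 0" by (simp add: sum_subtractf Theta_sum)
  ultimately have "(\<lambda>w p. qf ((Theta l m - ?Y) $ w) p) \<in> bimage 0" by (rule bimage_of_good)
  moreover have "(\<lambda>w p. qf ((Theta l m - ?Y) $ w) p) = (\<lambda>w p. theta l m w p - (if w = v then 2 * (l \<bullet> p) * (m \<bullet> p) else 0))"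
    by (auto simp: fun_eq_iff qf_diff_matrix theta_def qf_symm)
  ultimately show ?thesis by simp
qed

lemma theta_swap: "(\<lambda>w p. theta l m w p - theta m l w p) \<in> bimage 0"
proof -
  have "good (Theta l m - Theta m l)" by (intro good_diff Theta_good)
  moreover have "(\<Sum>w\<in>UNIV. (Theta l m - Theta m l) $ w) = 0" by (simp add: sum_subtractf Theta_sum symm_def)
  ultimately have "(\<lambda>w p. qf ((Theta l m - Theta m l) $ w) p) \<in> bimage 0" by (rule bimage_of_good)
  then show ?thesis by (simp add: qf_diff_matrix theta_def)
qed

text \<open>The lift of the linear syzygy \<open>l (m k) - m (l k) = 0\<close> among
  quadrics.\<close>

definition syz :: "real^3 \<Rightarrow> real^3 \<Rightarrow> real^3 \<Rightarrow> 'v \<Rightarrow> real^3 \<Rightarrow> real" where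
  "syz l m k = (\<lambda>v p. (l \<bullet> p) * theta m k v p - (m \<bullet> p) * theta l k v p)"

lemma syz_local:
  assumes "l \<bullet> u v = 0" "m \<bullet> u v = 0" "k \<bullet> u v = 0"
  shows "syz l m k \<in> bimage 1"
proof -
  have 1: "(\<lambda>w p. (l \<bullet> p) * (theta m k w p - (if w = v then 2 * (m \<bullet> p) * (k \<bullet> p) else 0))) \<in> bimage (0 + 1)"
    by (rule bimage_mult[OF theta_local inner_in_forms]) (use assms in auto)
  have 2: "(\<lambda>w p. (m \<bullet> p) * (theta l k w p - (if w = v then 2 * (l \<bullet> p) * (k \<bullet> p) else 0))) \<in> bimage (0 + 1)"
    by (rule bimage_mult[OF theta_local inner_in_forms]) (use assms in auto)
  have "syz l m k = (\<lambda>w p. (l \<bullet> p) * (theta m k w p - (if w = v then 2 * (m \<bullet> p) * (k \<bullet> p) else 0))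
     - (m \<bullet> p) * (theta l k w p - (if w = v then 2 * (l \<bullet> p) * (k \<bullet> p) else 0)))"
    by (auto simp: syz_def fun_eq_iff algebra_simps)
  then show ?thesis using bimage_diff[OF 1 2] by simp
qed

lemma syz_cyclic: "(\<lambda>v p. syz l m k v p + (syz m k l v p + syz k l m v p)) \<in> bimage 1"
proof -
  have *: "(\<lambda>v p. (x \<bullet> p) * (theta y z v p - theta z y v p)) \<in> bimage 1" for x y z
    using bimage_mult[OF theta_swap inner_in_forms, of x y z] by simp
  have "(\<lambda>v p. syz l m k v p + (syz m k l v p + syz k l m v p)) =
    (\<lambda>v p. (l \<bullet> p) * (theta m k v p - theta k m v p) + ((m \<bullet> p) * (theta k l v p - theta l k v p) + (k \<bullet> p) * (theta l m v p - theta m l v p)))"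
    by (simp add: syz_def fun_eq_iff algebra_simps)
  then show ?thesis using bimage_add[OF * bimage_add[OF * *]] by simp
qed

text \<open>Composed with a functional that kills the image, \<open>syz\<close> becomes a trilinear
  form, skew in the first two arguments, with zero cyclic sum, and zero whenever all arguments
  vanish at one ray. Four of the rays are enough for \<open>trilinear_vanishes\<close>.\<close>

lemma syz_in_bimage: "syz l m k \<in> bimage 1"
proof (rule ccontr)
  assume "syz l m k \<notin> bimage 1"
  from ts_separating_functional[OF bimage_subspace this]
  obtain \<phi> where \<phi>0: "(\<forall>F G. \<phi> (\<lambda>i y. F i y + G i y) = \<phi> F + (\<phi> G :: real)) \<and> (\<forall>c F. \<phi> (\<lambda>i y. c * F i y) = c * \<phi> F) \<and>
     (\<forall>F\<in>bimage 1. \<phi> F = 0) \<and> \<phi> (syz l m k) \<noteq> 0" by (rule exE)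
  have \<phi>: "\<phi> (\<lambda>i y. F i y + G i y) = \<phi> F + \<phi> G" "\<phi> (\<lambda>i y. c * F i y) = c * \<phi> F"
     "F \<in> bimage 1 \<Longrightarrow> \<phi> F = 0" "\<phi> (syz l m k) \<noteq> 0" for F G c
    using \<phi>0 by simp_all
  obtain a :: 'v where True by blast
  obtain b c e where d: "distinct [a,b,c,e]" using ex_three_others by blast
  have "\<phi> (syz l m k) = 0"
  proof (rule trilinear_vanishes[where a = "u a" and b = "u b" and c = "u c" and e = "u e"])
    fix x y
    show "linear (\<lambda>z. \<phi> (syz z x y))"
    proof (rule linearI)
      fix z z' r
      have "syz (z + z') x y = (\<lambda>v p. syz z x y v p + syz z' x y v p)"
        by (simp add: syz_def fun_eq_iff theta_add1 inner_add_left algebra_simps)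
      then show "\<phi> (syz (z + z') x y) = \<phi> (syz z x y) + \<phi> (syz z' x y)" by (simp add: \<phi>(1))
      have "syz (r *\<^sub>R z) x y = (\<lambda>v p. r * syz z x y v p)"
        by (simp add: syz_def fun_eq_iff theta_scale1 algebra_simps)
      then show "\<phi> (syz (r *\<^sub>R z) x y) = r *\<^sub>R \<phi> (syz z x y)" by (simp add: \<phi>(2))
    qed
    show "linear (\<lambda>z. \<phi> (syz x z y))"
    proof (rule linearI)
      fix z z' r
      have "syz x (z + z') y = (\<lambda>v p. syz x z y v p + syz x z' y v p)"
        by (simp add: syz_def fun_eq_iff theta_add1 inner_add_left algebra_simps)
      then show "\<phi> (syz x (z + z') y) = \<phi> (syz x z y) + \<phi> (syz x z' y)" by (simp add: \<phi>(1))
      have "syz x (r *\<^sub>R z) y = (\<lambda>v p. r * syz x z y v p)"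
        by (simp add: syz_def fun_eq_iff theta_scale1 algebra_simps)
      then show "\<phi> (syz x (r *\<^sub>R z) y) = r *\<^sub>R \<phi> (syz x z y)" by (simp add: \<phi>(2))
    qed
    show "linear (\<lambda>z. \<phi> (syz x y z))"
    proof (rule linearI)
      fix z z' r
      have "syz x y (z + z') = (\<lambda>v p. syz x y z v p + syz x y z' v p)"
        by (simp add: syz_def fun_eq_iff theta_add2 inner_add_left algebra_simps)
      then show "\<phi> (syz x y (z + z')) = \<phi> (syz x y z) + \<phi> (syz x y z')" by (simp add: \<phi>(1))
      have "syz x y (r *\<^sub>R z) = (\<lambda>v p. r * syz x y z v p)"
        by (simp add: syz_def fun_eq_iff theta_scale2 algebra_simps)
      then show "\<phi> (syz x y (r *\<^sub>R z)) = r *\<^sub>R \<phi> (syz x y z)" by (simp add: \<phi>(2))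
    qed
  next
    fix x y z
    have "syz x y z = (\<lambda>v p. (-1) * syz y x z v p)" by (simp add: syz_def fun_eq_iff)
    then have "\<phi> (syz x y z) = (-1) * \<phi> (syz y x z)" by (simp only: \<phi>(2))
    then show "\<phi> (syz x y z) = - \<phi> (syz y x z)" by simp
    have "0 = \<phi> (\<lambda>v p. syz x y z v p + (syz y z x v p + syz z x y v p))" using \<phi>(3)[OF syz_cyclic] by simp
    also have "\<dots> = \<phi> (syz x y z) + (\<phi> (syz y z x) + \<phi> (syz z x y))" unfolding \<phi>(1) by (rule refl)
    finally show "\<phi> (syz x y z) + \<phi> (syz y z x) + \<phi> (syz z x y) = 0" by simp
  next
    fix w x y z assume "w \<in> {u a, u b, u c, u e}" "x \<bullet> w = 0" "y \<bullet> w = 0" "z \<bullet> w = 0"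
    then show "\<phi> (syz x y z) = 0" using \<phi>(3)[OF syz_local] by blast
  next
    show "u a \<bullet> cross3 (u b) (u c) \<noteq> 0" "u e \<bullet> cross3 (u b) (u c) \<noteq> 0"
      "u e \<bullet> cross3 (u c) (u a) \<noteq> 0" "u e \<bullet> cross3 (u a) (u b) \<noteq> 0"
      using d by (auto intro!: det_ne)
  qed
  then show False using \<phi>(4) by blast
qed

text \<open>The relation is resolved by applying \<open>koszul_exact\<close> twice: first to the
  sums \<open>g j\<close>, then for each \<open>j\<close> to what remains of \<open>h\<close> after
  subtracting the skew coefficients. The coefficients \<open>a\<close> go with differences of
  \<open>theta\<close> under swapping, the coefficients \<open>b\<close> with
  \<open>syz\<close>.\<close>

lemma quadratic_combination:
  fixes h :: "3 \<Rightarrow> 3 \<Rightarrow> real^3 \<Rightarrow> real"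
  assumes h: "\<And>i j. h i j \<in> forms e" and rel: "\<And>p. (\<Sum>i\<in>UNIV. \<Sum>j\<in>UNIV. h i j p * (p $ i * p $ j)) = 0"
  shows "(\<lambda>v p. \<Sum>i\<in>UNIV. \<Sum>j\<in>UNIV. h i j p * theta (axis i 1) (axis j 1) v p) \<in> bimage e"
proof -
  let ?t = "\<lambda>i j. theta (axis i 1) (axis j 1)"
  define g where "g j p = (\<Sum>i\<in>UNIV. h i j p * p $ i)" for j p
  have gf: "g j \<in> forms (e + 1)" for j unfolding g_def by (intro forms_sum forms_mult h coord_in_forms)
  have "(\<Sum>j\<in>UNIV. g j p * p $ j) = 0" for p
    using rel[of p] by (subst (asm) sum.swap) (simp add: g_def sum_distrib_right sum_distrib_left mult_ac)
  from koszul_exact[OF gf this] obtain a where a0: "(\<forall>j k. a j k \<in> forms_pred (e + 1)) \<and> (\<forall>j k p. a j k p = - a k j p) \<and>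
     (\<forall>j p. g j p = (\<Sum>k\<in>UNIV. a j k p * p $ k))" by (rule exE)
  have fp: "forms_pred (e + 1) = forms e" by (simp add: forms_pred_def)
  have a: "a j k \<in> forms e" "a j k p = - a k j p" "g j p = (\<Sum>k\<in>UNIV. a j k p * p $ k)" for j k p
    using a0 unfolding fp by blast+
  let ?P = "\<lambda>j b. (\<forall>i k. b i k \<in> forms_pred e) \<and> (\<forall>i k p. b i k p = - b k i p) \<and>
     (\<forall>i p. h i j p - a j i p = (\<Sum>k\<in>UNIV. b i k p * p $ k))"
  have "\<exists>b. ?P j b" for j
  proof (rule koszul_exact)
    show "(\<lambda>p. h i j p - a j i p) \<in> forms e" for i by (intro forms_diff h a)
    show "(\<Sum>i\<in>UNIV. (h i j p - a j i p) * p $ i) = 0" for p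
      using a(3)[of j p] by (simp add: g_def left_diff_distrib sum_subtractf)
  qed
  then have "\<exists>b. \<forall>j. ?P j (b j)" by (intro choice allI)
  then obtain b where b0: "\<forall>j. ?P j (b j)" by (rule exE)
  have b: "b j i k \<in> forms_pred e" "b j i k p = - b j k i p"
     "h i j p - a j i p = (\<Sum>k\<in>UNIV. b j i k p * p $ k)" for i j k p
    using spec[OF b0, of j] by blast+
  have part1: "(\<lambda>v p. \<Sum>i\<in>UNIV. \<Sum>j\<in>UNIV. (1/2 * a j i p) * (?t i j v p - ?t j i v p)) \<in> bimage e"
  proof (intro bimage_sum)
    fix i j
    show "(\<lambda>v p. (1/2 * a j i p) * (?t i j v p - ?t j i v p)) \<in> bimage e"
      using bimage_mult[OF theta_swap[of "axis i 1" "axis j 1"] forms_scale[OF a(1)[of j i], of "1/2"]] by simp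
  qed
  have part2: "(\<lambda>v p. \<Sum>j\<in>UNIV. \<Sum>i\<in>UNIV. \<Sum>k\<in>UNIV. (1/2 * b j i k p) * syz (axis k 1) (axis i 1) (axis j 1) v p) \<in> bimage e"
  proof (intro bimage_sum)
    fix j i k
    show "(\<lambda>v p. (1/2 * b j i k p) * syz (axis k 1) (axis i 1) (axis j 1) v p) \<in> bimage e"
    proof (cases "e = 0")
      case True
      then have "b j i k = (\<lambda>p. 0)" using b(1)[of j i k] by (simp add: forms_pred_def)
      then show ?thesis using bimage_zero by simp
    next
      case False
      then have "b j i k \<in> forms (e - 1)" using b(1)[of j i k] by (simp add: forms_pred_def)
      from bimage_mult[OF syz_in_bimage[of "axis k 1" "axis i 1" "axis j 1"] forms_scale[OF this, of "1/2"]]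
      show ?thesis using False by simp
    qed
  qed
  \<comment> \<open>Skewness of \<open>a\<close> and of \<open>b\<close> makes every term occur
    twice, hence the factors 1/2.\<close>
  have eq: "(\<Sum>i\<in>UNIV. \<Sum>j\<in>UNIV. h i j p * ?t i j v p) =
     (\<Sum>i\<in>UNIV. \<Sum>j\<in>UNIV. (1/2 * a j i p) * (?t i j v p - ?t j i v p)) +
     (\<Sum>j\<in>UNIV. \<Sum>i\<in>UNIV. \<Sum>k\<in>UNIV. (1/2 * b j i k p) * syz (axis k 1) (axis i 1) (axis j 1) v p)" for v p
  proof -
    have A1: "(\<Sum>i\<in>UNIV. \<Sum>j\<in>UNIV. a j i p * ?t j i v p) = - (\<Sum>i\<in>UNIV. \<Sum>j\<in>UNIV. a j i p * ?t i j v p)"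
      by (subst sum.swap, simp only: sum_negf[symmetric], intro sum.cong refl, subst a(2)) simp
    have A: "(\<Sum>i\<in>UNIV. \<Sum>j\<in>UNIV. (1/2 * a j i p) * (?t i j v p - ?t j i v p)) = (\<Sum>i\<in>UNIV. \<Sum>j\<in>UNIV. a j i p * ?t i j v p)"
    proof -
      have "(\<Sum>i\<in>UNIV. \<Sum>j\<in>UNIV. (1/2 * a j i p) * (?t i j v p - ?t j i v p)) =
         1/2 * ((\<Sum>i\<in>UNIV. \<Sum>j\<in>UNIV. a j i p * ?t i j v p) - (\<Sum>i\<in>UNIV. \<Sum>j\<in>UNIV. a j i p * ?t j i v p))"
        by (simp add: sum_subtractf[symmetric] sum_distrib_left right_diff_distrib mult_ac)
      then show ?thesis unfolding A1 by simp
    qed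
    have B1: "(\<Sum>i\<in>UNIV. \<Sum>k\<in>UNIV. b j i k p * (p $ i * ?t k j v p)) = - (\<Sum>i\<in>UNIV. \<Sum>k\<in>UNIV. b j i k p * (p $ k * ?t i j v p))" for j
      by (subst sum.swap, simp only: sum_negf[symmetric], intro sum.cong refl, subst b(2)) simp
    have B: "(\<Sum>i\<in>UNIV. \<Sum>k\<in>UNIV. (1/2 * b j i k p) * syz (axis k 1) (axis i 1) (axis j 1) v p) = (\<Sum>i\<in>UNIV. (h i j p - a j i p) * ?t i j v p)" for j
    proof -
      have "(\<Sum>i\<in>UNIV. \<Sum>k\<in>UNIV. (1/2 * b j i k p) * syz (axis k 1) (axis i 1) (axis j 1) v p) =
        1/2 * ((\<Sum>i\<in>UNIV. \<Sum>k\<in>UNIV. b j i k p * (p $ k * ?t i j v p)) - (\<Sum>i\<in>UNIV. \<Sum>k\<in>UNIV. b j i k p * (p $ i * ?t k j v p)))"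
        by (simp add: syz_def inner_axis' sum_subtractf[symmetric] sum_distrib_left right_diff_distrib mult_ac)
      also have "\<dots> = (\<Sum>i\<in>UNIV. \<Sum>k\<in>UNIV. b j i k p * (p $ k * ?t i j v p))" unfolding B1 by simp
      also have "\<dots> = (\<Sum>i\<in>UNIV. (h i j p - a j i p) * ?t i j v p)"
        unfolding b(3) by (simp add: sum_distrib_right sum_distrib_left mult_ac)
      finally show ?thesis .
    qed
    have "(\<Sum>j\<in>UNIV. \<Sum>i\<in>UNIV. (h i j p - a j i p) * ?t i j v p) = (\<Sum>i\<in>UNIV. \<Sum>j\<in>UNIV. (h i j p - a j i p) * ?t i j v p)"
      by (rule sum.swap)
    then show ?thesis unfolding A B by (simp add: sum.distrib[symmetric] left_diff_distrib)
  qed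
  show ?thesis unfolding eq by (rule bimage_add[OF part1 part2])
qed

text \<open>Modulo the image, the square of a normal placed at a ray of its edge equals half of
  \<open>theta\<close> on that normal. After this replacement the tuple is a combination of
  \<open>theta\<close> on basis vectors, and its zero sum turns into a relation among the products
  of coordinates.\<close>

lemma closed_image:
  "bdm ` direct_sum (interior2 K) (edge_ideal d) = {f\<in>direct_sum UNIV (vertex_ideal d). (\<Sum>v\<in>UNIV. f v) = 0}"
proof (cases "d < 2")
  case True
  then show ?thesis using low_degree_image(1)[OF True] low_degree_image(2)[OF True, of UNIV] by auto
next
  case False
  then obtain e where d: "d = e + 2" by (metis le_add_diff_inverse2 not_less)
  have "{f\<in>direct_sum UNIV (vertex_ideal d). (\<Sum>v\<in>UNIV. f v) = 0} \<subseteq> bimage e"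
  proof
    fix f assume f: "f \<in> {f\<in>direct_sum UNIV (vertex_ideal d). (\<Sum>v\<in>UNIV. f v) = 0}"
    let ?E = "\<lambda>v. {\<tau>\<in>interior2 K. v \<in> \<tau>}"
    have "f \<in> direct_sum interior_vertices (vertex_ideal (e + 2))" using f by (simp add: d iv)
    then obtain H where H: "\<And>v \<tau>. H v \<tau> \<in> forms e"
      "\<And>v p. f v p = (\<Sum>\<tau>\<in>?E v. (normal u \<tau> \<bullet> p)\<^sup>2 * H v \<tau> p)"
      using vertex_ideal_decomposition unfolding iv by fastforce
    \<comment> \<open>The coefficients obtained by expanding each square of a normal in products of
      coordinates.\<close>
    define h where "h i j p = (\<Sum>v\<in>UNIV. \<Sum>\<tau>\<in>?E v. (1/2 * (normal u \<tau> $ i * normal u \<tau> $ j)) * H v \<tau> p)" for i j p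
    have hf: "h i j \<in> forms e" for i j unfolding h_def by (intro forms_sum forms_scale H(1))
    have swap: "(\<Sum>i\<in>UNIV. \<Sum>j\<in>UNIV. h i j p * q i j) =
       (\<Sum>v\<in>UNIV. \<Sum>\<tau>\<in>?E v. 1/2 * H v \<tau> p * (\<Sum>i\<in>UNIV. \<Sum>j\<in>UNIV. normal u \<tau> $ i * normal u \<tau> $ j * q i j))" for p and q :: "3 \<Rightarrow> 3 \<Rightarrow> real"
    proof -
      have "(\<Sum>i\<in>UNIV. \<Sum>j\<in>UNIV. h i j p * q i j) =
        (\<Sum>i\<in>UNIV. \<Sum>j\<in>UNIV. \<Sum>v\<in>UNIV. \<Sum>\<tau>\<in>?E v. 1/2 * H v \<tau> p * (normal u \<tau> $ i * normal u \<tau> $ j * q i j))"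
        unfolding h_def sum_distrib_right by (intro sum.cong refl) simp
      also have "\<dots> = (\<Sum>v\<in>UNIV. \<Sum>i\<in>UNIV. \<Sum>j\<in>UNIV. \<Sum>\<tau>\<in>?E v. 1/2 * H v \<tau> p * (normal u \<tau> $ i * normal u \<tau> $ j * q i j))"
        by (subst (2) sum.swap, subst sum.swap) (rule refl)
      also have "\<dots> = (\<Sum>v\<in>UNIV. \<Sum>\<tau>\<in>?E v. \<Sum>i\<in>UNIV. \<Sum>j\<in>UNIV. 1/2 * H v \<tau> p * (normal u \<tau> $ i * normal u \<tau> $ j * q i j))"
        by (intro sum.cong refl, subst (2) sum.swap, subst sum.swap) (rule refl)
      finally show ?thesis by (simp add: sum_distrib_left)
    qed
    have "(\<Sum>i\<in>UNIV. \<Sum>j\<in>UNIV. h i j p * (p $ i * p $ j)) = 0" for p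
    proof -
      have "(\<Sum>i\<in>UNIV. \<Sum>j\<in>UNIV. normal u \<tau> $ i * normal u \<tau> $ j * (p $ i * p $ j)) = (normal u \<tau> \<bullet> p)\<^sup>2" for \<tau>
        by (simp add: inner_vec_def power2_eq_square sum_product mult_ac)
      then have "(\<Sum>i\<in>UNIV. \<Sum>j\<in>UNIV. h i j p * (p $ i * p $ j)) = (\<Sum>v\<in>UNIV. \<Sum>\<tau>\<in>?E v. 1/2 * H v \<tau> p * (normal u \<tau> \<bullet> p)\<^sup>2)"
        unfolding swap by simp
      also have "\<dots> = 1/2 * (\<Sum>v\<in>UNIV. f v p)" by (simp add: H(2) sum_distrib_left mult_ac)
      also have "(\<Sum>v\<in>UNIV. f v p) = (\<Sum>v\<in>UNIV. f v) p"
      proof -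
        have "(\<Sum>v\<in>A. f v) p = (\<Sum>v\<in>A. f v p)" for A by (induction A rule: infinite_finite_induct) auto
        then show ?thesis by simp
      qed
      also have "\<dots> = 0" using f by simp
      finally show ?thesis by simp
    qed
    from quadratic_combination[OF hf this]
    have q: "(\<lambda>v p. \<Sum>i\<in>UNIV. \<Sum>j\<in>UNIV. h i j p * theta (axis i 1) (axis j 1) v p) \<in> bimage e" .
    have loc: "(\<lambda>w p. \<Sum>v\<in>UNIV. \<Sum>\<tau>\<in>?E v. (1/2 * H v \<tau> p) *
        (theta (normal u \<tau>) (normal u \<tau>) w p - (if w = v then 2 * (normal u \<tau> \<bullet> p) * (normal u \<tau> \<bullet> p) else 0))) \<in> bimage e"
    proof (intro bimage_sum)
      fix v \<tau> assume t: "\<tau> \<in> ?E v"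
      have "normal u \<tau> \<bullet> u v = 0" using normal_perp t by blast
      from bimage_mult[OF theta_local[OF this this] forms_scale[OF H(1)[of v \<tau>], of "1/2"]]
      show "(\<lambda>w p. (1/2 * H v \<tau> p) *
        (theta (normal u \<tau>) (normal u \<tau>) w p - (if w = v then 2 * (normal u \<tau> \<bullet> p) * (normal u \<tau> \<bullet> p) else 0))) \<in> bimage e"
        by simp
    qed
    have "f = (\<lambda>w p. (\<Sum>i\<in>UNIV. \<Sum>j\<in>UNIV. h i j p * theta (axis i 1) (axis j 1) w p) - (\<Sum>v\<in>UNIV. \<Sum>\<tau>\<in>?E v. (1/2 * H v \<tau> p) *
        (theta (normal u \<tau>) (normal u \<tau>) w p - (if w = v then 2 * (normal u \<tau> \<bullet> p) * (normal u \<tau> \<bullet> p) else 0))))"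
    proof (intro ext)
      fix w p
      have 1: "(\<Sum>i\<in>UNIV. \<Sum>j\<in>UNIV. h i j p * theta (axis i 1) (axis j 1) w p) =
        (\<Sum>v\<in>UNIV. \<Sum>\<tau>\<in>?E v. (1/2 * H v \<tau> p) * theta (normal u \<tau>) (normal u \<tau>) w p)"
        unfolding swap by (simp only: theta_expansion[symmetric])
      have 2: "(\<Sum>v\<in>UNIV. \<Sum>\<tau>\<in>?E v. (1/2 * H v \<tau> p) * (if w = v then 2 * (normal u \<tau> \<bullet> p) * (normal u \<tau> \<bullet> p) else 0)) = f w p"
      proof -
        have "(\<Sum>v\<in>UNIV. \<Sum>\<tau>\<in>?E v. (1/2 * H v \<tau> p) * (if w = v then 2 * (normal u \<tau> \<bullet> p) * (normal u \<tau> \<bullet> p) else 0))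
          = (\<Sum>v\<in>UNIV. if v = w then \<Sum>\<tau>\<in>?E w. (normal u \<tau> \<bullet> p)\<^sup>2 * H w \<tau> p else 0)"
          by (intro sum.cong) (auto simp: power2_eq_square mult_ac)
        then show ?thesis by (simp add: H(2))
      qed
      show "f w p = (\<Sum>i\<in>UNIV. \<Sum>j\<in>UNIV. h i j p * theta (axis i 1) (axis j 1) w p) - (\<Sum>v\<in>UNIV. \<Sum>\<tau>\<in>?E v. (1/2 * H v \<tau> p) *
        (theta (normal u \<tau>) (normal u \<tau>) w p - (if w = v then 2 * (normal u \<tau> \<bullet> p) * (normal u \<tau> \<bullet> p) else 0)))"
        unfolding right_diff_distrib sum_subtractf 1 2 by simp
    qed
    then show "f \<in> bimage e" using bimage_diff[OF q loc] by simp
  qed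
  moreover have "bimage e \<subseteq> {f\<in>direct_sum UNIV (vertex_ideal d). (\<Sum>v\<in>UNIV. f v) = 0}"
  proof
    fix y assume y: "y \<in> bimage e"
    then have "y \<in> direct_sum UNIV (vertex_ideal d)" using bimage_subset[of e] unfolding iv d by blast
    moreover obtain g where "y = bdm g" using y unfolding image_eq_bimage[symmetric] by (rule imageE)
    ultimately show "y \<in> {f\<in>direct_sum UNIV (vertex_ideal d). (\<Sum>v\<in>UNIV. f v) = 0}"
      using sum_bdm_zero[OF cl, of g] by simp
  qed
  ultimately show ?thesis using image_eq_bimage[of e] unfolding d by blast
qed

end

section \<open>The generic dimension formula\<close>

lemma coord_poly_case_option:
  assumes "coord_poly P" shows "coord_poly (\<lambda>u. P (case_option p u))"
  using assms
proof induction
  case (cp_coord v i)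
  show ?case by (cases v) (auto intro: coord_poly.intros)
qed (auto intro: coord_poly.intros)

text \<open>The apex is frozen at the value it has at a nonzero of the polynomial; what remains is a
  nonzero polynomial in the other rays.\<close>

lemma generically_case_option:
  assumes "generically \<phi>" shows "generically (\<lambda>u. \<exists>p. \<phi> (case_option p u))"
proof -
  obtain P w where P: "coord_poly P" "P w \<noteq> 0" "\<And>u. P u \<noteq> 0 \<Longrightarrow> \<phi> u"
    using assms by (auto simp: generically_def)
  let ?Q = "\<lambda>u. P (case_option (w None) u)"
  have "case_option (w None) (\<lambda>v. w (Some v)) = w" by (auto simp: fun_eq_iff split: option.split)
  then have "?Q (\<lambda>v. w (Some v)) \<noteq> 0" using P(2) by simp
  then show ?thesis unfolding generically_def
    using coord_poly_case_option[OF P(1), of "w None"] P(3) by (intro exI[of _ ?Q]) blast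
qed

section \<open>Coning off the boundary\<close>

definition cone_complex :: "'v set set \<Rightarrow> 'v option set set" where
  "cone_complex K = (\<lambda>\<sigma>. Some ` \<sigma>) ` facets K \<union> (\<lambda>\<tau>. insert None (Some ` \<tau>)) ` bdry_2faces K"

context pure_fan
begin

lemma Some_image_eq: "Some ` A = Some ` B \<longleftrightarrow> A = B"
  by (metis inj_Some inj_image_eq_iff)

lemma cone_degree_pair:
  assumes "card \<tau> = 2"
  shows "{T\<in>cone_complex K. Some ` \<tau> \<subseteq> T} =
     (\<lambda>\<sigma>. Some ` \<sigma>) ` star \<tau> \<union> (if \<tau> \<in> bdry_2faces K then {insert None (Some ` \<tau>)} else {})"
proof -
  have 1: "Some ` \<tau> \<subseteq> Some ` \<sigma> \<longleftrightarrow> \<tau> \<subseteq> \<sigma>" for \<sigma> by auto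
  have 2: "Some ` \<tau> \<subseteq> insert None (Some ` \<tau>') \<longleftrightarrow> \<tau> = \<tau>'" if "\<tau>' \<in> bdry_2faces K" for \<tau>'
    using that assms card_seteq[of \<tau>' \<tau>] by (auto simp: bdry_2faces_def)
  show ?thesis unfolding cone_complex_def star_def using 1 2 by auto
qed

text \<open>A boundary edge gains its missing second triangle from the cone, and the edges at the
  apex have even degree by the parity in \<open>local_counts\<close>. A nonempty subcycle contains
  with a triangle every triangle across an edge of degree two, so by connectedness of the facets it
  is everything.\<close>

lemma cone_min_cycle: "min_cycle (cone_complex K)"
proof -
  let ?S = "cone_complex K"
  have c3: "\<forall>T\<in>?S. card T = 3"
    by (auto simp: cone_complex_def facet_card card_image bdry_2faces_def card_insert_if image_iff)
  have st: "star \<tau> = {}" if "\<tau> \<notin> K" for \<tau> using that K_down facet_K by (auto simp: star_def)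
  have ev: "even (degree2 ?S e)" if e: "card e = 2" for e
  proof (cases "None \<in> e")
    case False
    then obtain \<tau> where t: "e = Some ` \<tau>" by (metis (no_types, opaque_lifting) not_None_eq subsetI subset_image_iff UNIV_I image_eqI)
    have c: "card \<tau> = 2" using e t by (simp add: card_image)
    have ci: "card ((\<lambda>\<sigma>. Some ` \<sigma>) ` star \<tau>) = card (star \<tau>)" by (intro card_image inj_onI) (simp add: Some_image_eq)
    have nn: "insert None (Some ` \<tau>) \<notin> (\<lambda>\<sigma>. Some ` \<sigma>) ` star \<tau>" by auto
    have "degree2 ?S e = card (star \<tau>) + (if \<tau> \<in> bdry_2faces K then 1 else 0)"
      unfolding degree2_def t cone_degree_pair[OF c] using ci nn by simp
    moreover have "card (star \<tau>) = (if \<tau> \<notin> K then 0 else if \<tau> \<in> bdry_2faces K then 1 else 2)"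
      using st[of \<tau>] bdry_2faces_iff[of \<tau>] interior2_iff[of \<tau>] star_interior[of \<tau>] c by auto
    moreover have "\<tau> \<in> bdry_2faces K \<Longrightarrow> \<tau> \<in> K" by (simp add: bdry_2faces_iff)
    ultimately show ?thesis by (cases "\<tau> \<in> K"; cases "\<tau> \<in> bdry_2faces K") simp_all
  next
    case True
    obtain x z where xz: "e = {x,z}" "x \<noteq> z" using e by (auto simp: card_2_iff)
    have "\<exists>b. e = {None, Some b}" using xz True by (cases x; cases z) (auto simp: doubleton_eq_iff)
    then obtain b where b: "e = {None, Some b}" by blast
    have "{T\<in>?S. e \<subseteq> T} = (\<lambda>\<tau>. insert None (Some ` \<tau>)) ` {\<tau>\<in>bdry_2faces K. b \<in> \<tau>}"
      unfolding b cone_complex_def by auto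
    moreover have "inj_on (\<lambda>\<tau>. insert None (Some ` \<tau>)) {\<tau>\<in>bdry_2faces K. b \<in> \<tau>}"
    proof (rule inj_onI)
      fix x y :: "'v set" assume e: "insert None (Some ` x) = insert None (Some ` y)"
      have "Some ` x = Some ` y" by (rule insert_ident[THEN iffD1, OF _ _ e]) auto
      then show "x = y" by (simp only: Some_image_eq)
    qed
    ultimately have "degree2 ?S e = card {\<tau>\<in>bdry_2faces K. b \<in> \<tau>}" unfolding degree2_def by (simp add: card_image)
    moreover have "even (card {\<tau>\<in>bdry_2faces K. b \<in> \<tau>})" using local_counts[of b] by presburger
    ultimately show ?thesis by simp
  qed
  have other: "T' \<in> D" if D: "cycle2 D" "D \<subseteq> ?S" and T: "T \<in> D" "Some ` \<tau> \<subseteq> T" "card \<tau> = 2" "{T\<in>?S. Some ` \<tau> \<subseteq> T} = {T,T'}" for D T T' \<tau>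
  proof (rule ccontr)
    assume "T' \<notin> D"
    then have "{T\<in>D. Some ` \<tau> \<subseteq> T} = {T}" using D T by blast
    then have "degree2 D (Some ` \<tau>) = 1" by (simp add: degree2_def)
    moreover have "card (Some ` \<tau>) = 2" using T(3) by (simp add: card_image)
    ultimately show False using D(1) unfolding cycle2_def by (metis odd_one)
  qed
  have "D = {} \<or> D = ?S" if D: "D \<subseteq> ?S" "cycle2 D" for D
  proof (rule disjCI)
    assume "D \<noteq> ?S"
    show "D = {}"
    proof (rule ccontr)
      assume "D \<noteq> {}"
      have bd: "\<exists>\<sigma>. star \<tau> = {\<sigma>} \<and> {T\<in>?S. Some ` \<tau> \<subseteq> T} = {Some ` \<sigma>, insert None (Some ` \<tau>)} \<and> \<sigma> \<in> facets K \<and> \<tau> \<subseteq> \<sigma> \<and> card \<tau> = 2" if t: "\<tau> \<in> bdry_2faces K" for \<tau>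
      proof -
        have t2: "card \<tau> = 2" "card (star \<tau>) = 1" using t by (auto simp: bdry_2faces_iff)
        then obtain \<sigma> where "star \<tau> = {\<sigma>}" by (auto simp: card_1_singleton_iff)
        then show ?thesis using cone_degree_pair[OF t2(1)] t t2 by (intro exI[of _ \<sigma>]) (auto simp: star_def)
      qed
      obtain a where a: "a \<in> facets K" "Some ` a \<in> D"
      proof -
        obtain T where T: "T \<in> D" using \<open>D \<noteq> {}\<close> by blast
        then have "T \<in> ?S" using D(1) by blast
        then consider \<sigma> where "\<sigma> \<in> facets K" "T = Some ` \<sigma>" | \<tau> where "\<tau> \<in> bdry_2faces K" "T = insert None (Some ` \<tau>)"
          unfolding cone_complex_def by blast
        then show thesis
        proof cases
          case 1 then show ?thesis using that T by blast
        next
          case 2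
          obtain \<sigma> where s: "{T\<in>?S. Some ` \<tau> \<subseteq> T} = {Some ` \<sigma>, T}" "\<sigma> \<in> facets K" "card \<tau> = 2" using bd[OF 2(1)] 2(2) by blast
          have "Some ` \<sigma> \<in> D" by (rule other[OF D(2,1) T, of \<tau>]) (use s 2 in auto)
          then show ?thesis using that s by blast
        qed
      qed
      have all: "Some ` b \<in> D" if b: "b \<in> facets K" for b
      proof -
        have "(facet_adj K {})\<^sup>*\<^sup>* a b" using her a b K_empty unfolding hereditary_def by blast
        then show ?thesis
        proof (induction rule: rtranclp_induct)
          case base show ?case by (rule a)
        next
          case (step y x)
          then have yx: "y \<in> facets K" "x \<in> facets K" "card (y \<inter> x) = 2" by (auto simp: facet_adj_def)
          note i = adjacent_interior[OF yx]
          have "y \<inter> x \<notin> bdry_2faces K" using i(1) by (auto simp: interior2_iff bdry_2faces_iff)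
          then have "{T\<in>?S. Some ` (y \<inter> x) \<subseteq> T} = {Some ` y, Some ` x}"
            using cone_degree_pair[OF yx(3)] i(2) by auto
          then show ?case by (intro other[OF D(2,1) step(3), of "y \<inter> x"]) (use yx in auto)
        qed
      qed
      have "?S \<subseteq> D"
      proof
        fix T assume "T \<in> ?S"
        then consider \<sigma> where "\<sigma> \<in> facets K" "T = Some ` \<sigma>" | \<tau> where "\<tau> \<in> bdry_2faces K" "T = insert None (Some ` \<tau>)"
          unfolding cone_complex_def by blast
        then show "T \<in> D"
        proof cases
          case 1 then show ?thesis using all by blast
        next
          case 2
          obtain \<sigma> where s: "{T\<in>?S. Some ` \<tau> \<subseteq> T} = {Some ` \<sigma>, T}" "\<sigma> \<in> facets K" "\<tau> \<subseteq> \<sigma>" "card \<tau> = 2" using bd[OF 2(1)] 2(2) by blast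
          show ?thesis by (rule other[OF D(2,1) all[OF s(2)], of \<tau>]) (use s in auto)
        qed
      qed
      then show False using D(1) \<open>D \<noteq> ?S\<close> by blast
    qed
  qed
  moreover have "?S \<noteq> {}" using facets_nonempty by (auto simp: cone_complex_def)
  ultimately show ?thesis unfolding min_cycle_def cycle2_def[of ?S] using c3 ev by blast
qed

lemma cone_edges:
  "{Some x, Some y} \<in> edges2 (cone_complex K) \<Longrightarrow> {x,y} \<in> edges"
  "{Some x, None} \<in> edges2 (cone_complex K) \<Longrightarrow> x \<notin> interior_vertices"
  "Some x \<in> \<Union>(edges2 (cone_complex K))"
proof -
  have c3: "\<forall>T\<in>cone_complex K. card T = 3" using cone_min_cycle by (simp add: min_cycle_def cycle2_def)
  have down: "{x,y} \<in> K" if "Some x \<in> T" "Some y \<in> T" "T \<in> cone_complex K" for x y T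
  proof -
    from that(3) consider \<sigma> where "\<sigma> \<in> facets K" "T = Some ` \<sigma>" | \<tau> where "\<tau> \<in> bdry_2faces K" "T = insert None (Some ` \<tau>)"
      unfolding cone_complex_def by blast
    then show ?thesis
    proof cases
      case 1 then show ?thesis using that K_down[OF facet_K[OF 1(1)], of "{x,y}"] by auto
    next
      case 2 then show ?thesis using that K_down[of \<tau> "{x,y}"] by (auto simp: bdry_2faces_def)
    qed
  qed
  show "{x,y} \<in> edges" if "{Some x, Some y} \<in> edges2 (cone_complex K)"
  proof -
    have "x \<noteq> y" using that by (auto simp: edges2_def)
    then show ?thesis using that down by (auto simp: edges2_def edges_def)
  qed
  show "x \<notin> interior_vertices" if "{Some x, None} \<in> edges2 (cone_complex K)"
    using that interior_vertex_iff by (auto simp: edges2_def cone_complex_def)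
  show "Some x \<in> \<Union>(edges2 (cone_complex K))"
  proof -
    obtain \<sigma> where "\<sigma> \<in> facets K" "x \<in> \<sigma>" using in_facet[OF K_vertex[of x]] by auto
    then have "Some x \<in> \<Union>(cone_complex K)" by (auto simp: cone_complex_def)
    then show ?thesis using Union_edges2[OF c3] by simp
  qed
qed

text \<open>The zero form at the apex is admissible: the apex is joined to boundary rays only, where
  \<open>A\<close> vanishes, and to nothing if there is no boundary.\<close>

lemma cone_compatible:
  assumes A: "compatible u edges A" and z: "\<And>x. x \<notin> interior_vertices \<Longrightarrow> A x = 0 \<or> bdry_2faces K = {}"
  shows "compatible (case_option p u) (edges2 (cone_complex K)) (case_option 0 A)"
  unfolding compatible_def
proof (intro allI impI)
  fix a b assume ab: "{a,b} \<in> edges2 (cone_complex K)"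
  have nb: "A x = 0" if "{Some x, None} \<in> edges2 (cone_complex K)" for x
    using cone_edges(2)[OF that] z[of x] interior_vertices_closed by auto
  consider "a = None" "b = None" | x where "a = Some x" "b = None" | x where "a = None" "b = Some x" | x y where "a = Some x" "b = Some y"
    by (cases a; cases b) auto
  then show "qf (case_option 0 A a) (cross3 (case_option p u a) (case_option p u b)) = qf (case_option 0 A b) (cross3 (case_option p u a) (case_option p u b))"
  proof cases
    case 1 then show ?thesis by simp
  next
    case 2 then show ?thesis using nb[of x] ab by simp
  next
    case 3 then show ?thesis using nb[of x] ab by (simp add: insert_commute)
  next
    case 4 then show ?thesis using cone_edges(1)[of x y] ab A by (auto simp: compatible_def)
  qed
qed

text \<open>The apex and the two rays of a boundary 2-face carry zero and are independent, which
  pins the global form to zero.\<close>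

lemma open_rigidity:
  assumes r: "rigid (case_option p u) (edges2 (cone_complex K))" and t: "triples_independent (case_option p u)"
    and bd: "bdry_2faces K \<noteq> {}" and A: "compatible u edges A" "\<And>x. x \<notin> interior_vertices \<Longrightarrow> A x = 0"
    and n: "n \<bullet> u x = 0"
  shows "qf (A x) n = 0"
proof -
  obtain \<tau> where t0: "\<tau> \<in> bdry_2faces K" using bd by blast
  then obtain a b where ab: "\<tau> = {a,b}" "a \<noteq> b" by (auto simp: bdry_2faces_def card_2_iff)
  have "a \<notin> interior_vertices" "b \<notin> interior_vertices" using t0 ab interior_vertex_iff by auto
  then have z: "A a = 0" "A b = 0" using A(2) by auto
  have c3: "\<forall>T\<in>cone_complex K. card T = 3" using cone_min_cycle by (simp add: min_cycle_def cycle2_def)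
  have "insert None (Some ` \<tau>) \<in> cone_complex K" using t0 by (auto simp: cone_complex_def)
  then have N: "None \<in> \<Union>(edges2 (cone_complex K))" unfolding Union_edges2[OF c3] by blast
  have "qf (case_option 0 A (Some x)) n = 0"
  proof (rule rigid_pinned_zero[OF r N cone_edges(3)[of a] cone_edges(3)[of b]])
    show "case_option p u None \<bullet> cross3 (case_option p u (Some a)) (case_option p u (Some b)) \<noteq> 0"
      using t ab(2) unfolding triples_independent_def by blast
    show "compatible (case_option p u) (edges2 (cone_complex K)) (case_option 0 A)"
      by (rule cone_compatible[OF A(1)]) (use A(2) in blast)
  qed (use z n cone_edges(3) in auto)
  then show ?thesis by simp
qed

lemma closed_rigidity:
  assumes r: "rigid (case_option p u) (edges2 (cone_complex K))" and bd: "bdry_2faces K = {}"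
  shows "rigid u edges"
  unfolding rigid_def
proof (intro allI impI)
  fix A assume A: "compatible u edges A"
  have "compatible (case_option p u) (edges2 (cone_complex K)) (case_option 0 A)"
    by (rule cone_compatible[OF A]) (use bd in blast)
  from r[unfolded rigid_def, rule_format, OF this]
  obtain B where B: "\<forall>x\<in>\<Union>(edges2 (cone_complex K)). \<forall>n. n \<bullet> case_option p u x = 0 \<longrightarrow> qf (case_option 0 A x) n = qf B n" by (rule exE)
  have "qf (A x) n = qf B n" if "n \<bullet> u x = 0" for x n
    using B[rule_format, OF cone_edges(3)[of x], of n] that by simp
  then show "\<exists>B. \<forall>x\<in>\<Union>edges. \<forall>n. n \<bullet> u x = 0 \<longrightarrow> qf (A x) n = qf B n" by blast
qed

lemma four_vertices:
  assumes "bdry_2faces K = {}" shows "CARD('v) \<ge> 4"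
proof -
  obtain \<sigma> where s: "\<sigma> \<in> facets K" using facets_nonempty by blast
  then obtain v w x where vwx: "\<sigma> = {v,w,x}" "distinct [v,w,x]" using facet_card[OF s] by (auto simp: card_3_iff)
  have "{v,w} \<in> K" using K_down[OF facet_K[OF s]] vwx by auto
  then have i: "{v,w} \<in> interior2 K" using assms bdry_2faces_iff[of "{v,w}"] interior2_iff[of "{v,w}"] vwx by auto
  have "\<sigma> \<in> star {v,w}" using s vwx by (auto simp: star_def)
  then obtain b where b: "\<sigma> \<noteq> b" "\<sigma> \<inter> b = {v,w}" "b \<in> facets K" using interior_star[OF i] by metis
  have "card (\<sigma> \<union> b) = 4"
    using card_Un_Int[of \<sigma> b] b facet_card[OF s] facet_card[OF b(3)] vwx by simp
  then show ?thesis by (metis card_mono finite subset_UNIV)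
qed

section \<open>Splines and the Euler characteristic\<close>

lemma C1_eq_splines: "C1 K u d = splines (forms d) (edge_ideal d)"
proof -
  have sub: "fs.subspace (edge_ideal d \<tau>)" for \<tau> by (rule sq_ideal_forms_subspace) simp
  have mem: "jmp F \<tau> \<in> edge_ideal d \<tau> \<longleftrightarrow> (\<lambda>p. F a p - F b p) \<in> edge_ideal d \<tau>"
    if t: "\<tau> \<in> interior2 K" "star \<tau> = {a,b}" "a \<noteq> b" "oside b \<tau> = - oside a \<tau>" for F \<tau> a b
  proof -
    have pm: "oside a \<tau> = 1 \<or> oside a \<tau> = -1" using oside_pm1[OF t(1)] t(2) by blast
    have j: "jmp F \<tau> = (\<lambda>p. oside a \<tau> * (F a p - F b p))"
      using jump_eq[OF t(2-4)] t(1) by (simp add: jmp_def fun_eq_iff)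
    have "(\<lambda>p. F a p - F b p) = (\<lambda>p. oside a \<tau> * jmp F \<tau> p)" unfolding j using pm by auto
    then show ?thesis using j fs.subspace_scale[OF sub[of \<tau>]] by metis
  qed
  have adj: "star (a \<inter> b) = {a,b} \<and> a \<noteq> b \<and> oside b (a \<inter> b) = - oside a (a \<inter> b) \<and> a \<inter> b \<in> interior2 K"
    if ab: "a \<in> facets K" "b \<in> facets K" "card (a \<inter> b) = 2" for a b
  proof -
    note i = adjacent_interior[OF ab]
    have "a \<in> star (a \<inter> b)" using i(2) by simp
    then obtain b' where b': "star (a \<inter> b) = {a,b'}" "a \<noteq> b'" "oside b' (a \<inter> b) = - oside a (a \<inter> b)"
      using interior_star[OF i(1)] by metis
    have "b' = b" using b' i by auto
    then show ?thesis using b' i by auto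
  qed
  show ?thesis
  proof (intro set_eqI iffI)
    fix F assume F: "F \<in> C1 K u d"
    have Ff: "\<And>\<sigma>. \<sigma> \<in> facets K \<Longrightarrow> F \<sigma> \<in> forms d" using F by (auto simp: C1_def)
    have "jmp F \<tau> \<in> edge_ideal d \<tau>" if t: "\<tau> \<in> interior2 K" for \<tau>
    proof -
      obtain a where a: "a \<in> star \<tau>" using star_interior[OF t] by fastforce
      obtain b where b: "star \<tau> = {a,b}" "a \<noteq> b" "a \<inter> b = \<tau>" "oside b \<tau> = - oside a \<tau>" "b \<in> facets K"
        using interior_star[OF t a] .
      have af: "a \<in> facets K" using a by (simp add: star_def)
      have "card (a \<inter> b) = 2" using t b(3) by (simp add: interior2_iff)
      then have "(\<lambda>p. F a p - F b p) \<in> sq_ideal u {\<tau>}" using F af b(3,5) unfolding C1_def by blast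
      moreover have "(\<lambda>p. F a p - F b p) \<in> forms d" by (intro forms_diff Ff af b(5))
      ultimately show ?thesis using mem[OF t b(1,2,4)] by blast
    qed
    then show "F \<in> splines (forms d) (edge_ideal d)" using F by (auto simp: splines_def direct_sum_def C1_def)
  next
    fix F assume F: "F \<in> splines (forms d) (edge_ideal d)"
    have "(\<lambda>p. F a p - F b p) \<in> sq_ideal u {a \<inter> b}" if ab: "a \<in> facets K" "b \<in> facets K" "card (a \<inter> b) = 2" for a b
    proof -
      have "jmp F (a \<inter> b) \<in> edge_ideal d (a \<inter> b)" using F adj[OF ab] by (auto simp: splines_def)
      then show ?thesis using mem[of "a \<inter> b" a b F] adj[OF ab] by blast
    qed
    then show "F \<in> C1 K u d" using F by (auto simp: splines_def direct_sum_def C1_def)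
  qed
qed

text \<open>With \<open>J = X\<close> the smoothness condition is void, so that
  \<open>spline_count\<close> yields the Euler characteristic of the fan with coefficients in
  \<open>X\<close>.\<close>

lemma splines_all: assumes X: "fs.subspace X" shows "splines X (\<lambda>_. X) = direct_sum (facets K) (\<lambda>_. X)"
proof -
  have "jmp F \<tau> \<in> X" if F: "F \<in> direct_sum (facets K) (\<lambda>_. X)" and t: "\<tau> \<in> interior2 K" for F \<tau>
  proof -
    have "jmp F \<tau> = (\<Sum>\<sigma>\<in>star \<tau>. (\<lambda>p. oside \<sigma> \<tau> * F \<sigma> p))"
    proof
      fix p
      have "(\<Sum>\<sigma>\<in>A. (\<lambda>p. oside \<sigma> \<tau> * F \<sigma> p)) p = (\<Sum>\<sigma>\<in>A. oside \<sigma> \<tau> * F \<sigma> p)" for A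
        by (induction A rule: infinite_finite_induct) auto
      then show "jmp F \<tau> p = (\<Sum>\<sigma>\<in>star \<tau>. (\<lambda>p. oside \<sigma> \<tau> * F \<sigma> p)) p" using t by (simp add: jmp_def jump_def)
    qed
    also have "\<dots> \<in> X" using F by (intro fs.subspace_sum[OF X] fs.subspace_scale[OF X]) (auto simp: direct_sum_def star_def)
    finally show ?thesis .
  qed
  then show ?thesis by (auto simp: splines_def)
qed

lemma chi_eq:
  fixes d :: nat
  defines "s \<equiv> int (fs.dim (forms d))"
  shows "chi_RJ K u d = int (card (facets K)) * s - (\<Sum>\<tau>\<in>interior2 K. s - int (fs.dim (edge_ideal d \<tau>)))
    + (\<Sum>v\<in>interior_vertices. s - int (fs.dim (vertex_ideal d v)))
    - (if bdry_2faces K = {} then s - int (fs.dim (sq_ideal u (interior2 K) \<inter> forms d)) else 0)"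
proof -
  have b2: "card A \<le> 2" if "A \<in> bdry K" for A
    using that by (auto simp: bdry_def bdry_2faces_def intro: card_mono[THEN order_trans])
  have S3: "{A\<in>K. card A = 3 \<and> A \<notin> bdry K} = facets K" using b2 facets_iff by fastforce
  have S2: "{A\<in>K. card A = 2 \<and> A \<notin> bdry K} = interior2 K" by (auto simp: interior2_def)
  have S1: "{A\<in>K. card A = 1 \<and> A \<notin> bdry K} = (\<lambda>v. {v}) ` interior_vertices"
    using K_vertex by (auto simp: interior_vertices_def card_1_singleton_iff)
  \<comment> \<open>The zero cone lies in the boundary as soon as there is a boundary 2-face, so it
    contributes only in the absence of a boundary.\<close>
  have S0: "{A\<in>K. card A = 0 \<and> A \<notin> bdry K} = (if bdry_2faces K = {} then {{}} else {})"
    using K_empty by (auto simp: bdry_def)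
  have nf: "A \<notin> facets K" if "card A \<noteq> 3" for A using that facet_card by auto
  have H3: "HF_quot K u \<sigma> d = s" if "\<sigma> \<in> facets K" for \<sigma>
  proof -
    have "{\<lambda>p. 0} \<inter> forms d = {0}" using forms_0 by (auto simp: zero_fun_def)
    then show ?thesis using that fs_dim_zero by (simp add: HF_quot_def Jid_def s_def fdim_eq)
  qed
  have H2: "HF_quot K u \<tau> d = s - int (fs.dim (edge_ideal d \<tau>))" if t: "\<tau> \<in> interior2 K" for \<tau>
  proof -
    have "\<tau>' = \<tau>" if "\<tau>' \<in> interior2 K" "\<tau> \<subseteq> \<tau>'" for \<tau>'
      using that t card_seteq[of \<tau>' \<tau>] by (simp add: interior2_iff)
    then have "{\<tau>'\<in>interior2 K. \<tau> \<subseteq> \<tau>'} = {\<tau>}" using t by blast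
    then show ?thesis using nf[of \<tau>] t by (simp add: HF_quot_def Jid_def s_def fdim_eq interior2_iff)
  qed
  have H1: "HF_quot K u {v} d = s - int (fs.dim (vertex_ideal d v))" for v
    using nf[of "{v}"] by (simp add: HF_quot_def Jid_def s_def fdim_eq)
  have H0: "HF_quot K u {} d = s - int (fs.dim (sq_ideal u (interior2 K) \<inter> forms d))"
    using nf[of "{}"] by (simp add: HF_quot_def Jid_def s_def fdim_eq)
  have "chi_RJ K u d = (\<Sum>\<gamma>\<in>{A\<in>K. card A = 3 \<and> A \<notin> bdry K}. HF_quot K u \<gamma> d)
     - (\<Sum>\<gamma>\<in>{A\<in>K. card A = 2 \<and> A \<notin> bdry K}. HF_quot K u \<gamma> d)
     + (\<Sum>\<gamma>\<in>{A\<in>K. card A = 1 \<and> A \<notin> bdry K}. HF_quot K u \<gamma> d)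
     - (\<Sum>\<gamma>\<in>{A\<in>K. card A = 0 \<and> A \<notin> bdry K}. HF_quot K u \<gamma> d)"
  proof -
    have "{0..3::nat} = {0,1,2,3}" by auto
    then show ?thesis by (simp add: chi_RJ_def)
  qed
  also have "\<dots> = int (card (facets K)) * s - (\<Sum>\<tau>\<in>interior2 K. s - int (fs.dim (edge_ideal d \<tau>)))
    + (\<Sum>v\<in>interior_vertices. s - int (fs.dim (vertex_ideal d v)))
    - (if bdry_2faces K = {} then s - int (fs.dim (sq_ideal u (interior2 K) \<inter> forms d)) else 0)"
    unfolding S3 S2 S1 S0 using H3 H2 H1 H0 by (simp add: sum.reindex inj_on_def)
  finally show ?thesis .
qed

lemma forms_span': "forms d \<subseteq> fs.span (mono3 ` {m. mdeg m = d})" "finite (mono3 ` {m. mdeg m = d})"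
  using forms_finite_span finite_mdeg by auto

text \<open>Two instances of \<open>spline_count\<close> are combined, one for the ideals and one
  for constant coefficients. In both the image of \<open>bdm\<close> is a full direct sum, of known
  dimension.\<close>

theorem open_dimension:
  assumes sc: "simply_connected (lk_space K u)" and bd: "bdry_2faces K \<noteq> {}"
    and r: "rigid (case_option p u) (edges2 (cone_complex K))" and t: "triples_independent (case_option p u)"
  shows "int (tdim (C1 K u d)) = chi_RJ K u d"
proof -
  let ?s = "fs.dim (forms d)"
  have e_sub: "fs.subspace (edge_ideal d \<tau>)" for \<tau> by (rule sq_ideal_forms_subspace) simp
  have v_sub: "fs.subspace (vertex_ideal d v)" for v by (rule sq_ideal_forms_subspace) simp
  have J: "bdm ` direct_sum (interior2 K) (edge_ideal d) = direct_sum interior_vertices (vertex_ideal d)"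
    using open_rigidity[OF r t bd] by (intro open_image) blast
  have X: "bdm ` direct_sum (interior2 K) (\<lambda>_. forms d) = direct_sum interior_vertices (\<lambda>_. forms d)"
    by (rule const_image(1)[OF forms_subspace bd])
  have 1: "ts.dim (C1 K u d) + ts.dim (direct_sum interior_vertices (vertex_ideal d)) = ?s + (\<Sum>\<tau>\<in>interior2 K. fs.dim (edge_ideal d \<tau>))"
    using spline_count[OF sc forms_subspace forms_span', of "edge_ideal d" d] e_sub unfolding J C1_eq_splines by auto
  have 2: "ts.dim (direct_sum (facets K) (\<lambda>_. forms d)) + ts.dim (direct_sum interior_vertices (\<lambda>_. forms d)) = ?s + (\<Sum>\<tau>\<in>interior2 K. ?s)"
    using spline_count[OF sc forms_subspace forms_span', of "\<lambda>_. forms d" d] forms_subspace unfolding X splines_all[OF forms_subspace] by auto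
  have d1: "ts.dim (direct_sum interior_vertices (vertex_ideal d)) = (\<Sum>v\<in>interior_vertices. fs.dim (vertex_ideal d v))"
    by (rule direct_sum_dim[OF _ forms_span'(2)]) (use forms_span'(1) v_sub in auto)
  have d2: "ts.dim (direct_sum (facets K) (\<lambda>_. forms d)) = card (facets K) * ?s"
    using direct_sum_dim[OF _ forms_span'(2), of "facets K" "\<lambda>_. forms d" d] forms_span'(1) forms_subspace by auto
  have d3: "ts.dim (direct_sum interior_vertices (\<lambda>_. forms d)) = card interior_vertices * ?s"
    using direct_sum_dim[OF _ forms_span'(2), of interior_vertices "\<lambda>_. forms d" d] forms_span'(1) forms_subspace by auto
  have 1: "int (tdim (C1 K u d)) + (\<Sum>v\<in>interior_vertices. int (fs.dim (vertex_ideal d v))) = int ?s + (\<Sum>\<tau>\<in>interior2 K. int (fs.dim (edge_ideal d \<tau>)))"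
    using arg_cong[OF 1, of int] unfolding d1 tdim_eq by simp
  have 2: "int (card (facets K)) * int ?s + int (card interior_vertices) * int ?s = int ?s + int (card (interior2 K)) * int ?s"
    using arg_cong[OF 2, of int] unfolding d2 d3 by simp
  show ?thesis unfolding chi_eq using 1 2 bd by (simp add: sum_subtractf)
qed

end

section \<open>Dimension count without boundary\<close>

context closed_rigid_fan
begin

lemma vertex_sum_image: "(\<lambda>f. \<Sum>v\<in>UNIV. f v) ` direct_sum (UNIV :: 'v set) (vertex_ideal d) = sq_ideal u (interior2 K) \<inter> forms d"
proof (cases "d < 2")
  case True
  have "sq_ideal u T \<inter> forms d = {0}" for T :: "'v set set"
    unfolding sq_ideal_forms_eq[OF finite] using True by (simp add: zero_fun_def)
  then show ?thesis unfolding low_degree_image(2)[OF True] by simp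
next
  case False
  then obtain e where d: "d = e + 2" by (metis le_add_diff_inverse2 not_less)
  have e2: "\<not> e + 2 < 2" by simp
  have app: "(\<Sum>v\<in>UNIV. f v) p = (\<Sum>v\<in>UNIV. f v p)" for f :: "'v \<Rightarrow> real^3 \<Rightarrow> real" and p
  proof -
    have "(\<Sum>v\<in>A. f v) p = (\<Sum>v\<in>A. f v p)" for A by (induction A rule: infinite_finite_induct) auto
    then show ?thesis .
  qed
  show ?thesis
  proof
    show "(\<lambda>f. \<Sum>v\<in>UNIV. f v) ` direct_sum (UNIV :: 'v set) (vertex_ideal d) \<subseteq> sq_ideal u (interior2 K) \<inter> forms d"
    proof (rule image_subsetI)
      fix f assume f: "f \<in> direct_sum (UNIV :: 'v set) (vertex_ideal d)"
      then obtain H where H: "\<And>v \<tau>. H v \<tau> \<in> forms e"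
        "\<And>v p. f v p = (\<Sum>\<tau>\<in>{\<tau>\<in>interior2 K. v \<in> \<tau>}. (normal u \<tau> \<bullet> p)\<^sup>2 * H v \<tau> p)"
        using vertex_ideal_decomposition unfolding iv d by fastforce
      have "(\<Sum>v\<in>UNIV. f v) = (\<lambda>p. \<Sum>\<tau>\<in>interior2 K. (normal u \<tau> \<bullet> p)\<^sup>2 * (\<Sum>v\<in>\<tau>. H v \<tau> p))"
      proof
        fix p
        have "(\<Sum>v\<in>UNIV. f v) p = (\<Sum>v\<in>UNIV. \<Sum>\<tau>\<in>{\<tau>\<in>interior2 K. v \<in> \<tau>}. (normal u \<tau> \<bullet> p)\<^sup>2 * H v \<tau> p)"
          unfolding app H(2) ..
        also have "\<dots> = (\<Sum>\<tau>\<in>interior2 K. \<Sum>v\<in>{v\<in>UNIV. v \<in> \<tau>}. (normal u \<tau> \<bullet> p)\<^sup>2 * H v \<tau> p)"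
          by (rule sum.swap_restrict) simp_all
        finally show "(\<Sum>v\<in>UNIV. f v) p = (\<Sum>\<tau>\<in>interior2 K. (normal u \<tau> \<bullet> p)\<^sup>2 * (\<Sum>v\<in>\<tau>. H v \<tau> p))"
          by (simp add: sum_distrib_left)
      qed
      moreover have "\<forall>\<tau>\<in>interior2 K. (\<lambda>p. \<Sum>v\<in>\<tau>. H v \<tau> p) \<in> forms (e + 2 - 2)"
        by (intro ballI, simp, intro forms_sum H(1))
      ultimately show "(\<Sum>v\<in>UNIV. f v) \<in> sq_ideal u (interior2 K) \<inter> forms d"
        unfolding d sq_ideal_forms_eq[OF finite] if_not_P[OF e2] mem_Collect_eq
        by (intro exI[of _ "\<lambda>\<tau> p. \<Sum>v\<in>\<tau>. H v \<tau> p"] conjI)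
    qed
    show "sq_ideal u (interior2 K) \<inter> forms d \<subseteq> (\<lambda>f. \<Sum>v\<in>UNIV. f v) ` direct_sum (UNIV :: 'v set) (vertex_ideal d)"
    proof
      fix g assume "g \<in> sq_ideal u (interior2 K) \<inter> forms d"
      then obtain H where H: "g = (\<lambda>p. \<Sum>\<tau>\<in>interior2 K. (normal u \<tau> \<bullet> p)\<^sup>2 * H \<tau> p)" "\<And>\<tau>. \<tau> \<in> interior2 K \<Longrightarrow> H \<tau> \<in> forms e"
        unfolding d sq_ideal_forms_eq[OF finite] if_not_P[OF e2] by auto
      \<comment> \<open>Each generator is assigned to one of its two rays, namely the first in the
        chosen orientation.\<close>
      let ?h = "\<lambda>v \<tau>. if v = fst (orient \<tau>) then H \<tau> else (\<lambda>p. 0)"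
      define f where "f v = (\<lambda>p. \<Sum>\<tau>\<in>{\<tau>\<in>interior2 K. v \<in> \<tau>}. (normal u \<tau> \<bullet> p)\<^sup>2 * ?h v \<tau> p)" for v
      have "f v \<in> vertex_ideal d v" for v
        unfolding d sq_ideal_forms_eq[OF finite] if_not_P[OF e2] mem_Collect_eq f_def
        by (rule exI[of _ "?h v"]) (use H(2) forms_0 in auto)
      then have fd: "f \<in> direct_sum (UNIV :: 'v set) (vertex_ideal d)" by (simp add: direct_sum_def)
      have "(\<Sum>v\<in>UNIV. f v) = g"
      proof
        fix p
        have "(\<Sum>v\<in>UNIV. f v) p = (\<Sum>v\<in>UNIV. \<Sum>\<tau>\<in>{\<tau>\<in>interior2 K. v \<in> \<tau>}. (normal u \<tau> \<bullet> p)\<^sup>2 * ?h v \<tau> p)"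
          unfolding app f_def ..
        also have "\<dots> = (\<Sum>\<tau>\<in>interior2 K. \<Sum>v\<in>{v\<in>UNIV. v \<in> \<tau>}. (normal u \<tau> \<bullet> p)\<^sup>2 * ?h v \<tau> p)"
          by (rule sum.swap_restrict) simp_all
        also have "\<dots> = (\<Sum>\<tau>\<in>interior2 K. (normal u \<tau> \<bullet> p)\<^sup>2 * H \<tau> p)"
        proof (rule sum.cong[OF refl])
          fix \<tau> assume "\<tau> \<in> interior2 K"
          then have "card \<tau> = 2" by (simp add: interior2_iff)
          then have m: "fst (orient \<tau>) \<in> \<tau>" using orient(1)[of \<tau>] by blast
          have "(\<Sum>v\<in>{v\<in>UNIV. v \<in> \<tau>}. (normal u \<tau> \<bullet> p)\<^sup>2 * ?h v \<tau> p) = (\<Sum>v\<in>\<tau>. if v = fst (orient \<tau>) then (normal u \<tau> \<bullet> p)\<^sup>2 * H \<tau> p else 0)"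
            by (intro sum.cong) auto
          then show "(\<Sum>v\<in>{v\<in>UNIV. v \<in> \<tau>}. (normal u \<tau> \<bullet> p)\<^sup>2 * ?h v \<tau> p) = (normal u \<tau> \<bullet> p)\<^sup>2 * H \<tau> p"
            using m by simp
        qed
        finally show "(\<Sum>v\<in>UNIV. f v) p = g p" by (simp add: H(1))
      qed
      then show "g \<in> (\<lambda>f. \<Sum>v\<in>UNIV. f v) ` direct_sum (UNIV :: 'v set) (vertex_ideal d)" using fd by blast
    qed
  qed
qed

text \<open>The images of \<open>bdm\<close> are now the kernels of the sum maps over the rays, and
  the images of these sum maps supply the contribution of the zero cone.\<close>

theorem closed_dimension:
  assumes sc: "simply_connected (lk_space K u)"
  shows "int (tdim (C1 K u d)) = chi_RJ K u d"
proof -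
  let ?s = "fs.dim (forms d)"
  let ?U = "UNIV :: 'v set"
  have e_sub: "fs.subspace (edge_ideal d \<tau>)" for \<tau> by (rule sq_ideal_forms_subspace) simp
  have v_sub: "fs.subspace (vertex_ideal d v)" for v by (rule sq_ideal_forms_subspace) simp
  let ?IJ = "{f\<in>direct_sum ?U (vertex_ideal d). (\<Sum>v\<in>UNIV. f v) = 0}"
  let ?IX = "{f\<in>direct_sum ?U (\<lambda>_. forms d). (\<Sum>v\<in>UNIV. f v) = 0}"
  have X: "bdm ` direct_sum (interior2 K) (\<lambda>_. forms d) = ?IX" by (rule const_image(2)[OF forms_subspace cl])
  have 1: "ts.dim (C1 K u d) + ts.dim ?IJ = ?s + (\<Sum>\<tau>\<in>interior2 K. fs.dim (edge_ideal d \<tau>))"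
    using spline_count[OF sc forms_subspace forms_span', of "edge_ideal d" d] e_sub unfolding closed_image C1_eq_splines by auto
  have 2: "ts.dim (direct_sum (facets K) (\<lambda>_. forms d)) + ts.dim ?IX = ?s + (\<Sum>\<tau>\<in>interior2 K. ?s)"
    using spline_count[OF sc forms_subspace forms_span', of "\<lambda>_. forms d" d] forms_subspace unfolding X splines_all[OF forms_subspace] by auto
  have d1: "ts.dim ?IJ + fs.dim (sq_ideal u (interior2 K) \<inter> forms d) = (\<Sum>v\<in>UNIV. fs.dim (vertex_ideal d v))"
    by (rule closed_image_dim[OF forms_span'[of d] v_sub _ vertex_sum_image]) (rule Int_lower2)
  have surX: "(\<lambda>f. \<Sum>v\<in>UNIV. f v) ` direct_sum ?U (\<lambda>_. forms d) = forms d"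
  proof
    show "(\<lambda>f. \<Sum>v\<in>UNIV. f v) ` direct_sum ?U (\<lambda>_. forms d) \<subseteq> forms d"
      by (auto simp: direct_sum_def intro!: fs.subspace_sum[OF forms_subspace])
    show "forms d \<subseteq> (\<lambda>f. \<Sum>v\<in>UNIV. f v) ` direct_sum ?U (\<lambda>_. forms d)"
    proof
      fix h :: "real^3 \<Rightarrow> real" assume h: "h \<in> forms d"
      let ?f = "\<lambda>v::'v. if v = undefined then h else 0"
      have "?f \<in> direct_sum ?U (\<lambda>_. forms d)" using h forms_0 by (auto simp: direct_sum_def zero_fun_def)
      moreover have "(\<Sum>v\<in>UNIV. ?f v) = h" by simp
      ultimately show "h \<in> (\<lambda>f. \<Sum>v\<in>UNIV. f v) ` direct_sum ?U (\<lambda>_. forms d)" by (metis image_eqI)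
    qed
  qed
  have d3: "ts.dim ?IX + ?s = (\<Sum>v\<in>?U. ?s)"
    by (rule closed_image_dim[OF forms_span'[of d] forms_subspace _ surX]) (rule order_refl)
  have d2: "ts.dim (direct_sum (facets K) (\<lambda>_. forms d)) = card (facets K) * ?s"
    using direct_sum_dim[OF _ forms_span'(2), of "facets K" "\<lambda>_. forms d" d] forms_span'(1) forms_subspace by auto
  have 1: "int (tdim (C1 K u d)) + int (ts.dim ?IJ) = int ?s + (\<Sum>\<tau>\<in>interior2 K. int (fs.dim (edge_ideal d \<tau>)))"
    using arg_cong[OF 1, of int] unfolding tdim_eq by simp
  have 2: "int (card (facets K)) * int ?s + int (ts.dim ?IX) = int ?s + int (card (interior2 K)) * int ?s"
    using arg_cong[OF 2, of int] unfolding d2 by simp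
  have 3: "int (ts.dim ?IJ) + int (fs.dim (sq_ideal u (interior2 K) \<inter> forms d)) = (\<Sum>v\<in>?U. int (fs.dim (vertex_ideal d v)))"
    using arg_cong[OF d1, of int] by simp
  have 4: "int (ts.dim ?IX) + int ?s = int CARD('v) * int ?s"
    using arg_cong[OF d3, of int] by simp
  show ?thesis unfolding chi_eq iv using 1 2 3 4 cl by (simp add: sum_subtractf)
qed

end

theorem theorem9p9:
  fixes K :: "('v::finite) set set"
  assumes "pure3 K" and "hereditary K"
  shows "\<exists>P. coord_poly P \<and> (\<exists>u. P u \<noteq> 0) \<and>
     (\<forall>u. P u \<noteq> 0 \<longrightarrow> simplicial_fan K u \<longrightarrow> simply_connected (lk_space K u) \<longrightarrow>
        (\<forall>d. int (tdim (C1 K u d)) = chi_RJ K u d))"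
proof -
  have "generically (\<lambda>u. simplicial_fan K u \<longrightarrow> simply_connected (lk_space K u) \<longrightarrow>
        (\<forall>d. int (tdim (C1 K u d)) = chi_RJ K u d))"
  \<comment> \<open>If \<open>K\<close> has no realisation the claim is vacuous and the constant
    polynomial 1 serves.\<close>
  proof (cases "\<exists>u. simplicial_fan K u")
    case False
    then show ?thesis by (intro generically_mono[OF generically_True]) blast
  next
    case True
    then obtain w where "simplicial_fan K w" by blast
    \<comment> \<open>One realisation suffices to see that the coned complex is a minimal cycle, a
      property of \<open>K\<close> alone; the resulting polynomial then governs all
      realisations.\<close>
    then interpret w: pure_fan K w using assms by unfold_locales
    have "generically (\<lambda>u. rigid u (edges2 (cone_complex K)) \<and> triples_independent u)"
      by (intro generically_conj min_cycle_generically_rigid w.cone_min_cycle generically_triples_independent)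
    then have "generically (\<lambda>u. \<exists>p. rigid (case_option p u) (edges2 (cone_complex K)) \<and> triples_independent (case_option p u))"
      by (rule generically_case_option)
    then show ?thesis
    proof (rule generically_mono, intro impI allI)
      fix u :: "'v \<Rightarrow> real^3" and d
      assume "\<exists>p. rigid (case_option p u) (edges2 (cone_complex K)) \<and> triples_independent (case_option p u)"
        and fan: "simplicial_fan K u" and sc: "simply_connected (lk_space K u)"
      then obtain p where p: "rigid (case_option p u) (edges2 (cone_complex K))" "triples_independent (case_option p u)" by blast
      interpret pure_fan K u using assms fan by unfold_locales
      show "int (tdim (C1 K u d)) = chi_RJ K u d"
      proof (cases "bdry_2faces K = {}")
        case False
        then show ?thesis using open_dimension[OF sc _ p] by blast
      next
        case True
        have "triples_independent u" unfolding triples_independent_def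
        proof (intro allI impI)
          fix x y z :: 'v assume "x \<noteq> y" "y \<noteq> z" "x \<noteq> z"
          then have "case_option p u (Some x) \<bullet> cross3 (case_option p u (Some y)) (case_option p u (Some z)) \<noteq> 0"
            using p(2) unfolding triples_independent_def by blast
          then show "u x \<bullet> cross3 (u y) (u z) \<noteq> 0" by simp
        qed
        then interpret closed_rigid_fan K u
          using closed_rigidity[OF p(1) True] four_vertices[OF True] True by unfold_locales
        show ?thesis by (rule closed_dimension[OF sc])
      qed
    qed
  qed
  then show ?thesis unfolding generically_def .
qed

end
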